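(* Let $I$ be an index set and, for each $n$, let $(\mathbf{X}_n^{(i)})_{i\in I}$ be a family of independent unnormalized finite-moment Wigner matrices of size $n\times n$, with parameters $\beta_i\in\mathbb{R}$. Let $I_1,I_3\subset I$ be disjoint, let $(b_n^{(i)})_n$ be band widths of slow growth for $i\in I_1$ and of proportional growth with full proportion for $i\in I_3$, and let $\mathbf{\Theta}_n^{(i)}$, $i\in I_1\cup I_3$, be the corresponding normalized random band matrices. Then $(\mathbf{\Theta}_n^{(i)})_{i\in I_1\cup I_3}$ converges in distribution to a semicircular system. If furthermore $\beta_i=1$ for all $i$, then the augmented family $(\mathbf{\Theta}_n^{(i)},\deg(\mathbf{\Theta}_n^{(i)}))_{i\in I_1\cup I_3}$ also converges in distribution, the families $(\mathbf{\Theta}_n^{(i)})_{i\in I_1\cup I_3}$ and $(\deg(\mathbf{\Theta}_n^{(i)}))_{i\in I_1\cup I_3}$ are asymptotically free, and $(\deg(\mathbf{\Theta}_n^{(i)}))_{i\in I_1\cup I_3}$ converges in distribution to a Gaussian system.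
   Context: Wigner matrices: an unnormalized Wigner matrix $\mathbf{X}_n$ is the $n\times n$ Hermitian matrix with $\mathbf{X}_n(j,k)=X_{j,k}$ for $j\le k$, where $(X_{j,k})_{1\le j<k<\infty}$ and $(X_{j,j})_{j\ge1}$ are independent families of i.i.d. random variables; the $X_{j,k}$ ($j<k$) are complex-valued (possibly real-valued) with $\mathbb{E}X_{j,k}=0$ and $\mathbb{E}|X_{j,k}|^2=1$; the $X_{j,j}$ are real-valued with finite variance. It is finite-moment if all these variables have finite moments of all orders. Its parameter is $\beta=\mathbb{E}[X_{j,k}^2]$ ($j<k$); $\beta=1$ iff the matrix is real. Random band matrices: for nonnegative integers $b_n$, set $\mathbf{\Xi}_n(j,k)=\mathbf{1}\{|j-k|\le b_n\}\,\mathbf{X}_n(j,k)$. Slow growth: $b_n\to\infty$, $b_n=o(n)$, and $\mathbf{\Theta}_n=(2b_n)^{-1/2}\mathbf{\Xi}_n$. Full proportion: $b_n/n\to1$ and $\mathbf{\Theta}_n=n^{-1/2}\mathbf{\Xi}_n$. $\deg(\mathbf{A})$ is the diagonal matrix of row sums of $\mathbf{A}$: $\deg(\mathbf{A})(j,j)=\sum_k\mathbf{A}(j,k)$. Convergence in distribution is with respect to the $*$-probability spaces of random $n\times n$ matrices with entries having all moments, equipped with $\mathbb{E}\frac1n\mathrm{tr}$: the expectation of every non-commutative polynomial in the family converges to its expectation in the limit family. Two families are asymptotically free if they jointly converge in distribution to families that are free. A semicircular system is a family of freely independent self-adjoint standard semicircular random variables (density $\frac1{2\pi}\sqrt{4-x^2}$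 on $[-2,2]$); a Gaussian system is a family of classically (tensor) independent, commuting self-adjoint standard normal random variables. *)

theory Defs
  imports
    "HOL-Probability.Probability"
    "HOL-Library.Poly_Mapping"
    "HOL-Library.Landau_Symbols"
    "HOL-Library.Nonpos_Ints"
    "Jordan_Normal_Form.Schur_Decomposition"
begin

section \<open>Noncommutative probability\<close>

record 'a star_alg = "'a ring" +
  cscale :: "complex \<Rightarrow> 'a \<Rightarrow> 'a"
  adj :: "'a \<Rightarrow> 'a"
  state :: "'a \<Rightarrow> complex"

locale star_probability_space = ring A for A :: "('a, 'b) star_alg_scheme" (structure) +
  assumes cscale_closed: "a \<in> carrier A \<Longrightarrow> cscale A c a \<in> carrier A"
    and cscale_add_left: "a \<in> carrier A \<Longrightarrow> cscale A (c + d) a = cscale A c a \<oplus> cscale A d a"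
    and cscale_add_right: "\<lbrakk>a \<in> carrier A; b \<in> carrier A\<rbrakk> \<Longrightarrow>
      cscale A c (a \<oplus> b) = cscale A c a \<oplus> cscale A c b"
    and cscale_cscale: "a \<in> carrier A \<Longrightarrow> cscale A c (cscale A d a) = cscale A (c * d) a"
    and cscale_one: "a \<in> carrier A \<Longrightarrow> cscale A 1 a = a"
    and cscale_mult_left: "\<lbrakk>a \<in> carrier A; b \<in> carrier A\<rbrakk> \<Longrightarrow>
      cscale A c a \<otimes> b = cscale A c (a \<otimes> b)"
    and cscale_mult_right: "\<lbrakk>a \<in> carrier A; b \<in> carrier A\<rbrakk> \<Longrightarrow>
      a \<otimes> cscale A c b = cscale A c (a \<otimes> b)"
    and adj_closed: "a \<in> carrier A \<Longrightarrow> adj A a \<in> carrier A"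
    and adj_adj: "a \<in> carrier A \<Longrightarrow> adj A (adj A a) = a"
    and adj_add: "\<lbrakk>a \<in> carrier A; b \<in> carrier A\<rbrakk> \<Longrightarrow> adj A (a \<oplus> b) = adj A a \<oplus> adj A b"
    and adj_mult: "\<lbrakk>a \<in> carrier A; b \<in> carrier A\<rbrakk> \<Longrightarrow> adj A (a \<otimes> b) = adj A b \<otimes> adj A a"
    and adj_cscale: "a \<in> carrier A \<Longrightarrow> adj A (cscale A c a) = cscale A (cnj c) (adj A a)"
    and state_add: "\<lbrakk>a \<in> carrier A; b \<in> carrier A\<rbrakk> \<Longrightarrow> state A (a \<oplus> b) = state A a + state A b"
    and state_cscale: "a \<in> carrier A \<Longrightarrow> state A (cscale A c a) = c * state A a"
    and state_one: "state A \<one> = 1"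
    and state_positive: "a \<in> carrier A \<Longrightarrow> state A (adj A a \<otimes> a) \<in> \<real>\<^sub>\<ge>\<^sub>0"

definition lprod :: "('a, 'b) star_alg_scheme \<Rightarrow> 'a list \<Rightarrow> 'a" where
  "lprod A as = foldr (mult A) as (one A)"

text \<open>Noncommutative polynomials with complex coefficients in indeterminates indexed by
  \<^typ>\<open>'v\<close> are finitely supported functions on words; the polynomials in the indeterminates
  indexed by a set \<open>J\<close> are those supported on words over \<open>J\<close>.\<close>

type_synonym 'v nc_poly = "'v list \<Rightarrow>\<^sub>0 complex"

definition nc_polys :: "'v set \<Rightarrow> 'v nc_poly set" where
  "nc_polys J = {p. Poly_Mapping.keys p \<subseteq> lists J}"

definition nc_eval :: "('a, 'b) star_alg_scheme \<Rightarrow> ('v \<Rightarrow> 'a) \<Rightarrow> 'v nc_poly \<Rightarrow> 'a" where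
  "nc_eval A a p =
    finsum A (\<lambda>w. cscale A (Poly_Mapping.lookup p w) (lprod A (map a w))) (Poly_Mapping.keys p)"

text \<open>Only polynomials in the family itself, without adjoints, are tested: the families of
  interest are self-adjoint up to null sets.\<close>

definition converges_in_distribution ::
  "(nat \<Rightarrow> ('a, 'x) star_alg_scheme) \<Rightarrow> (nat \<Rightarrow> 'v \<Rightarrow> 'a) \<Rightarrow>
   ('b, 'y) star_alg_scheme \<Rightarrow> ('v \<Rightarrow> 'b) \<Rightarrow> 'v set \<Rightarrow> bool" where
  "converges_in_distribution A a B b J \<longleftrightarrow>
    star_probability_space B \<and> b \<in> J \<rightarrow> carrier B \<and>
    (\<forall>p\<in>nc_polys J.
      (\<lambda>n. state (A n) (nc_eval (A n) (a n) p)) \<longlonglongrightarrow> state B (nc_eval B b p))"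

definition star_subalgebra :: "('a, 'b) star_alg_scheme \<Rightarrow> 'a set \<Rightarrow> bool" where
  "star_subalgebra A S \<longleftrightarrow> S \<subseteq> carrier A \<and> one A \<in> S \<and>
    (\<forall>a\<in>S. \<forall>b\<in>S. add A a b \<in> S \<and> mult A a b \<in> S) \<and>
    (\<forall>c. \<forall>a\<in>S. cscale A c a \<in> S) \<and> (\<forall>a\<in>S. adj A a \<in> S)"

definition gen_star_subalgebra :: "('a, 'b) star_alg_scheme \<Rightarrow> 'a set \<Rightarrow> 'a set" where
  "gen_star_subalgebra A G = \<Inter>{S. star_subalgebra A S \<and> G \<subseteq> S}"

definition free_subalgebras :: "('a, 'b) star_alg_scheme \<Rightarrow> ('k \<Rightarrow> 'a set) \<Rightarrow> 'k set \<Rightarrow> bool" where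
  "free_subalgebras A S K \<longleftrightarrow>
    (\<forall>ks as. ks \<noteq> [] \<and> set ks \<subseteq> K \<and> distinct_adj ks \<and>
       list_all2 (\<lambda>k a. a \<in> S k \<and> state A a = 0) ks as \<longrightarrow>
       state A (lprod A as) = 0)"

definition tensor_independent_subalgebras ::
  "('a, 'b) star_alg_scheme \<Rightarrow> ('k \<Rightarrow> 'a set) \<Rightarrow> 'k set \<Rightarrow> bool" where
  "tensor_independent_subalgebras A S K \<longleftrightarrow>
    (\<forall>k\<in>K. \<forall>l\<in>K. k \<noteq> l \<longrightarrow> (\<forall>a\<in>S k. \<forall>b\<in>S l. mult A a b = mult A b a)) \<and>
    (\<forall>ks as. set ks \<subseteq> K \<and> distinct ks \<and> list_all2 (\<lambda>k a. a \<in> S k) ks as \<longrightarrow>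
       state A (lprod A as) = prod_list (map (state A) as))"

definition free_families ::
  "('a, 'b) star_alg_scheme \<Rightarrow> ('v \<Rightarrow> 'a) \<Rightarrow> 'v set \<Rightarrow> ('u \<Rightarrow> 'a) \<Rightarrow> 'u set \<Rightarrow> bool" where
  "free_families A a J b L \<longleftrightarrow>
    free_subalgebras A
      (case_bool (gen_star_subalgebra A (a ` J)) (gen_star_subalgebra A (b ` L))) UNIV"

text \<open>The limit space is sought on the type \<^typ>\<open>('v + 'u) nc_poly\<close>. This is no restriction:
  every *-algebra generated by a family indexed by \<^typ>\<open>'v + 'u\<close> is in bijection with a subset
  of this type, so any limit can be realised on it.\<close>

definition asymptotically_free ::
  "(nat \<Rightarrow> ('a, 'x) star_alg_scheme) \<Rightarrow> (nat \<Rightarrow> 'v \<Rightarrow> 'a) \<Rightarrow> 'v set \<Rightarrow>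
   (nat \<Rightarrow> 'u \<Rightarrow> 'a) \<Rightarrow> 'u set \<Rightarrow> bool" where
  "asymptotically_free A a J b L \<longleftrightarrow>
    (\<exists>(B :: ('v + 'u) nc_poly star_alg) c d.
       converges_in_distribution A (\<lambda>n. case_sum (a n) (b n)) B (case_sum c d) (J <+> L) \<and>
       free_families B c J d L)"

definition has_law :: "('a, 'b) star_alg_scheme \<Rightarrow> 'a \<Rightarrow> real measure \<Rightarrow> bool" where
  "has_law A a \<mu> \<longleftrightarrow>
    a \<in> carrier A \<and> adj A a = a \<and>
    (\<forall>k::nat. integrable \<mu> (\<lambda>x. x ^ k) \<and>
       state A (lprod A (replicate k a)) = complex_of_real (\<integral>x. x ^ k \<partial>\<mu>))"

definition semicircle_law :: "real measure" where
  "semicircle_law = density lborel (\<lambda>x. ennreal (indicator {-2..2} x * sqrt (4 - x\<^sup>2) / (2 * pi)))"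

definition semicircular_system :: "('a, 'b) star_alg_scheme \<Rightarrow> ('v \<Rightarrow> 'a) \<Rightarrow> 'v set \<Rightarrow> bool" where
  "semicircular_system A s J \<longleftrightarrow>
    (\<forall>i\<in>J. has_law A (s i) semicircle_law) \<and>
    free_subalgebras A (\<lambda>i. gen_star_subalgebra A {s i}) J"

definition gaussian_system :: "('a, 'b) star_alg_scheme \<Rightarrow> ('v \<Rightarrow> 'a) \<Rightarrow> 'v set \<Rightarrow> bool" where
  "gaussian_system A g J \<longleftrightarrow>
    (\<forall>i\<in>J. has_law A (g i) (density lborel (\<lambda>x. ennreal (std_normal_density x)))) \<and>
    tensor_independent_subalgebras A (\<lambda>i. gen_star_subalgebra A {g i}) J"

section \<open>Random matrices\<close>

definition all_moments :: "'w measure \<Rightarrow> ('w \<Rightarrow> complex) \<Rightarrow> bool" where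
  "all_moments M f \<longleftrightarrow> f \<in> borel_measurable M \<and> (\<forall>p::nat. integrable M (\<lambda>\<omega>. norm (f \<omega>) ^ p))"

text \<open>Random matrices are not identified up to almost sure equality; this does not
  affect the values of the state.\<close>

definition random_matrix_space :: "'w measure \<Rightarrow> nat \<Rightarrow> ('w \<Rightarrow> complex mat) star_alg" where
  "random_matrix_space M n =
    \<lparr>carrier = {Y. (\<forall>\<omega>. Y \<omega> \<in> carrier_mat n n) \<and>
                   (\<forall>j<n. \<forall>k<n. all_moments M (\<lambda>\<omega>. Y \<omega> $$ (j, k)))},
     mult = (\<lambda>Y Z \<omega>. Y \<omega> * Z \<omega>), one = (\<lambda>\<omega>. 1\<^sub>m n),
     zero = (\<lambda>\<omega>. 0\<^sub>m n n), add = (\<lambda>Y Z \<omega>. Y \<omega> + Z \<omega>),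
     cscale = (\<lambda>c Y \<omega>. c \<cdot>\<^sub>m Y \<omega>),
     adj = (\<lambda>Y \<omega>. mat_adjoint (Y \<omega>)),
     state = (\<lambda>Y. \<integral>\<omega>. (\<Sum>j<n. Y \<omega> $$ (j, j)) / of_nat n \<partial>M)\<rparr>"

text \<open>Rows and columns are indexed from 0. An array \<open>X\<close> is only ever read on and above the
  diagonal; its values \<open>X j k\<close> for \<open>j > k\<close> are irrelevant.\<close>

definition wigner_matrix :: "(nat \<Rightarrow> nat \<Rightarrow> 'w \<Rightarrow> complex) \<Rightarrow> nat \<Rightarrow> 'w \<Rightarrow> complex mat" where
  "wigner_matrix X n \<omega> =
    Matrix.mat n n (\<lambda>(j, k). if j \<le> k then X j k \<omega> else cnj (X k j \<omega>))"

definition wigner_array :: "'w measure \<Rightarrow> (nat \<Rightarrow> nat \<Rightarrow> 'w \<Rightarrow> complex) \<Rightarrow> bool" where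
  "wigner_array M X \<longleftrightarrow>
    prob_space.indep_vars M (\<lambda>_. borel) (\<lambda>(j, k). X j k) {(j, k). j \<le> k} \<and>
    (\<forall>j k j' k'. j < k \<longrightarrow> j' < k' \<longrightarrow> distr M borel (X j k) = distr M borel (X j' k')) \<and>
    (\<forall>j j'. distr M borel (X j j) = distr M borel (X j' j')) \<and>
    (\<forall>j k. j < k \<longrightarrow>
       integrable M (X j k) \<and> (\<integral>\<omega>. X j k \<omega> \<partial>M) = 0 \<and>
       integrable M (\<lambda>\<omega>. (norm (X j k \<omega>))\<^sup>2) \<and> (\<integral>\<omega>. (norm (X j k \<omega>))\<^sup>2 \<partial>M) = 1) \<and>
    (\<forall>j. (\<forall>\<omega>\<in>space M. X j j \<omega> \<in> \<real>) \<and> integrable M (\<lambda>\<omega>. (norm (X j j \<omega>))\<^sup>2))"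

definition finite_moment_wigner_array :: "'w measure \<Rightarrow> (nat \<Rightarrow> nat \<Rightarrow> 'w \<Rightarrow> complex) \<Rightarrow> bool" where
  "finite_moment_wigner_array M X \<longleftrightarrow>
    wigner_array M X \<and> (\<forall>j k. j \<le> k \<longrightarrow> all_moments M (X j k))"

definition wigner_parameter ::
  "'w measure \<Rightarrow> (nat \<Rightarrow> nat \<Rightarrow> 'w \<Rightarrow> complex) \<Rightarrow> complex \<Rightarrow> bool" where
  "wigner_parameter M X \<beta> \<longleftrightarrow> (\<forall>j k. j < k \<longrightarrow> (\<integral>\<omega>. (X j k \<omega>)\<^sup>2 \<partial>M) = \<beta>)"

definition independent_matrices ::
  "'w measure \<Rightarrow> nat \<Rightarrow> ('i \<Rightarrow> 'w \<Rightarrow> complex mat) \<Rightarrow> 'i set \<Rightarrow> bool" where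
  "independent_matrices M n Y I \<longleftrightarrow>
    prob_space.indep_vars M (\<lambda>_. Pi\<^sub>M ({..<n} \<times> {..<n}) (\<lambda>_. borel))
      (\<lambda>i \<omega>. \<lambda>jk\<in>{..<n} \<times> {..<n}. Y i \<omega> $$ jk) I"

definition band_matrix ::
  "(nat \<Rightarrow> nat \<Rightarrow> 'w \<Rightarrow> complex) \<Rightarrow> nat \<Rightarrow> nat \<Rightarrow> 'w \<Rightarrow> complex mat" where
  "band_matrix X b n \<omega> =
    Matrix.mat n n (\<lambda>(j, k). if \<bar>int j - int k\<bar> \<le> int b then wigner_matrix X n \<omega> $$ (j, k) else 0)"

definition slow_growth :: "(nat \<Rightarrow> nat) \<Rightarrow> bool" where
  "slow_growth b \<longleftrightarrow>
    filterlim b at_top sequentially \<and> (\<lambda>n. real (b n)) \<in> o(\<lambda>n. real n)"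

definition full_proportion :: "(nat \<Rightarrow> nat) \<Rightarrow> bool" where
  "full_proportion b \<longleftrightarrow> (\<lambda>n. real (b n) / real n) \<longlonglongrightarrow> 1"

definition slow_band_matrix ::
  "(nat \<Rightarrow> nat \<Rightarrow> 'w \<Rightarrow> complex) \<Rightarrow> (nat \<Rightarrow> nat) \<Rightarrow> nat \<Rightarrow> 'w \<Rightarrow> complex mat" where
  "slow_band_matrix X b n \<omega> =
    complex_of_real (1 / sqrt (2 * real (b n))) \<cdot>\<^sub>m band_matrix X (b n) n \<omega>"

definition full_band_matrix ::
  "(nat \<Rightarrow> nat \<Rightarrow> 'w \<Rightarrow> complex) \<Rightarrow> (nat \<Rightarrow> nat) \<Rightarrow> nat \<Rightarrow> 'w \<Rightarrow> complex mat" where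
  "full_band_matrix X b n \<omega> =
    complex_of_real (1 / sqrt (real n)) \<cdot>\<^sub>m band_matrix X (b n) n \<omega>"

definition deg :: "complex mat \<Rightarrow> complex mat" where
  "deg A = mat_diag (dim_row A) (\<lambda>j. \<Sum>k<dim_col A. A $$ (j, k))"

section \<open>The random matrix spaces are *-probability spaces\<close>

lemma all_moments_bound:
  assumes f: "f \<in> borel_measurable M"
    and "\<And>p::nat. \<exists>g. integrable M g \<and> (\<forall>\<omega>. norm (f \<omega>) ^ p \<le> g \<omega>)"
  shows "all_moments M f"
  unfolding all_moments_def
proof (intro conjI allI f)
  fix p :: nat
  obtain g where g: "integrable M g" "\<And>\<omega>. norm (f \<omega>) ^ p \<le> g \<omega>"
    using assms(2)[of p] by auto
  have m: "(\<lambda>\<omega>. norm (f \<omega>) ^ p) \<in> borel_measurable M" using f by measurable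
  show "integrable M (\<lambda>\<omega>. norm (f \<omega>) ^ p)"
    by (rule Bochner_Integration.integrable_bound[OF g(1) m])
      (use g(2) in \<open>auto intro!: AE_I2 order_trans[OF _ abs_ge_self]\<close>)
qed

lemma all_moments_const: "prob_space M \<Longrightarrow> all_moments M (\<lambda>_. c)"
  by (simp add: all_moments_def prob_space.finite_measure finite_measure.integrable_const)

lemma all_moments_add:
  assumes "all_moments M f" "all_moments M g"
  shows "all_moments M (\<lambda>\<omega>. f \<omega> + g \<omega>)"
proof (rule all_moments_bound)
  show "(\<lambda>\<omega>. f \<omega> + g \<omega>) \<in> borel_measurable M" using assms unfolding all_moments_def by auto
  fix p :: nat
  have "norm (f \<omega> + g \<omega>) ^ p \<le> 2 ^ p * (norm (f \<omega>) ^ p + norm (g \<omega>) ^ p)" for \<omega>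
  proof -
    have "norm (f \<omega> + g \<omega>) \<le> 2 * max (norm (f \<omega>)) (norm (g \<omega>))"
      using norm_triangle_ineq[of "f \<omega>" "g \<omega>"] by linarith
    then have "norm (f \<omega> + g \<omega>) ^ p \<le> (2 * max (norm (f \<omega>)) (norm (g \<omega>))) ^ p"
      by (intro power_mono) auto
    also have "\<dots> \<le> 2 ^ p * (norm (f \<omega>) ^ p + norm (g \<omega>) ^ p)"
      by (auto simp: power_mult_distrib max_def)
    finally show ?thesis .
  qed
  then show "\<exists>h. integrable M h \<and> (\<forall>\<omega>. norm (f \<omega> + g \<omega>) ^ p \<le> h \<omega>)"
    using assms unfolding all_moments_def
    by (intro exI[of _ "\<lambda>\<omega>. 2 ^ p * (norm (f \<omega>) ^ p + norm (g \<omega>) ^ p)"]) auto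
qed

lemma all_moments_mult:
  assumes "all_moments M f" "all_moments M g"
  shows "all_moments M (\<lambda>\<omega>. f \<omega> * g \<omega>)"
proof (rule all_moments_bound)
  show "(\<lambda>\<omega>. f \<omega> * g \<omega>) \<in> borel_measurable M" using assms unfolding all_moments_def by auto
  fix p :: nat
  have "norm (f \<omega> * g \<omega>) ^ p \<le> norm (f \<omega>) ^ (p * 2) + norm (g \<omega>) ^ (p * 2)" for \<omega>
  proof -
    have "2 * (x * y) \<le> x\<^sup>2 + y\<^sup>2" "x * y \<ge> 0 \<Longrightarrow> x * y \<le> x\<^sup>2 + y\<^sup>2" for x y :: real
      using sum_squares_bound[of x y] by (simp_all add: mult_ac)
    from this(2)[of "norm (f \<omega>) ^ p" "norm (g \<omega>) ^ p"] show ?thesis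
      by (simp add: norm_mult power_mult_distrib power_mult)
  qed
  then show "\<exists>h. integrable M h \<and> (\<forall>\<omega>. norm (f \<omega> * g \<omega>) ^ p \<le> h \<omega>)"
    using assms unfolding all_moments_def
    by (intro exI[of _ "\<lambda>\<omega>. norm (f \<omega>) ^ (p * 2) + norm (g \<omega>) ^ (p * 2)"]) auto
qed

lemma all_moments_cnj: "all_moments M f \<Longrightarrow> all_moments M (\<lambda>\<omega>. cnj (f \<omega>))"
  unfolding all_moments_def
  using measurable_compose[of f M borel cnj, OF _ borel_measurable_continuous_onI]
  by (simp add: continuous_on_cnj)

lemma all_moments_sum:
  assumes "prob_space M" "\<And>i. i \<in> S \<Longrightarrow> all_moments M (f i)"
  shows "all_moments M (\<lambda>\<omega>. \<Sum>i\<in>S. f i \<omega>)"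
  using assms(2)
  by (induction S rule: infinite_finite_induct)
    (auto intro!: all_moments_const[OF assms(1)] all_moments_add)

lemma all_moments_integrable: "all_moments M f \<Longrightarrow> integrable M f"
  unfolding all_moments_def by (auto dest!: spec[of _ 1] intro: integrable_norm_cancel)

lemma mat_adjoint_index:
  "\<lbrakk>i < dim_col A; j < dim_row A\<rbrakk> \<Longrightarrow> mat_adjoint A $$ (i, j) = conjugate (A $$ (j, i))"
  unfolding mat_adjoint_def by (auto simp: mat_of_rows_def)

lemma mat_adjoint_dims: "dim_row (mat_adjoint A) = dim_col A" "dim_col (mat_adjoint A) = dim_row A"
  unfolding mat_adjoint_def by auto

lemma matmul_index:
  "\<lbrakk>A \<in> carrier_mat n n; B \<in> carrier_mat n n; i < n; j < n\<rbrakk> \<Longrightarrow>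
   (A * B) $$ (i, j) = (\<Sum>k<n. A $$ (i, k) * B $$ (k, j))"
  by (auto simp: scalar_prod_def atLeast0LessThan)

lemma star_probability_space_random_matrix_space:
  assumes M: "prob_space M" and n: "n > 0"
  shows "star_probability_space (random_matrix_space M n)"
proof -
  let ?A = "random_matrix_space M n"
  have car: "Y \<in> carrier ?A \<longleftrightarrow> (\<forall>\<omega>. Y \<omega> \<in> carrier_mat n n) \<and>
      (\<forall>j<n. \<forall>k<n. all_moments M (\<lambda>\<omega>. Y \<omega> $$ (j, k)))" for Y
    by (simp add: random_matrix_space_def)
  have carM: "Y \<omega> \<in> carrier_mat n n" "dim_row (Y \<omega>) = n" "dim_col (Y \<omega>) = n"
    if "Y \<in> carrier ?A" for Y \<omega>
    using that unfolding car by (metis carrier_matD)+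
  have carI: "all_moments M (\<lambda>\<omega>. Y \<omega> $$ (j, k))"
    if "Y \<in> carrier ?A" "j < n" "k < n" for Y j k using that unfolding car by auto
  have ops: "mult ?A = (\<lambda>Y Z \<omega>. Y \<omega> * Z \<omega>)" "one ?A = (\<lambda>\<omega>. 1\<^sub>m n)"
    "zero ?A = (\<lambda>\<omega>. 0\<^sub>m n n)" "add ?A = (\<lambda>Y Z \<omega>. Y \<omega> + Z \<omega>)"
    "cscale ?A = (\<lambda>c Y \<omega>. c \<cdot>\<^sub>m Y \<omega>)" "adj ?A = (\<lambda>Y \<omega>. mat_adjoint (Y \<omega>))"
    "state ?A = (\<lambda>Y. \<integral>\<omega>. (\<Sum>j<n. Y \<omega> $$ (j, j)) / of_nat n \<partial>M)"
    by (simp_all add: random_matrix_space_def)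
  have cl_mult: "(\<lambda>\<omega>. Y \<omega> * Z \<omega>) \<in> carrier ?A"
    if Y: "Y \<in> carrier ?A" and Z: "Z \<in> carrier ?A" for Y Z
    unfolding car
  proof (intro conjI allI impI)
    fix j k assume jk: "j < n" "k < n"
    have "(\<lambda>\<omega>. (Y \<omega> * Z \<omega>) $$ (j, k)) = (\<lambda>\<omega>. \<Sum>l<n. Y \<omega> $$ (j, l) * Z \<omega> $$ (l, k))"
      by (rule ext, rule matmul_index) (use carM Y Z jk in auto)
    then show "all_moments M (\<lambda>\<omega>. (Y \<omega> * Z \<omega>) $$ (j, k))"
      by (auto intro!: all_moments_sum[OF M] all_moments_mult carI Y Z jk)
  qed (use carM Y Z in auto)
  have cl_add: "(\<lambda>\<omega>. Y \<omega> + Z \<omega>) \<in> carrier ?A"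
    if Y: "Y \<in> carrier ?A" and Z: "Z \<in> carrier ?A" for Y Z
    unfolding car using carM[OF Y] carM[OF Z] carI[OF Y] carI[OF Z] by (auto intro: all_moments_add)
  have cl_scale: "(\<lambda>\<omega>. c \<cdot>\<^sub>m Y \<omega>) \<in> carrier ?A" if Y: "Y \<in> carrier ?A" for Y c
    unfolding car using carM[OF Y] carI[OF Y]
    by (auto intro!: all_moments_mult all_moments_const[OF M])
  have cl_adj: "(\<lambda>\<omega>. mat_adjoint (Y \<omega>)) \<in> carrier ?A" if Y: "Y \<in> carrier ?A" for Y
    unfolding car using carM[OF Y] carI[OF Y]
    by (auto simp: mat_adjoint_dims mat_adjoint_index intro!: all_moments_cnj carrier_matI)
  have cl_one: "(\<lambda>\<omega>. 1\<^sub>m n) \<in> carrier ?A" and cl_zero: "(\<lambda>\<omega>. 0\<^sub>m n n) \<in> carrier ?A"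
    unfolding car by (auto intro: all_moments_const[OF M])
  have ab: "abelian_group ?A"
  proof (rule abelian_groupI)
    fix Y assume Y: "Y \<in> carrier ?A"
    show "\<exists>Z\<in>carrier ?A. Z \<oplus>\<^bsub>?A\<^esub> Y = \<zero>\<^bsub>?A\<^esub>"
      by (rule bexI[of _ "\<lambda>\<omega>. (-1) \<cdot>\<^sub>m Y \<omega>"])
        (use carM[OF Y] cl_scale[OF Y] in \<open>auto simp: ops intro!: eq_matI ext\<close>)
  qed (auto simp: ops cl_add cl_zero carM intro!: ext eq_matI)
  have mon: "monoid ?A"
    by (rule monoidI)
      (auto simp: ops cl_mult cl_one carM intro!: ext assoc_mult_mat left_mult_one_mat right_mult_one_mat)
  have ring: "ring ?A"
    by (rule ringI[OF ab mon])
      (auto simp: ops carM intro!: ext add_mult_distrib_mat mult_add_distrib_mat)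
  have int: "integrable M (\<lambda>\<omega>. Y \<omega> $$ (j, j))" if "Y \<in> carrier ?A" "j < n" for Y j
    by (intro all_moments_integrable carI that)
  show ?thesis
  proof (intro star_probability_space.intro ring star_probability_space_axioms.intro)
    fix Y assume Y: "Y \<in> carrier ?A"
    note d = carM[OF Y]
    have diag: "(\<Sum>j<n. (mat_adjoint (Y \<omega>) * Y \<omega>) $$ (j, j)) / of_nat n =
        complex_of_real ((\<Sum>j<n. \<Sum>k<n. (norm (Y \<omega> $$ (k, j)))\<^sup>2) / real n)" for \<omega>
    proof -
      have "(mat_adjoint (Y \<omega>) * Y \<omega>) $$ (j, j) =
          complex_of_real (\<Sum>k<n. (norm (Y \<omega> $$ (k, j)))\<^sup>2)" if "j < n" for j
        using that d
        by (subst matmul_index[where n = n])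
          (auto simp: mat_adjoint_dims mat_adjoint_index complex_norm_square mult.commute
            simp del: of_real_power intro!: carrier_matI sum.cong)
      then show ?thesis by simp
    qed
    show "state ?A (adj ?A Y \<otimes>\<^bsub>?A\<^esub> Y) \<in> \<real>\<^sub>\<ge>\<^sub>0"
      unfolding ops diag integral_complex_of_real nonneg_Reals_of_real_iff
      by (intro Bochner_Integration.integral_nonneg divide_nonneg_nonneg sum_nonneg) auto
    show "state ?A (cscale ?A c Y) = c * state ?A Y" for c
      using d by (simp add: ops flip: sum_distrib_left)
    fix Z assume Z: "Z \<in> carrier ?A"
    note dz = carM[OF Z]
    show "state ?A (Y \<oplus>\<^bsub>?A\<^esub> Z) = state ?A Y + state ?A Z"
    proof -
      have i: "integrable M (\<lambda>\<omega>. \<Sum>j<n. Y \<omega> $$ (j, j))"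
        "integrable M (\<lambda>\<omega>. \<Sum>j<n. Z \<omega> $$ (j, j))"
        using int[OF Y] int[OF Z] by (auto intro: Bochner_Integration.integrable_sum)
      have "(\<Sum>j<n. (Y \<omega> + Z \<omega>) $$ (j, j)) =
          (\<Sum>j<n. Y \<omega> $$ (j, j)) + (\<Sum>j<n. Z \<omega> $$ (j, j))" for \<omega>
        using d dz by (simp add: sum.distrib)
      then show ?thesis
        by (simp only: ops integral_divide_zero Bochner_Integration.integral_add[OF i] add_divide_distrib)
    qed
    show "adj ?A (Y \<otimes>\<^bsub>?A\<^esub> Z) = adj ?A Z \<otimes>\<^bsub>?A\<^esub> adj ?A Y"
      using d dz
      by (auto simp: ops mat_adjoint_dims mat_adjoint_index scalar_prod_def mult.commute
          intro!: ext eq_matI sum.cong)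
  next
    show "state ?A \<one>\<^bsub>?A\<^esub> = 1"
      using n M by (simp add: ops prob_space.prob_space)
  qed (auto simp: ops cl_scale cl_adj mat_adjoint_dims mat_adjoint_index carM algebra_simps
      intro!: ext eq_matI)
qed

lemma band_in_space:
  assumes "prob_space M" "finite_moment_wigner_array M X"
  shows "slow_band_matrix X b n \<in> carrier (random_matrix_space M n)"
    and "full_band_matrix X b n \<in> carrier (random_matrix_space M n)"
    and "(\<lambda>\<omega>. deg (slow_band_matrix X b n \<omega>)) \<in> carrier (random_matrix_space M n)"
    and "(\<lambda>\<omega>. deg (full_band_matrix X b n \<omega>)) \<in> carrier (random_matrix_space M n)"
proof -
  have e: "all_moments M (\<lambda>\<omega>. band_matrix X c n \<omega> $$ (j,k))" if "j < n" "k < n" for j k c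
    using that assms unfolding finite_moment_wigner_array_def
    by (cases "\<bar>int j - int k\<bar> \<le> int c"; cases "j \<le> k")
      (auto simp: band_matrix_def wigner_matrix_def intro: all_moments_cnj all_moments_const)
  have d: "dim_row (band_matrix X c n \<omega>) = n" "dim_col (band_matrix X c n \<omega>) = n" for c \<omega>
    by (simp_all add: band_matrix_def)
  note defs = random_matrix_space_def slow_band_matrix_def full_band_matrix_def deg_def mat_diag_def
  note am = all_moments_mult all_moments_const[OF assms(1)] all_moments_sum[OF assms(1)] e
  show "slow_band_matrix X b n \<in> carrier (random_matrix_space M n)"
    "full_band_matrix X b n \<in> carrier (random_matrix_space M n)"
    by (auto simp: defs d divide_inverse intro!: am carrier_matI)
  have deg_in: "(\<lambda>\<omega>. deg (Y \<omega>)) \<in> carrier (random_matrix_space M n)"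
    if Y: "Y \<in> carrier (random_matrix_space M n)" for Y
  proof -
    have dY: "dim_row (Y \<omega>) = n" "dim_col (Y \<omega>) = n" for \<omega>
      using Y unfolding random_matrix_space_def by (auto dest!: spec[of _ \<omega>])
    have "all_moments M (\<lambda>\<omega>. deg (Y \<omega>) $$ (j, k))" if "j < n" "k < n" for j k
      using that Y by (cases "j = k")
        (auto simp: deg_def mat_diag_def dY random_matrix_space_def intro!: am)
    then show ?thesis by (auto simp: random_matrix_space_def deg_def dY intro!: mat_diag_dim)
  qed
  show "(\<lambda>\<omega>. deg (slow_band_matrix X b n \<omega>)) \<in> carrier (random_matrix_space M n)"
    "(\<lambda>\<omega>. deg (full_band_matrix X b n \<omega>)) \<in> carrier (random_matrix_space M n)"
    by (rule deg_in, fact)+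
qed

end

theory Submission
  imports Defs
begin

text \<open>
  The normalised expected trace of a word in the matrices \<open>\<Theta>\<^sub>i\<close> and their degree matrices \<open>D\<^sub>i\<close> is a sum,
  over the labellings of the vertices of a graph by row indices, of moments of entries. Such moments
  are dominated by sums of products of the variance profile over sets of edges that cover the graph,
  so that sums over connected graphs stay bounded. Splitting off the first edge, only its pairings
  with a single other edge survive in the limit, and a sum over two graphs joined by a bridge
  factorises. For the limit \<open>\<tau>\<close> of the word moments this gives, for every word \<open>w\<close>,
  \<open>\<tau>(\<Theta>\<^sub>i w) = \<Sum> \<tau>(u) \<tau>(v)\<close> over the factorisations \<open>w = u \<Theta>\<^sub>i v\<close>, whereas on words in degree matrices only,
  \<open>\<tau>(D\<^sub>i w) = \<beta>\<^sub>i \<Sum> \<tau>(u v)\<close> over the factorisations \<open>w = u D\<^sub>i v\<close>. The first recursion is the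
  Schwinger--Dyson equation: it forces the \<open>\<Theta>\<^sub>i\<close> to be semicircular and free from each other and from the
  \<open>D\<^sub>i\<close>. For \<open>\<beta>\<^sub>i = 1\<close> the second one is Wick's formula. The limits live on monoid algebras, on which
  \<open>\<tau>\<close> is positive as a limit of states.
\<close>

section \<open>Weighted sums over connected graphs\<close>

text \<open>The row sums of the variance profile are close to 1 only on average: a slow band loses
  up to half of a row near its two corners. A factorisation over a bridge therefore cannot condition
  on a single index. Limits of graph sums are stated with an arbitrary bounded weight at a root
  (\<open>rooted_limit\<close>), since the weight that one side of a bridge induces on the other is
  bounded but not constant. Pair partitions are never enumerated. One step, the expansion of the
  first edge, yields both the factorisation over a bridge and the recursions: a pairing removes two
  random edges and leaves one deterministic kernel edge together with identifications of vertices.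
  If that kernel edge is not a bridge, it costs a factor \<epsilon> tending to 0. This is why
  \<beta> is absent from the recursion for \<Theta>: a pairing with equal orientation never leaves a
  bridge there, whereas in the star of a word in degree matrices only such a pairing leaves one. The
  value \<beta> = 1 has a second effect: it makes the entries real almost surely, so that the degree
  matrices are self-adjoint and their limit functional is positive.\<close>

definition conn :: "'v set \<Rightarrow> ('v \<times> 'v) set \<Rightarrow> bool" where
  "conn V S \<longleftrightarrow> (\<forall>P::'v \<Rightarrow> bool. (\<forall>(x, y)\<in>S. P x = P y) \<longrightarrow> (\<forall>x\<in>V. \<forall>y\<in>V. P x = P y))"

text \<open>Connectivity is encoded without paths, by two-valued labellings that agree along edges.
  Proofs of connectivity become propagation of equalities, and edges need no orientation.\<close>

lemma connI:
  assumes "\<And>P x y. (\<And>a b. (a, b) \<in> S \<Longrightarrow> P a = P b) \<Longrightarrow> x \<in> V \<Longrightarrow> y \<in> V \<Longrightarrow> P x = (P y :: bool)"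
  shows "conn V S"
  unfolding conn_def
proof (intro allI impI ballI)
  fix P :: "'a \<Rightarrow> bool" and x y
  assume P: "\<forall>(x, y)\<in>S. P x = P y" and xy: "x \<in> V" "y \<in> V"
  show "P x = P y" by (rule assms[OF _ xy]) (use P in auto)
qed

lemma connD:
  assumes "conn V S" "\<And>a b. (a, b) \<in> S \<Longrightarrow> P a = P b" "x \<in> V" "y \<in> V"
  shows "P x = (P y :: bool)"
proof -
  have "(\<forall>(x, y)\<in>S. P x = P y) \<longrightarrow> (\<forall>x\<in>V. \<forall>y\<in>V. P x = P y)"
    using assms(1) unfolding conn_def by (rule spec)
  moreover have "\<forall>(x, y)\<in>S. P x = P y"
    by (intro ballI, clarify) (rule assms(2))
  ultimately show ?thesis using assms(3,4) by blast
qed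

text \<open>Otherwise the indicator of \<open>U\<close> would agree along every edge and still
  separate \<open>U\<close> from its complement.\<close>

lemma conn_crossing:
  assumes "conn V S" "S \<subseteq> V \<times> V" "U \<subset> V" "U \<noteq> {}"
  obtains x v where "x \<in> U" "v \<in> V - U" "(x, v) \<in> S \<or> (v, x) \<in> S"
proof (rule ccontr)
  assume *: "\<not> thesis"
  obtain a b where ab: "a \<in> U" "b \<in> V - U" using assms by blast
  have "(a \<in> U) = (b \<in> U)"
    by (rule connD[OF assms(1), where P = "\<lambda>z. z \<in> U"]) (use * that ab assms in blast)+
  then show False using ab by auto
qed

lemma conn_insert:
  assumes "conn U S" "x \<in> U" "(x, v) \<in> S' \<or> (v, x) \<in> S'" "S \<subseteq> S'"
  shows "conn (insert v U) S'"
proof (rule connI)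
  fix P :: "'a \<Rightarrow> bool" and a b
  assume P: "\<And>a b. (a, b) \<in> S' \<Longrightarrow> P a = P b" and ab: "a \<in> insert v U" "b \<in> insert v U"
  have "P z = P x" if "z \<in> U" for z
    by (rule connD[OF assms(1)]) (use P assms that in auto)
  moreover have "P v = P x" using P assms by blast
  ultimately show "P a = P b" using ab by auto
qed

text \<open>A leaf of a spanning tree, different from the root: a largest connected proper subset
  containing \<open>r\<close> is extended along a crossing edge, by maximality to all of
  \<open>V\<close>, and the vertex so added can be removed again. The neighbour \<open>x\<close> is
  recorded because its edge will control the sum over the values at \<open>v\<close>.\<close>

lemma conn_removable_vertex:
  assumes fin: "finite V" and c: "conn V S" and S: "S \<subseteq> V \<times> V" and r: "r \<in> V" "V \<noteq> {r}"
  obtains v x where "v \<in> V" "v \<noteq> r" "x \<in> V" "x \<noteq> v" "(x, v) \<in> S \<or> (v, x) \<in> S"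
    "conn (V - {v}) {(a, b). (a, b) \<in> S \<and> a \<noteq> v \<and> b \<noteq> v}"
proof -
  define W where "W = {U. r \<in> U \<and> U \<subset> V \<and> conn U (S \<inter> U \<times> U)}"
  have "finite W" using fin unfolding W_def by (auto intro: finite_subset[of _ "Pow V"])
  moreover have "{r} \<in> W" using r by (auto simp: W_def conn_def)
  ultimately obtain U where U: "U \<in> W" and max: "\<And>U'. U' \<in> W \<Longrightarrow> card U' \<le> card U"
    using Max_in[of "card ` W"] Max_ge[of "card ` W"]
    by (metis (no_types, lifting) empty_iff finite_imageI image_iff image_eqI)
  have U': "r \<in> U" "U \<subset> V" "conn U (S \<inter> U \<times> U)" using U by (auto simp: W_def)
  obtain x v where xv: "x \<in> U" "v \<in> V - U" "(x, v) \<in> S \<or> (v, x) \<in> S"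
    by (rule conn_crossing[OF c S U'(2)]) (use U' in auto)
  have c': "conn (insert v U) (S \<inter> insert v U \<times> insert v U)"
    by (rule conn_insert[OF U'(3) xv(1)]) (use xv in auto)
  have eq: "insert v U = V"
  proof (rule ccontr)
    assume "insert v U \<noteq> V"
    then have "insert v U \<in> W" using c' U' xv by (auto simp: W_def)
    then have "card (insert v U) \<le> card U" by (rule max)
    moreover have "finite U" using U' fin by (auto intro: finite_subset)
    ultimately show False using xv by simp
  qed
  have 1: "V - {v} = U" using eq xv by auto
  have 2: "{(a, b). (a, b) \<in> S \<and> a \<noteq> v \<and> b \<noteq> v} = S \<inter> U \<times> U" using S 1 by auto
  show ?thesis
    by (rule that[of v x]) (use xv U' in \<open>auto simp: 1 2\<close>)
qed

section \<open>Labellings of the vertices by row indices\<close>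

abbreviation Phi :: "'v set \<Rightarrow> nat \<Rightarrow> ('v \<Rightarrow> nat) set" where
  "Phi V n \<equiv> PiE V (\<lambda>_. {..<n})"

lemma sum_Phi_insert:
  assumes "finite V" "v \<notin> V"
  shows "(\<Sum>\<phi>\<in>Phi (insert v V) n. f \<phi>) = (\<Sum>\<phi>\<in>Phi V n. \<Sum>k<n. f (\<phi>(v := k)))"
proof -
  have "(\<Sum>\<phi>\<in>Phi (insert v V) n. f \<phi>) = (\<Sum>(k, \<phi>)\<in>{..<n} \<times> Phi V n. f (\<phi>(v := k)))"
    unfolding PiE_insert_eq
    by (subst sum.reindex[OF inj_combinator[OF assms(2)]]) (auto simp: case_prod_unfold)
  also have "\<dots> = (\<Sum>\<phi>\<in>Phi V n. \<Sum>k<n. f (\<phi>(v := k)))"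
    by (subst sum.swap) (simp add: sum.cartesian_product)
  finally show ?thesis .
qed

lemma sum_Phi_Un:
  assumes "finite A" "finite B" "A \<inter> B = {}"
  shows "(\<Sum>\<phi>\<in>Phi (A \<union> B) n. f \<phi>) = (\<Sum>\<phi>\<in>Phi A n. \<Sum>\<psi>\<in>Phi B n. f (override_on \<psi> \<phi> A))"
  using assms
proof (induction A arbitrary: f rule: finite_induct)
  case (insert v A)
  have ov: "override_on \<psi> (\<phi>(v := k)) (insert v A) = (override_on \<psi> \<phi> A)(v := k)" for \<psi> \<phi> :: "'a \<Rightarrow> nat" and k
    by (auto simp: override_on_def fun_eq_iff)
  have "(\<Sum>\<phi>\<in>Phi (insert v A \<union> B) n. f \<phi>) = (\<Sum>\<phi>\<in>Phi (A \<union> B) n. \<Sum>k<n. f (\<phi>(v := k)))"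
    using insert by (simp add: sum_Phi_insert)
  also have "\<dots> = (\<Sum>\<phi>\<in>Phi A n. \<Sum>\<psi>\<in>Phi B n. \<Sum>k<n. f ((override_on \<psi> \<phi> A)(v := k)))"
    using insert by simp
  also have "\<dots> = (\<Sum>\<phi>\<in>Phi A n. \<Sum>k<n. \<Sum>\<psi>\<in>Phi B n. f ((override_on \<psi> \<phi> A)(v := k)))"
    by (intro sum.cong refl sum.swap)
  also have "\<dots> = (\<Sum>\<phi>\<in>Phi (insert v A) n. \<Sum>\<psi>\<in>Phi B n. f (override_on \<psi> \<phi> (insert v A)))"
    using insert by (simp add: sum_Phi_insert ov)
  finally show ?case .
qed (simp add: PiE_empty_domain)

definition ends :: "('v \<times> 'v \<times> 'l) list \<Rightarrow> ('v \<times> 'v) set" where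
  "ends G = (\<lambda>(x, y, l). (x, y)) ` set G"

lemma ends_simps [simp]: "ends [] = {}" "ends ((x, y, l) # G) = insert (x, y) (ends G)"
  "ends (G @ H) = ends G \<union> ends H"
  by (auto simp: ends_def image_Un)

text \<open>\<open>K n i j k\<close> is the variance of an off-diagonal entry of the normalised
  matrix \<open>i\<close>, and \<epsilon> a uniform bound for it. \<open>row_le\<close> controls
  every single row, \<open>row_avg\<close> only the average deviation from 1, as rows near the
  corners of a slow band keep only about half of their mass.\<close>

locale kernel_family =
  fixes J :: "'i set" and K :: "nat \<Rightarrow> 'i \<Rightarrow> nat \<Rightarrow> nat \<Rightarrow> real" and \<epsilon> :: "nat \<Rightarrow> 'i \<Rightarrow> real"
  assumes K_nonneg: "0 \<le> K n i j k"
    and K_sym: "K n i j k = K n i k j"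
    and K_le: "i \<in> J \<Longrightarrow> K n i j k \<le> \<epsilon> n i"
    and eps_le: "i \<in> J \<Longrightarrow> \<epsilon> n i \<le> 1"
    and eps_lim: "i \<in> J \<Longrightarrow> (\<lambda>n. \<epsilon> n i) \<longlonglongrightarrow> 0"
    and row_le: "i \<in> J \<Longrightarrow> j < n \<Longrightarrow> (\<Sum>k<n. K n i j k) \<le> 2"
    and row_avg: "i \<in> J \<Longrightarrow> (\<lambda>n. (\<Sum>j<n. \<bar>(\<Sum>k<n. K n i j k) - 1\<bar>) / real n) \<longlonglongrightarrow> 0"
begin

lemma K_le1: "i \<in> J \<Longrightarrow> K n i j k \<le> 1"
  using K_le eps_le order_trans by blast

lemma eps_nonneg: "i \<in> J \<Longrightarrow> 0 \<le> \<epsilon> n i"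
  using K_le[of i n 0 0] K_nonneg[of n i 0 0] by linarith

text \<open>An edge labelled \<^term>\<open>None\<close> forces its two end points to take the same value.\<close>

definition edge_kernel :: "nat \<Rightarrow> 'i option \<Rightarrow> nat \<Rightarrow> nat \<Rightarrow> real" where
  "edge_kernel n l j k = (case l of None \<Rightarrow> of_bool (j = k) | Some i \<Rightarrow> K n i j k)"

definition wt :: "nat \<Rightarrow> ('v \<times> 'v \<times> 'i option) list \<Rightarrow> ('v \<Rightarrow> nat) \<Rightarrow> real" where
  "wt n G \<phi> = prod_list (map (\<lambda>(x, y, l). edge_kernel n l (\<phi> x) (\<phi> y)) G)"

definition graph_on :: "'v set \<Rightarrow> ('v \<times> 'v \<times> 'i option) list \<Rightarrow> bool" where
  "graph_on V G \<longleftrightarrow> (\<forall>(x, y, l)\<in>set G. x \<in> V \<and> y \<in> V \<and> (\<forall>i. l = Some i \<longrightarrow> i \<in> J))"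

lemma graph_on_simps [simp]: "graph_on V []"
  "graph_on V ((x, y, l) # G) \<longleftrightarrow> x \<in> V \<and> y \<in> V \<and> (\<forall>i. l = Some i \<longrightarrow> i \<in> J) \<and> graph_on V G"
  "graph_on V (G @ H) \<longleftrightarrow> graph_on V G \<and> graph_on V H"
  by (simp_all add: graph_on_def ball_Un)

lemma graph_on_ends: "graph_on V G \<Longrightarrow> ends G \<subseteq> V \<times> V"
  by (auto simp: graph_on_def ends_def)

lemma graph_on_mono: "graph_on V G \<Longrightarrow> set H \<subseteq> set G \<Longrightarrow> V \<subseteq> W \<Longrightarrow> graph_on W H"
  by (fastforce simp: graph_on_def)

lemma wt_simps [simp]: "wt n [] \<phi> = 1" "wt n ((x, y, l) # G) \<phi> = edge_kernel n l (\<phi> x) (\<phi> y) * wt n G \<phi>"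
  "wt n (G @ H) \<phi> = wt n G \<phi> * wt n H \<phi>"
  by (auto simp: wt_def)

lemma edge_kernel_simps [simp]: "edge_kernel n None j k = of_bool (j = k)" "edge_kernel n (Some i) j k = K n i j k"
  by (auto simp: edge_kernel_def)

lemma edge_kernel_bounds: "0 \<le> edge_kernel n l j k" "(\<forall>i. l = Some i \<longrightarrow> i \<in> J) \<Longrightarrow> edge_kernel n l j k \<le> 1"
  by (auto simp: edge_kernel_def K_nonneg K_le1 split: option.split)

lemma edge_kernel_row: "(\<forall>i. l = Some i \<longrightarrow> i \<in> J) \<Longrightarrow> j < n \<Longrightarrow> (\<Sum>k<n. edge_kernel n l j k) \<le> 2"
  by (cases l) (auto simp: row_le of_bool_def)

lemma edge_kernel_sym: "edge_kernel n l j k = edge_kernel n l k j"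
  by (cases l) (auto simp: K_sym)

lemma wt_nonneg: "0 \<le> wt n G \<phi>"
  unfolding wt_def by (induction G) (auto intro!: mult_nonneg_nonneg edge_kernel_bounds)

lemma wt_le1: "graph_on V G \<Longrightarrow> wt n G \<phi> \<le> 1"
  by (induction G) (auto intro!: mult_le_one edge_kernel_bounds wt_nonneg)

lemma wt_cong: "graph_on V G \<Longrightarrow> (\<And>x. x \<in> V \<Longrightarrow> \<phi> x = \<psi> x) \<Longrightarrow> wt n G \<phi> = wt n G \<psi>"
  by (induction G) auto

lemma wt_fun_upd: "graph_on V G \<Longrightarrow> v \<notin> V \<Longrightarrow> wt n G (\<phi>(v := k)) = wt n G \<phi>"
  by (rule wt_cong) auto

lemma wt_mset: "mset G = mset H \<Longrightarrow> wt n G \<phi> = wt n H \<phi>"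
  unfolding wt_def prod_mset_prod_list[symmetric] mset_map by simp

text \<open>Used with \<open>P\<close> saying that an edge avoids a vertex \<open>v\<close>: then
  \<open>g\<close> is the edge by which \<open>v\<close> hangs on the rest, and \<open>L\<close>
  collects the other edges at \<open>v\<close>.\<close>

lemma split_incident:
  assumes "g \<in> set G" "\<not> P g"
  obtains L where "mset G = mset (filter P G @ g # L)" "set L \<subseteq> {x \<in> set G. \<not> P x}"
proof -
  let ?N = "filter (\<lambda>x. \<not> P x) G"
  have "mset G = mset (filter P G) + mset ?N"
    using multiset_partition[of "mset G" P] by (simp add: mset_filter)
  also have "mset ?N = mset (g # remove1 g ?N)"
    using assms by (simp add: insert_DiffM)
  finally have "mset G = mset (filter P G @ g # remove1 g ?N)" by simp
  moreover have "set (remove1 g ?N) \<subseteq> {x \<in> set G. \<not> P x}"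
    using set_remove1_subset[of g ?N] by auto
  ultimately show ?thesis using that by blast
qed

text \<open>A spanning tree is summed from its leaves: at a removable vertex every edge but one is
  bounded by 1, and the sum over the index at that vertex is a row sum, at most 2. What remains is
  the sum over the root with its weight \<open>\<delta>\<close>.\<close>

lemma sum_wt_le:
  fixes V :: "'v set"
  assumes "finite V" "graph_on V G" "conn V (ends G)" "r \<in> V" "\<And>j. 0 \<le> \<delta> j"
  shows "(\<Sum>\<phi>\<in>Phi V n. \<delta> (\<phi> r) * wt n G \<phi>) \<le> 2 ^ card V * (\<Sum>j<n. \<delta> j)"
  using assms
proof (induction "card V" arbitrary: V G rule: less_induct)
  case less
  show ?case
  proof (cases "V = {r}")
    case True
    have "(\<Sum>\<phi>\<in>Phi V n. \<delta> (\<phi> r) * wt n G \<phi>) = (\<Sum>j<n. \<delta> j * wt n G ((\<lambda>_. undefined)(r := j)))"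
      using sum_Phi_insert[of "{}" r "\<lambda>\<phi>. \<delta> (\<phi> r) * wt n G \<phi>" n] True by (simp add: PiE_empty_domain fun_upd_def)
    also have "\<dots> \<le> (\<Sum>j<n. \<delta> j * 1)"
      by (intro sum_mono mult_left_mono wt_le1[OF less.prems(2)] less.prems)
    also have "\<dots> \<le> 2 ^ card V * (\<Sum>j<n. \<delta> j)" using True less.prems(5) by (simp add: sum_nonneg)
    finally show ?thesis .
  next
    case False
    obtain v x where vx: "v \<in> V" "v \<noteq> r" "x \<in> V" "x \<noteq> v" "(x, v) \<in> ends G \<or> (v, x) \<in> ends G"
      and c: "conn (V - {v}) {(a, b). (a, b) \<in> ends G \<and> a \<noteq> v \<and> b \<noteq> v}"
      by (rule conn_removable_vertex[OF less.prems(1) less.prems(3) graph_on_ends[OF less.prems(2)] less.prems(4) False])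
    define P where "P = (\<lambda>(a, b, l :: 'i option). a \<noteq> v \<and> b \<noteq> v)"
    define GU where "GU = filter P G"
    obtain a b l where g: "(a, b, l) \<in> set G" "(a, b) = (x, v) \<or> (a, b) = (v, x)"
      using vx(5) by (auto simp: ends_def)
    have nP: "\<not> P (a, b, l)" using g(2) by (auto simp: P_def)
    obtain L where L: "mset G = mset (GU @ (a, b, l) # L)" "set L \<subseteq> {x \<in> set G. \<not> P x}"
      unfolding GU_def by (rule split_incident[where P = P, OF g(1) nP])
    define U where "U = V - {v}"
    have V: "V = insert v U" "v \<notin> U" "finite U" using vx less.prems by (auto simp: U_def)
    have gU: "graph_on U GU" using less.prems(2) by (auto simp: graph_on_def GU_def P_def U_def)
    have gL: "graph_on V L" by (rule graph_on_mono[OF less.prems(2)]) (use L(2) in auto)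
    have lJ: "\<forall>i. l = Some i \<longrightarrow> i \<in> J" using g(1) less.prems(2) by (auto simp: graph_on_def)
    have "{(a, b). (a, b) \<in> ends G \<and> a \<noteq> v \<and> b \<noteq> v} = ends GU"
      by (force simp: GU_def ends_def P_def)
    then have cU: "conn U (ends GU)" using c by (simp add: U_def)
    \<comment> \<open>Among the edges at \<open>v\<close> only the one to \<open>x\<close> is kept;
      those in \<open>L\<close> are at most 1.\<close>
    have le: "wt n G \<phi> \<le> wt n GU \<phi> * edge_kernel n l (\<phi> x) (\<phi> v)" for \<phi>
    proof -
      have "wt n G \<phi> = wt n GU \<phi> * edge_kernel n l (\<phi> a) (\<phi> b) * wt n L \<phi>" using wt_mset[OF L(1)] by simp
      also have "\<dots> \<le> wt n GU \<phi> * edge_kernel n l (\<phi> a) (\<phi> b) * 1"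
        by (intro mult_left_mono wt_le1[OF gL] mult_nonneg_nonneg wt_nonneg edge_kernel_bounds)
      finally show ?thesis using g(2) edge_kernel_sym by auto
    qed
    have "(\<Sum>\<phi>\<in>Phi V n. \<delta> (\<phi> r) * wt n G \<phi>) = (\<Sum>\<phi>\<in>Phi U n. \<Sum>k<n. \<delta> (\<phi> r) * wt n G (\<phi>(v := k)))"
      unfolding V(1) using V vx by (simp add: sum_Phi_insert)
    also have "\<dots> \<le> (\<Sum>\<phi>\<in>Phi U n. \<Sum>k<n. \<delta> (\<phi> r) * (wt n GU \<phi> * edge_kernel n l (\<phi> x) k))"
    proof (intro sum_mono mult_left_mono less.prems)
      fix \<phi> k
      show "wt n G (\<phi>(v := k)) \<le> wt n GU \<phi> * edge_kernel n l (\<phi> x) k"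
        using le[of "\<phi>(v := k)"] wt_fun_upd[OF gU V(2)] vx by simp
    qed
    also have "\<dots> = (\<Sum>\<phi>\<in>Phi U n. (\<delta> (\<phi> r) * wt n GU \<phi>) * (\<Sum>k<n. edge_kernel n l (\<phi> x) k))"
      by (simp add: sum_distrib_left mult_ac)
    also have "\<dots> \<le> (\<Sum>\<phi>\<in>Phi U n. (\<delta> (\<phi> r) * wt n GU \<phi>) * 2)"
      by (intro sum_mono mult_left_mono edge_kernel_row lJ mult_nonneg_nonneg less.prems wt_nonneg)
        (use vx V in \<open>auto simp: PiE_def Pi_def\<close>)
    also have "\<dots> = 2 * (\<Sum>\<phi>\<in>Phi U n. \<delta> (\<phi> r) * wt n GU \<phi>)"
      by (simp add: sum_distrib_left mult_ac)
    also have "\<dots> \<le> 2 * (2 ^ card U * (\<Sum>j<n. \<delta> j))"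
      using less.hyps[of U GU] gU cU V vx less.prems by (intro mult_left_mono) auto
    also have "\<dots> = 2 ^ card V * (\<Sum>j<n. \<delta> j)" using V by simp
    finally show ?thesis .
  qed
qed

lemma sum_wt_le':
  assumes "finite V" "graph_on V G" "conn V (ends G)" "V \<noteq> {}"
  shows "(\<Sum>\<phi>\<in>Phi V n. wt n G \<phi>) \<le> 2 ^ card V * real n"
proof -
  obtain r where "r \<in> V" using assms by auto
  from sum_wt_le[OF assms(1-3) this, of "\<lambda>_. 1" n] show ?thesis by simp
qed


text \<open>The sum over all vertices but the root is close to \<open>t\<close> for most values of
  the root, with an error uniform over all weights bounded by \<open>D\<close>. The weight is
  arbitrary because at a bridge it is produced by the other side.\<close>

definition rooted_limit :: "'v set \<Rightarrow> ('v \<times> 'v \<times> 'i option) list \<Rightarrow> 'v \<Rightarrow> real \<Rightarrow> bool" where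
  "rooted_limit V G r t \<longleftrightarrow> (\<exists>\<eta>. \<eta> \<longlonglongrightarrow> 0 \<and>
     (\<forall>n D \<delta>. (\<forall>j<n. \<bar>\<delta> j\<bar> \<le> D) \<longrightarrow>
       \<bar>(\<Sum>\<phi>\<in>Phi V n. \<delta> (\<phi> r) * wt n G \<phi>) - t * (\<Sum>j<n. \<delta> j)\<bar> \<le> D * real n * \<eta> n))"

lemma rooted_limitI:
  assumes "\<eta> \<longlonglongrightarrow> 0" "\<And>n D \<delta>. (\<And>j. j < n \<Longrightarrow> \<bar>\<delta> j\<bar> \<le> D) \<Longrightarrow>
     \<bar>(\<Sum>\<phi>\<in>Phi V n. \<delta> (\<phi> r) * wt n G \<phi>) - t * (\<Sum>j<n. \<delta> j)\<bar> \<le> D * real n * \<eta> n"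
  shows "rooted_limit V G r t"
  unfolding rooted_limit_def using assms by blast

lemma wt_eq1: "(\<And>x y l. (x, y, l) \<in> set G \<Longrightarrow> l = None \<and> x = y) \<Longrightarrow> wt n G \<phi> = 1"
  by (induction G) (auto, fastforce)

lemma wt_le_eps:
  assumes "graph_on V G" "(x, y, Some i) \<in> set G"
  shows "wt n G \<phi> \<le> \<epsilon> n i"
  using assms
proof (induction G)
  case (Cons g G)
  obtain a b l where g: "g = (a, b, l)" by (cases g)
  show ?case
  proof (cases "g = (x, y, Some i)")
    case True
    have "edge_kernel n (Some i) (\<phi> x) (\<phi> y) * wt n G \<phi> \<le> \<epsilon> n i * 1"
      by (intro mult_mono wt_le1 wt_nonneg) (use Cons.prems True K_le eps_nonneg in auto)
    then show ?thesis using True by simp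
  next
    case False
    then have *: "wt n G \<phi> \<le> \<epsilon> n i" using Cons g by auto
    have "edge_kernel n l (\<phi> a) (\<phi> b) * wt n G \<phi> \<le> 1 * \<epsilon> n i"
      by (intro mult_mono edge_kernel_bounds wt_nonneg *) (use Cons.prems g in auto)
    then show ?thesis using g by simp
  qed
qed simp

lemma Phi_less: "\<phi> \<in> Phi V n \<Longrightarrow> x \<in> V \<Longrightarrow> \<phi> x < n"
  by (auto simp: PiE_def Pi_def)

definition row_deviation :: "nat \<Rightarrow> 'i \<Rightarrow> real" where
  "row_deviation n i = (\<Sum>j<n. \<bar>(\<Sum>k<n. K n i j k) - 1\<bar>) / real n"

lemma row_deviation_lim: "i \<in> J \<Longrightarrow> (\<lambda>n. row_deviation n i) \<longlonglongrightarrow> 0"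
  unfolding row_deviation_def by (rule row_avg)

lemma sum_row_deviation: "(\<Sum>j<n. \<bar>(\<Sum>k<n. K n i j k) - 1\<bar>) = real n * row_deviation n i"
  unfolding row_deviation_def by (cases "n = 0") auto

text \<open>Every edge is a loop at \<open>r\<close>. A loop with a kernel is at most
  \<open>\<epsilon> n i\<close>, so the limit is 0; without such a loop all weights are 1 and so is
  the limit.\<close>

lemma det_limit_single:
  assumes "graph_on {r} G"
  shows "\<exists>t. rooted_limit {r} G r t"
proof -
  have s: "(\<Sum>\<phi>\<in>Phi {r} n. \<delta> (\<phi> r) * wt n G \<phi>) = (\<Sum>j<n. \<delta> j * wt n G ((\<lambda>_. undefined)(r := j)))" for n \<delta>
    using sum_Phi_insert[of "{}" r "\<lambda>\<phi>. \<delta> (\<phi> r) * wt n G \<phi>" n] by (simp add: PiE_empty_domain fun_upd_def)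
  show ?thesis
  proof (cases "\<exists>x y i. (x, y, Some i) \<in> set G")
    case True
    then obtain x y i where i: "(x, y, Some i) \<in> set G" by blast
    then have iJ: "i \<in> J" using assms by (auto simp: graph_on_def)
    have "rooted_limit {r} G r 0"
    proof (rule rooted_limitI[OF eps_lim[OF iJ]])
      fix n D and \<delta> :: "nat \<Rightarrow> real" assume d: "\<And>j. j < n \<Longrightarrow> \<bar>\<delta> j\<bar> \<le> D"
      have "\<bar>\<Sum>j<n. \<delta> j * wt n G ((\<lambda>_. undefined)(r := j))\<bar> \<le> (\<Sum>j<n. D * \<epsilon> n i)"
        by (rule order_trans[OF sum_abs], rule sum_mono, unfold abs_mult, rule mult_mono)
          (use d wt_le_eps[OF assms i] wt_nonneg in \<open>auto simp: abs_of_nonneg[OF wt_nonneg] intro: order_trans[OF abs_ge_zero d]\<close>)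
      then show "\<bar>(\<Sum>\<phi>\<in>Phi {r} n. \<delta> (\<phi> r) * wt n G \<phi>) - 0 * (\<Sum>j<n. \<delta> j)\<bar> \<le> D * real n * \<epsilon> n i"
        unfolding s by (simp add: mult_ac)
    qed
    then show ?thesis ..
  next
    case False
    have "wt n G \<phi> = 1" for n \<phi>
    proof (rule wt_eq1)
      fix x y l assume "(x, y, l) \<in> set G"
      then show "l = None \<and> x = y" using False assms by (cases l) (auto simp: graph_on_def)
    qed
    then have "rooted_limit {r} G r 1"
      by (intro rooted_limitI[of "\<lambda>_. 0"]) (use s in simp_all)
    then show ?thesis ..
  qed
qed

text \<open>An equality edge forces the values at \<open>v\<close> and \<open>x\<close> to coincide,
  so the sum over the index at \<open>v\<close> has one term and \<open>v\<close> may be renamed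
  \<open>x\<close>. The root survives since \<open>r \<noteq> v\<close>.\<close>

lemma det_limit_contract:
  fixes V :: "'v set"
  assumes fin: "finite V" and G: "graph_on V G" and c: "conn V (ends G)"
    and g: "(a, b, None) \<in> set G" and v: "(a, b) = (x, v) \<or> (a, b) = (v, x)" "x \<noteq> v" and r: "r \<noteq> v"
  defines "\<rho> \<equiv> \<lambda>z. if z = v then x else z"
  defines "G' \<equiv> map (\<lambda>(y, z, l). (\<rho> y, \<rho> z, l)) G"
  shows "graph_on (V - {v}) G'" "conn (V - {v}) (ends G')"
    "rooted_limit (V - {v}) G' r t \<Longrightarrow> rooted_limit V G r t"
proof -
  have xV: "x \<in> V" "v \<in> V" using G g v by (auto simp: graph_on_def)
  show G': "graph_on (V - {v}) G'"
    unfolding graph_on_def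
  proof (clarify, intro conjI allI impI)
    fix y z l assume "(y, z, l) \<in> set G'"
    then obtain y' z' where 1: "(y', z', l) \<in> set G" "y = \<rho> y'" "z = \<rho> z'" by (auto simp: G'_def)
    then have "y' \<in> V" "z' \<in> V" "\<And>i. l = Some i \<Longrightarrow> i \<in> J" using G by (auto simp: graph_on_def)
    then show "y \<in> V - {v}" "z \<in> V - {v}" "\<And>i. l = Some i \<Longrightarrow> i \<in> J"
      using 1 xV v(2) by (auto simp: \<rho>_def)
  qed
  show "conn (V - {v}) (ends G')"
  proof (rule connI)
    fix P :: "'v \<Rightarrow> bool" and p q assume P: "\<And>a b. (a, b) \<in> ends G' \<Longrightarrow> P a = P b" and pq: "p \<in> V - {v}" "q \<in> V - {v}"
    have "(P \<circ> \<rho>) p = (P \<circ> \<rho>) q"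
    proof (rule connD[OF c, where P = "P \<circ> \<rho>"])
      fix a b assume "(a, b) \<in> ends G"
      then have "(\<rho> a, \<rho> b) \<in> ends G'" by (force simp: ends_def G'_def)
      then show "(P \<circ> \<rho>) a = (P \<circ> \<rho>) b" using P by simp
    qed (use pq in auto)
    then show "P p = P q" using pq by (auto simp: \<rho>_def)
  qed
  have w: "wt n G \<phi> = of_bool (\<phi> v = \<phi> x) * wt n G' \<phi>" for n and \<phi> :: "'v \<Rightarrow> nat"
  proof (cases "\<phi> v = \<phi> x")
    case True
    then have "\<phi> (\<rho> z) = \<phi> z" for z by (auto simp: \<rho>_def)
    then have "wt n G' \<phi> = wt n G \<phi>" unfolding G'_def wt_def by (induction G) auto
    then show ?thesis using True by simp
  next
    case False
    have "wt n G \<phi> = 0" using g v False unfolding wt_def prod_list_zero_iff by force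
    then show ?thesis using False by simp
  qed
  have V: "V = insert v (V - {v})" "v \<notin> V - {v}" "finite (V - {v})" using xV fin by auto
  have s: "(\<Sum>\<phi>\<in>Phi V n. \<delta> (\<phi> r) * wt n G \<phi>) = (\<Sum>\<phi>\<in>Phi (V - {v}) n. \<delta> (\<phi> r) * wt n G' \<phi>)" for n and \<delta> :: "nat \<Rightarrow> real"
  proof -
    have "(\<Sum>\<phi>\<in>Phi V n. \<delta> (\<phi> r) * wt n G \<phi>) = (\<Sum>\<phi>\<in>Phi (V - {v}) n. \<Sum>k<n. \<delta> (\<phi> r) * (of_bool (k = \<phi> x) * wt n G' \<phi>))"
      by (subst V(1), subst sum_Phi_insert[OF V(3,2)])
        (use r v(2) in \<open>auto simp: w wt_fun_upd[OF G' V(2)] intro!: sum.cong\<close>)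
    also have "\<dots> = (\<Sum>\<phi>\<in>Phi (V - {v}) n. \<delta> (\<phi> r) * wt n G' \<phi> * (\<Sum>k<n. of_bool (k = \<phi> x)))"
      unfolding sum_distrib_left by (simp only: mult_ac)
    also have "\<dots> = (\<Sum>\<phi>\<in>Phi (V - {v}) n. \<delta> (\<phi> r) * wt n G' \<phi> * 1)"
    proof (intro sum.cong refl arg_cong2[where f = "(*)"])
      fix \<phi> assume "\<phi> \<in> Phi (V - {v}) n"
      then have "\<phi> x < n" using xV v by (intro Phi_less[of \<phi> "V - {v}"]) auto
      then show "(\<Sum>k<n. of_bool (k = \<phi> x)) = (1 :: real)" by (simp add: of_bool_def)
    qed
    finally show ?thesis by simp
  qed
  show "rooted_limit (V - {v}) G' r t \<Longrightarrow> rooted_limit V G r t" unfolding rooted_limit_def s .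
qed

text \<open>Induction on the number of vertices. Equality edges between distinct vertices are
  contracted. Otherwise a removable vertex \<open>v\<close> hangs on a kernel edge to
  \<open>x\<close>: a second kernel edge at \<open>v\<close> forces the limit 0, and without one the
  sum over the index at \<open>v\<close> is a row sum, which is 1 on average.\<close>

lemma det_limit:
  fixes V :: "'v set"
  assumes "finite V" "graph_on V G" "conn V (ends G)" "r \<in> V"
  shows "\<exists>t. rooted_limit V G r t"
  using assms
proof (induction "card V" arbitrary: V G rule: less_induct)
  case less
  consider (single) "V = {r}" | (contract) a b where "V \<noteq> {r}" "(a, b, None) \<in> set G" "a \<noteq> b"
    | (leaf) "V \<noteq> {r}" "\<forall>a b. (a, b, None) \<in> set G \<longrightarrow> a = b" by blast
  then show ?case
  proof cases
    case single
    then show ?thesis using det_limit_single[of r G] less.prems by simp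
  next
    case (contract a b)
    \<comment> \<open>Of the two ends, \<open>v\<close> is chosen to differ from the root.\<close>
    obtain x v where v: "(a, b) = (x, v) \<or> (a, b) = (v, x)" "x \<noteq> v" "r \<noteq> v"
      using contract by (cases "b = r") auto
    have vV: "v \<in> V" using contract v less.prems by (auto simp: graph_on_def)
    note D = det_limit_contract[OF less.prems(1-3) contract(2) v]
    have "\<exists>t. rooted_limit (V - {v}) (map (\<lambda>(y, z, l). (if y = v then x else y, if z = v then x else z, l)) G) r t"
      by (rule less.hyps[OF card_Diff1_less[OF less.prems(1) vV]]) (use D(1,2) less.prems v vV in auto)
    then show ?thesis using D(3) by blast
  next
    case leaf
    obtain v x where vx: "v \<in> V" "v \<noteq> r" "x \<in> V" "x \<noteq> v" "(x, v) \<in> ends G \<or> (v, x) \<in> ends G"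
      and c: "conn (V - {v}) {(a, b). (a, b) \<in> ends G \<and> a \<noteq> v \<and> b \<noteq> v}"
      by (rule conn_removable_vertex[OF less.prems(1) less.prems(3) graph_on_ends[OF less.prems(2)] less.prems(4) leaf(1)])
    define P where "P = (\<lambda>(a, b, l :: 'i option). a \<noteq> v \<and> b \<noteq> v)"
    define GU where "GU = filter P G"
    obtain a b l where g: "(a, b, l) \<in> set G" "(a, b) = (x, v) \<or> (a, b) = (v, x)"
      using vx(5) by (auto simp: ends_def)
    have nP: "\<not> P (a, b, l)" using g(2) by (auto simp: P_def)
    obtain L where L: "mset G = mset (GU @ (a, b, l) # L)" "set L \<subseteq> {x \<in> set G. \<not> P x}"
      unfolding GU_def by (rule split_incident[where P = P, OF g(1) nP])
    obtain i where i: "l = Some i" "i \<in> J"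
      using g leaf(2) vx(4) less.prems(2) by (cases l) (auto simp: graph_on_def)
    define U where "U = V - {v}"
    have V: "V = insert v U" "v \<notin> U" "finite U" "x \<in> U" "r \<in> U" using vx less.prems by (auto simp: U_def)
    have gU: "graph_on U GU" using less.prems(2) by (auto simp: graph_on_def GU_def P_def U_def)
    have gL: "graph_on V L" by (rule graph_on_mono[OF less.prems(2)]) (use L(2) in auto)
    have "{(a, b). (a, b) \<in> ends G \<and> a \<noteq> v \<and> b \<noteq> v} = ends GU"
      by (force simp: GU_def ends_def P_def)
    then have cU: "conn U (ends GU)" using c by (simp add: U_def)
    have eq: "wt n G \<phi> = wt n GU \<phi> * (K n i (\<phi> x) (\<phi> v) * wt n L \<phi>)" for n \<phi>
      using wt_mset[OF L(1), of n \<phi>] g(2) i K_sym by auto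
    have S: "(\<Sum>\<phi>\<in>Phi V n. \<delta> (\<phi> r) * wt n G \<phi>) =
        (\<Sum>\<phi>\<in>Phi U n. \<Sum>k<n. \<delta> (\<phi> r) * (wt n GU \<phi> * (K n i (\<phi> x) k * wt n L (\<phi>(v := k)))))" for n and \<delta> :: "nat \<Rightarrow> real"
      unfolding V(1) using V(2,3) vx by (simp add: sum_Phi_insert eq wt_fun_upd[OF gU V(2)])
    have b: "(\<Sum>\<phi>\<in>Phi U n. wt n GU \<phi>) \<le> 2 ^ card U * real n" for n
      by (rule sum_wt_le'[OF V(3) gU cU]) (use V in auto)
    have cV: "card V = Suc (card U)" using V by simp
    show ?thesis
    proof (cases "\<exists>y z i. (y, z, Some i) \<in> set L")
      case True
      then obtain y z i' where i': "(y, z, Some i') \<in> set L" by blast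
      then have iJ: "i' \<in> J" using gL by (auto simp: graph_on_def)
      \<comment> \<open>The second kernel edge supplies the factor \<open>\<epsilon> n i'\<close>,
        while the first still bounds the sum over the index at \<open>v\<close> by a row
        sum.\<close>
      have "rooted_limit V G r 0"
      proof (rule rooted_limitI[of "\<lambda>n. 2 ^ card V * \<epsilon> n i'"])
        show "(\<lambda>n. 2 ^ card V * \<epsilon> n i') \<longlonglongrightarrow> 0" using eps_lim[OF iJ] by (rule tendsto_mult_right_zero)
        fix n D and \<delta> :: "nat \<Rightarrow> real" assume d: "\<And>j. j < n \<Longrightarrow> \<bar>\<delta> j\<bar> \<le> D"
        show "\<bar>(\<Sum>\<phi>\<in>Phi V n. \<delta> (\<phi> r) * wt n G \<phi>) - 0 * (\<Sum>j<n. \<delta> j)\<bar> \<le> D * real n * (2 ^ card V * \<epsilon> n i')"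
        proof (cases "n = 0")
          case True
          then show ?thesis using vx by (auto simp: PiE_eq_empty_iff)
        next
          case False
          have D0: "0 \<le> D" using d[of 0] False by linarith
          have "\<bar>(\<Sum>\<phi>\<in>Phi V n. \<delta> (\<phi> r) * wt n G \<phi>)\<bar> \<le>
            (\<Sum>\<phi>\<in>Phi U n. \<Sum>k<n. D * (wt n GU \<phi> * (K n i (\<phi> x) k * \<epsilon> n i')))"
            unfolding S
          proof (rule order_trans[OF sum_abs], rule sum_mono, rule order_trans[OF sum_abs], rule sum_mono)
            fix \<phi> k assume "\<phi> \<in> Phi U n"
            then have 1: "\<bar>\<delta> (\<phi> r)\<bar> \<le> D" using V by (intro d Phi_less[of \<phi> U]) auto
            have 2: "wt n GU \<phi> * (K n i (\<phi> x) k * wt n L (\<phi>(v := k))) \<le> wt n GU \<phi> * (K n i (\<phi> x) k * \<epsilon> n i')"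
              by (intro mult_left_mono wt_le_eps[OF gL i'] K_nonneg wt_nonneg)
            have 3: "0 \<le> wt n GU \<phi> * (K n i (\<phi> x) k * wt n L (\<phi>(v := k)))"
              by (intro mult_nonneg_nonneg wt_nonneg K_nonneg)
            show "\<bar>\<delta> (\<phi> r) * (wt n GU \<phi> * (K n i (\<phi> x) k * wt n L (\<phi>(v := k))))\<bar> \<le>
              D * (wt n GU \<phi> * (K n i (\<phi> x) k * \<epsilon> n i'))"
              unfolding abs_mult[of "\<delta> (\<phi> r)"] abs_of_nonneg[OF 3] by (rule mult_mono[OF 1 2 D0 3])
          qed
          also have "\<dots> = (\<Sum>\<phi>\<in>Phi U n. (D * \<epsilon> n i') * (wt n GU \<phi> * (\<Sum>k<n. K n i (\<phi> x) k)))"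
            by (simp add: sum_distrib_left mult_ac)
          also have "\<dots> \<le> (\<Sum>\<phi>\<in>Phi U n. (D * \<epsilon> n i') * (wt n GU \<phi> * 2))"
            by (intro sum_mono mult_left_mono row_le i wt_nonneg mult_nonneg_nonneg D0 eps_nonneg iJ Phi_less[of _ U]) (use V in auto)
          also have "\<dots> = (D * \<epsilon> n i' * 2) * (\<Sum>\<phi>\<in>Phi U n. wt n GU \<phi>)"
            by (simp add: sum_distrib_left mult_ac)
          also have "\<dots> \<le> (D * \<epsilon> n i' * 2) * (2 ^ card U * real n)"
            by (intro mult_left_mono b mult_nonneg_nonneg D0 eps_nonneg iJ) auto
          finally show ?thesis by (simp add: cV mult_ac)
        qed
      qed
      then show ?thesis ..
    next
      case False
      \<comment> \<open>No edge of \<open>L\<close> carries a kernel, and all equality edges are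
        loops in this case.\<close>
      have L1: "wt n L \<phi> = 1" for n \<phi>
      proof (rule wt_eq1)
        fix y z l assume "(y, z, l) \<in> set L"
        then show "l = None \<and> y = z" using False leaf(2) L(2) by (cases l) auto
      qed
      obtain t \<eta> where t: "\<eta> \<longlonglongrightarrow> 0" "\<And>n D \<delta>. (\<And>j. j < n \<Longrightarrow> \<bar>\<delta> j\<bar> \<le> D) \<Longrightarrow>
         \<bar>(\<Sum>\<phi>\<in>Phi U n. \<delta> (\<phi> r) * wt n GU \<phi>) - t * (\<Sum>j<n. \<delta> j)\<bar> \<le> D * real n * \<eta> n"
        using less.hyps[of U GU] gU cU V unfolding rooted_limit_def by (auto simp: cV)
      have "rooted_limit V G r t"
      proof (rule rooted_limitI[of "\<lambda>n. \<eta> n + 2 ^ card U * row_deviation n i"])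
        show "(\<lambda>n. \<eta> n + 2 ^ card U * row_deviation n i) \<longlonglongrightarrow> 0"
          using tendsto_add[OF t(1) tendsto_mult_right_zero[OF row_deviation_lim[OF i(2)]]] by simp
        fix n D and \<delta> :: "nat \<Rightarrow> real" assume d: "\<And>j. j < n \<Longrightarrow> \<bar>\<delta> j\<bar> \<le> D"
        show "\<bar>(\<Sum>\<phi>\<in>Phi V n. \<delta> (\<phi> r) * wt n G \<phi>) - t * (\<Sum>j<n. \<delta> j)\<bar> \<le> D * real n * (\<eta> n + 2 ^ card U * row_deviation n i)"
        proof (cases "n = 0")
          case True
          then show ?thesis using vx by (auto simp: PiE_eq_empty_iff)
        next
          case False
          have D0: "0 \<le> D" using d[of 0] False by linarith
          have "(\<Sum>\<phi>\<in>Phi V n. \<delta> (\<phi> r) * wt n G \<phi>) - (\<Sum>\<phi>\<in>Phi U n. \<delta> (\<phi> r) * wt n GU \<phi>) =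
            (\<Sum>\<phi>\<in>Phi U n. \<delta> (\<phi> r) * wt n GU \<phi> * ((\<Sum>k<n. K n i (\<phi> x) k) - 1))"
            unfolding S L1 by (simp add: sum_distrib_left sum_subtractf algebra_simps)
          also have "\<bar>\<dots>\<bar> \<le> (\<Sum>\<phi>\<in>Phi U n. D * (\<bar>(\<Sum>k<n. K n i (\<phi> x) k) - 1\<bar> * wt n GU \<phi>))"
          proof (rule order_trans[OF sum_abs], rule sum_mono)
            fix \<phi> assume "\<phi> \<in> Phi U n"
            then have "\<bar>\<delta> (\<phi> r)\<bar> \<le> D" using V by (intro d Phi_less[of \<phi> U]) auto
            then have "\<bar>\<delta> (\<phi> r)\<bar> * (\<bar>(\<Sum>k<n. K n i (\<phi> x) k) - 1\<bar> * wt n GU \<phi>) \<le> D * (\<bar>(\<Sum>k<n. K n i (\<phi> x) k) - 1\<bar> * wt n GU \<phi>)"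
              by (intro mult_right_mono mult_nonneg_nonneg wt_nonneg) auto
            then show "\<bar>\<delta> (\<phi> r) * wt n GU \<phi> * ((\<Sum>k<n. K n i (\<phi> x) k) - 1)\<bar> \<le> D * (\<bar>(\<Sum>k<n. K n i (\<phi> x) k) - 1\<bar> * wt n GU \<phi>)"
              by (simp add: abs_mult wt_nonneg mult_ac)
          qed
          also have "\<dots> = D * (\<Sum>\<phi>\<in>Phi U n. \<bar>(\<Sum>k<n. K n i (\<phi> x) k) - 1\<bar> * wt n GU \<phi>)"
            by (simp add: sum_distrib_left)
          \<comment> \<open>The tree bound is rooted at \<open>x\<close> instead of
            \<open>r\<close>, with the deviation of the row as weight: single rows may be far from
            1, but the total deviation is o(n).\<close>
          also have "\<dots> \<le> D * (2 ^ card U * (\<Sum>j<n. \<bar>(\<Sum>k<n. K n i j k) - 1\<bar>))"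
            by (intro mult_left_mono D0 sum_wt_le[OF V(3) gU cU V(4), of "\<lambda>j. \<bar>(\<Sum>k<n. K n i j k) - 1\<bar>"]) auto
          finally have "\<bar>(\<Sum>\<phi>\<in>Phi V n. \<delta> (\<phi> r) * wt n G \<phi>) - (\<Sum>\<phi>\<in>Phi U n. \<delta> (\<phi> r) * wt n GU \<phi>)\<bar>
            \<le> D * real n * (2 ^ card U * row_deviation n i)" unfolding sum_row_deviation by (simp add: mult_ac)
          with t(2)[of n \<delta> D, OF d] show ?thesis by (simp add: distrib_left)
        qed
      qed
      then show ?thesis ..
    qed
  qed
qed

lemma rooted_limit_tendsto:
  assumes "rooted_limit V G r t"
  shows "(\<lambda>n. (\<Sum>\<phi>\<in>Phi V n. wt n G \<phi>) / real n) \<longlonglongrightarrow> t"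
proof -
  obtain \<eta> where t: "\<eta> \<longlonglongrightarrow> 0" "\<And>n D \<delta>. (\<And>j. j < n \<Longrightarrow> \<bar>\<delta> j\<bar> \<le> D) \<Longrightarrow>
         \<bar>(\<Sum>\<phi>\<in>Phi V n. \<delta> (\<phi> r) * wt n G \<phi>) - t * (\<Sum>j<n. \<delta> j)\<bar> \<le> D * real n * \<eta> n"
    using assms unfolding rooted_limit_def by blast
  have "\<bar>(\<Sum>\<phi>\<in>Phi V n. wt n G \<phi>) / real n - t\<bar> \<le> \<eta> n" if "n > 0" for n
    using t(2)[of n "\<lambda>_. 1" 1] that by (simp add: field_simps abs_le_iff)
  then have "(\<lambda>n. (\<Sum>\<phi>\<in>Phi V n. wt n G \<phi>) / real n - t) \<longlonglongrightarrow> 0"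
    by (intro Lim_null_comparison[OF _ t(1)] eventually_mono[OF eventually_gt_at_top[of 0]]) auto
  then show ?thesis by (rule LIM_zero_cancel)
qed

text \<open>Summing over \<open>A\<close> first turns the bridge into a bounded weight at
  \<open>v\<close>; the limit for \<open>B\<close> replaces the remaining sum by \<open>tB\<close>
  times the total of that weight. The total is a sum over \<open>A\<close> weighted by row sums at
  \<open>u\<close>, hence close to \<open>tA\<close> times the sum of all row sums, which is close
  to \<open>n\<close>.\<close>

lemma det_factor:
  fixes A B :: "'v set"
  assumes fin: "finite A" "finite B" "A \<inter> B = {}" and g: "graph_on A GA" "graph_on B GB"
    and cA: "conn A (ends GA)" and uv: "u \<in> A" "v \<in> B" and i: "i \<in> J"
    and lA: "rooted_limit A GA u tA" and lB: "rooted_limit B GB v tB"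
  shows "(\<lambda>n. (\<Sum>\<phi>\<in>Phi (A \<union> B) n. wt n (GA @ GB @ [(u, v, Some i)]) \<phi>) / real n) \<longlonglongrightarrow> tA * tB"
proof -
  obtain a where a: "a \<longlonglongrightarrow> 0" "\<And>n D \<delta>. (\<And>j. j < n \<Longrightarrow> \<bar>\<delta> j\<bar> \<le> D) \<Longrightarrow>
         \<bar>(\<Sum>\<phi>\<in>Phi A n. \<delta> (\<phi> u) * wt n GA \<phi>) - tA * (\<Sum>j<n. \<delta> j)\<bar> \<le> D * real n * a n"
    using lA unfolding rooted_limit_def by blast
  obtain b where b: "b \<longlonglongrightarrow> 0" "\<And>n D \<delta>. (\<And>j. j < n \<Longrightarrow> \<bar>\<delta> j\<bar> \<le> D) \<Longrightarrow>
         \<bar>(\<Sum>\<phi>\<in>Phi B n. \<delta> (\<phi> v) * wt n GB \<phi>) - tB * (\<Sum>j<n. \<delta> j)\<bar> \<le> D * real n * b n"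
    using lB unfolding rooted_limit_def by blast
  \<comment> \<open>The tree bound \<open>2 ^ card A\<close> times the bound 2 for a column sum of
    \<open>K\<close>.\<close>
  define D where "D = 2 ^ card A * (2 :: real)"
  define \<eta> where "\<eta> n = D * b n + \<bar>tB\<bar> * (2 * a n) + \<bar>tA * tB\<bar> * row_deviation n i" for n
  have \<eta>: "\<eta> \<longlonglongrightarrow> 0" unfolding \<eta>_def
    by (intro tendsto_add_zero tendsto_mult_right_zero a b row_deviation_lim i)
  have "\<bar>(\<Sum>\<phi>\<in>Phi (A \<union> B) n. wt n (GA @ GB @ [(u, v, Some i)]) \<phi>) / real n - tA * tB\<bar> \<le> \<eta> n" if n: "n > 0" for n
  proof -
    define \<delta> where "\<delta> k = (\<Sum>\<phi>\<in>Phi A n. K n i (\<phi> u) k * wt n GA \<phi>)" for k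
    define \<rho> where "\<rho> j = (\<Sum>k<n. K n i j k)" for j
    define S where "S = (\<Sum>\<phi>\<in>Phi (A \<union> B) n. wt n (GA @ GB @ [(u, v, Some i)]) \<phi>)"
    have oA: "wt n GA (override_on \<psi> \<phi> A) = wt n GA \<phi>" for \<phi> \<psi> by (rule wt_cong[OF g(1)]) (auto simp: override_on_def)
    have oB: "wt n GB (override_on \<psi> \<phi> A) = wt n GB \<psi>" for \<phi> \<psi> by (rule wt_cong[OF g(2)]) (use fin in \<open>auto simp: override_on_def\<close>)
    have ouv: "override_on \<psi> \<phi> A u = \<phi> u" "override_on \<psi> \<phi> A v = \<psi> v" for \<phi> \<psi> :: "'v \<Rightarrow> nat"
      using uv fin by (auto simp: override_on_def)
    have "S = (\<Sum>\<phi>\<in>Phi A n. \<Sum>\<psi>\<in>Phi B n. wt n GB \<psi> * (K n i (\<phi> u) (\<psi> v) * wt n GA \<phi>))"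
      unfolding S_def using fin by (simp add: sum_Phi_Un oA oB ouv mult_ac)
    also have "\<dots> = (\<Sum>\<psi>\<in>Phi B n. \<delta> (\<psi> v) * wt n GB \<psi>)"
      unfolding \<delta>_def by (subst sum.swap) (simp add: sum_distrib_left mult_ac)
    finally have S1: "S = (\<Sum>\<psi>\<in>Phi B n. \<delta> (\<psi> v) * wt n GB \<psi>)" .
    have "\<bar>\<delta> k\<bar> \<le> D" if "k < n" for k
    proof -
      have "\<delta> k \<le> 2 ^ card A * (\<Sum>j<n. K n i j k)" unfolding \<delta>_def
        by (rule sum_wt_le[OF fin(1) g(1) cA uv(1)]) (rule K_nonneg)
      also have "\<dots> \<le> 2 ^ card A * 2" using row_le[OF i that] by (subst K_sym) (intro mult_left_mono, auto)
      finally have "\<delta> k \<le> D" by (simp add: D_def)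
      moreover have "0 \<le> \<delta> k" unfolding \<delta>_def by (intro sum_nonneg mult_nonneg_nonneg K_nonneg wt_nonneg)
      ultimately show ?thesis by simp
    qed
    then have 1: "\<bar>S - tB * (\<Sum>k<n. \<delta> k)\<bar> \<le> D * real n * b n" unfolding S1 by (rule b(2))
    have "(\<Sum>k<n. \<delta> k) = (\<Sum>\<phi>\<in>Phi A n. \<rho> (\<phi> u) * wt n GA \<phi>)"
      unfolding \<delta>_def \<rho>_def by (subst sum.swap) (simp add: sum_distrib_right)
    then have 2: "\<bar>(\<Sum>k<n. \<delta> k) - tA * (\<Sum>j<n. \<rho> j)\<bar> \<le> 2 * real n * a n"
      using a(2)[of n \<rho> 2] row_le[OF i] by (auto simp: \<rho>_def sum_nonneg K_nonneg)
    have "\<bar>(\<Sum>j<n. \<rho> j) - real n\<bar> = \<bar>\<Sum>j<n. \<rho> j - 1\<bar>" by (simp add: sum_subtractf)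
    also have "\<dots> \<le> real n * row_deviation n i" unfolding sum_row_deviation[symmetric] \<rho>_def by (rule sum_abs)
    finally have 3: "\<bar>(\<Sum>j<n. \<rho> j) - real n\<bar> \<le> real n * row_deviation n i" .
    have "S - tA * tB * n = (S - tB * (\<Sum>k<n. \<delta> k)) + tB * ((\<Sum>k<n. \<delta> k) - tA * (\<Sum>j<n. \<rho> j)) + (tA * tB) * ((\<Sum>j<n. \<rho> j) - real n)"
      by (simp add: algebra_simps)
    also have "\<bar>\<dots>\<bar> \<le> D * real n * b n + \<bar>tB\<bar> * (2 * real n * a n) + \<bar>tA * tB\<bar> * (real n * row_deviation n i)"
      by (intro order_trans[OF abs_triangle_ineq] add_mono 1) (auto simp only: abs_mult intro!: mult_left_mono 2 3 mult_nonneg_nonneg abs_ge_zero)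
    also have "\<dots> = real n * \<eta> n" by (simp add: \<eta>_def algebra_simps)
    finally have "\<bar>S - tA * tB * n\<bar> \<le> real n * \<eta> n" .
    moreover have "S / real n - tA * tB = (S - tA * tB * n) / real n" using n by (simp add: field_simps)
    ultimately show ?thesis unfolding S_def[symmetric] using n by (simp add: abs_divide field_simps)
  qed
  then have "(\<lambda>n. (\<Sum>\<phi>\<in>Phi (A \<union> B) n. wt n (GA @ GB @ [(u, v, Some i)]) \<phi>) / real n - tA * tB) \<longlonglongrightarrow> 0"
    by (intro Lim_null_comparison[OF _ \<eta>] eventually_mono[OF eventually_gt_at_top[of 0]]) auto
  then show ?thesis by (rule LIM_zero_cancel)
qed

end

section \<open>Moments of entries along the edges of a graph\<close>

text \<open>Entries at mirror positions are conjugates of one variable, so independence and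
  coincidence depend only on the unordered pair of indices.\<close>

definition key :: "'i \<times> nat \<times> nat \<Rightarrow> 'i \<times> nat \<times> nat" where
  "key = (\<lambda>(i, j, k). (i, min j k, max j k))"

definition del :: "nat \<Rightarrow> 'a list \<Rightarrow> 'a list" where
  "del p xs = take p xs @ drop (Suc p) xs"

definition edge_index :: "('v \<Rightarrow> nat) \<Rightarrow> 'v \<times> 'v \<times> 'i \<Rightarrow> 'i \<times> nat \<times> nat" where
  "edge_index \<phi> = (\<lambda>(x, y, i). (i, \<phi> x, \<phi> y))"

definition kernel_edges :: "('v \<times> 'v \<times> 'i) list \<Rightarrow> ('v \<times> 'v \<times> 'i option) list" where
  "kernel_edges E = map (\<lambda>(x, y, i). (x, y, Some i)) E"

definition loop :: "('v \<Rightarrow> nat) \<Rightarrow> 'v \<times> 'v \<times> 'i \<Rightarrow> bool" where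
  "loop \<phi> = (\<lambda>(x, y, i). \<phi> x = \<phi> y)"

text \<open>Diagonal entries may have a nonzero mean, so an edge mapped to the diagonal can
  contribute without a partner and is exempt. Every other edge has to share its variable with an
  edge of \<open>R\<close>.\<close>

definition covers :: "('v \<Rightarrow> nat) \<Rightarrow> ('v \<times> 'v \<times> 'i) list \<Rightarrow> ('v \<times> 'v \<times> 'i) list \<Rightarrow> bool" where
  "covers \<phi> R E \<longleftrightarrow> (\<forall>e\<in>set E. loop \<phi> e \<or> (\<exists>r\<in>set R. key (edge_index \<phi> r) = key (edge_index \<phi> e)))"

text \<open>Lists rather than sets, because \<open>wt\<close> multiplies along lists; the bound on
  the length makes them finitely many.\<close>

definition edge_selections :: "'a list \<Rightarrow> 'a list set" where
  "edge_selections E = {R. set R \<subseteq> set E \<and> length R \<le> length E}"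

lemma finite_edge_selections: "finite (edge_selections E)"
  unfolding edge_selections_def by (rule finite_lists_length_le) simp

lemma set_del: "set (del p xs) \<subseteq> set xs"
  unfolding del_def by (auto dest: in_set_takeD in_set_dropD)

lemma length_del: "p < length xs \<Longrightarrow> length (del p xs) = length xs - 1"
  unfolding del_def by simp

lemma split_del: "p < length xs \<Longrightarrow> set xs = insert (xs ! p) (set (del p xs))"
  by (subst id_take_nth_drop[of p xs]) (auto simp: del_def)

lemma filter_del: "p < length xs \<Longrightarrow> length (filter P xs) \<le> Suc (length (filter P (del p xs)))"
  by (subst id_take_nth_drop[of p xs]) (auto simp: del_def)

lemma kernel_edges_simps [simp]: "kernel_edges [] = []" "kernel_edges ((x, y, i) # E) = (x, y, Some i) # kernel_edges E" "kernel_edges (E @ F) = kernel_edges E @ kernel_edges F"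
  by (auto simp: kernel_edges_def)

lemma set_kernel_edges: "set (kernel_edges E) = (\<lambda>(x, y, i). (x, y, Some i)) ` set E"
  by (simp add: kernel_edges_def)

lemma kernel_edges_mono: "set E \<subseteq> set F \<Longrightarrow> set (kernel_edges E) \<subseteq> set (kernel_edges F)"
  unfolding set_kernel_edges by (rule image_mono)

lemma ends_kernel_edges [simp]: "ends (kernel_edges E) = ends E"
  unfolding ends_def set_kernel_edges by force

lemma key_eq_iff: "key (i, j, k) = key (i', j', k') \<longleftrightarrow> i = i' \<and> (j = j' \<and> k = k' \<or> j = k' \<and> k = j')"
  by (auto simp: key_def min_def max_def)

lemma key_loop: "key (edge_index \<phi> e) = key (edge_index \<phi> e') \<Longrightarrow> loop \<phi> e = loop \<phi> e'"
  by (cases e; cases e') (auto simp: edge_index_def loop_def key_eq_iff)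

text \<open>What the graph calculus uses of the entries: factorisation over distinct keys, a bound
  for a single key in which \<open>sqrt (K n i j k)\<close> is the size of an entry and
  \<open>C\<close> an absolute moment, and the first and second moments off the diagonal. The last
  two are E|X|^2 = 1 and E X^2 = \<beta>, scaled by \<open>K\<close>.\<close>

locale wigner_moments = kernel_family J K \<epsilon>
  for J :: "'i set" and K :: "nat \<Rightarrow> 'i \<Rightarrow> nat \<Rightarrow> nat \<Rightarrow> real" and \<epsilon> :: "nat \<Rightarrow> 'i \<Rightarrow> real" +
  fixes entry_moment :: "nat \<Rightarrow> ('i \<times> nat \<times> nat) list \<Rightarrow> complex" and \<beta> :: "'i \<Rightarrow> real" and C :: "'i \<Rightarrow> nat \<Rightarrow> real"
  assumes entry_moment_Nil: "entry_moment n [] = 1"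
    and entry_moment_split: "\<lbrakk>set (e # es) \<subseteq> J \<times> {..<n} \<times> {..<n}\<rbrakk> \<Longrightarrow>
      entry_moment n (e # es) = entry_moment n (e # filter (\<lambda>e'. key e' = key e) es) * entry_moment n (filter (\<lambda>e'. key e' \<noteq> key e) es)"
    and entry_moment_bound: "\<lbrakk>i \<in> J; j < n; k < n; \<forall>e\<in>set es. key e = key (i, j, k)\<rbrakk> \<Longrightarrow>
      norm (entry_moment n es) \<le> C i (length es) * sqrt (K n i j k) ^ length es"
    and entry_moment_single: "\<lbrakk>i \<in> J; j < n; k < n; j \<noteq> k\<rbrakk> \<Longrightarrow> entry_moment n [(i, j, k)] = 0"
    and entry_moment_opp: "\<lbrakk>i \<in> J; j < n; k < n; j \<noteq> k\<rbrakk> \<Longrightarrow> entry_moment n [(i, j, k), (i, k, j)] = of_real (K n i j k)"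
    and entry_moment_same: "\<lbrakk>i \<in> J; j < n; k < n; j \<noteq> k\<rbrakk> \<Longrightarrow> entry_moment n [(i, j, k), (i, j, k)] = of_real (\<beta> i * K n i j k)"
begin

section \<open>Domination of moments by kernel weights\<close>

definition edge_moment :: "nat \<Rightarrow> ('v \<times> 'v \<times> 'i) list \<Rightarrow> ('v \<Rightarrow> nat) \<Rightarrow> complex" where
  "edge_moment n E \<phi> = entry_moment n (map (edge_index \<phi>) E)"

text \<open>A moment is bounded by a single weight, but the covering list that realises the bound
  depends on \<open>\<phi>\<close>. The sum over all covering lists is one function that can be
  summed over \<open>\<phi>\<close>.\<close>

definition majorant :: "nat \<Rightarrow> ('v \<times> 'v \<times> 'i) list \<Rightarrow> ('v \<Rightarrow> nat) \<Rightarrow> real" where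
  "majorant n E \<phi> = (\<Sum>R\<in>edge_selections E. of_bool (covers \<phi> R E) * wt n (kernel_edges R) \<phi>)"

lemma wt_le_majorant: "R \<in> edge_selections E \<Longrightarrow> covers \<phi> R E \<Longrightarrow> wt n (kernel_edges R) \<phi> \<le> majorant n E \<phi>"
  unfolding majorant_def
  using member_le_sum[of R "edge_selections E" "\<lambda>R. of_bool (covers \<phi> R E) * wt n (kernel_edges R) \<phi>"]
  by (auto simp: finite_edge_selections wt_nonneg)

lemma majorant_nonneg: "0 \<le> majorant n E \<phi>"
  unfolding majorant_def by (intro sum_nonneg mult_nonneg_nonneg wt_nonneg) auto

lemma sqrtK_le: "i \<in> J \<Longrightarrow> sqrt (K n i j k) \<le> sqrt (\<epsilon> n i)" "i \<in> J \<Longrightarrow> sqrt (\<epsilon> n i) \<le> 1"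
    "0 \<le> sqrt (K n i j k)" "i \<in> J \<Longrightarrow> sqrt (K n i j k) \<le> 1"
  using K_le eps_le K_le1 K_nonneg by auto

definition admissible :: "nat \<Rightarrow> 'i set \<Rightarrow> ('v \<Rightarrow> nat) \<Rightarrow> ('v \<times> 'v \<times> 'i) list \<Rightarrow> bool" where
  "admissible n L \<phi> E \<longleftrightarrow> (\<forall>(x, y, i)\<in>set E. i \<in> L \<and> \<phi> x < n \<and> \<phi> y < n)"

lemma admissible_simps [simp]: "admissible n L \<phi> []" "admissible n L \<phi> ((x, y, i) # E) \<longleftrightarrow> i \<in> L \<and> \<phi> x < n \<and> \<phi> y < n \<and> admissible n L \<phi> E"
  by (auto simp: admissible_def)

lemma admissible_mono: "admissible n L \<phi> E \<Longrightarrow> set F \<subseteq> set E \<Longrightarrow> admissible n L \<phi> F"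
  by (auto simp: admissible_def)

text \<open>Independence splits off the edges that \<open>\<phi>\<close> maps to the variable of the
  first edge; that factor involves one variable only and is controlled by an absolute
  moment.\<close>

lemma edge_moment_group:
  assumes "admissible n L \<phi> ((x, y, i) # E)" "L \<subseteq> J"
  defines "P \<equiv> \<lambda>e. key (edge_index \<phi> e) = key (edge_index \<phi> (x, y, i))"
  shows "edge_moment n ((x, y, i) # E) \<phi> = edge_moment n ((x, y, i) # filter P E) \<phi> * edge_moment n (filter (\<lambda>e. \<not> P e) E) \<phi>"
    and "norm (edge_moment n ((x, y, i) # filter P E) \<phi>) \<le>
      C i (Suc (length (filter P E))) * sqrt (K n i (\<phi> x) (\<phi> y)) ^ Suc (length (filter P E))"
proof -
  have 1: "set (map (edge_index \<phi>) ((x, y, i) # E)) \<subseteq> J \<times> {..<n} \<times> {..<n}"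
    using assms(1,2) unfolding admissible_def edge_index_def by auto
  show "edge_moment n ((x, y, i) # E) \<phi> = edge_moment n ((x, y, i) # filter P E) \<phi> * edge_moment n (filter (\<lambda>e. \<not> P e) E) \<phi>"
    using entry_moment_split[of "edge_index \<phi> (x, y, i)" "map (edge_index \<phi>) E" n] 1
    unfolding edge_moment_def by (simp add: filter_map comp_def P_def)
  have "norm (entry_moment n (map (edge_index \<phi>) ((x, y, i) # filter P E))) \<le>
      C i (length (map (edge_index \<phi>) ((x, y, i) # filter P E))) * sqrt (K n i (\<phi> x) (\<phi> y)) ^ length (map (edge_index \<phi>) ((x, y, i) # filter P E))"
    by (rule entry_moment_bound) (use assms in \<open>auto simp: P_def edge_index_def\<close>)
  then show "norm (edge_moment n ((x, y, i) # filter P E) \<phi>) \<le>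
      C i (Suc (length (filter P E))) * sqrt (K n i (\<phi> x) (\<phi> y)) ^ Suc (length (filter P E))"
    unfolding edge_moment_def by simp
qed

text \<open>The mixed second moment of two entries off the diagonal: \<open>K\<close> for opposite
  and \<open>\<beta> K\<close> for equal orientation. On the diagonal the formula is not the true
  second moment; the difference goes into the error of \<open>step_pointwise\<close>.\<close>

definition match_weight :: "nat \<Rightarrow> 'v \<times> 'v \<times> 'i \<Rightarrow> 'v \<times> 'v \<times> 'i \<Rightarrow> ('v \<Rightarrow> nat) \<Rightarrow> real" where
  "match_weight n = (\<lambda>(x, y, i) (x', y', i') \<phi>. if i' = i then
     (of_bool (\<phi> x = \<phi> y' \<and> \<phi> y = \<phi> x') + \<beta> i * of_bool (\<phi> x = \<phi> x' \<and> \<phi> y = \<phi> y')) * K n i (\<phi> x) (\<phi> y) else 0)"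

lemma match_weight_eq_0:
  assumes "key (edge_index \<phi> e') \<noteq> key (edge_index \<phi> e)"
  shows "match_weight n e e' \<phi> = 0"
proof -
  obtain x y i x' y' i' where e: "e = (x, y, i)" "e' = (x', y', i')" by (cases e; cases e')
  have *: "\<not> (i' = i \<and> (\<phi> x' = \<phi> x \<and> \<phi> y' = \<phi> y \<or> \<phi> x' = \<phi> y \<and> \<phi> y' = \<phi> x))"
    using assms unfolding e edge_index_def prod.case key_eq_iff by simp
  show ?thesis
  proof (cases "i' = i")
    case True
    then have "\<not> (\<phi> x = \<phi> y' \<and> \<phi> y = \<phi> x')" "\<not> (\<phi> x = \<phi> x' \<and> \<phi> y = \<phi> y')" using * by metis+
    then show ?thesis unfolding match_weight_def e prod.case by (simp only: of_bool_eq mult_zero_right mult_zero_left add_0_right if_cancel)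
  qed (simp add: match_weight_def e)
qed

lemma match_weight_le: "\<bar>match_weight n (x, y, i) e' \<phi>\<bar> \<le> (1 + \<bar>\<beta> i\<bar>) * K n i (\<phi> x) (\<phi> y)"
proof -
  obtain x' y' i' where e': "e' = (x', y', i')" by (cases e')
  have "\<bar>of_bool p + \<beta> i * of_bool q\<bar> \<le> 1 + \<bar>\<beta> i\<bar>" for p q :: bool by (cases p; cases q) auto
  then have "\<bar>(of_bool p + \<beta> i * of_bool q) * K n i (\<phi> x) (\<phi> y)\<bar> \<le> (1 + \<bar>\<beta> i\<bar>) * K n i (\<phi> x) (\<phi> y)" for p q :: bool
    unfolding abs_mult abs_of_nonneg[OF K_nonneg] by (rule mult_right_mono[OF _ K_nonneg])
  moreover have "\<bar>0 :: real\<bar> \<le> (1 + \<bar>\<beta> i\<bar>) * K n i (\<phi> x) (\<phi> y)" by (simp add: K_nonneg)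
  ultimately show ?thesis unfolding match_weight_def e' prod.case by (cases "i' = i") (simp_all only: if_True if_False simp_thms)
qed

context
  fixes L :: "'i set" and M :: nat and B :: real
  assumes L: "L \<subseteq> J" and B: "1 \<le> B" "\<And>i m. i \<in> L \<Longrightarrow> m \<le> M \<Longrightarrow> C i m \<le> B"
begin

text \<open>The edges are removed one variable at a time. A diagonal variable gives a bounded factor
  and counts as covered. An off-diagonal variable met once has mean 0; met at least twice it gives a
  power of \<open>sqrt K\<close> that is at most \<open>K\<close>, which pays for one representative
  edge in \<open>R\<close>.\<close>

lemma edge_moment_bound:
  assumes "admissible n L \<phi> E" "length E \<le> M"
  shows "\<exists>R. R \<in> edge_selections E \<and> covers \<phi> R E \<and> norm (edge_moment n E \<phi>) \<le> B ^ length E * wt n (kernel_edges R) \<phi>"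
  using assms
proof (induction "length E" arbitrary: E rule: less_induct)
  case less
  show ?case
  proof (cases E)
    case Nil
    then show ?thesis by (intro exI[of _ "[]"]) (auto simp: edge_selections_def covers_def edge_moment_def entry_moment_Nil)
  next
    case (Cons e E')
    obtain x y i where e: "e = (x, y, i)" by (cases e)
    define P where "P = (\<lambda>e'. key (edge_index \<phi> e') = key (edge_index \<phi> (x, y, i)))"
    define S where "S = filter P E'"
    define T where "T = filter (\<lambda>e. \<not> P e) E'"
    have v: "admissible n L \<phi> ((x, y, i) # E')" using less.prems Cons e by simp
    have iJ: "i \<in> L" "i \<in> J" using v L by auto
    have g: "edge_moment n ((x, y, i) # E') \<phi> = edge_moment n ((x, y, i) # S) \<phi> * edge_moment n T \<phi>"
      "norm (edge_moment n ((x, y, i) # S) \<phi>) \<le> C i (Suc (length S)) * sqrt (K n i (\<phi> x) (\<phi> y)) ^ Suc (length S)"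
      unfolding S_def T_def P_def by (rule edge_moment_group[OF v L])+
    have lT: "length T \<le> length E'" "length S \<le> length E'" by (simp_all add: T_def S_def)
    have vT: "admissible n L \<phi> T" by (rule admissible_mono[OF v]) (auto simp: T_def)
    obtain R where R: "R \<in> edge_selections T" "covers \<phi> R T" "norm (edge_moment n T \<phi>) \<le> B ^ length T * wt n (kernel_edges R) \<phi>"
      using less.hyps[OF _ vT] less.prems(2) Cons lT by auto
    have "set T \<subseteq> set E'" by (auto simp: T_def)
    then have RT: "R \<in> edge_selections E'" using R(1) lT unfolding edge_selections_def by auto
    have BT: "B * B ^ length T \<le> B ^ length E"
      using power_increasing[of "Suc (length T)" "length E" B] B(1) lT Cons by simp
    have s1: "sqrt (K n i (\<phi> x) (\<phi> y)) ^ m \<le> 1" for m using sqrtK_le iJ by (intro power_le_one) auto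
    have "norm (edge_moment n ((x, y, i) # S) \<phi>) \<le> B * sqrt (K n i (\<phi> x) (\<phi> y)) ^ Suc (length S)"
      by (rule order_trans[OF g(2)]) (intro mult_right_mono B iJ zero_le_power sqrtK_le, use lT less.prems Cons in simp)
    then have main: "norm (edge_moment n E \<phi>) \<le> (B * sqrt (K n i (\<phi> x) (\<phi> y)) ^ Suc (length S)) * (B ^ length T * wt n (kernel_edges R) \<phi>)"
      unfolding Cons e g(1) norm_mult by (intro mult_mono R) (use B in \<open>auto simp: K_nonneg\<close>)
    show ?thesis
    proof (cases "\<phi> x = \<phi> y")
      case True
      have l: "loop \<phi> (x, y, i)" using True by (simp add: loop_def)
      have "covers \<phi> R E"
        unfolding covers_def
      proof
        fix e' assume e': "e' \<in> set E"
        show "loop \<phi> e' \<or> (\<exists>r\<in>set R. key (edge_index \<phi> r) = key (edge_index \<phi> e'))"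
        proof (cases "P e'")
          case True
          then show ?thesis using key_loop[of \<phi> e' "(x, y, i)"] l by (simp add: P_def)
        next
          case False
          then have "e' \<in> set T" using e' Cons e by (auto simp: T_def P_def)
          then show ?thesis using R(2) by (auto simp: covers_def)
        qed
      qed
      moreover have "norm (edge_moment n E \<phi>) \<le> B ^ length E * wt n (kernel_edges R) \<phi>"
      proof -
        have "(B * sqrt (K n i (\<phi> x) (\<phi> y)) ^ Suc (length S)) * (B ^ length T * wt n (kernel_edges R) \<phi>) \<le> (B * 1) * (B ^ length T * wt n (kernel_edges R) \<phi>)"
          by (intro mult_right_mono mult_left_mono s1 mult_nonneg_nonneg wt_nonneg zero_le_power) (use B in auto)
        also have "\<dots> \<le> B ^ length E * wt n (kernel_edges R) \<phi>"
          using mult_right_mono[OF BT wt_nonneg[of n "kernel_edges R" \<phi>]] by (simp add: mult_ac)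
        finally show ?thesis using main by simp
      qed
      moreover have "R \<in> edge_selections E" using RT Cons by (auto simp: edge_selections_def)
      ultimately show ?thesis by blast
    next
      case False
      have "covers \<phi> (e # R) E"
        unfolding covers_def
      proof
        fix e' assume e': "e' \<in> set E"
        show "loop \<phi> e' \<or> (\<exists>r\<in>set (e # R). key (edge_index \<phi> r) = key (edge_index \<phi> e'))"
        proof (cases "P e'")
          case True
          then show ?thesis using e by (simp add: P_def)
        next
          case False
          then have "e' \<in> set T" using e' Cons e by (auto simp: T_def P_def)
          then show ?thesis using R(2) by (auto simp: covers_def)
        qed
      qed
      moreover have "norm (edge_moment n E \<phi>) \<le> B ^ length E * wt n (kernel_edges (e # R)) \<phi>"
      proof (cases "S = []")
        case True
        have "edge_moment n ((x, y, i) # S) \<phi> = 0" using True False v iJ entry_moment_single by (simp add: edge_moment_def edge_index_def)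
        then show ?thesis unfolding Cons e g(1) using B by (auto intro!: mult_nonneg_nonneg wt_nonneg K_nonneg)
      next
        case S: False
        then obtain m where m: "length S = Suc m" by (cases S) auto
        have "sqrt (K n i (\<phi> x) (\<phi> y)) ^ Suc (length S) = K n i (\<phi> x) (\<phi> y) * sqrt (K n i (\<phi> x) (\<phi> y)) ^ m"
          by (simp add: m K_nonneg mult.assoc[symmetric])
        also have "\<dots> \<le> K n i (\<phi> x) (\<phi> y) * 1" by (intro mult_left_mono s1 K_nonneg)
        finally have s2: "sqrt (K n i (\<phi> x) (\<phi> y)) ^ Suc (length S) \<le> K n i (\<phi> x) (\<phi> y)" by simp
        have "(B * sqrt (K n i (\<phi> x) (\<phi> y)) ^ Suc (length S)) * (B ^ length T * wt n (kernel_edges R) \<phi>)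
            \<le> (B * K n i (\<phi> x) (\<phi> y)) * (B ^ length T * wt n (kernel_edges R) \<phi>)"
          by (intro mult_right_mono mult_left_mono s2 mult_nonneg_nonneg wt_nonneg zero_le_power) (use B in auto)
        also have "\<dots> = (B * B ^ length T) * wt n (kernel_edges (e # R)) \<phi>" by (simp add: e mult_ac)
        also have "\<dots> \<le> B ^ length E * wt n (kernel_edges (e # R)) \<phi>" by (intro mult_right_mono BT wt_nonneg)
        finally show ?thesis using main by simp
      qed
      moreover have "e # R \<in> edge_selections E" using RT Cons by (auto simp: edge_selections_def)
      ultimately show ?thesis by blast
    qed
  qed
qed

lemma edge_moment_le_majorant:
  assumes "admissible n L \<phi> E" "length E \<le> M"
  shows "norm (edge_moment n E \<phi>) \<le> B ^ M * majorant n E \<phi>"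
proof -
  obtain R where R: "R \<in> edge_selections E" "covers \<phi> R E" "norm (edge_moment n E \<phi>) \<le> B ^ length E * wt n (kernel_edges R) \<phi>"
    using edge_moment_bound[OF assms] by blast
  have "B ^ length E * wt n (kernel_edges R) \<phi> \<le> B ^ M * majorant n E \<phi>"
    by (intro mult_mono power_increasing wt_le_majorant R assms B zero_le_power wt_nonneg) (use B in auto)
  then show ?thesis using R(3) by simp
qed

text \<open>Off the diagonal, if no other edge meets the variable of the first one, both sides
  vanish; if exactly one does, the sum reduces to one term, which equals the moment. On the
  diagonal, or with at least three edges on the variable, both sides are small: a factor of order
  \<open>sqrt \<epsilon>\<close> is left over beyond the weight that the majorant accounts
  for.\<close>

lemma step_pointwise:
  assumes v: "admissible n L \<phi> ((x, y, i) # E)" and len: "Suc (length E) \<le> M"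
  shows "norm (edge_moment n ((x, y, i) # E) \<phi> - (\<Sum>p<length E. of_real (match_weight n (x, y, i) (E ! p) \<phi>) * edge_moment n (del p E) \<phi>))
    \<le> (1 + real M * (1 + \<bar>\<beta> i\<bar>)) * B ^ M * sqrt (\<epsilon> n i) * majorant n ((x, y, i) # E) \<phi>"
proof -
  let ?e = "(x, y, i)"
  define P where "P = (\<lambda>e'. key (edge_index \<phi> e') = key (edge_index \<phi> ?e))"
  define S where "S = filter P E"
  define T where "T = filter (\<lambda>e. \<not> P e) E"
  define rhs where "rhs = (\<Sum>p<length E. of_real (match_weight n ?e (E ! p) \<phi>) * edge_moment n (del p E) \<phi>)"
  have iJ: "i \<in> L" "i \<in> J" using v L by auto
  have g: "edge_moment n (?e # E) \<phi> = edge_moment n (?e # S) \<phi> * edge_moment n T \<phi>"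
    "norm (edge_moment n (?e # S) \<phi>) \<le> C i (Suc (length S)) * sqrt (K n i (\<phi> x) (\<phi> y)) ^ Suc (length S)"
    unfolding S_def T_def P_def by (rule edge_moment_group[OF v L])+
  have lT: "length T \<le> length E" "length S \<le> length E" "length S + length T = length E"
    unfolding T_def S_def using sum_length_filter_compl[of P E] by simp_all
  have vE: "admissible n L \<phi> E" using v by simp
  have eps0: "0 \<le> sqrt (\<epsilon> n i)" using eps_nonneg iJ by simp
  \<comment> \<open>The summand 1 stands for the moment itself, \<open>real M\<close> for the number
    of pairings, each of weight at most \<open>(1 + \<bar>\<beta> i\<bar>) * K\<close>.\<close>
  define BB where "BB = (1 + real M * (1 + \<bar>\<beta> i\<bar>)) * B ^ M"
  have BB: "0 \<le> BB" using B by (simp add: BB_def)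
  have rhs0: "0 \<le> BB * sqrt (\<epsilon> n i) * majorant n (?e # E) \<phi>"
    by (intro mult_nonneg_nonneg BB eps0 majorant_nonneg)
  \<comment> \<open>The first edge is not in \<open>S\<close>, so \<open>length S \<ge> 2\<close>
    means three edges on one variable.\<close>
  consider (a) "\<phi> x \<noteq> \<phi> y" "S = []" | (b) e' where "\<phi> x \<noteq> \<phi> y" "S = [e']" | (c) "\<phi> x = \<phi> y \<or> length S \<ge> 2"
    by (cases S rule: remdups_adj.cases) auto
  then have "norm (edge_moment n (?e # E) \<phi> - rhs) \<le> BB * sqrt (\<epsilon> n i) * majorant n (?e # E) \<phi>"
  proof cases
    case a
    have "edge_moment n (?e # S) \<phi> = 0" using a v iJ entry_moment_single by (simp add: edge_moment_def edge_index_def)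
    moreover have "match_weight n ?e (E ! p) \<phi> = 0" if "p < length E" for p
      by (rule match_weight_eq_0) (use a(2) that in \<open>auto simp: S_def P_def filter_empty_conv\<close>)
    ultimately show ?thesis using rhs0 by (simp add: g(1) rhs_def)
  next
    case b
    obtain us vs where E: "E = us @ e' # vs" "\<forall>u\<in>set us. \<not> P u" "P e'" "filter P vs = []"
      using b(2) unfolding S_def by (auto simp: filter_eq_Cons_iff)
    have vs: "\<forall>u\<in>set vs. \<not> P u" using E(4) by (simp add: filter_empty_conv)
    have T: "T = us @ vs" using E vs unfolding T_def by (auto simp: filter_id_conv)
    \<comment> \<open>All positions but that of \<open>e'\<close> have a different key, hence
      matching weight 0.\<close>
    have "rhs = (\<Sum>p<length E. if p = length us then of_real (match_weight n ?e e' \<phi>) * edge_moment n T \<phi> else 0)"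
      unfolding rhs_def
    proof (intro sum.cong refl)
      fix p assume p: "p \<in> {..<length E}"
      show "of_real (match_weight n ?e (E ! p) \<phi>) * edge_moment n (del p E) \<phi> =
        (if p = length us then of_real (match_weight n ?e e' \<phi>) * edge_moment n T \<phi> else 0)"
      proof (cases "p = length us")
        case True
        then show ?thesis by (simp add: E(1) T del_def)
      next
        case False
        then have "\<not> P (E ! p)" using p E(2) vs by (auto simp: E(1) nth_append nth_Cons' split: if_splits)
        then show ?thesis using False match_weight_eq_0[of \<phi> "E ! p" ?e n] by (simp add: P_def)
      qed
    qed
    also have "\<dots> = of_real (match_weight n ?e e' \<phi>) * edge_moment n T \<phi>" by (simp add: E(1))
    also have "of_real (match_weight n ?e e' \<phi>) = edge_moment n (?e # S) \<phi>"
    proof -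
      obtain x' y' i' where e': "e' = (x', y', i')" by (cases e')
      have k: "i' = i" "\<phi> x' = \<phi> x \<and> \<phi> y' = \<phi> y \<or> \<phi> x' = \<phi> y \<and> \<phi> y' = \<phi> x"
        using E(3) unfolding P_def e' edge_index_def by (auto simp: key_eq_iff)
      have lt: "\<phi> x < n" "\<phi> y < n" using v by auto
      from k(2) show ?thesis
      proof
        assume a: "\<phi> x' = \<phi> x \<and> \<phi> y' = \<phi> y"
        have "match_weight n ?e e' \<phi> = \<beta> i * K n i (\<phi> x) (\<phi> y)" using a b(1) k(1) by (simp add: e' match_weight_def)
        moreover have "edge_moment n (?e # S) \<phi> = of_real (\<beta> i * K n i (\<phi> x) (\<phi> y))"
          using entry_moment_same[OF iJ(2) lt b(1)] a k(1) unfolding b(2) e' edge_moment_def edge_index_def by simp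
        ultimately show ?thesis by (simp only:)
      next
        assume a: "\<phi> x' = \<phi> y \<and> \<phi> y' = \<phi> x"
        have "match_weight n ?e e' \<phi> = K n i (\<phi> x) (\<phi> y)" using a b(1) k(1) by (simp add: e' match_weight_def)
        moreover have "edge_moment n (?e # S) \<phi> = of_real (K n i (\<phi> x) (\<phi> y))"
          using entry_moment_opp[OF iJ(2) lt b(1)] a k(1) unfolding b(2) e' edge_moment_def edge_index_def by simp
        ultimately show ?thesis by (simp only:)
      qed
    qed
    finally have "edge_moment n (?e # E) \<phi> - rhs = 0" using g(1) by simp
    then show ?thesis using rhs0 by simp
  next
    case c
    have cov: "covers \<phi> R (?e # E)" if "covers \<phi> R E" "\<phi> x = \<phi> y" for R
      using that by (auto simp: covers_def loop_def)
    have sK: "sqrt (K n i (\<phi> x) (\<phi> y)) ^ m \<le> 1" for m using sqrtK_le iJ by (intro power_le_one) auto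
    \<comment> \<open>One factor \<open>sqrt K\<close> is traded for \<open>sqrt \<epsilon>\<close>;
      the others are at most 1.\<close>
    have sKe: "sqrt (K n i (\<phi> x) (\<phi> y)) ^ Suc m \<le> sqrt (\<epsilon> n i)" for m
      using mult_mono[OF sqrtK_le(1)[OF iJ(2), of n "\<phi> x" "\<phi> y"] sK[of m]] eps0 sqrtK_le(3) by simp
    have Kle: "K n i (\<phi> x) (\<phi> y) \<le> sqrt (\<epsilon> n i)"
    proof -
      have "K n i (\<phi> x) (\<phi> y) = sqrt (K n i (\<phi> x) (\<phi> y)) ^ Suc 1" by (simp add: K_nonneg)
      then show ?thesis using sKe[of 1] by simp
    qed
    have 1: "norm (edge_moment n (?e # E) \<phi>) \<le> B ^ M * (sqrt (\<epsilon> n i) * majorant n (?e # E) \<phi>)"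
    proof -
      have vT: "admissible n L \<phi> T" by (rule admissible_mono[OF vE]) (auto simp: T_def)
      obtain R where R: "R \<in> edge_selections T" "covers \<phi> R T" "norm (edge_moment n T \<phi>) \<le> B ^ length T * wt n (kernel_edges R) \<phi>"
        using edge_moment_bound[OF vT] lT len by auto
      have "set T \<subseteq> set E" by (auto simp: T_def)
      then have RE: "R \<in> edge_selections E" using R(1) lT unfolding edge_selections_def by auto
      have "norm (edge_moment n (?e # S) \<phi>) \<le> B * sqrt (K n i (\<phi> x) (\<phi> y)) ^ Suc (length S)"
        by (rule order_trans[OF g(2)]) (intro mult_right_mono B iJ zero_le_power sqrtK_le, use lT len in simp)
      then have "norm (edge_moment n (?e # E) \<phi>) \<le> (B * sqrt (K n i (\<phi> x) (\<phi> y)) ^ Suc (length S)) * (B ^ length T * wt n (kernel_edges R) \<phi>)"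
        unfolding g(1) norm_mult by (intro mult_mono R) (use B in \<open>auto simp: K_nonneg\<close>)
      also have "\<dots> = B ^ Suc (length T) * (sqrt (K n i (\<phi> x) (\<phi> y)) ^ Suc (length S) * wt n (kernel_edges R) \<phi>)" by simp
      also have "\<dots> \<le> B ^ M * (sqrt (K n i (\<phi> x) (\<phi> y)) ^ Suc (length S) * wt n (kernel_edges R) \<phi>)"
        by (intro mult_right_mono power_increasing mult_nonneg_nonneg wt_nonneg zero_le_power sqrtK_le) (use B lT len in auto)
      also have "\<dots> \<le> B ^ M * (sqrt (\<epsilon> n i) * majorant n (?e # E) \<phi>)"
      proof (intro mult_left_mono zero_le_power)
        show "sqrt (K n i (\<phi> x) (\<phi> y)) ^ Suc (length S) * wt n (kernel_edges R) \<phi> \<le> sqrt (\<epsilon> n i) * majorant n (?e # E) \<phi>"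
        proof (cases "\<phi> x = \<phi> y")
          case True
          have "covers \<phi> R E"
            unfolding covers_def
          proof
            fix e' assume e': "e' \<in> set E"
            show "loop \<phi> e' \<or> (\<exists>r\<in>set R. key (edge_index \<phi> r) = key (edge_index \<phi> e'))"
            proof (cases "P e'")
              case P: True
              then show ?thesis using key_loop[of \<phi> e' "(x, y, i)"] True by (simp add: P_def loop_def)
            next
              case False
              then have "e' \<in> set T" using e' by (auto simp: T_def P_def)
              then show ?thesis using R(2) by (auto simp: covers_def)
            qed
          qed
          then have "wt n (kernel_edges R) \<phi> \<le> majorant n (?e # E) \<phi>"
            by (intro wt_le_majorant cov True) (use RE in \<open>auto simp: edge_selections_def\<close>)
          then show ?thesis by (intro mult_mono sKe wt_nonneg eps0)
        next
          case False
          \<comment> \<open>Two of the at least three factors \<open>sqrt K\<close> form the kernel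
            of the first edge, which joins the cover; the others give
            \<open>sqrt \<epsilon>\<close>.\<close>
          then obtain m where m: "length S = Suc (Suc m)" using c by (cases S rule: remdups_adj.cases) auto
          have "covers \<phi> (?e # R) (?e # E)"
            unfolding covers_def
          proof
            fix e' assume e': "e' \<in> set (?e # E)"
            show "loop \<phi> e' \<or> (\<exists>r\<in>set (?e # R). key (edge_index \<phi> r) = key (edge_index \<phi> e'))"
            proof (cases "P e'")
              case True
              then show ?thesis by (simp add: P_def)
            next
              case False
              then have "e' \<in> set T" using e' by (auto simp: T_def P_def)
              then show ?thesis using R(2) by (auto simp: covers_def)
            qed
          qed
          then have w: "wt n (kernel_edges (?e # R)) \<phi> \<le> majorant n (?e # E) \<phi>"
            by (intro wt_le_majorant) (use RE in \<open>auto simp: edge_selections_def\<close>)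
          have "sqrt (K n i (\<phi> x) (\<phi> y)) ^ Suc (length S) = K n i (\<phi> x) (\<phi> y) * sqrt (K n i (\<phi> x) (\<phi> y)) ^ Suc m"
            by (simp add: m K_nonneg mult.assoc[symmetric])
          then have "sqrt (K n i (\<phi> x) (\<phi> y)) ^ Suc (length S) * wt n (kernel_edges R) \<phi>
              = sqrt (K n i (\<phi> x) (\<phi> y)) ^ Suc m * wt n (kernel_edges (?e # R)) \<phi>" by (simp add: mult_ac)
          also have "\<dots> \<le> sqrt (\<epsilon> n i) * majorant n (?e # E) \<phi>"
            by (intro mult_mono sKe w wt_nonneg eps0)
          finally show ?thesis .
        qed
      qed (use B in simp)
      finally show ?thesis .
    qed
    have 2: "norm (of_real (match_weight n ?e (E ! p) \<phi>) * edge_moment n (del p E) \<phi>) \<le>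
      (1 + \<bar>\<beta> i\<bar>) * B ^ M * (sqrt (\<epsilon> n i) * majorant n (?e # E) \<phi>)" if p: "p < length E" for p
    proof (cases "P (E ! p)")
      case False
      then have "match_weight n ?e (E ! p) \<phi> = 0" by (intro match_weight_eq_0) (simp add: P_def)
      then show ?thesis using B by (auto intro!: mult_nonneg_nonneg eps0 majorant_nonneg eps_nonneg iJ)
    next
      case True
      have vD: "admissible n L \<phi> (del p E)" by (rule admissible_mono[OF vE set_del])
      have lD: "length (del p E) \<le> M" using len length_del[OF p] by simp
      obtain R where R: "R \<in> edge_selections (del p E)" "covers \<phi> R (del p E)"
          "norm (edge_moment n (del p E) \<phi>) \<le> B ^ length (del p E) * wt n (kernel_edges R) \<phi>"
        using edge_moment_bound[OF vD lD] by auto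
      have RE: "R \<in> edge_selections (?e # E)" using R(1) set_del[of p E] length_del[OF p] unfolding edge_selections_def by auto
      have Ep: "\<And>e'. e' \<in> set E \<Longrightarrow> e' = E ! p \<or> e' \<in> set (del p E)" using split_del[OF p] by auto
      have "covers \<phi> R (?e # E)"
      proof (cases "\<phi> x = \<phi> y")
        case l: True
        have "loop \<phi> (E ! p)" using True key_loop[of \<phi> "E ! p" ?e] l by (simp add: P_def loop_def)
        then have "covers \<phi> R E" using R(2) Ep unfolding covers_def by metis
        then show ?thesis by (rule cov[OF _ l])
      next
        case False
        \<comment> \<open>A third edge \<open>e2\<close> on the variable survives the deletion, so a
          cover of the shortened list already contains this key. The kernel in the matching weight
          is then a surplus factor.\<close>
        then have "length (filter P (del p E)) \<ge> 1" using filter_del[OF p, of P] c by (simp add: S_def)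
        then obtain e2 where e2: "e2 \<in> set (del p E)" "P e2" by (metis filter_empty_conv length_0_conv not_one_le_zero)
        moreover have "\<not> loop \<phi> e2" using e2(2) False key_loop[of \<phi> e2 ?e] by (simp add: P_def loop_def)
        ultimately obtain r where r: "r \<in> set R" "key (edge_index \<phi> r) = key (edge_index \<phi> ?e)"
          using R(2) by (auto simp: covers_def P_def)
        then show ?thesis using R(2) Ep True unfolding covers_def P_def by (metis set_ConsD)
      qed
      then have w: "wt n (kernel_edges R) \<phi> \<le> majorant n (?e # E) \<phi>" by (intro wt_le_majorant RE)
      have "norm (of_real (match_weight n ?e (E ! p) \<phi>) * edge_moment n (del p E) \<phi>) \<le>
        ((1 + \<bar>\<beta> i\<bar>) * K n i (\<phi> x) (\<phi> y)) * (B ^ length (del p E) * wt n (kernel_edges R) \<phi>)"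
        unfolding norm_mult norm_of_real by (intro mult_mono match_weight_le R) (auto intro!: mult_nonneg_nonneg K_nonneg)
      also have "\<dots> \<le> ((1 + \<bar>\<beta> i\<bar>) * sqrt (\<epsilon> n i)) * (B ^ M * majorant n (?e # E) \<phi>)"
        by (intro mult_mono Kle w power_increasing lD mult_nonneg_nonneg wt_nonneg K_nonneg eps0 B(1) zero_le_power) (use B in auto)
      finally show ?thesis by (simp add: mult_ac)
    qed
    have "norm rhs \<le> (\<Sum>p<length E. (1 + \<bar>\<beta> i\<bar>) * B ^ M * (sqrt (\<epsilon> n i) * majorant n (?e # E) \<phi>))"
      unfolding rhs_def by (rule order_trans[OF norm_sum]) (intro sum_mono 2, simp)
    also have "\<dots> = real (length E) * ((1 + \<bar>\<beta> i\<bar>) * B ^ M * (sqrt (\<epsilon> n i) * majorant n (?e # E) \<phi>))" by simp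
    also have "\<dots> \<le> real M * ((1 + \<bar>\<beta> i\<bar>) * B ^ M * (sqrt (\<epsilon> n i) * majorant n (?e # E) \<phi>))"
      using len B by (intro mult_right_mono mult_nonneg_nonneg eps0 majorant_nonneg) auto
    finally have "norm (edge_moment n (?e # E) \<phi> - rhs) \<le> B ^ M * (sqrt (\<epsilon> n i) * majorant n (?e # E) \<phi>) + real M * ((1 + \<bar>\<beta> i\<bar>) * B ^ M * (sqrt (\<epsilon> n i) * majorant n (?e # E) \<phi>))"
      using 1 by (intro order_trans[OF norm_triangle_ineq4] add_mono)
    then show ?thesis by (simp add: BB_def algebra_simps)
  qed
  then show ?thesis by (simp add: BB_def rhs_def)
qed

end

end

lemma tendsto_0_bound:
  fixes f :: "nat \<Rightarrow> complex"
  assumes "\<And>n. norm (f n) \<le> g n" "g \<longlonglongrightarrow> 0"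
  shows "f \<longlonglongrightarrow> 0"
  by (rule Lim_null_comparison[OF always_eventually assms(2)]) (simp add: assms(1))

lemma null_mult_Bseq:
  fixes f g :: "nat \<Rightarrow> complex"
  assumes "f \<longlonglongrightarrow> 0" "Bseq g"
  shows "(\<lambda>n. f n * g n) \<longlonglongrightarrow> 0"
proof -
  obtain c where c: "\<And>n. norm (g n) \<le> c" using assms(2) unfolding Bseq_def by auto
  have "(\<lambda>n. norm (f n) * c) \<longlonglongrightarrow> 0"
    using tendsto_norm_zero[OF assms(1)] by (rule tendsto_mult_left_zero)
  then show ?thesis
    by (rule tendsto_0_bound[rotated]) (simp add: norm_mult c mult_left_mono)
qed

section \<open>Sums of moments over connected graphs\<close>

context wigner_moments begin

lemma admissible_Phi: "graph_on V (kernel_edges E) \<Longrightarrow> \<phi> \<in> Phi V n \<Longrightarrow> admissible n (snd ` snd ` set E) \<phi> E"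
  by (force simp: admissible_def graph_on_def set_kernel_edges Phi_less)

lemma labels_J: "graph_on V (kernel_edges E) \<Longrightarrow> snd ` snd ` set E \<subseteq> J"
  by (force simp: graph_on_def set_kernel_edges)

lemma moment_const:
  assumes "finite L"
  obtains B :: real where "1 \<le> B" "\<And>i m. i \<in> L \<Longrightarrow> m \<le> M \<Longrightarrow> C i m \<le> B"
proof -
  let ?S = "insert 1 ((\<lambda>(i, m). C i m) ` (L \<times> {..M}))"
  have fin: "finite ?S" using assms by simp
  show ?thesis
  proof (rule that)
    show "1 \<le> Max ?S" by (rule Max_ge[OF fin]) simp
    show "C i m \<le> Max ?S" if "i \<in> L" "m \<le> M" for i m
      by (rule Max_ge[OF fin]) (use that in force)
  qed
qed

text \<open>\<open>G\<close> holds the deterministic factors, kernels and equalities, and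
  \<open>E\<close> the entries under the expectation. A connected graph has one free index, hence
  the single division by \<open>n\<close>.\<close>

definition graph_sum :: "nat \<Rightarrow> 'v set \<Rightarrow> ('v \<times> 'v \<times> 'i option) list \<Rightarrow> ('v \<times> 'v \<times> 'i) list \<Rightarrow> complex" where
  "graph_sum n V G E = (\<Sum>\<phi>\<in>Phi V n. of_real (wt n G \<phi>) * edge_moment n E \<phi>) / of_nat n"

text \<open>A cover \<open>R\<close> need not connect \<open>V\<close>: an edge of \<open>E\<close>
  may be represented by an edge between other vertices with the same values, or be mapped to the
  diagonal. For given \<open>\<phi>\<close>, equality edges between all vertices of equal value
  (\<open>KL \<phi>\<close>) restore connectivity and have weight 1. Only finitely many lists
  \<open>KL \<phi>\<close> arise, and the tree bound applies to each.\<close>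

lemma majorant_sum_bounded:
  fixes V :: "'v set"
  assumes fin: "finite V" "V \<noteq> {}" and G: "graph_on V G" "graph_on V (kernel_edges E)" and c: "conn V (ends G \<union> ends E)"
  shows "\<exists>c\<ge>0. \<forall>n. (\<Sum>\<phi>\<in>Phi V n. wt n G \<phi> * majorant n E \<phi>) \<le> c * real n"
proof -
  obtain vs where vs: "set vs = V \<times> V" using finite_list[of "V \<times> V"] fin by auto
  define KL where "KL \<phi> = map (\<lambda>(x, y). (x, y, None :: 'i option)) (filter (\<lambda>(x, y). \<phi> x = \<phi> y) vs)" for \<phi> :: "'v \<Rightarrow> nat"
  define \<K> where "\<K> = {k. set k \<subseteq> (\<lambda>(x, y). (x, y, None :: 'i option)) ` set vs \<and> length k \<le> length vs}"
  have fK: "finite \<K>" unfolding \<K>_def by (rule finite_lists_length_le) simp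
  have KL: "KL \<phi> \<in> \<K>" for \<phi> unfolding KL_def \<K>_def by auto
  have KLw: "wt n (KL \<phi>) \<phi> = 1" for n \<phi> unfolding KL_def by (induction vs) auto
  have KLg: "graph_on V k" if "k \<in> \<K>" for k using that vs unfolding \<K>_def graph_on_def by auto
  have KLc: "conn V (ends (G @ kernel_edges R @ KL \<phi>))" if cov: "covers \<phi> R E" and R: "R \<in> edge_selections E" for R \<phi>
  proof (rule connI)
    fix P :: "'v \<Rightarrow> bool" and p q
    assume P: "\<And>a b. (a, b) \<in> ends (G @ kernel_edges R @ KL \<phi>) \<Longrightarrow> P a = P b" and pq: "p \<in> V" "q \<in> V"
    have eq: "P a = P b" if "a \<in> V" "b \<in> V" "\<phi> a = \<phi> b" for a b
      by (rule P) (use that vs in \<open>force simp: ends_def KL_def\<close>)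
    show "P p = P q"
    proof (rule connD[where P = P, OF c _ pq])
      fix a b assume "(a, b) \<in> ends G \<union> ends E"
      then show "P a = P b"
      proof
        assume "(a, b) \<in> ends E"
        then obtain i where e: "(a, b, i) \<in> set E" by (auto simp: ends_def)
        then have ab: "a \<in> V" "b \<in> V" using G(2) by (auto simp: graph_on_def set_kernel_edges)
        show ?thesis
        proof (cases "\<phi> a = \<phi> b")
          case False
          then obtain r where r: "r \<in> set R" "key (edge_index \<phi> r) = key (edge_index \<phi> (a, b, i))"
            using cov e unfolding covers_def loop_def by fastforce
          obtain a' b' i' where r': "r = (a', b', i')" by (cases r)
          have ab': "a' \<in> V" "b' \<in> V" using r(1) R G(2) unfolding r' by (auto simp: edge_selections_def graph_on_def set_kernel_edges)
          have "(a', b') \<in> ends R" using r(1) r' by (force simp: ends_def)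
          then have "P a' = P b'" by (intro P) simp
          \<comment> \<open>Equal keys mean equal values at the ends, possibly exchanged, so
            equality edges tie the ends of \<open>r\<close> to those of the edge it
            represents.\<close>
          moreover have "\<phi> a' = \<phi> a \<and> \<phi> b' = \<phi> b \<or> \<phi> a' = \<phi> b \<and> \<phi> b' = \<phi> a"
            using r(2) unfolding r' edge_index_def prod.case key_eq_iff by simp
          ultimately show ?thesis using eq ab ab' by metis
        qed (use eq ab in blast)
      qed (use P in simp)
    qed
  qed
  define Q where "Q R = {k \<in> \<K>. conn V (ends (G @ kernel_edges R @ k))}" for R
  have gR: "graph_on V (kernel_edges R)" if "R \<in> edge_selections E" for R
    by (rule graph_on_mono[OF G(2) kernel_edges_mono]) (use that in \<open>auto simp: edge_selections_def\<close>)
  have le: "of_bool (covers \<phi> R E) * wt n (G @ kernel_edges R) \<phi> \<le> (\<Sum>k\<in>Q R. wt n (G @ kernel_edges R @ k) \<phi>)"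
    if R: "R \<in> edge_selections E" for R n \<phi>
  proof (cases "covers \<phi> R E")
    case True
    have "wt n (G @ kernel_edges R) \<phi> = wt n (G @ kernel_edges R @ KL \<phi>) \<phi>" by (simp add: KLw)
    also have "\<dots> \<le> (\<Sum>k\<in>Q R. wt n (G @ kernel_edges R @ k) \<phi>)"
      by (rule member_le_sum) (use KL KLc[OF True R] fK wt_nonneg in \<open>auto simp: Q_def simp del: wt_simps\<close>)
    finally show ?thesis using True by simp
  qed (simp add: sum_nonneg wt_nonneg del: wt_simps)
  define cc where "cc = (\<Sum>R\<in>edge_selections E. \<Sum>k\<in>Q R. 2 ^ card V :: real)"
  show ?thesis
  proof (intro exI[of _ cc] conjI allI)
    show "0 \<le> cc" unfolding cc_def by (intro sum_nonneg) auto
    fix n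
    have "(\<Sum>\<phi>\<in>Phi V n. wt n G \<phi> * majorant n E \<phi>) = (\<Sum>\<phi>\<in>Phi V n. \<Sum>R\<in>edge_selections E. of_bool (covers \<phi> R E) * wt n (G @ kernel_edges R) \<phi>)"
      unfolding majorant_def by (simp add: sum_distrib_left mult_ac)
    also have "\<dots> \<le> (\<Sum>\<phi>\<in>Phi V n. \<Sum>R\<in>edge_selections E. \<Sum>k\<in>Q R. wt n (G @ kernel_edges R @ k) \<phi>)"
      by (intro sum_mono le)
    also have "\<dots> = (\<Sum>R\<in>edge_selections E. \<Sum>k\<in>Q R. \<Sum>\<phi>\<in>Phi V n. wt n (G @ kernel_edges R @ k) \<phi>)"
      by (subst sum.swap) (intro sum.cong refl sum.swap)
    also have "\<dots> \<le> (\<Sum>R\<in>edge_selections E. \<Sum>k\<in>Q R. 2 ^ card V * real n)"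
      by (intro sum_mono sum_wt_le' fin) (use G gR KLg in \<open>auto simp: Q_def simp del: ends_simps\<close>)
    also have "\<dots> = cc * real n" by (simp add: cc_def sum_distrib_right mult.assoc)
    finally show "(\<Sum>\<phi>\<in>Phi V n. wt n G \<phi> * majorant n E \<phi>) \<le> cc * real n" .
  qed
qed

lemma norm_sum_bounded:
  fixes V :: "'v set"
  assumes fin: "finite V" "V \<noteq> {}" and G: "graph_on V G" "graph_on V (kernel_edges E)" and c: "conn V (ends G \<union> ends E)"
  shows "\<exists>c\<ge>0. \<forall>n. (\<Sum>\<phi>\<in>Phi V n. wt n G \<phi> * norm (edge_moment n E \<phi>)) \<le> c * real n"
proof -
  let ?L = "snd ` snd ` set E"
  obtain c where c: "c \<ge> 0" "\<And>n. (\<Sum>\<phi>\<in>Phi V n. wt n G \<phi> * majorant n E \<phi>) \<le> c * real n"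
    using majorant_sum_bounded[OF assms] by blast
  obtain B where B: "1 \<le> B" "\<And>i m. i \<in> ?L \<Longrightarrow> m \<le> length E \<Longrightarrow> C i m \<le> B"
    by (rule moment_const[of ?L "length E"]) auto
  have "(\<Sum>\<phi>\<in>Phi V n. wt n G \<phi> * norm (edge_moment n E \<phi>)) \<le> (B ^ length E * c) * real n" for n
  proof -
    have "(\<Sum>\<phi>\<in>Phi V n. wt n G \<phi> * norm (edge_moment n E \<phi>)) \<le> (\<Sum>\<phi>\<in>Phi V n. wt n G \<phi> * (B ^ length E * majorant n E \<phi>))"
      by (intro sum_mono mult_left_mono wt_nonneg edge_moment_le_majorant[OF labels_J[OF G(2)] B(1) B(2)] admissible_Phi[OF G(2)]) auto
    also have "\<dots> = B ^ length E * (\<Sum>\<phi>\<in>Phi V n. wt n G \<phi> * majorant n E \<phi>)"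
      by (simp add: sum_distrib_left mult_ac)
    also have "\<dots> \<le> B ^ length E * (c * real n)" by (intro mult_left_mono c zero_le_power) (use B in auto)
    finally show ?thesis by simp
  qed
  then show ?thesis by (intro exI[of _ "B ^ length E * c"]) (use B c in auto)
qed

lemma norm_graph_sum_le: "norm (graph_sum n V G E) \<le> (\<Sum>\<phi>\<in>Phi V n. wt n G \<phi> * norm (edge_moment n E \<phi>)) / real n"
  unfolding graph_sum_def norm_divide norm_of_nat
  by (intro divide_right_mono order_trans[OF norm_sum] sum_mono) (auto simp: norm_mult wt_nonneg)

lemma graph_sum_bounded:
  assumes "finite V" "V \<noteq> {}" "graph_on V G" "graph_on V (kernel_edges E)" "conn V (ends G \<union> ends E)"
  shows "Bseq (\<lambda>n. graph_sum n V G E)"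
proof -
  obtain c where c: "c \<ge> 0" "\<And>n. (\<Sum>\<phi>\<in>Phi V n. wt n G \<phi> * norm (edge_moment n E \<phi>)) \<le> c * real n"
    using norm_sum_bounded[OF assms] by blast
  have "norm (graph_sum n V G E) \<le> c" for n
    using order_trans[OF norm_graph_sum_le divide_right_mono[OF c(2)[of n], of "real n"]] c(1) by (cases "n = 0") auto
  then show ?thesis by (rule BseqI')
qed

lemma graph_sum_mset: "mset G = mset H \<Longrightarrow> graph_sum n V G E = graph_sum n V H E"
  unfolding graph_sum_def using wt_mset by metis

text \<open>The sum without the extra edge is bounded, and the edge contributes a factor at most
  \<open>\<epsilon> n i\<close>. Kernel edges other than bridges are thus negligible.\<close>

lemma graph_sum_redundant_edge:
  fixes V :: "'v set"
  assumes "finite V" "graph_on V G" "graph_on V (kernel_edges E)" "conn V (ends G \<union> ends E)"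
    and uv: "u \<in> V" "v \<in> V" "i \<in> J"
  shows "(\<lambda>n. graph_sum n V ((u, v, Some i) # G) E) \<longlonglongrightarrow> 0"
proof -
  obtain c where c: "c \<ge> 0" "\<And>n. (\<Sum>\<phi>\<in>Phi V n. wt n G \<phi> * norm (edge_moment n E \<phi>)) \<le> c * real n"
    using norm_sum_bounded[of V G E] assms by blast
  have "norm (graph_sum n V ((u, v, Some i) # G) E) \<le> \<epsilon> n i * c" for n
  proof -
    have "(\<Sum>\<phi>\<in>Phi V n. wt n ((u, v, Some i) # G) \<phi> * norm (edge_moment n E \<phi>)) \<le> (\<Sum>\<phi>\<in>Phi V n. \<epsilon> n i * (wt n G \<phi> * norm (edge_moment n E \<phi>)))"
      by (intro sum_mono) (auto simp: mult.assoc intro!: mult_right_mono K_le uv mult_nonneg_nonneg wt_nonneg)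
    also have "\<dots> \<le> \<epsilon> n i * (c * real n)"
      unfolding sum_distrib_left[symmetric] by (intro mult_left_mono c eps_nonneg uv)
    finally have "norm (graph_sum n V ((u, v, Some i) # G) E) \<le> \<epsilon> n i * (c * real n) / real n"
      by (rule order_trans[OF norm_graph_sum_le divide_right_mono]) simp
    then show ?thesis using eps_nonneg[OF uv(3)] c(1) by (cases "n = 0") auto
  qed
  then show ?thesis by (rule tendsto_0_bound) (intro tendsto_mult_left_zero eps_lim uv)
qed

text \<open>The variance of the matched pair stays behind as a kernel edge from \<open>x\<close> to
  \<open>y\<close>, and equality edges identify the ends: crosswise for opposite orientation,
  straight and with factor \<open>\<beta> i\<close> for equal orientation. The result is again made
  of graph sums, so the step can be iterated.\<close>

definition pairing :: "nat \<Rightarrow> 'v set \<Rightarrow> ('v \<times> 'v \<times> 'i option) list \<Rightarrow> 'v \<times> 'v \<times> 'i \<Rightarrow> ('v \<times> 'v \<times> 'i) list \<Rightarrow> nat \<Rightarrow> complex" where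
  "pairing n V G = (\<lambda>(x, y, i) E p. case E ! p of (x', y', i') \<Rightarrow> if i' = i then
     graph_sum n V ((x, y, Some i) # (x, y', None) # (y, x', None) # G) (del p E) +
     of_real (\<beta> i) * graph_sum n V ((x, y, Some i) # (x, x', None) # (y, y', None) # G) (del p E) else 0)"

lemma pairing_eq:
  "pairing n V G (x, y, i) E p = (\<Sum>\<phi>\<in>Phi V n. of_real (wt n G \<phi> * match_weight n (x, y, i) (E ! p) \<phi>) * edge_moment n (del p E) \<phi>) / of_nat n"
proof -
  obtain x' y' i' where e: "E ! p = (x', y', i')" by (cases "E ! p")
  show ?thesis
  proof (cases "i' = i")
    case True
    have "of_real (wt n G \<phi> * match_weight n (x, y, i) (E ! p) \<phi>) * edge_moment n (del p E) \<phi> =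
      of_real (wt n ((x, y, Some i) # (x, y', None) # (y, x', None) # G) \<phi>) * edge_moment n (del p E) \<phi> +
      of_real (\<beta> i) * (of_real (wt n ((x, y, Some i) # (x, x', None) # (y, y', None) # G) \<phi>) * edge_moment n (del p E) \<phi>)" for \<phi>
      unfolding match_weight_def e prod.case True wt_simps edge_kernel_simps of_bool_conj
      by (simp add: algebra_simps)
    then show ?thesis
      unfolding pairing_def e prod.case using True
      by (simp add: graph_sum_def sum.distrib sum_distrib_left add_divide_distrib)
  qed (simp add: pairing_def e match_weight_def)
qed

text \<open>Gaussian integration by parts up to o(1): the pointwise error carries
  \<open>sqrt (\<epsilon> n i)\<close>, and the majorant sums to O(n).\<close>

lemma graph_sum_step:
  fixes V :: "'v set"
  assumes fin: "finite V" and G: "graph_on V G" "graph_on V (kernel_edges ((x, y, i) # E))"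
    and c: "conn V (ends G \<union> ends ((x, y, i) # E))"
  shows "(\<lambda>n. graph_sum n V G ((x, y, i) # E) - (\<Sum>p<length E. pairing n V G (x, y, i) E p)) \<longlonglongrightarrow> 0"
proof -
  let ?E = "(x, y, i) # E"
  let ?L = "snd ` snd ` set ?E"
  have iJ: "i \<in> J" and V0: "V \<noteq> {}" using G(2) by auto
  obtain c where c: "c \<ge> 0" "\<And>n. (\<Sum>\<phi>\<in>Phi V n. wt n G \<phi> * majorant n ?E \<phi>) \<le> c * real n"
    using majorant_sum_bounded[OF fin V0 G c] by blast
  obtain B where B: "1 \<le> B" "\<And>i m. i \<in> ?L \<Longrightarrow> m \<le> length ?E \<Longrightarrow> C i m \<le> B"
    by (rule moment_const[of ?L "length ?E"]) auto
  define b where "b = (1 + real (length ?E) * (1 + \<bar>\<beta> i\<bar>)) * B ^ length ?E"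
  have b0: "0 \<le> b" using B by (simp add: b_def)
  have s0: "0 \<le> sqrt (\<epsilon> n i)" for n using eps_nonneg[OF iJ] by simp
  have "norm (graph_sum n V G ?E - (\<Sum>p<length E. pairing n V G (x, y, i) E p)) \<le> b * sqrt (\<epsilon> n i) * c" for n
  proof -
    define d where "d \<phi> = edge_moment n ?E \<phi> - (\<Sum>p<length E. of_real (match_weight n (x, y, i) (E ! p) \<phi>) * edge_moment n (del p E) \<phi>)" for \<phi>
    have "(\<Sum>p<length E. pairing n V G (x, y, i) E p) = (\<Sum>\<phi>\<in>Phi V n. of_real (wt n G \<phi>) *
        (\<Sum>p<length E. of_real (match_weight n (x, y, i) (E ! p) \<phi>) * edge_moment n (del p E) \<phi>)) / of_nat n"
      unfolding pairing_eq sum_divide_distrib[symmetric]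
      by (subst sum.swap) (simp add: sum_distrib_left mult_ac)
    then have "graph_sum n V G ?E - (\<Sum>p<length E. pairing n V G (x, y, i) E p) = (\<Sum>\<phi>\<in>Phi V n. of_real (wt n G \<phi>) * d \<phi>) / of_nat n"
      by (simp add: graph_sum_def d_def diff_divide_distrib[symmetric] sum_subtractf[symmetric] right_diff_distrib)
    also have "norm \<dots> \<le> (\<Sum>\<phi>\<in>Phi V n. wt n G \<phi> * norm (d \<phi>)) / real n"
      unfolding norm_divide norm_of_nat
      by (intro divide_right_mono order_trans[OF norm_sum] sum_mono) (auto simp: norm_mult wt_nonneg)
    also have "\<dots> \<le> (\<Sum>\<phi>\<in>Phi V n. wt n G \<phi> * (b * sqrt (\<epsilon> n i) * majorant n ?E \<phi>)) / real n"
      unfolding d_def b_def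
      by (intro divide_right_mono sum_mono mult_left_mono wt_nonneg step_pointwise[OF labels_J[OF G(2)] B(1) B(2)] admissible_Phi[OF G(2)]) auto
    also have "\<dots> = b * sqrt (\<epsilon> n i) * (\<Sum>\<phi>\<in>Phi V n. wt n G \<phi> * majorant n ?E \<phi>) / real n"
      by (simp add: sum_distrib_left mult_ac)
    also have "\<dots> \<le> b * sqrt (\<epsilon> n i) * (c * real n) / real n"
      by (intro divide_right_mono mult_left_mono c mult_nonneg_nonneg b0 s0) auto
    also have "\<dots> \<le> b * sqrt (\<epsilon> n i) * c" using b0 s0 c by (cases "n = 0") auto
    finally show ?thesis .
  qed
  moreover have "(\<lambda>n. b * sqrt (\<epsilon> n i) * c) \<longlonglongrightarrow> 0"
    using tendsto_real_sqrt[OF eps_lim[OF iJ]] by (intro tendsto_mult_left_zero tendsto_mult_right_zero) simp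
  ultimately show ?thesis by (rule tendsto_0_bound)
qed

lemma graph_sum_Nil: "graph_sum n V G [] = of_real ((\<Sum>\<phi>\<in>Phi V n. wt n G \<phi>) / real n)"
  by (simp add: graph_sum_def edge_moment_def entry_moment_Nil)


text \<open>Induction on the number of random edges: the first edge is expanded in the joint graph
  and in its own component. Pairings inside the component fall under the induction hypothesis. A
  pairing between \<open>A\<close> and \<open>B\<close> ties the two together, so that the edge from
  \<open>u\<close> to \<open>v\<close> is no longer a bridge and the term vanishes. Without random
  edges the claim comes from \<open>det_factor\<close>.\<close>

lemma graph_sum_factor:
  fixes A B :: "'v set"
  assumes "finite A" "finite B" "A \<inter> B = {}" "u \<in> A" "v \<in> B" "i \<in> J"
    and "graph_on A GA" "graph_on A (kernel_edges EA)" "conn A (ends GA \<union> ends EA)"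
    and "graph_on B GB" "graph_on B (kernel_edges EB)" "conn B (ends GB \<union> ends EB)"
  shows "(\<lambda>n. graph_sum n (A \<union> B) ((u, v, Some i) # GA @ GB) (EA @ EB) - graph_sum n A GA EA * graph_sum n B GB EB) \<longlonglongrightarrow> 0"
  using assms
proof (induction "length EA + length EB" arbitrary: GA GB EA EB rule: less_induct)
  case less
  note fin = less.prems(1-3) and uv = less.prems(4-6) and gA = less.prems(7-9) and gB = less.prems(10-12)
  let ?V = "A \<union> B" and ?G = "(u, v, Some i) # GA @ GB"
  have gU: "graph_on ?V GA" "graph_on ?V (kernel_edges EA)" "graph_on ?V GB" "graph_on ?V (kernel_edges EB)"
    using gA gB by (auto intro: graph_on_mono)
  have gG: "graph_on ?V ?G" using gU uv by auto
  have V0: "A \<noteq> {}" "B \<noteq> {}" using uv by auto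
  have cU: "conn ?V S" if cA: "conn A SA" "conn B SB"
    and sub: "SA \<subseteq> S" "SB \<subseteq> S" "(u, v) \<in> S" for S SA SB
  proof (rule connI)
    fix P :: "'v \<Rightarrow> bool" and p q assume P: "\<And>a b. (a, b) \<in> S \<Longrightarrow> P a = P b" and pq: "p \<in> ?V" "q \<in> ?V"
    have 1: "P z = P u" if "z \<in> A" for z by (rule connD[where P = P, OF cA(1)]) (use P sub that uv in auto)
    have 2: "P z = P v" if "z \<in> B" for z by (rule connD[where P = P, OF cA(2)]) (use P sub that uv in auto)
    have "P u = P v" by (rule P) (rule sub)
    then show "P p = P q" using 1 2 pq by auto
  qed
  have cT: "conn ?V (ends ?G \<union> ends (EA @ EB))" by (rule cU[OF gA(3) gB(3)]) auto
  consider (Nil) "EA = []" "EB = []" | (A) e E' where "EA = e # E'" | (B) e E' where "EA = []" "EB = e # E'"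
    by (cases EA; cases EB) auto
  then show ?case
  proof cases
    case Nil
    obtain tA where tA: "rooted_limit A GA u tA" using det_limit[of A GA u] gA fin uv Nil by auto
    obtain tB where tB: "rooted_limit B GB v tB" using det_limit[of B GB v] gB fin uv Nil by auto
    have 1: "(\<lambda>n. graph_sum n ?V ?G []) \<longlonglongrightarrow> of_real (tA * tB)"
    proof -
      have "(\<lambda>n. (\<Sum>\<phi>\<in>Phi ?V n. wt n (GA @ GB @ [(u, v, Some i)]) \<phi>) / real n) \<longlonglongrightarrow> tA * tB"
        by (rule det_factor[OF fin gA(1) gB(1) _ uv tA tB]) (use gA Nil in simp)
      moreover have "wt n (GA @ GB @ [(u, v, Some i)]) = wt n ?G" for n
        by (rule ext) (simp add: mult_ac)
      ultimately show ?thesis unfolding graph_sum_Nil by (intro tendsto_of_real) simp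
    qed
    have 2: "(\<lambda>n. graph_sum n A GA [] * graph_sum n B GB []) \<longlonglongrightarrow> of_real tA * of_real tB"
      unfolding graph_sum_Nil by (intro tendsto_mult tendsto_of_real rooted_limit_tendsto[OF tA] rooted_limit_tendsto[OF tB])
    show ?thesis using tendsto_diff[OF 1 2] Nil by simp
  next
    case (A e E')
    obtain x y l where e: "e = (x, y, l)" by (cases e)
    have xy: "x \<in> A" "y \<in> A" "l \<in> J" using gA A e by auto
    have s1: "(\<lambda>n. graph_sum n ?V ?G (EA @ EB) - (\<Sum>p<length (E' @ EB). pairing n ?V ?G (x, y, l) (E' @ EB) p)) \<longlonglongrightarrow> 0"
      unfolding A e append_Cons
      by (rule graph_sum_step) (use fin gG gU cT A e in simp_all)
    have s2: "(\<lambda>n. graph_sum n A GA EA - (\<Sum>p<length E'. pairing n A GA (x, y, l) E' p)) \<longlonglongrightarrow> 0"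
      unfolding A e by (rule graph_sum_step) (use fin gA A e in auto)
    have main: "(\<lambda>n. pairing n ?V ?G (x, y, l) (E' @ EB) p - pairing n A GA (x, y, l) E' p * graph_sum n B GB EB) \<longlonglongrightarrow> 0"
      if p: "p < length E'" for p
    proof -
      obtain x' y' i' where e': "E' ! p = (x', y', i')" by (cases "E' ! p")
      have inE: "(x', y', i') \<in> set E'" using e' p by (metis nth_mem)
      have xy': "x' \<in> A" "y' \<in> A" using inE gA(2) A by (auto simp: graph_on_def set_kernel_edges)
      have d: "del p (E' @ EB) = del p E' @ EB" using p by (simp add: del_def)
      have nth: "(E' @ EB) ! p = (x', y', i')" using p e' by (simp add: nth_append)
      \<comment> \<open>The two orientations differ only in which ends are identified;
        \<open>a\<close> and \<open>b\<close> treat both at once.\<close>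
      have IH: "(\<lambda>n. graph_sum n ?V ((x, y, Some l) # (x, a, None) # (y, b, None) # ?G) (del p (E' @ EB)) -
          graph_sum n A ((x, y, Some l) # (x, a, None) # (y, b, None) # GA) (del p E') * graph_sum n B GB EB) \<longlonglongrightarrow> 0"
        if ab: "(a, b) = (y', x') \<or> (a, b) = (x', y')" for a b
      proof -
        let ?GA = "(x, y, Some l) # (x, a, None) # (y, b, None) # GA"
        have "(\<lambda>n. graph_sum n ?V ((u, v, Some i) # ?GA @ GB) (del p E' @ EB) - graph_sum n A ?GA (del p E') * graph_sum n B GB EB) \<longlonglongrightarrow> 0"
        proof (rule less.hyps[OF _ fin uv _ _ _ gB])
          show "length (del p E') + length EB < length EA + length EB" using p A by (simp add: length_del)
          show "graph_on A ?GA" using gA xy xy' ab by auto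
          show "graph_on A (kernel_edges (del p E'))"
            by (rule graph_on_mono[OF gA(2) kernel_edges_mono]) (use A set_del[of p E'] in auto)
          show "conn A (ends ?GA \<union> ends (del p E'))"
          proof (rule connI)
            fix P :: "'v \<Rightarrow> bool" and q r assume P: "\<And>s t. (s, t) \<in> ends ?GA \<union> ends (del p E') \<Longrightarrow> P s = P t" and qr: "q \<in> A" "r \<in> A"
            show "P q = P r"
            proof (rule connD[where P = P, OF gA(3) _ qr])
              fix s t assume "(s, t) \<in> ends GA \<union> ends EA"
              moreover have "P x = P y" "P x = P a" "P y = P b" using P by auto
              moreover have "P s = P t" if "(s, t) \<in> ends GA" using that P by auto
              moreover have "P s = P t" if "(s, t) \<in> ends E'"
              proof -
                obtain j where "(s, t, j) \<in> set E'" using \<open>(s, t) \<in> ends E'\<close> by (auto simp: ends_def)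
                \<comment> \<open>The matched edge is gone, but its ends are still linked, through
                  the identifications and the kernel edge from \<open>x\<close> to
                  \<open>y\<close>.\<close>
                then have "(s, t, j) = (x', y', i') \<or> (s, t, j) \<in> set (del p E')" using split_del[OF p] e' by auto
                moreover have "P s = P t" if "(s, t, j) \<in> set (del p E')"
                  by (rule P) (use that in \<open>force simp: ends_def\<close>)
                ultimately show ?thesis using \<open>P x = P y\<close> \<open>P x = P a\<close> \<open>P y = P b\<close> ab by auto
              qed
              ultimately show "P s = P t" using A e by auto
            qed
          qed
        qed
        moreover have "graph_sum n ?V ((u, v, Some i) # ?GA @ GB) E'' = graph_sum n ?V ((x, y, Some l) # (x, a, None) # (y, b, None) # ?G) E''" for n E''
          by (rule graph_sum_mset) simp
        ultimately show ?thesis unfolding d by simp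
      qed
      show ?thesis
      proof (cases "i' = l")
        case True
        have "pairing n ?V ?G (x, y, l) (E' @ EB) p - pairing n A GA (x, y, l) E' p * graph_sum n B GB EB =
          (graph_sum n ?V ((x, y, Some l) # (x, y', None) # (y, x', None) # ?G) (del p (E' @ EB)) -
            graph_sum n A ((x, y, Some l) # (x, y', None) # (y, x', None) # GA) (del p E') * graph_sum n B GB EB) +
          of_real (\<beta> l) * (graph_sum n ?V ((x, y, Some l) # (x, x', None) # (y, y', None) # ?G) (del p (E' @ EB)) -
            graph_sum n A ((x, y, Some l) # (x, x', None) # (y, y', None) # GA) (del p E') * graph_sum n B GB EB)" for n
          unfolding pairing_def nth e' prod.case using True by (simp add: algebra_simps)
        then show ?thesis by (simp only:) (intro tendsto_add_zero tendsto_mult_right_zero IH; simp)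
      qed (simp add: pairing_def nth e')
    qed
    have cross: "(\<lambda>n. pairing n ?V ?G (x, y, l) (E' @ EB) p) \<longlonglongrightarrow> 0"
      if p: "length E' \<le> p" "p < length (E' @ EB)" for p
    proof -
      obtain x' y' i' where e': "(E' @ EB) ! p = (x', y', i')" by (cases "(E' @ EB) ! p")
      have inE: "(x', y', i') \<in> set EB" using e' p nth_mem[of "p - length E'" EB] by (simp add: nth_append)
      have xy': "x' \<in> B" "y' \<in> B" using inE gB(2) by (auto simp: graph_on_def set_kernel_edges)
      have d: "ends E' \<subseteq> ends (del p (E' @ EB))" "ends EB \<subseteq> insert (x', y') (ends (del p (E' @ EB)))"
      proof -
        have 1: "set E' \<subseteq> set (del p (E' @ EB))" using p by (simp add: del_def)
        have 2: "set EB \<subseteq> insert (x', y', i') (set (del p (E' @ EB)))"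
          using split_del[OF p(2)] unfolding e' set_append by (metis Un_upper2)
        show "ends E' \<subseteq> ends (del p (E' @ EB))" unfolding ends_def by (rule image_mono[OF 1])
        show "ends EB \<subseteq> insert (x', y') (ends (del p (E' @ EB)))"
          using image_mono[OF 2, of "\<lambda>(x, y, l). (x, y)"] by (simp add: ends_def)
      qed
      have gd: "graph_on ?V (kernel_edges (del p (E' @ EB)))"
      proof -
        have "graph_on ?V (kernel_edges (EA @ EB))" using gU by simp
        then show ?thesis by (rule graph_on_mono[OF _ kernel_edges_mono]) (use A set_del[of p "E' @ EB"] in auto)
      qed
      have "(\<lambda>n. graph_sum n ?V ((x, y, Some l) # (x, a, None) # (y, b, None) # ?G) (del p (E' @ EB))) \<longlonglongrightarrow> 0"
        if ab: "(a, b) = (y', x') \<or> (a, b) = (x', y')" for a b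
      proof -
        let ?H = "(x, y, Some l) # (x, a, None) # (y, b, None) # GA @ GB"
        have "(\<lambda>n. graph_sum n ?V ((u, v, Some i) # ?H) (del p (E' @ EB))) \<longlonglongrightarrow> 0"
        proof (rule graph_sum_redundant_edge)
          show "conn ?V (ends ?H \<union> ends (del p (E' @ EB)))"
          proof (rule connI)
            fix P :: "'v \<Rightarrow> bool" and q r assume P: "\<And>s t. (s, t) \<in> ends ?H \<union> ends (del p (E' @ EB)) \<Longrightarrow> P s = P t" and qr: "q \<in> ?V" "r \<in> ?V"
            have e: "P x = P y" "P x = P a" "P y = P b" using P by auto
            have "P z = P x" if "z \<in> A" for z
              by (rule connD[where P = P, OF gA(3) _ that xy(1)]) (use P d(1) e A \<open>e = (x, y, l)\<close> in auto)
            moreover have "P z = P a" if "z \<in> B" for z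
            proof (rule connD[where P = P, OF gB(3) _ that])
              fix s t assume "(s, t) \<in> ends GB \<union> ends EB"
              then have "(s, t) \<in> ends GB \<or> (s, t) = (x', y') \<or> (s, t) \<in> ends (del p (E' @ EB))" using d(2) by auto
              then show "P s = P t" using P e ab by auto
            qed (use ab xy' in auto)
            ultimately show "P q = P r" using qr e by auto
          qed
        qed (use fin gU gd uv xy xy' ab in auto)
        moreover have "graph_sum n ?V ((u, v, Some i) # ?H) E'' = graph_sum n ?V ((x, y, Some l) # (x, a, None) # (y, b, None) # ?G) E''" for n E''
          by (rule graph_sum_mset) simp
        ultimately show ?thesis by simp
      qed
      note lims = this
      show ?thesis
      proof (cases "i' = l")
        case True
        then show ?thesis unfolding pairing_def e' prod.case
          by simp (intro tendsto_add_zero tendsto_mult_right_zero lims; simp)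
      qed (simp add: pairing_def e')
    qed
    have sum_split: "(\<Sum>p<length (E' @ EB). pairing n ?V ?G (x, y, l) (E' @ EB) p) =
      (\<Sum>p<length E'. pairing n ?V ?G (x, y, l) (E' @ EB) p) + (\<Sum>p\<in>{length E'..<length (E' @ EB)}. pairing n ?V ?G (x, y, l) (E' @ EB) p)" for n
      by (subst sum.union_disjoint[symmetric]) (auto intro!: sum.cong)
    have bB: "Bseq (\<lambda>n. graph_sum n B GB EB)" by (rule graph_sum_bounded) (use fin V0 gB in auto)
    \<comment> \<open>The sum over \<open>B\<close> is bounded, so the expansion error of the
      \<open>A\<close>-component may be multiplied by it; the four null sequences then recombine to
      the claim.\<close>
    have "(\<lambda>n. (graph_sum n ?V ?G (EA @ EB) - (\<Sum>p<length (E' @ EB). pairing n ?V ?G (x, y, l) (E' @ EB) p)) +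
        (\<Sum>p<length E'. pairing n ?V ?G (x, y, l) (E' @ EB) p - pairing n A GA (x, y, l) E' p * graph_sum n B GB EB) +
        (\<Sum>p\<in>{length E'..<length (E' @ EB)}. pairing n ?V ?G (x, y, l) (E' @ EB) p) -
        (graph_sum n A GA EA - (\<Sum>p<length E'. pairing n A GA (x, y, l) E' p)) * graph_sum n B GB EB) \<longlonglongrightarrow> 0 + 0 + 0 - 0"
      by (intro tendsto_add tendsto_diff s1 tendsto_null_sum main cross null_mult_Bseq[OF s2 bB]) auto
    then show ?thesis unfolding sum_split by (simp add: sum_subtractf sum_distrib_right sum_distrib_left algebra_simps)
  next
    case (B e E')
    obtain x y l where e: "e = (x, y, l)" by (cases e)
    have xy: "x \<in> B" "y \<in> B" "l \<in> J" using gB B e by auto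
    have s1: "(\<lambda>n. graph_sum n ?V ?G EB - (\<Sum>p<length E'. pairing n ?V ?G (x, y, l) E' p)) \<longlonglongrightarrow> 0"
      unfolding B e
      by (rule graph_sum_step) (use fin gG gU cT B e in simp_all)
    have s2: "(\<lambda>n. graph_sum n B GB EB - (\<Sum>p<length E'. pairing n B GB (x, y, l) E' p)) \<longlonglongrightarrow> 0"
      unfolding B e by (rule graph_sum_step) (use fin gB B e in auto)
    have main: "(\<lambda>n. pairing n ?V ?G (x, y, l) E' p - graph_sum n A GA [] * pairing n B GB (x, y, l) E' p) \<longlonglongrightarrow> 0"
      if p: "p < length E'" for p
    proof -
      obtain x' y' i' where e': "E' ! p = (x', y', i')" by (cases "E' ! p")
      have inE: "(x', y', i') \<in> set E'" using e' p by (metis nth_mem)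
      have xy': "x' \<in> B" "y' \<in> B" using inE gB(2) B by (auto simp: graph_on_def set_kernel_edges)
      have IH: "(\<lambda>n. graph_sum n ?V ((x, y, Some l) # (x, a, None) # (y, b, None) # ?G) (del p E') -
          graph_sum n A GA [] * graph_sum n B ((x, y, Some l) # (x, a, None) # (y, b, None) # GB) (del p E')) \<longlonglongrightarrow> 0"
        if ab: "(a, b) = (y', x') \<or> (a, b) = (x', y')" for a b
      proof -
        let ?GB = "(x, y, Some l) # (x, a, None) # (y, b, None) # GB"
        have "(\<lambda>n. graph_sum n ?V ((u, v, Some i) # GA @ ?GB) ([] @ del p E') - graph_sum n A GA [] * graph_sum n B ?GB (del p E')) \<longlonglongrightarrow> 0"
        proof (rule less.hyps[OF _ fin uv gA(1)])
          show "length ([] :: ('v \<times> 'v \<times> 'i) list) + length (del p E') < length EA + length EB" using p B by (simp add: length_del)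
          show "graph_on A (kernel_edges [])" by simp
          show "conn A (ends GA \<union> ends [])" using gA(3) B by simp
          show "graph_on B ?GB" using gB xy xy' ab by auto
          show "graph_on B (kernel_edges (del p E'))"
            by (rule graph_on_mono[OF gB(2) kernel_edges_mono]) (use B set_del[of p E'] in auto)
          show "conn B (ends ?GB \<union> ends (del p E'))"
          proof (rule connI)
            fix P :: "'v \<Rightarrow> bool" and q r assume P: "\<And>s t. (s, t) \<in> ends ?GB \<union> ends (del p E') \<Longrightarrow> P s = P t" and qr: "q \<in> B" "r \<in> B"
            show "P q = P r"
            proof (rule connD[where P = P, OF gB(3) _ qr])
              fix s t assume "(s, t) \<in> ends GB \<union> ends EB"
              moreover have "P x = P y" "P x = P a" "P y = P b" using P by auto
              moreover have "P s = P t" if "(s, t) \<in> ends GB" using that P by auto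
              moreover have "P s = P t" if "(s, t) \<in> ends E'"
              proof -
                obtain j where "(s, t, j) \<in> set E'" using \<open>(s, t) \<in> ends E'\<close> by (auto simp: ends_def)
                then have "(s, t, j) = (x', y', i') \<or> (s, t, j) \<in> set (del p E')" using split_del[OF p] e' by auto
                moreover have "P s = P t" if "(s, t, j) \<in> set (del p E')"
                  by (rule P) (use that in \<open>force simp: ends_def\<close>)
                ultimately show ?thesis using \<open>P x = P y\<close> \<open>P x = P a\<close> \<open>P y = P b\<close> ab by auto
              qed
              ultimately show "P s = P t" using B e by auto
            qed
          qed
        qed
        moreover have "graph_sum n ?V ((u, v, Some i) # GA @ ?GB) E'' = graph_sum n ?V ((x, y, Some l) # (x, a, None) # (y, b, None) # ?G) E''" for n E''
          by (rule graph_sum_mset) simp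
        ultimately show ?thesis by simp
      qed
      show ?thesis
      proof (cases "i' = l")
        case True
        have "pairing n ?V ?G (x, y, l) E' p - graph_sum n A GA [] * pairing n B GB (x, y, l) E' p =
          (graph_sum n ?V ((x, y, Some l) # (x, y', None) # (y, x', None) # ?G) (del p E') -
            graph_sum n A GA [] * graph_sum n B ((x, y, Some l) # (x, y', None) # (y, x', None) # GB) (del p E')) +
          of_real (\<beta> l) * (graph_sum n ?V ((x, y, Some l) # (x, x', None) # (y, y', None) # ?G) (del p E') -
            graph_sum n A GA [] * graph_sum n B ((x, y, Some l) # (x, x', None) # (y, y', None) # GB) (del p E'))" for n
          unfolding pairing_def e' prod.case using True by (simp add: algebra_simps)
        then show ?thesis by (simp only:) (intro tendsto_add_zero tendsto_mult_right_zero IH; simp)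
      qed (simp add: pairing_def e')
    qed
    have bA: "Bseq (\<lambda>n. graph_sum n A GA EA)" by (rule graph_sum_bounded) (use fin V0 gA in auto)
    have "(\<lambda>n. (graph_sum n ?V ?G EB - (\<Sum>p<length E'. pairing n ?V ?G (x, y, l) E' p)) +
        (\<Sum>p<length E'. pairing n ?V ?G (x, y, l) E' p - graph_sum n A GA [] * pairing n B GB (x, y, l) E' p) -
        (graph_sum n B GB EB - (\<Sum>p<length E'. pairing n B GB (x, y, l) E' p)) * graph_sum n A GA EA) \<longlonglongrightarrow> 0 + 0 - 0"
      by (intro tendsto_add tendsto_diff s1 tendsto_null_sum main null_mult_Bseq[OF s2 bA]) auto
    then show ?thesis using B by (simp add: sum_subtractf sum_distrib_left algebra_simps)
  qed
qed

end

section \<open>Words and paths\<close>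

text \<open>A word in \<^typ>\<open>'i + 'i\<close> stands for a product of the matrices (letters \<^const>\<open>Inl\<close>) and of their
  diagonal row sum matrices (letters \<^const>\<open>Inr\<close>). Its entries are sums over a path whose spine
  vertices are \<open>Inl a, Inl (a + 1), \<dots>\<close>; a row sum at \<open>Inl q\<close> contributes the pendant vertex \<open>Inr q\<close>.\<close>

fun path_vertices :: "nat \<Rightarrow> ('i + 'i) list \<Rightarrow> (nat + nat) set" where
  "path_vertices a [] = {Inl a}"
| "path_vertices a (Inl i # w) = insert (Inl a) (path_vertices (Suc a) w)"
| "path_vertices a (Inr i # w) = insert (Inl a) (insert (Inr a) (path_vertices (Suc a) w))"

text \<open>A degree letter is a diagonal matrix and does not move the row index, so its two spine
  vertices are identified.\<close>

fun path_constraints :: "nat \<Rightarrow> ('i + 'i) list \<Rightarrow> ((nat + nat) \<times> (nat + nat) \<times> 'i option) list" where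
  "path_constraints a [] = []"
| "path_constraints a (Inl i # w) = path_constraints (Suc a) w"
| "path_constraints a (Inr i # w) = (Inl a, Inl (Suc a), None) # path_constraints (Suc a) w"

fun path_edges :: "nat \<Rightarrow> ('i + 'i) list \<Rightarrow> ((nat + nat) \<times> (nat + nat) \<times> 'i) list" where
  "path_edges a [] = []"
| "path_edges a (Inl i # w) = (Inl a, Inl (Suc a), i) # path_edges (Suc a) w"
| "path_edges a (Inr i # w) = (Inl a, Inr a, i) # path_edges (Suc a) w"

lemma finite_path_vertices: "finite (path_vertices a w)"
  by (induction a w rule: path_vertices.induct) auto

lemma path_vertices_Inl: "Inl q \<in> path_vertices a w \<longleftrightarrow> a \<le> q \<and> q \<le> a + length w"
  by (induction a w rule: path_vertices.induct) auto

lemma path_vertices_Inr: "Inr q \<in> path_vertices a w \<Longrightarrow> a \<le> q \<and> q < a + length w"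
  by (induction a w rule: path_vertices.induct) auto

lemma length_path_edges [simp]: "length (path_edges a w) = length w"
  by (induction a w rule: path_edges.induct) auto

lemma path_edges_append: "path_edges a (u @ v) = path_edges a u @ path_edges (a + length u) v"
  by (induction a u rule: path_edges.induct) auto

lemma path_constraints_append: "path_constraints a (u @ v) = path_constraints a u @ path_constraints (a + length u) v"
  by (induction a u rule: path_constraints.induct) auto

lemma path_vertices_append: "path_vertices a (u @ v) = path_vertices a u \<union> path_vertices (a + length u) v"
proof (induction a u rule: path_vertices.induct)
  case (1 a)
  show ?case using path_vertices_Inl[of a a v] by auto
qed auto

text \<open>Connectivity of a word graph in the form in which \<open>connI\<close> is used, with the
  initial spine vertex as reference. It also serves for parts of a larger graph.\<close>

lemma path_const:
  assumes "\<And>x y. (x, y) \<in> ends (path_constraints a w) \<union> ends (path_edges a w) \<Longrightarrow> P x = P y" "z \<in> path_vertices a w"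
  shows "P z = (P (Inl a) :: bool)"
  using assms
proof (induction a w arbitrary: z rule: path_vertices.induct)
  case (2 a i w)
  have "P z' = P (Inl (Suc a))" if "z' \<in> path_vertices (Suc a) w" for z'
    by (rule "2.IH") (use "2.prems" that in auto)
  moreover have "P (Inl a) = P (Inl (Suc a))" by (rule "2.prems"(1)) simp
  ultimately show ?case using "2.prems"(2) by auto
next
  case (3 a i w)
  have "P z' = P (Inl (Suc a))" if "z' \<in> path_vertices (Suc a) w" for z'
    by (rule "3.IH") (use "3.prems" that in auto)
  moreover have "P (Inl a) = P (Inl (Suc a))" "P (Inl a) = P (Inr a)" by (rule "3.prems"(1), simp)+
  ultimately show ?case using "3.prems"(2) by (simp, metis)
qed auto

section \<open>Word graphs and elimination of constrained vertices\<close>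

context wigner_moments begin

lemma graph_on_path_constraints: "graph_on (path_vertices a w) (path_constraints a w)"
  by (induction a w rule: path_constraints.induct) (auto simp: path_vertices_Inl intro: graph_on_mono)

lemma graph_on_path_edges: "w \<in> lists (J <+> J) \<Longrightarrow> graph_on (path_vertices a w) (kernel_edges (path_edges a w))"
  by (induction a w rule: path_edges.induct) (auto simp: path_vertices_Inl intro: graph_on_mono)

lemma graph_sum_flip: "graph_sum n V ((x, y, l) # G) E = graph_sum n V ((y, x, l) # G) E"
  by (simp add: graph_sum_def edge_kernel_sym[of n l])

lemma edge_moment_cong: "graph_on V (kernel_edges E) \<Longrightarrow> (\<And>x. x \<in> V \<Longrightarrow> \<phi> x = \<psi> x) \<Longrightarrow> edge_moment n E \<phi> = edge_moment n E \<psi>"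
  unfolding edge_moment_def by (intro arg_cong[where f = "entry_moment n"] map_cong refl) (auto simp: edge_index_def graph_on_def set_kernel_edges)

text \<open>A vertex that is only tied by equalities is summed out with a single term. This removes
  the starting vertex of a path after a pairing has merged it into the second half.\<close>

lemma graph_sum_elim:
  assumes "finite V" "v \<notin> V" "x \<in> V" "y \<in> V" "graph_on V G" "graph_on V (kernel_edges E)"
  shows "graph_sum n (insert v V) ((v, x, None) # (v, y, None) # G) E = graph_sum n V ((x, y, None) # G) E"
proof -
  have "(\<Sum>\<phi>\<in>Phi (insert v V) n. of_real (wt n ((v, x, None) # (v, y, None) # G) \<phi>) * edge_moment n E \<phi>) =
    (\<Sum>\<phi>\<in>Phi V n. \<Sum>k<n. if k = \<phi> x then of_real (wt n ((x, y, None) # G) \<phi>) * edge_moment n E \<phi> else 0)"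
  proof (subst sum_Phi_insert[OF assms(1,2)], intro sum.cong refl)
    fix \<phi> k
    have "edge_moment n E (\<phi>(v := k)) = edge_moment n E \<phi>" by (rule edge_moment_cong[OF assms(6)]) (use assms in auto)
    moreover have "wt n G (\<phi>(v := k)) = wt n G \<phi>" by (rule wt_fun_upd[OF assms(5,2)])
    moreover have "x \<noteq> v" "y \<noteq> v" using assms by auto
    ultimately show "of_real (wt n ((v, x, None) # (v, y, None) # G) (\<phi>(v := k))) * edge_moment n E (\<phi>(v := k)) =
      (if k = \<phi> x then of_real (wt n ((x, y, None) # G) \<phi>) * edge_moment n E \<phi> else 0)"
      by simp
  qed
  also have "\<dots> = (\<Sum>\<phi>\<in>Phi V n. of_real (wt n ((x, y, None) # G) \<phi>) * edge_moment n E \<phi>)"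
    by (intro sum.cong refl) (use Phi_less[OF _ assms(3)] in simp)
  finally show ?thesis by (simp only: graph_sum_def)
qed

end

text \<open>Two graph forms of the same trace. \<open>word_moment_path\<close> closes the path of a
  word by an equality of its end points; the offset is free so that subwords can be recognised in
  place. \<open>word_moment_star\<close> is for words in degree matrices: all spine vertices
  coincide and form the centre of a star, whose leaves may carry arbitrary distinct names.\<close>

locale word_moments = wigner_moments J K \<epsilon> entry_moment \<beta> C
  for J :: "'i set" and K :: "nat \<Rightarrow> 'i \<Rightarrow> nat \<Rightarrow> nat \<Rightarrow> real" and \<epsilon> :: "nat \<Rightarrow> 'i \<Rightarrow> real"
    and entry_moment :: "nat \<Rightarrow> ('i \<times> nat \<times> nat) list \<Rightarrow> complex" and \<beta> :: "'i \<Rightarrow> real" and C :: "'i \<Rightarrow> nat \<Rightarrow> real" +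
  fixes word_moment :: "nat \<Rightarrow> ('i + 'i) list \<Rightarrow> complex"
  assumes word_moment_path: "w \<in> lists (J <+> J) \<Longrightarrow>
      word_moment n w = graph_sum n (path_vertices a w) ((Inl a, Inl (a + length w), None) # path_constraints a w) (path_edges a w)"
    and word_moment_star: "\<lbrakk>distinct (map fst ls); snd ` set ls \<subseteq> J\<rbrakk> \<Longrightarrow> word_moment n (map (Inr \<circ> snd) ls) =
      graph_sum n (insert (Inl 0) (Inr ` fst ` set ls)) [] (map (\<lambda>(l, i). (Inl 0 :: nat + nat, Inr l, i)) ls)"
    and word_moment_trace: "\<lbrakk>u \<in> lists (J <+> J); v \<in> lists (J <+> J)\<rbrakk> \<Longrightarrow> word_moment n (u @ v) = word_moment n (v @ u)"
    and word_moment_Nil: "n > 0 \<Longrightarrow> word_moment n [] = 1"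
begin

text \<open>Paired crosswise with a matrix letter, the edge from 0 to 1 identifies 0 with
  \<open>Suc (Suc p)\<close> and 1 with \<open>Suc p\<close>: the cycle is pinched into the cycles
  of the subwords before and after the letter, joined by a bridge. Paired straight, or with the
  pendant edge of a degree letter, the rest stays connected and the kernel edge is
  redundant.\<close>

lemma pairing_letter:
  assumes w: "w \<in> lists (J <+> J)" "i \<in> J" and p: "p < length w"
  shows "(\<lambda>n. pairing n (path_vertices 0 (Inl i # w)) ((Inl 0, Inl (length (Inl i # w)), None) # path_constraints 0 (Inl i # w))
      (Inl 0, Inl 1, i) (path_edges 1 w) p - (if w ! p = Inl i then word_moment n (take p w) * word_moment n (drop (Suc p) w) else 0)) \<longlonglongrightarrow> 0"
proof -
  define A where "A = take p w"
  define B where "B = drop (Suc p) w"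
  obtain c where c: "w ! p = c" by simp
  have wAB: "w = A @ c # B" "length A = p" using p c by (auto simp: A_def B_def id_take_nth_drop)
  have AB: "A \<in> lists (J <+> J)" "B \<in> lists (J <+> J)" using w(1) wAB by auto
  \<comment> \<open>\<open>w\<close> starts at spine vertex 1, so its matrix letter at position
    \<open>p\<close> joins the vertices \<open>Suc p\<close> and \<open>?q\<close>.\<close>
  let ?q = "Suc (Suc p)" and ?m = "Suc (length w)"
  let ?V0 = "path_vertices 0 (Inl i # w)" and ?G0 = "(Inl 0, Inl (length (Inl i # w)), None) # path_constraints 0 (Inl i # w)"
  have m: "?q + length B = ?m" using wAB by simp
  have E: "path_edges 1 w = path_edges 1 A @ path_edges (Suc p) [c] @ path_edges ?q B"
    using wAB by (cases c) (simp_all add: path_edges_append)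
  have d: "del p (path_edges 1 w) = path_edges 1 A @ path_edges ?q B"
    unfolding E using wAB by (cases c) (simp_all add: del_def)
  have inV: "Inl 1 \<in> path_vertices 1 A" "Inl (Suc p) \<in> path_vertices 1 A" "Inl ?q \<in> path_vertices ?q B" "Inl ?m \<in> path_vertices ?q B"
    using wAB m by (auto simp: path_vertices_Inl)
  have gA: "graph_on (path_vertices 1 A) (path_constraints 1 A)" "graph_on (path_vertices 1 A) (kernel_edges (path_edges 1 A))"
    and gB: "graph_on (path_vertices ?q B) (path_constraints ?q B)" "graph_on (path_vertices ?q B) (kernel_edges (path_edges ?q B))"
    using graph_on_path_constraints graph_on_path_edges AB by blast+
  show ?thesis
  proof (cases c)
    case (Inl j)
    have nth: "path_edges 1 w ! p = (Inl (Suc p), Inl ?q, j)"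
      unfolding E using wAB Inl by (simp add: nth_append)
    have V: "?V0 = path_vertices 1 A \<union> insert (Inl 0) (path_vertices ?q B)"
      using inV Inl wAB path_vertices_append[of 1 A "c # B"] by auto
    have G: "path_constraints 0 (Inl i # w) = path_constraints 1 A @ path_constraints ?q B" using wAB Inl path_constraints_append[of 1 A "c # B"] by simp
    show ?thesis
    proof (cases "j = i")
      case False
      then show ?thesis using nth c Inl by (simp add: pairing_def)
    next
      case True
      let ?H = "(Inl 0, Inl ?m, None) # path_constraints 1 A @ path_constraints ?q B"
      have 1: "(\<lambda>n. graph_sum n ?V0 ((Inl 0, Inl 1, Some i) # (Inl 0, Inl ?q, None) # (Inl 1, Inl (Suc p), None) # ?H) (path_edges 1 A @ path_edges ?q B)
        - word_moment n A * word_moment n B) \<longlonglongrightarrow> 0"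
      proof -
        let ?GA = "(Inl 1, Inl (1 + length A), None) # path_constraints 1 A"
        let ?GB = "(Inl 0, Inl ?q, None) # (Inl 0, Inl (?q + length B), None) # path_constraints ?q B"
        have "(\<lambda>n. graph_sum n (path_vertices 1 A \<union> insert (Inl 0) (path_vertices ?q B)) ((Inl 1, Inl 0, Some i) # ?GA @ ?GB) (path_edges 1 A @ path_edges ?q B) -
           graph_sum n (path_vertices 1 A) ?GA (path_edges 1 A) * graph_sum n (insert (Inl 0) (path_vertices ?q B)) ?GB (path_edges ?q B)) \<longlonglongrightarrow> 0"
        proof (rule graph_sum_factor)
          show "path_vertices 1 A \<inter> insert (Inl 0) (path_vertices ?q B) = {}"
          proof -
            have "z \<notin> insert (Inl 0) (path_vertices ?q B)" if "z \<in> path_vertices 1 A" for z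
              using that wAB(2) by (cases z) (auto simp: path_vertices_Inl dest!: path_vertices_Inr)
            then show ?thesis by blast
          qed
          show "graph_on (path_vertices 1 A) ?GA" using gA inV wAB by simp
          show "graph_on (insert (Inl 0) (path_vertices ?q B)) ?GB"
            using gB(1) inV m by (auto intro: graph_on_mono)
          show "graph_on (insert (Inl 0) (path_vertices ?q B)) (kernel_edges (path_edges ?q B))"
            using gB(2) by (auto intro: graph_on_mono)
          show "conn (path_vertices 1 A) (ends ?GA \<union> ends (path_edges 1 A))"
          proof (rule connI)
            fix P :: "nat + nat \<Rightarrow> bool" and x y
            assume P: "\<And>a b. (a, b) \<in> ends ?GA \<union> ends (path_edges 1 A) \<Longrightarrow> P a = P b" and xy: "x \<in> path_vertices 1 A" "y \<in> path_vertices 1 A"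
            show "P x = P y"
              using path_const[of 1 A P, OF _ xy(1)] path_const[of 1 A P, OF _ xy(2)] P by simp
          qed
          show "conn (insert (Inl 0) (path_vertices ?q B)) (ends ?GB \<union> ends (path_edges ?q B))"
          proof (rule connI)
            fix P :: "nat + nat \<Rightarrow> bool" and x y
            assume P: "\<And>a b. (a, b) \<in> ends ?GB \<union> ends (path_edges ?q B) \<Longrightarrow> P a = P b"
              and xy: "x \<in> insert (Inl 0) (path_vertices ?q B)" "y \<in> insert (Inl 0) (path_vertices ?q B)"
            have "P z = P (Inl ?q)" if "z \<in> path_vertices ?q B" for z
              by (rule path_const[of ?q B P, OF _ that]) (rule P, auto)
            moreover have "P (Inl 0) = P (Inl ?q)" using P by simp
            ultimately show "P x = P y" using xy by auto
          qed
        qed (use finite_path_vertices inV w(2) gA in auto)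
        moreover have "graph_sum n (path_vertices 1 A) ?GA (path_edges 1 A) = word_moment n A" for n using word_moment_path[OF AB(1), of n 1] by simp
        \<comment> \<open>Eliminating vertex 0 merges its two equalities into the one that closes
          the path of \<open>B\<close>.\<close>
        moreover have "graph_sum n (insert (Inl 0) (path_vertices ?q B)) ?GB (path_edges ?q B) = word_moment n B" for n
          unfolding word_moment_path[OF AB(2), of n ?q] m
          by (rule graph_sum_elim) (use finite_path_vertices inV gB in \<open>auto simp: path_vertices_Inl\<close>)
        moreover have "graph_sum n ?V0 ((Inl 0, Inl 1, Some i) # (Inl 0, Inl ?q, None) # (Inl 1, Inl (Suc p), None) # ?H) (path_edges 1 A @ path_edges ?q B) =
          graph_sum n (path_vertices 1 A \<union> insert (Inl 0) (path_vertices ?q B)) ((Inl 1, Inl 0, Some i) # ?GA @ ?GB) (path_edges 1 A @ path_edges ?q B)" for n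
          unfolding V m graph_sum_flip[of n _ "Inl 0" "Inl 1"] by (rule graph_sum_mset) (simp add: wAB(2))
        ultimately show ?thesis by simp
      qed
      have 2: "(\<lambda>n. graph_sum n ?V0 ((Inl 0, Inl 1, Some i) # (Inl 0, Inl (Suc p), None) # (Inl 1, Inl ?q, None) # ?H) (path_edges 1 A @ path_edges ?q B)) \<longlonglongrightarrow> 0"
      proof (rule graph_sum_redundant_edge)
        show "conn ?V0 (ends ((Inl 0, Inl (Suc p), None) # (Inl 1, Inl ?q, None) # ?H) \<union> ends (path_edges 1 A @ path_edges ?q B))"
        proof (rule connI)
          fix P :: "nat + nat \<Rightarrow> bool" and x y
          assume P: "\<And>a b. (a, b) \<in> ends ((Inl 0, Inl (Suc p), None) # (Inl 1, Inl ?q, None) # ?H) \<union> ends (path_edges 1 A @ path_edges ?q B) \<Longrightarrow> P a = P b"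
            and xy: "x \<in> ?V0" "y \<in> ?V0"
          have a: "P z = P (Inl 1)" if "z \<in> path_vertices 1 A" for z
            by (rule path_const[of 1 A P, OF _ that]) (rule P, auto)
          have "P z = P (Inl ?q)" if "z \<in> path_vertices ?q B" for z
            by (rule path_const[of ?q B P, OF _ that]) (rule P, auto)
          moreover have "P (Inl 1) = P (Inl ?q)" "P (Inl 0) = P (Inl (Suc p))" using P by simp_all
          moreover have "P (Inl (Suc p)) = P (Inl 1)" using a inV by blast
          ultimately show "P x = P y" using xy a unfolding V by auto
        qed
        show "graph_on ?V0 ((Inl 0, Inl (Suc p), None) # (Inl 1, Inl ?q, None) # ?H)"
          unfolding V using inV gA gB by (auto intro: graph_on_mono)
        show "graph_on ?V0 (kernel_edges (path_edges 1 A @ path_edges ?q B))"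
          unfolding V using gA gB by (auto intro: graph_on_mono)
      qed (use finite_path_vertices inV w(2) V in auto)
      have "pairing n ?V0 ?G0 (Inl 0, Inl 1, i) (path_edges 1 w) p - word_moment n A * word_moment n B =
        (graph_sum n ?V0 ((Inl 0, Inl 1, Some i) # (Inl 0, Inl ?q, None) # (Inl 1, Inl (Suc p), None) # ?H) (path_edges 1 A @ path_edges ?q B) - word_moment n A * word_moment n B) +
        of_real (\<beta> i) * graph_sum n ?V0 ((Inl 0, Inl 1, Some i) # (Inl 0, Inl (Suc p), None) # (Inl 1, Inl ?q, None) # ?H) (path_edges 1 A @ path_edges ?q B)" for n
        unfolding pairing_def nth d prod.case G using True by simp
      then have "(\<lambda>n. pairing n ?V0 ?G0 (Inl 0, Inl 1, i) (path_edges 1 w) p - word_moment n A * word_moment n B) \<longlonglongrightarrow> 0"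
        by (simp only:) (intro tendsto_add_zero tendsto_mult_right_zero 1 2)
      then show ?thesis using c Inl True by (simp add: A_def B_def)
    qed
  next
    case (Inr j)
    have nth: "path_edges 1 w ! p = (Inl (Suc p), Inr (Suc p), j)"
      unfolding E using wAB Inr by (simp add: nth_append)
    have V: "?V0 = insert (Inl 0) (insert (Inr (Suc p)) (path_vertices 1 A \<union> path_vertices ?q B))"
      using inV Inr wAB path_vertices_append[of 1 A "c # B"] by auto
    have G: "path_constraints 0 (Inl i # w) = path_constraints 1 A @ (Inl (Suc p), Inl ?q, None) # path_constraints ?q B"
      using wAB Inr path_constraints_append[of 1 A "c # B"] by simp
    show ?thesis
    proof (cases "j = i")
      case False
      then show ?thesis using nth c Inr by (simp add: pairing_def)
    next
      case True
      \<comment> \<open>The equality of the degree letter and the closing equality connect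
        everything but the pendant vertex, which is reached through \<open>s\<close> or
        \<open>t\<close>.\<close>
      have red: "(\<lambda>n. graph_sum n ?V0 ((Inl 0, Inl 1, Some i) # (Inl 0, s, None) # (Inl 1, t, None) # ?G0) (path_edges 1 A @ path_edges ?q B)) \<longlonglongrightarrow> 0"
        if st: "(s, t) = (Inr (Suc p), Inl (Suc p)) \<or> (s, t) = (Inl (Suc p), Inr (Suc p))" for s t
      proof (rule graph_sum_redundant_edge)
        show "conn ?V0 (ends ((Inl 0, s, None) # (Inl 1, t, None) # ?G0) \<union> ends (path_edges 1 A @ path_edges ?q B))"
        proof (rule connI)
          fix P :: "nat + nat \<Rightarrow> bool" and x y
          assume P: "\<And>a b. (a, b) \<in> ends ((Inl 0, s, None) # (Inl 1, t, None) # ?G0) \<union> ends (path_edges 1 A @ path_edges ?q B) \<Longrightarrow> P a = P b"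
            and xy: "x \<in> ?V0" "y \<in> ?V0"
          have a: "P z = P (Inl 1)" if "z \<in> path_vertices 1 A" for z
            by (rule path_const[of 1 A P, OF _ that]) (use P G in auto)
          have b: "P z = P (Inl ?q)" if "z \<in> path_vertices ?q B" for z
            by (rule path_const[of ?q B P, OF _ that]) (use P G in auto)
          have e: "P (Inl 0) = P s" "P (Inl 1) = P t" "P (Inl (Suc p)) = P (Inl ?q)" "P (Inl 0) = P (Inl ?m)"
            by (rule P, use G in simp)+
          have "P (Inl (Suc p)) = P (Inl 1)" "P (Inl ?m) = P (Inl ?q)" using a b inV by blast+
          then show "P x = P y" using xy a b e st unfolding V by auto
        qed
        have "graph_on ?V0 (path_constraints 0 (Inl i # w))"
          unfolding V G using inV gA gB by (auto intro: graph_on_mono)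
        then show "graph_on ?V0 ((Inl 0, s, None) # (Inl 1, t, None) # ?G0)"
          using inV st V by auto
        show "graph_on ?V0 (kernel_edges (path_edges 1 A @ path_edges ?q B))"
          unfolding V using gA gB by (auto intro: graph_on_mono)
      qed (use finite_path_vertices inV w(2) V in auto)
      have "(\<lambda>n. pairing n ?V0 ?G0 (Inl 0, Inl 1, i) (path_edges 1 w) p) \<longlonglongrightarrow> 0"
        unfolding pairing_def nth d prod.case using True
        by (simp only: if_True simp_thms) (intro tendsto_add_zero tendsto_mult_right_zero red; simp)
      then show ?thesis using c Inr by simp
    qed
  qed
qed

lemma word_moment_letter:
  assumes w: "w \<in> lists (J <+> J)" "i \<in> J"
  shows "(\<lambda>n. word_moment n (Inl i # w) - (\<Sum>p | p < length w \<and> w ! p = Inl i. word_moment n (take p w) * word_moment n (drop (Suc p) w))) \<longlonglongrightarrow> 0"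
proof -
  let ?V0 = "path_vertices 0 (Inl i # w)" and ?G0 = "(Inl 0, Inl (length (Inl i # w)), None) # path_constraints 0 (Inl i # w)"
  have iw: "Inl i # w \<in> lists (J <+> J)" using w by auto
  have gE: "graph_on ?V0 (kernel_edges ((Inl 0, Inl 1, i) # path_edges 1 w))" using graph_on_path_edges[OF iw, of 0] by simp
  have "(\<lambda>n. graph_sum n ?V0 ?G0 ((Inl 0, Inl 1, i) # path_edges 1 w) - (\<Sum>p<length (path_edges 1 w). pairing n ?V0 ?G0 (Inl 0, Inl 1, i) (path_edges 1 w) p)) \<longlonglongrightarrow> 0"
  proof (rule graph_sum_step[OF finite_path_vertices _ gE])
    show "graph_on ?V0 ?G0" using graph_on_path_constraints[of 0 "Inl i # w"] by (simp add: path_vertices_Inl)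
    show "conn ?V0 (ends ?G0 \<union> ends ((Inl 0, Inl 1, i) # path_edges 1 w))"
    proof (rule connI)
      fix P :: "nat + nat \<Rightarrow> bool" and x y
      assume P: "\<And>a b. (a, b) \<in> ends ?G0 \<union> ends ((Inl 0, Inl 1, i) # path_edges 1 w) \<Longrightarrow> P a = P b" and xy: "x \<in> ?V0" "y \<in> ?V0"
      have "P z = P (Inl 0)" if "z \<in> ?V0" for z
        by (rule path_const[of 0 "Inl i # w" P, OF _ that]) (rule P, auto)
      then show "P x = P y" using xy by metis
    qed
  qed
  moreover have "(\<lambda>n. \<Sum>p<length w. pairing n ?V0 ?G0 (Inl 0, Inl 1, i) (path_edges 1 w) p -
      (if w ! p = Inl i then word_moment n (take p w) * word_moment n (drop (Suc p) w) else 0)) \<longlonglongrightarrow> 0"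
    by (intro tendsto_null_sum pairing_letter w) simp
  ultimately have "(\<lambda>n. (graph_sum n ?V0 ?G0 ((Inl 0, Inl 1, i) # path_edges 1 w) - (\<Sum>p<length w. pairing n ?V0 ?G0 (Inl 0, Inl 1, i) (path_edges 1 w) p)) +
     (\<Sum>p<length w. pairing n ?V0 ?G0 (Inl 0, Inl 1, i) (path_edges 1 w) p -
      (if w ! p = Inl i then word_moment n (take p w) * word_moment n (drop (Suc p) w) else 0))) \<longlonglongrightarrow> 0"
    unfolding length_path_edges by (rule tendsto_add_zero)
  moreover have "word_moment n (Inl i # w) = graph_sum n ?V0 ?G0 ((Inl 0, Inl 1, i) # path_edges 1 w)" for n
    using word_moment_path[OF iw, of n 0] by simp
  moreover have "(\<Sum>p | p < length w \<and> w ! p = Inl i. word_moment n (take p w) * word_moment n (drop (Suc p) w)) =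
     (\<Sum>p<length w. if w ! p = Inl i then word_moment n (take p w) * word_moment n (drop (Suc p) w) else 0)" for n
    by (subst sum.inter_filter[symmetric]) (auto intro!: sum.cong)
  ultimately show ?thesis by (simp only: sum_subtractf) (simp add: algebra_simps)
qed

text \<open>The value of the pendant component formed by two merged leaves: one free index, divided
  by \<open>n\<close>.\<close>

lemma graph_sum_two: "n > 0 \<Longrightarrow> x \<noteq> y \<Longrightarrow> graph_sum n {x, y} [(x, y, None)] [] = 1"
proof -
  assume n: "n > 0" "x \<noteq> y"
  have "(\<Sum>\<phi>\<in>Phi {x, y} n. wt n [(x, y, None)] \<phi>) = (\<Sum>j<n. \<Sum>k<n. of_bool (k = j))"
    using n sum_Phi_insert[of "{y}" x "wt n [(x, y, None)]" n] sum_Phi_insert[of "{}" y "\<lambda>\<phi>. \<Sum>k<n. wt n [(x, y, None)] (\<phi>(x := k))" n]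
    by (simp add: PiE_empty_domain)
  also have "\<dots> = real n" by simp
  finally show ?thesis using n by (simp add: graph_sum_Nil)
qed

text \<open>In the star both edges of a pair start at the centre. Crosswise pairing collapses both
  leaves into the centre, and the kernel edge is redundant. Straight pairing merges the two leaves
  into a component that hangs on the centre by a bridge; this leaves the star of the remaining
  letters, with factor \<open>\<beta> i\<close>.\<close>

lemma word_moment_degree:
  assumes "js \<in> lists J" "i \<in> J"
  shows "(\<lambda>n. word_moment n (map Inr (i # js)) - of_real (\<beta> i) * (\<Sum>p | p < length js \<and> js ! p = i. word_moment n (map Inr (del p js)))) \<longlonglongrightarrow> 0"
proof -
  \<comment> \<open>Leaf names start at 1, as 0 is reserved for the first letter.\<close>
  define ls where "ls = zip [1..<Suc (length js)] js"
  define st where "st = map (\<lambda>(l, i :: 'i). (Inl 0 :: nat + nat, Inr l :: nat + nat, i))"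
  have ls: "map snd ls = js" "distinct (map fst ls)" "0 \<notin> fst ` set ls" "length ls = length js"
    unfolding ls_def by (auto dest: set_zip_leftD simp del: upt_Suc)
  have dl: "distinct (map fst ((0, i) # ls))" "snd ` set ((0, i) # ls) \<subseteq> J"
  proof -
    have "snd ` set ls = set js" using ls(1) by (metis list.set_map)
    then show "snd ` set ((0, i) # ls) \<subseteq> J" using assms by auto
  qed (use ls in auto)
  let ?V = "\<lambda>ls. insert (Inl 0) (Inr ` fst ` set ls) :: (nat + nat) set"
  let ?L = "(0, i) # ls"
  have stL: "st ?L = (Inl 0, Inr 0, i) # st ls" by (simp add: st_def)
  have gr: "graph_on (?V ls') (kernel_edges (st ls'))" if "snd ` set ls' \<subseteq> J" for ls'
    using that by (induction ls') (auto simp: st_def intro: graph_on_mono)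
  have con: "P z = P (Inl 0)" if P0: "\<And>a b. (a, b) \<in> ends (st ls') \<Longrightarrow> P a = (P b :: bool)" and z0: "z \<in> ?V ls'" for P z ls'
  proof (cases "z = Inl 0")
    case False
    then obtain l i where l: "(l, i) \<in> set ls'" "z = Inr l" using z0 by auto
    then have "(Inl 0, Inr l) \<in> ends (st ls')" by (force simp: st_def ends_def)
    from P0[OF this] show ?thesis using l by simp
  qed simp
  have fin: "finite (?V ls')" for ls' by simp
  have m: "word_moment n (map Inr (i # js)) = graph_sum n (?V ?L) [] ((Inl 0, Inr 0, i) # st ls)" for n
    using word_moment_star[OF dl, of n] ls(1) by (auto simp: st_def)
  have step: "(\<lambda>n. graph_sum n (?V ?L) [] ((Inl 0, Inr 0, i) # st ls) -
      (\<Sum>p<length (st ls). pairing n (?V ?L) [] (Inl 0, Inr 0, i) (st ls) p)) \<longlonglongrightarrow> 0"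
  proof (rule graph_sum_step[OF fin])
    show "graph_on (?V ?L) (kernel_edges ((Inl 0, Inr 0, i) # st ls))" using gr[OF dl(2)] stL by simp
    show "conn (?V ?L) (ends [] \<union> ends ((Inl 0, Inr 0, i) # st ls))"
    proof (rule connI)
      fix P :: "nat + nat \<Rightarrow> bool" and x y
      assume P: "\<And>a b. (a, b) \<in> ends [] \<union> ends ((Inl 0, Inr 0, i) # st ls) \<Longrightarrow> P a = P b" and xy: "x \<in> ?V ?L" "y \<in> ?V ?L"
      show "P x = P y"
      proof -
        have *: "P a = P b" if "(a, b) \<in> ends (st ?L)" for a b by (rule P) (use that stL in simp)
        show ?thesis using con[of ?L P x, OF * xy(1)] con[of ?L P y, OF * xy(2)] by simp
      qed
    qed
  qed simp
  have pair: "(\<lambda>n. pairing n (?V ?L) [] (Inl 0, Inr 0, i) (st ls) p -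
      (if js ! p = i then of_real (\<beta> i) * word_moment n (map Inr (del p js)) else 0)) \<longlonglongrightarrow> 0" if p: "p < length js" for p
  proof -
    obtain l j where lj: "ls ! p = (l, j)" by (cases "ls ! p")
    have j: "js ! p = j" using lj ls(1,4) p by (metis nth_map snd_conv)
    have nth: "st ls ! p = (Inl 0, Inr l, j)" using lj p ls(4) by (simp add: st_def)
    have d: "del p (st ls) = st (del p ls)" "del p js = map snd (del p ls)"
      using ls(1) by (auto simp: st_def del_def take_map drop_map)
    have sl: "set ls = insert (l, j) (set (del p ls))" using split_del[of p ls] lj p ls(4) by simp
    have dd: "distinct (map fst (del p ls))" "l \<notin> fst ` set (del p ls)" "l \<noteq> 0" "0 \<notin> fst ` set (del p ls)"
    proof -
      have "ls = take p ls @ (l, j) # drop (Suc p) ls" using id_take_nth_drop[of p ls] p ls(4) lj by simp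
      then have "distinct (map fst (take p ls) @ l # map fst (drop (Suc p) ls))" using ls(2) by (metis fst_conv list.simps(9) map_append)
      then show "distinct (map fst (del p ls))" "l \<notin> fst ` set (del p ls)" by (auto simp: del_def)
      show "l \<noteq> 0" "0 \<notin> fst ` set (del p ls)" using ls(3) sl by auto
    qed
    have sJ: "snd ` set (del p ls) \<subseteq> J" using dl(2) sl by auto
    show ?thesis
    proof (cases "j = i")
      case False
      then show ?thesis using nth j by (simp add: pairing_def)
    next
      case True
      have V: "?V ?L = ?V (del p ls) \<union> {Inr 0, Inr l}" using sl by auto
      have 1: "(\<lambda>n. graph_sum n (?V ?L) ((Inl 0, Inr 0, Some i) # [(Inl 0, Inr l, None), (Inr 0, Inl 0, None)]) (st (del p ls))) \<longlonglongrightarrow> 0"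
      proof (rule graph_sum_redundant_edge[OF fin])
        show "conn (?V ?L) (ends [(Inl 0, Inr l, None :: 'i option), (Inr 0, Inl 0, None)] \<union> ends (st (del p ls)))"
        proof (rule connI)
          fix P :: "nat + nat \<Rightarrow> bool" and x y
          assume P: "\<And>a b. (a, b) \<in> ends [(Inl 0, Inr l, None :: 'i option), (Inr 0, Inl 0, None)] \<union> ends (st (del p ls)) \<Longrightarrow> P a = P b"
            and xy: "x \<in> ?V ?L" "y \<in> ?V ?L"
          have "P z = P (Inl 0)" if "z \<in> ?V (del p ls)" for z
            by (rule con[of "del p ls" P, OF _ that]) (rule P, simp)
          moreover have "P (Inl 0) = P (Inr l)" "P (Inr 0) = P (Inl 0)" using P by simp_all
          ultimately show "P x = P y" using xy unfolding V by blast
        qed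
        show "graph_on (?V ?L) (kernel_edges (st (del p ls)))"
          by (rule graph_on_mono[OF gr[OF sJ]]) (use V in auto)
      qed (use V assms in auto)
      have 2: "(\<lambda>n. graph_sum n (?V ?L) ((Inl 0, Inr 0, Some i) # [(Inl 0, Inl 0, None), (Inr 0, Inr l, None)]) (st (del p ls)) - word_moment n (map Inr (del p js))) \<longlonglongrightarrow> 0"
      proof -
        have "(\<lambda>n. graph_sum n (?V (del p ls) \<union> {Inr 0, Inr l}) ((Inl 0, Inr 0, Some i) # [(Inl 0, Inl 0, None)] @ [(Inr 0, Inr l, None)]) (st (del p ls) @ []) -
          graph_sum n (?V (del p ls)) [(Inl 0, Inl 0, None)] (st (del p ls)) * graph_sum n {Inr 0 :: nat + nat, Inr l} [(Inr 0, Inr l, None)] []) \<longlonglongrightarrow> 0"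
        proof (rule graph_sum_factor[of "?V (del p ls)" "{Inr 0, Inr l}" "Inl 0" "Inr 0" i "[(Inl 0, Inl 0, None)]" "st (del p ls)" "[(Inr 0, Inr l, None)]" "[]"])
          show "conn (?V (del p ls)) (ends [(Inl 0, Inl 0, None :: 'i option)] \<union> ends (st (del p ls)))"
          proof (rule connI)
            fix P :: "nat + nat \<Rightarrow> bool" and x y
            assume P: "\<And>a b. (a, b) \<in> ends [(Inl 0, Inl 0, None :: 'i option)] \<union> ends (st (del p ls)) \<Longrightarrow> P a = P b"
              and xy: "x \<in> ?V (del p ls)" "y \<in> ?V (del p ls)"
            have "P z = P (Inl 0)" if "z \<in> ?V (del p ls)" for z
              by (rule con[of "del p ls" P, OF _ that]) (rule P, simp)
            then show "P x = P y" using xy by metis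
          qed
          show "conn {Inr 0 :: nat + nat, Inr l} (ends [(Inr 0, Inr l, None :: 'i option)] \<union> ends ([] :: ((nat + nat) \<times> (nat + nat) \<times> 'i) list))"
            by (rule connI) auto
          show "?V (del p ls) \<inter> {Inr 0, Inr l} = {}" using dd by auto
        qed (use assms gr[OF sJ] in auto)
        moreover have "eventually (\<lambda>n. graph_sum n {Inr 0 :: nat + nat, Inr l} [(Inr 0, Inr l, None)] [] = 1) sequentially"
          using eventually_gt_at_top[of 0] by eventually_elim (rule graph_sum_two, use dd in auto)
        moreover have "graph_sum n (?V (del p ls)) [(Inl 0, Inl 0, None)] (st (del p ls)) = word_moment n (map Inr (del p js))" for n
          using word_moment_star[OF dd(1) sJ, of n] by (simp add: d(2) graph_sum_def st_def)
        ultimately show ?thesis unfolding V by (auto elim!: Lim_transform_eventually elim: eventually_mono)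
      qed
      have "pairing n (?V ?L) [] (Inl 0, Inr 0, i) (st ls) p - of_real (\<beta> i) * word_moment n (map Inr (del p js)) =
        graph_sum n (?V ?L) ((Inl 0, Inr 0, Some i) # [(Inl 0, Inr l, None), (Inr 0, Inl 0, None)]) (st (del p ls)) +
        of_real (\<beta> i) * (graph_sum n (?V ?L) ((Inl 0, Inr 0, Some i) # [(Inl 0, Inl 0, None), (Inr 0, Inr l, None)]) (st (del p ls)) - word_moment n (map Inr (del p js)))" for n
        unfolding pairing_def nth d(1) prod.case using True by (simp add: algebra_simps)
      then have "(\<lambda>n. pairing n (?V ?L) [] (Inl 0, Inr 0, i) (st ls) p - of_real (\<beta> i) * word_moment n (map Inr (del p js))) \<longlonglongrightarrow> 0"
        by (simp only:) (intro tendsto_add_zero tendsto_mult_right_zero 1 2)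
      then show ?thesis using True j by simp
    qed
  qed
  have lst: "length (st ls) = length js" using ls(4) by (simp add: st_def)
  have "(\<lambda>n. (graph_sum n (?V ?L) [] ((Inl 0, Inr 0, i) # st ls) - (\<Sum>p<length js. pairing n (?V ?L) [] (Inl 0, Inr 0, i) (st ls) p)) +
     (\<Sum>p<length js. pairing n (?V ?L) [] (Inl 0, Inr 0, i) (st ls) p - (if js ! p = i then of_real (\<beta> i) * word_moment n (map Inr (del p js)) else 0))) \<longlonglongrightarrow> 0"
    by (rule tendsto_add_zero[OF step[unfolded lst]]) (intro tendsto_null_sum pair, simp)
  moreover have "of_real (\<beta> i) * (\<Sum>p | p < length js \<and> js ! p = i. word_moment n (map Inr (del p js))) =
     (\<Sum>p<length js. if js ! p = i then of_real (\<beta> i) * word_moment n (map Inr (del p js)) else 0)" for n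
    unfolding sum_distrib_left by (subst sum.inter_filter[symmetric]) (auto intro!: sum.cong)
  ultimately show ?thesis unfolding m by (simp only: sum_subtractf) (simp add: algebra_simps)
qed

text \<open>Cyclicity brings a matrix letter to the front; a word without one consists of degree
  letters. Either recursion expresses the moment by shorter words up to a null sequence.\<close>

lemma word_moment_convergent: "w \<in> lists (J <+> J) \<Longrightarrow> convergent (\<lambda>n. word_moment n w)"
proof (induction "length w" arbitrary: w rule: less_induct)
  case less
  have main: "convergent (\<lambda>n. word_moment n (Inl i # v))" if v: "v \<in> lists (J <+> J)" "i \<in> J" "length v < length w" for i v
  proof -
    have "convergent (\<lambda>n. \<Sum>p | p < length v \<and> v ! p = Inl i. word_moment n (take p v) * word_moment n (drop (Suc p) v))"
      by (intro convergent_sum convergent_mult less.hyps) (use v in \<open>auto dest: in_set_takeD in_set_dropD\<close>)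
    then obtain t where t: "(\<lambda>n. \<Sum>p | p < length v \<and> v ! p = Inl i. word_moment n (take p v) * word_moment n (drop (Suc p) v)) \<longlonglongrightarrow> t"
      by (auto simp: convergent_def)
    from tendsto_add[OF word_moment_letter[OF v(1,2)] t] show ?thesis by (auto simp: convergent_def)
  qed
  consider "w = []" | i where "Inl i \<in> set w" | i js where "w = map Inr (i # js)"
  proof (cases "\<exists>i. Inl i \<in> set w")
    case False
    have "w = map Inr (map projr w)"
      by (subst map_map, rule map_idI[symmetric]) (use False in \<open>metis comp_apply old.sum.exhaust sum.sel(2)\<close>)
    then show ?thesis using that(1,3) by (cases "map projr w") auto
  qed (use that in auto)
  then show ?case
  proof cases
    case 1
    have "(\<lambda>n. word_moment n []) \<longlonglongrightarrow> 1"
      by (rule tendsto_eventually, rule eventually_mono[OF eventually_gt_at_top[of 0]]) (rule word_moment_Nil)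
    then show ?thesis using 1 by (auto simp: convergent_def)
  next
    case (2 i)
    then obtain u v where w: "w = u @ Inl i # v" by (auto simp: in_set_conv_decomp)
    have "word_moment n w = word_moment n (Inl i # v @ u)" for n
      using word_moment_trace[of u "Inl i # v" n] less.prems w by auto
    moreover have "convergent (\<lambda>n. word_moment n (Inl i # v @ u))" by (rule main) (use w less.prems in auto)
    ultimately show ?thesis by simp
  next
    case (3 i js)
    have v: "js \<in> lists J" "i \<in> J" using less.prems 3 by auto
    have "convergent (\<lambda>n. of_real (\<beta> i) * (\<Sum>p | p < length js \<and> js ! p = i. word_moment n (map Inr (del p js))))"
      by (intro convergent_mult convergent_const convergent_sum less.hyps)
        (use v 3 set_del in \<open>auto simp: length_del dest!: subsetD[OF set_del]\<close>)
    then obtain t where t: "(\<lambda>n. of_real (\<beta> i) * (\<Sum>p | p < length js \<and> js ! p = i. word_moment n (map Inr (del p js)))) \<longlonglongrightarrow> t"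
      by (auto simp: convergent_def)
    from tendsto_add[OF word_moment_degree[OF v] t] show ?thesis using 3 by (auto simp: convergent_def)
  qed
qed

end

section \<open>Monoid algebras\<close>

text \<open>With concatenation as addition, the convolution product of finitely supported functions
  on words is the product of noncommutative polynomials.\<close>

instantiation list :: (type) monoid_add
begin

definition zero_list :: "'a list" where "zero_list = []"

definition plus_list :: "'a list \<Rightarrow> 'a list \<Rightarrow> 'a list" where "plus_list = (@)"

instance by standard (simp_all add: zero_list_def plus_list_def)

end

abbreviation coef :: "('m \<Rightarrow>\<^sub>0 'c) \<Rightarrow> 'm \<Rightarrow> 'c :: zero" where "coef \<equiv> Poly_Mapping.lookup"
abbreviation mterm :: "'m \<Rightarrow> 'c \<Rightarrow> ('m \<Rightarrow>\<^sub>0 'c :: zero)" where "mterm \<equiv> Poly_Mapping.single"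
abbreviation supp :: "('m \<Rightarrow>\<^sub>0 'c :: zero) \<Rightarrow> 'm set" where "supp \<equiv> Poly_Mapping.keys"

text \<open>\<open>f\<close> receives the coefficient as an argument, so that conjugate-linear maps
  such as \<open>pstar\<close> are covered as well.\<close>

definition linear_ext :: "('m \<Rightarrow> complex \<Rightarrow> 'b) \<Rightarrow> ('m \<Rightarrow>\<^sub>0 complex) \<Rightarrow> 'b :: comm_monoid_add" where
  "linear_ext f p = (\<Sum>w\<in>supp p. f w (coef p w))"

lemma linear_ext_superset:
  assumes "finite S" "supp p \<subseteq> S" "\<And>w. f w 0 = 0"
  shows "linear_ext f p = (\<Sum>w\<in>S. f w (coef p w))"
  unfolding linear_ext_def
  by (rule sum.mono_neutral_left) (use assms in \<open>auto simp: in_keys_iff\<close>)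

lemma linear_ext_add:
  assumes "\<And>w. f w 0 = 0" "\<And>w c d. f w (c + d) = f w c + f w d"
  shows "linear_ext f (p + q) = linear_ext f p + linear_ext f q"
proof -
  let ?S = "supp p \<union> supp q"
  have "linear_ext f x = (\<Sum>w\<in>?S. f w (coef x w))" if "supp x \<subseteq> ?S" for x
    by (rule linear_ext_superset) (use that assms in auto)
  then show ?thesis using keys_add[of p q] by (simp add: lookup_add assms(2) sum.distrib)
qed

lemma linear_ext_single: "(\<And>w. f w 0 = 0) \<Longrightarrow> linear_ext f (mterm w c) = f w c"
  by (subst linear_ext_superset[of "{w}"]) (auto simp: lookup_single)

lemma poly_eq_sum:
  fixes p :: "'m \<Rightarrow>\<^sub>0 complex"
  shows "p = (\<Sum>w\<in>supp p. mterm w (coef p w))"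
proof (rule poly_mapping_eqI)
  fix k
  have "coef (\<Sum>w\<in>supp p. mterm w (coef p w)) k = (\<Sum>w\<in>supp p. if w = k then coef p w else 0)"
    by (simp add: lookup_sum lookup_single when_def)
  also have "\<dots> = coef p k" by (simp add: in_keys_iff)
  finally show "coef p k = coef (\<Sum>w\<in>supp p. mterm w (coef p w)) k" by simp
qed

lemma poly_induct [case_names zero single add]:
  fixes p :: "'m \<Rightarrow>\<^sub>0 complex"
  assumes "P 0" "\<And>w c. P (mterm w c)" "\<And>p q. P p \<Longrightarrow> P q \<Longrightarrow> P (p + q)"
  shows "P p"
proof -
  have "P (\<Sum>w\<in>S. mterm w (coef p w))" if "finite S" for S
    using that by (induction S) (auto intro: assms)
  then show ?thesis by (subst poly_eq_sum) simp
qed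

definition lin :: "('m \<Rightarrow> complex) \<Rightarrow> ('m \<Rightarrow>\<^sub>0 complex) \<Rightarrow> complex" where
  "lin \<tau> = linear_ext (\<lambda>w c. c * \<tau> w)"

lemma lin_add: "lin \<tau> (p + q) = lin \<tau> p + lin \<tau> q"
  unfolding lin_def by (rule linear_ext_add) (auto simp: algebra_simps)

lemma lin_single [simp]: "lin \<tau> (mterm w c) = c * \<tau> w"
  unfolding lin_def by (subst linear_ext_single) auto

lemma lin_0 [simp]: "lin \<tau> 0 = 0"
  by (simp add: lin_def linear_ext_def)

lemma lin_uminus: "lin \<tau> (- p) = - lin \<tau> p"
  using lin_add[of \<tau> p "- p"] by (simp add: eq_neg_iff_add_eq_0 add.commute)

lemma lin_diff: "lin \<tau> (p - q) = lin \<tau> p - lin \<tau> q"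
  using lin_add[of \<tau> p "- q"] by (simp add: lin_uminus)

lemma lin_sum: "lin \<tau> (\<Sum>i\<in>S. f i) = (\<Sum>i\<in>S. lin \<tau> (f i))"
  by (induction S rule: infinite_finite_induct) (auto simp: lin_add)

lemma lin_scale: "lin \<tau> (mterm 0 c * p) = c * lin \<tau> p"
  by (induction p rule: poly_induct) (auto simp: lin_add algebra_simps mult_single)

lemma lin_cong: "(\<And>w. w \<in> supp p \<Longrightarrow> \<tau> w = \<tau>' w) \<Longrightarrow> lin \<tau> p = lin \<tau>' p"
  by (auto simp: lin_def linear_ext_def intro!: sum.cong)

lemma lin_eq: "lin \<tau> p = (\<Sum>w\<in>supp p. coef p w * \<tau> w)"
  by (simp add: lin_def linear_ext_def)

definition pstar :: "('m \<Rightarrow> 'm) \<Rightarrow> ('m \<Rightarrow>\<^sub>0 complex) \<Rightarrow> ('m \<Rightarrow>\<^sub>0 complex)" where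
  "pstar r = linear_ext (\<lambda>w c. mterm (r w) (cnj c))"

lemma pstar_add: "pstar r (p + q) = pstar r p + pstar r q"
  unfolding pstar_def by (rule linear_ext_add) (auto simp: single_add)

lemma pstar_single [simp]: "pstar r (mterm w c) = mterm (r w) (cnj c)"
  unfolding pstar_def by (subst linear_ext_single) auto

lemma pstar_0 [simp]: "pstar r 0 = 0"
  by (simp add: pstar_def linear_ext_def)

lemma pstar_mult:
  fixes r :: "'m :: monoid_add \<Rightarrow> 'm"
  assumes "\<And>a b. r (a + b) = r b + r a"
  shows "pstar r (p * q) = pstar r q * pstar r p"
proof (induction p rule: poly_induct)
  case (single w c)
  show ?case
    by (induction q rule: poly_induct) (auto simp: algebra_simps pstar_add mult_single assms)
qed (auto simp: algebra_simps pstar_add)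

lemma pstar_pstar: "(\<And>a. r (r a) = a) \<Longrightarrow> pstar r (pstar r p) = p"
  by (induction p rule: poly_induct) (auto simp: pstar_add)

lemma supp_pstar: "supp (pstar r p) \<subseteq> r ` supp p"
proof -
  have "supp (pstar r p) \<subseteq> (\<Union>w\<in>supp p. supp (mterm (r w) (cnj (coef p w))))"
    unfolding pstar_def linear_ext_def by (rule keys_sum)
  then show ?thesis by (auto split: if_splits)
qed

text \<open>The algebra of the monoid \<^typ>\<open>'m\<close>, transported along the injection \<open>\<iota>\<close>.\<close>

definition monoid_alg :: "(('m :: monoid_add \<Rightarrow>\<^sub>0 complex) \<Rightarrow> 'b) \<Rightarrow> ('m \<Rightarrow> 'm) \<Rightarrow> ('m \<Rightarrow> complex) \<Rightarrow> 'b star_alg" where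
  "monoid_alg \<iota> r \<tau> =
    \<lparr>carrier = range \<iota>, mult = (\<lambda>a b. \<iota> (inv_into UNIV \<iota> a * inv_into UNIV \<iota> b)), one = \<iota> 1, zero = \<iota> 0,
     add = (\<lambda>a b. \<iota> (inv_into UNIV \<iota> a + inv_into UNIV \<iota> b)), cscale = (\<lambda>c a. \<iota> (mterm 0 c * inv_into UNIV \<iota> a)),
     adj = (\<lambda>a. \<iota> (pstar r (inv_into UNIV \<iota> a))), state = (\<lambda>a. lin \<tau> (inv_into UNIV \<iota> a))\<rparr>"

text \<open>\<open>r\<close> will be reversal on words and the identity on multisets. Positivity is
  an axiom of the locale; the random matrices supply it later.\<close>

locale monoid_algebra =
  fixes \<iota> :: "('m :: monoid_add \<Rightarrow>\<^sub>0 complex) \<Rightarrow> 'b" and r :: "'m \<Rightarrow> 'm" and \<tau> :: "'m \<Rightarrow> complex"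
  assumes inj: "inj \<iota>"
    and r_add: "r (a + b) = r b + r a" and r_r: "r (r a) = a" and r_0: "r 0 = 0"
    and \<tau>_0: "\<tau> 0 = 1"
    and \<tau>_pos: "lin \<tau> (pstar r p * p) \<in> \<real>\<^sub>\<ge>\<^sub>0"
begin

abbreviation "A \<equiv> monoid_alg \<iota> r \<tau>"

lemma A_simps [simp]: "carrier A = range \<iota>" "mult A (\<iota> p) (\<iota> q) = \<iota> (p * q)" "one A = \<iota> 1" "zero A = \<iota> 0"
  "add A (\<iota> p) (\<iota> q) = \<iota> (p + q)" "cscale A c (\<iota> p) = \<iota> (mterm 0 c * p)" "adj A (\<iota> p) = \<iota> (pstar r p)"
  "state A (\<iota> p) = lin \<tau> p"
  using inj by (simp_all add: monoid_alg_def)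

lemma ring_A: "ring A"
proof (rule ringI)
  show "abelian_group A"
  proof (rule abelian_groupI)
    fix x assume "x \<in> carrier A"
    then obtain p where "x = \<iota> p" by auto
    then show "\<exists>y\<in>carrier A. y \<oplus>\<^bsub>A\<^esub> x = \<zero>\<^bsub>A\<^esub>" by (intro bexI[of _ "\<iota> (- p)"]) auto
  qed (auto simp: ac_simps)
  show "monoid A" by (rule monoidI) (auto simp: mult.assoc)
qed (auto simp: algebra_simps)

lemma star_probability_space_A: "star_probability_space A"
proof (intro star_probability_space.intro ring_A star_probability_space_axioms.intro)
  have mono_comm: "p * mterm 0 c = mterm 0 c * p" for p :: "'m \<Rightarrow>\<^sub>0 complex" and c
    by (induction p rule: poly_induct) (auto simp: algebra_simps mult_single)
  show "a \<otimes>\<^bsub>A\<^esub> cscale A c b = cscale A c (a \<otimes>\<^bsub>A\<^esub> b)" if "a \<in> carrier A" "b \<in> carrier A" for a b c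
    using that by (auto simp: mult.assoc[symmetric] mono_comm)
  show "adj A (cscale A c a) = cscale A (cnj c) (adj A a)" if "a \<in> carrier A" for a c
    using that by (auto simp: pstar_mult[of r, OF r_add] r_0 mono_comm)
  show "state A (adj A a \<otimes>\<^bsub>A\<^esub> a) \<in> \<real>\<^sub>\<ge>\<^sub>0" if "a \<in> carrier A" for a
    using that by (auto intro: \<tau>_pos)
  show "state A \<one>\<^bsub>A\<^esub> = 1" using lin_single[of \<tau> 0 1] by (simp add: \<tau>_0)
  show "cscale A (c + d) a = cscale A c a \<oplus>\<^bsub>A\<^esub> cscale A d a" if "a \<in> carrier A" for a c d
    using that by (auto simp: single_add distrib_right)
  show "cscale A c (cscale A d a) = cscale A (c * d) a" if "a \<in> carrier A" for a c d
    using that by (auto simp: mult.assoc[symmetric] mult_single)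
  show "cscale A 1 a = a" if "a \<in> carrier A" for a using that by auto
qed (auto simp: distrib_left mult.assoc pstar_add pstar_mult[of r, OF r_add] pstar_pstar[of r, OF r_r] lin_add lin_scale)

lemma lprod_A: "lprod A (map \<iota> ps) = \<iota> (prod_list ps)"
  by (induction ps) (auto simp: lprod_def)

lemma state_lprod_words: "state A (lprod A (map (\<lambda>i. \<iota> (mterm (g i) 1)) w)) = \<tau> (sum_list (map g w))"
proof -
  have "prod_list (map (\<lambda>i. mterm (g i) (1 :: complex)) w) = mterm (sum_list (map g w)) 1"
    by (induction w) (auto simp: mult_single)
  then show ?thesis using lprod_A[of "map (\<lambda>i. mterm (g i) 1) w"] by (simp add: comp_def)
qed

text \<open>Products and adjoints keep the support inside a submonoid closed under \<open>r\<close>.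
  Freeness and independence quantify over the generated algebras, for which this gives upper
  bounds.\<close>

lemma star_subalgebra_supported:
  assumes "0 \<in> S" "\<And>a b. a \<in> S \<Longrightarrow> b \<in> S \<Longrightarrow> a + b \<in> S" "\<And>a. a \<in> S \<Longrightarrow> r a \<in> S"
  shows "star_subalgebra A (\<iota> ` {p. supp p \<subseteq> S})"
proof -
  have m: "supp (p * q) \<subseteq> S" if "supp p \<subseteq> S" "supp q \<subseteq> S" for p q :: "'m \<Rightarrow>\<^sub>0 complex"
    using keys_mult[of p q] that assms(2) by blast
  have 0: "supp (mterm 0 c) \<subseteq> S" for c :: complex using assms(1) by (cases "c = 0") auto
  have 1: "supp (1 :: 'm \<Rightarrow>\<^sub>0 complex) \<subseteq> S" using 0[of 1] by simp
  have st: "supp (pstar r p) \<subseteq> S" if "supp p \<subseteq> S" for p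
    using supp_pstar[of r p] that assms(3) by blast
  have ad: "supp (p + q) \<subseteq> S" if "supp p \<subseteq> S" "supp q \<subseteq> S" for p q :: "'m \<Rightarrow>\<^sub>0 complex"
    using keys_add[of p q] that by blast
  have I: "\<iota> p \<in> \<iota> ` {p. supp p \<subseteq> S}" if "supp p \<subseteq> S" for p using that by auto
  show ?thesis
    unfolding star_subalgebra_def
  proof (intro conjI)
    show "\<iota> ` {p. supp p \<subseteq> S} \<subseteq> carrier A" by auto
    show "\<one>\<^bsub>A\<^esub> \<in> \<iota> ` {p. supp p \<subseteq> S}" unfolding A_simps by (rule I[OF 1])
    show "\<forall>a\<in>\<iota> ` {p. supp p \<subseteq> S}. \<forall>b\<in>\<iota> ` {p. supp p \<subseteq> S}.
        a \<oplus>\<^bsub>A\<^esub> b \<in> \<iota> ` {p. supp p \<subseteq> S} \<and> a \<otimes>\<^bsub>A\<^esub> b \<in> \<iota> ` {p. supp p \<subseteq> S}"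
      unfolding Ball_image_comp comp_def A_simps by (intro ballI conjI I ad m) simp_all
    show "\<forall>c. \<forall>a\<in>\<iota> ` {p. supp p \<subseteq> S}. cscale A c a \<in> \<iota> ` {p. supp p \<subseteq> S}"
      unfolding Ball_image_comp comp_def A_simps by (intro ballI allI I m 0) simp_all
    show "\<forall>a\<in>\<iota> ` {p. supp p \<subseteq> S}. adj A a \<in> \<iota> ` {p. supp p \<subseteq> S}"
      unfolding Ball_image_comp comp_def A_simps by (intro ballI I st) simp_all
  qed
qed

lemma gen_star_subalgebra_supported:
  assumes "0 \<in> S" "\<And>a b. a \<in> S \<Longrightarrow> b \<in> S \<Longrightarrow> a + b \<in> S" "\<And>a. a \<in> S \<Longrightarrow> r a \<in> S"
    "\<And>i. i \<in> J \<Longrightarrow> g i \<in> S"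
  shows "gen_star_subalgebra A ((\<lambda>i. \<iota> (mterm (g i) 1)) ` J) \<subseteq> \<iota> ` {p. supp p \<subseteq> S}"
proof -
  have "(\<lambda>i. \<iota> (mterm (g i) 1)) ` J \<subseteq> \<iota> ` {p. supp p \<subseteq> S}"
    using assms(4) by (auto intro!: imageI)
  then show ?thesis unfolding gen_star_subalgebra_def
    using star_subalgebra_supported[OF assms(1-3)] by blast
qed

end

section \<open>Linearity and positivity of states on words\<close>

context star_probability_space begin

lemma lprod_closed: "set xs \<subseteq> carrier A \<Longrightarrow> lprod A xs \<in> carrier A"
  by (induction xs) (auto simp: lprod_def)

lemma state_zero: "state A \<zero> = 0"
  using state_add[of \<zero> \<zero>] by simp

lemma state_finsum:
  assumes "finite S" "f \<in> S \<rightarrow> carrier A"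
  shows "state A (finsum A f S) = (\<Sum>w\<in>S. state A (f w))"
  using assms by (induction S) (auto simp: state_zero state_add finsum_insert intro!: finsum_closed)

lemma state_nc_eval:
  assumes "a \<in> J \<rightarrow> carrier A" "p \<in> nc_polys J"
  shows "state A (nc_eval A a p) = (\<Sum>w\<in>supp p. coef p w * state A (lprod A (map a w)))"
proof -
  have c: "lprod A (map a w) \<in> carrier A" if "w \<in> supp p" for w
    by (rule lprod_closed) (use that assms in \<open>auto simp: nc_polys_def\<close>)
  show ?thesis unfolding nc_eval_def
    by (subst state_finsum) (auto simp: c cscale_closed state_cscale)
qed

lemma state_adj_finsum:
  assumes "finite S" "f \<in> S \<rightarrow> carrier A" "b \<in> carrier A"
  shows "state A (adj A (finsum A f S) \<otimes> b) = (\<Sum>w\<in>S. state A (adj A (f w) \<otimes> b))"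
    and "state A (b \<otimes> finsum A f S) = (\<Sum>w\<in>S. state A (b \<otimes> f w))"
proof -
  have adj0: "adj A \<zero> = \<zero>"
  proof -
    have "adj A \<zero> \<oplus> adj A \<zero> = adj A \<zero>" using adj_add[of \<zero> \<zero>] by simp
    then show ?thesis using adj_closed[of \<zero>] by (metis r_neg zero_closed add.l_cancel_one' local.add.r_cancel_one)
  qed
  show "state A (adj A (finsum A f S) \<otimes> b) = (\<Sum>w\<in>S. state A (adj A (f w) \<otimes> b))"
    using assms by (induction S)
      (auto simp: adj0 state_zero state_add finsum_insert adj_add adj_closed l_distr intro!: finsum_closed)
  show "state A (b \<otimes> finsum A f S) = (\<Sum>w\<in>S. state A (b \<otimes> f w))"
    using assms by (induction S) (auto simp: state_zero state_add finsum_insert r_distr intro!: finsum_closed)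
qed

text \<open>Positivity of the state at a linear combination of words, written out in word moments.
  In this form it passes to limits of the moments.\<close>

lemma state_words_positive:
  assumes "a \<in> J \<rightarrow> carrier A" "finite S" "S \<subseteq> lists J"
  shows "(\<Sum>u\<in>S. \<Sum>w\<in>S. cnj (c u) * c w * state A (adj A (lprod A (map a u)) \<otimes> lprod A (map a w))) \<in> \<real>\<^sub>\<ge>\<^sub>0"
proof -
  let ?f = "\<lambda>w. cscale A (c w) (lprod A (map a w))"
  have cl: "lprod A (map a w) \<in> carrier A" if "w \<in> S" for w
    by (rule lprod_closed) (use that assms in auto)
  have f: "?f \<in> S \<rightarrow> carrier A" using cl cscale_closed by auto
  have F: "finsum A ?f S \<in> carrier A" using f by (rule finsum_closed)
  have "state A (adj A (finsum A ?f S) \<otimes> finsum A ?f S) = (\<Sum>u\<in>S. \<Sum>w\<in>S. state A (adj A (?f u) \<otimes> ?f w))"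
    using f adj_closed by (subst state_adj_finsum(1)[OF assms(2) f F]) (intro sum.cong refl state_adj_finsum(2)[OF assms(2) f], auto)
  also have "\<dots> = (\<Sum>u\<in>S. \<Sum>w\<in>S. cnj (c u) * c w * state A (adj A (lprod A (map a u)) \<otimes> lprod A (map a w)))"
    by (intro sum.cong refl)
      (simp add: cl adj_cscale cscale_mult_left cscale_mult_right state_cscale adj_closed cscale_closed)
  finally show ?thesis using state_positive[OF F] by simp
qed

end

section \<open>Freeness from the Schwinger--Dyson equation\<close>

definition word :: "'v list \<Rightarrow> 'v nc_poly" where "word w = mterm w 1"

lemma word_append: "word (u @ v) = word u * word v"
  by (simp add: word_def mult_single plus_list_def)

lemma word_Nil [simp]: "word [] = 1"
  by (simp add: word_def flip: zero_list_def)

definition centered :: "('v list \<Rightarrow> complex) \<Rightarrow> 'v list \<Rightarrow> 'v nc_poly" where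
  "centered \<tau> w = word w - mterm 0 (\<tau> w)"

text \<open>The bilinear map obtained by cutting a polynomial at the occurrences of a letter; it obeys a
  Leibniz rule.\<close>

definition cutw :: "('v list \<Rightarrow> complex) \<Rightarrow> 'v \<Rightarrow> 'v nc_poly \<Rightarrow> 'v nc_poly \<Rightarrow> 'v list \<Rightarrow> complex" where
  "cutw \<tau> i X Z w = (\<Sum>p | p < length w \<and> w ! p = i.
     lin \<tau> (X * word (take p w)) * lin \<tau> (word (drop (Suc p) w) * Z))"

definition cut :: "('v list \<Rightarrow> complex) \<Rightarrow> 'v \<Rightarrow> 'v nc_poly \<Rightarrow> 'v nc_poly \<Rightarrow> 'v nc_poly \<Rightarrow> complex" where
  "cut \<tau> i X Y Z = lin (cutw \<tau> i X Z) Y"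

lemma cutw_alt: "cutw \<tau> i X Z w = (\<Sum>p<length w. if w ! p = i then
     lin \<tau> (X * word (take p w)) * lin \<tau> (word (drop (Suc p) w) * Z) else 0)"
  unfolding cutw_def by (subst sum.inter_filter[symmetric]) (auto intro!: sum.cong)

text \<open>A letter at which to cut lies in \<open>u\<close> or in \<open>v\<close>; the other word
  is absorbed into the outer argument. This is the Leibniz rule on words.\<close>

lemma cutw_append: "cutw \<tau> i X Z (u @ v) = cutw \<tau> i X (word v * Z) u + cutw \<tau> i (X * word u) Z v"
proof -
  let ?f = "\<lambda>p. if (u @ v) ! p = i then
     lin \<tau> (X * word (take p (u @ v))) * lin \<tau> (word (drop (Suc p) (u @ v)) * Z) else 0"
  have "cutw \<tau> i X Z (u @ v) = (\<Sum>p<length u + length v. ?f p)" by (simp add: cutw_alt)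
  also have "\<dots> = (\<Sum>p<length u. ?f p) + (\<Sum>p\<in>{length u..<length u + length v}. ?f p)"
    by (subst sum.union_disjoint[symmetric]) (auto intro!: sum.cong)
  also have "(\<Sum>p\<in>{length u..<length u + length v}. ?f p) = (\<Sum>p<length v. ?f (p + length u))"
    by (rule sum.reindex_bij_witness[of _ "\<lambda>p. p + length u" "\<lambda>p. p - length u"]) auto
  also have "\<dots> = cutw \<tau> i (X * word u) Z v"
    unfolding cutw_alt by (rule sum.cong) (auto simp: nth_append word_append mult.assoc)
  also have "(\<Sum>p<length u. ?f p) = cutw \<tau> i X (word v * Z) u"
    unfolding cutw_alt by (rule sum.cong) (auto simp: nth_append word_append mult.assoc)
  finally show ?thesis .
qed

lemma cutw_Nil [simp]: "cutw \<tau> i X Z [] = 0"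
  by (simp add: cutw_def)

lemma cutw_add: "cutw \<tau> i (X + X') Z w = cutw \<tau> i X Z w + cutw \<tau> i X' Z w"
  "cutw \<tau> i X (Z + Z') w = cutw \<tau> i X Z w + cutw \<tau> i X Z' w"
  by (simp_all add: cutw_def distrib_left distrib_right lin_add sum.distrib)

lemma lin_mterm_mult: "lin \<tau> (X * mterm w c) = c * lin \<tau> (X * word w)" "lin \<tau> (mterm w c * X) = c * lin \<tau> (word w * X)"
  by (induction X rule: poly_induct) (auto simp: algebra_simps lin_add mult_single word_def)

lemma cut_add: "cut \<tau> i X (Y + Y') Z = cut \<tau> i X Y Z + cut \<tau> i X Y' Z"
  by (simp add: cut_def lin_add)

lemma cut_add_left: "cut \<tau> i (X + X') Y Z = cut \<tau> i X Y Z + cut \<tau> i X' Y Z"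
  and cut_add_right: "cut \<tau> i X Y (Z + Z') = cut \<tau> i X Y Z + cut \<tau> i X Y Z'"
  by (simp_all add: cut_def lin_eq cutw_add sum.distrib distrib_left)

lemma cut_0 [simp]: "cut \<tau> i X 0 Z = 0" "cut \<tau> i 0 Y Z = 0" "cut \<tau> i X Y 0 = 0"
  by (simp_all add: cut_def lin_eq cutw_def)

lemma cutw_mterm: "cutw \<tau> i (X * mterm u c) Z w = c * cutw \<tau> i (X * word u) Z w"
  "cutw \<tau> i X (mterm v c * Z) w = c * cutw \<tau> i X (word v * Z) w"
proof -
  have 1: "X * mterm u c * word t = X * mterm (u @ t) c" "X * word u * word t = X * word (u @ t)" for t
    by (simp_all add: word_def mult.assoc mult_single plus_list_def)
  have 2: "word t * (mterm v c * Z) = mterm (t @ v) c * Z" "word t * (word v * Z) = word (t @ v) * Z" for t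
    by (simp_all add: word_def mult.assoc[symmetric] mult_single plus_list_def)
  show "cutw \<tau> i (X * mterm u c) Z w = c * cutw \<tau> i (X * word u) Z w"
    unfolding cutw_def 1 lin_mterm_mult by (simp add: sum_distrib_left mult_ac)
  show "cutw \<tau> i X (mterm v c * Z) w = c * cutw \<tau> i X (word v * Z) w"
    unfolding cutw_def 2 lin_mterm_mult by (simp add: sum_distrib_left mult_ac)
qed

lemma cut_mult: "cut \<tau> i X (Y * Y') Z = cut \<tau> i X Y (Y' * Z) + cut \<tau> i (X * Y) Y' Z"
proof (induction Y rule: poly_induct)
  case (single u c)
  show ?case
  proof (induction Y' rule: poly_induct)
    case (single v d)
    show ?case
      by (simp add: cut_def mult_single plus_list_def cutw_append cutw_mterm algebra_simps)
  qed (auto simp: cut_add cut_add_right algebra_simps)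
qed (auto simp: cut_add cut_add_left algebra_simps)

lemma cut_1 [simp]: "cut \<tau> i X 1 Z = 0"
  using lin_single[of "cutw \<tau> i X Z" 0 1] unfolding single_one cut_def by (simp add: zero_list_def)

text \<open>A constant contains no letter to cut at, so centering does not change the cut.\<close>

lemma cut_centered: "cut \<tau> i X (centered \<tau>' w) Z = cutw \<tau> i X Z w"
  by (simp add: cut_def centered_def lin_diff word_def zero_list_def)

lemma cutw_notin: "i \<notin> set w \<Longrightarrow> cutw \<tau> i X Z w = 0"
  unfolding cutw_def by (rule sum.neutral) auto

text \<open>A trace on words satisfying the Schwinger--Dyson equation of a semicircular letter, for every
  letter in the classes \<open>SD\<close>, makes the classes of letters free, provided that at most one class
  lies outside \<open>SD\<close>.\<close>

locale schwinger_dyson =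
  fixes \<tau> :: "'v list \<Rightarrow> complex" and C :: "'k \<Rightarrow> 'v set" and KS SD :: "'k set"
  assumes tau_Nil: "\<tau> [] = 1"
    and tau_trace: "\<tau> (u @ v) = \<tau> (v @ u)"
    and disjoint: "\<lbrakk>k \<in> KS; l \<in> KS; k \<noteq> l\<rbrakk> \<Longrightarrow> C k \<inter> C l = {}"
    and one_non_SD: "\<lbrakk>k \<in> KS; l \<in> KS; k \<notin> SD; l \<notin> SD\<rbrakk> \<Longrightarrow> k = l"
    and SD: "\<lbrakk>k \<in> KS; k \<in> SD; i \<in> C k; w \<in> lists (\<Union> (C ` KS))\<rbrakk> \<Longrightarrow>
       \<tau> (i # w) = (\<Sum>p | p < length w \<and> w ! p = i. \<tau> (take p w) * \<tau> (drop (Suc p) w))"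
begin

lemma lin_word [simp]: "lin \<tau> (word w) = \<tau> w"
  by (simp add: word_def)

lemma lin_trace: "lin \<tau> (X * Y) = lin \<tau> (Y * X)"
proof (induction X rule: poly_induct)
  case (single u c)
  show ?case
    by (induction Y rule: poly_induct)
      (auto simp: algebra_simps lin_add mult_single plus_list_def tau_trace)
qed (auto simp: algebra_simps lin_add)

lemma lin_mterm0: "lin \<tau> (X * (mterm 0 c * Y)) = c * lin \<tau> (X * Y)" "lin \<tau> (mterm 0 c * Y) = c * lin \<tau> Y"
proof -
  show 1: "lin \<tau> (mterm 0 c * Y) = c * lin \<tau> Y" for Y by (rule lin_scale)
  have "X * (mterm 0 c * Y) = mterm 0 c * (X * Y)"
    by (induction X rule: poly_induct, simp_all add: algebra_simps, induction Y rule: poly_induct)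
      (auto simp: algebra_simps mult_single plus_list_def zero_list_def)
  then show "lin \<tau> (X * (mterm 0 c * Y)) = c * lin \<tau> (X * Y)" using 1 by simp
qed

lemma expand_word: "lin \<tau> (X * (word w * Y)) = lin \<tau> (X * (centered \<tau> w * Y)) + \<tau> w * lin \<tau> (X * Y)"
  by (simp add: centered_def algebra_simps lin_diff lin_mterm0)

lemma expand_centered: "lin \<tau> (X * (centered \<tau> w * Y)) = lin \<tau> (X * (word w * Y)) - \<tau> w * lin \<tau> (X * Y)"
  by (simp add: expand_word)

abbreviation "L \<equiv> \<Union> (C ` KS)"

text \<open>The Schwinger-Dyson equation extended linearly; with both outer factors equal to 1 the
  cut is the sum over the factorisations.\<close>

lemma lin_letter:
  assumes "k \<in> KS" "k \<in> SD" "i \<in> C k" "supp Y \<subseteq> lists L"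
  shows "lin \<tau> (word [i] * Y) = cut \<tau> i 1 Y 1"
proof -
  have "lin \<tau> (word [i] * Y) = lin (\<lambda>w. \<tau> (i # w)) Y"
    by (induction Y rule: poly_induct) (auto simp: algebra_simps lin_add word_def mult_single plus_list_def)
  also have "\<dots> = cut \<tau> i 1 Y 1"
    unfolding cut_def by (rule lin_cong) (use SD[OF assms(1-3)] assms(4) in \<open>auto simp: cutw_def\<close>)
  finally show ?thesis .
qed

definition centered_prod :: "('k \<times> 'v list) list \<Rightarrow> 'v nc_poly" where
  "centered_prod ks = prod_list (map (\<lambda>(k, w). centered \<tau> w) ks)"

lemma centered_prod_simps [simp]: "centered_prod [] = 1" "centered_prod ((k, w) # ks) = centered \<tau> w * centered_prod ks" "centered_prod (ks @ ls) = centered_prod ks * centered_prod ls"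
  by (auto simp: centered_prod_def)

definition alternating :: "('k \<times> 'v list) list \<Rightarrow> bool" where
  "alternating ks \<longleftrightarrow> distinct_adj (map fst ks) \<and> (\<forall>(k, w)\<in>set ks. k \<in> KS \<and> w \<in> lists (C k))"

lemma supp_mult: "supp X \<subseteq> lists L \<Longrightarrow> supp Y \<subseteq> lists L \<Longrightarrow> supp (X * Y) \<subseteq> lists L"
  using keys_mult[of X Y] by (fastforce simp: plus_list_def)

lemma supp_centered: "w \<in> lists L \<Longrightarrow> supp (centered \<tau> w) \<subseteq> lists L"
  using keys_diff[of "word w" "mterm 0 (\<tau> w)"] by (auto simp: centered_def word_def zero_list_def split: if_splits)

lemma supp_1: "supp (1 :: 'v nc_poly) \<subseteq> lists L"
  by (simp add: zero_list_def)

lemma supp_centered_prod: "alternating ks \<Longrightarrow> supp (centered_prod ks) \<subseteq> lists L"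
proof (induction ks)
  case (Cons a ks)
  obtain k w where a: "a = (k, w)" by (cases a)
  have "w \<in> lists L" using Cons.prems a by (auto simp: alternating_def)
  moreover have "alternating ks" using Cons.prems by (auto simp: alternating_def distinct_adj_Cons)
  ultimately show ?case using Cons.IH a by (simp add: supp_mult supp_centered)
qed (use supp_1 in simp)

text \<open>Induction on the number of letters. By cyclicity the first letter \<open>i\<close> of a
  block in \<open>SD\<close> is moved to the front and expanded. Cuts inside its own block rebuild
  exactly the term that centering subtracts. A cut in a later block of the same class encloses a
  shorter product, which vanishes by induction, and \<open>pre\<close> contains no
  \<open>i\<close>.\<close>

lemma alternating_words: "alternating ks \<Longrightarrow> ks \<noteq> [] \<Longrightarrow> lin \<tau> (centered_prod ks) = 0"
proof (induction "sum_list (map (length \<circ> snd) ks)" arbitrary: ks rule: less_induct)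
  case less
  have IH: "lin \<tau> (centered_prod ls) = 0" if "alternating ls" "ls \<noteq> []" "sum_list (map (length \<circ> snd) ls) < sum_list (map (length \<circ> snd) ks)" for ls
    using less.hyps that by blast
  show ?case
  proof (cases "\<exists>k w. ks = [(k, w)]")
    case True
    then show ?thesis by (auto simp: centered_def lin_diff tau_Nil zero_list_def)
  next
    case False
    \<comment> \<open>Neighbouring blocks belong to different classes, so one of the first two lies
      in \<open>SD\<close>.\<close>
    obtain pre k w rest where ks: "ks = pre @ (k, w) # rest" "k \<in> SD"
      and pre: "pre = [] \<or> (\<exists>k0 w0. pre = [(k0, w0)] \<and> k0 \<in> KS \<and> k0 \<noteq> k \<and> w0 \<in> lists (C k0))"
    proof -
      obtain k1 w1 ks1 where 1: "ks = (k1, w1) # ks1" using less.prems by (cases ks) auto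
      show ?thesis
      proof (cases "k1 \<in> SD")
        case True
        then show ?thesis using that[of "[]" k1 w1 ks1] 1 by simp
      next
        case k1: False
        obtain k2 w2 ks2 where 2: "ks1 = (k2, w2) # ks2" using 1 False by (cases ks1) auto
        have "k2 \<in> SD" using one_non_SD[of k1 k2] k1 less.prems(1) 1 2 by (auto simp: alternating_def)
        then show ?thesis using that[of "[(k1, w1)]" k2 w2 ks2] 1 2 less.prems(1) by (auto simp: alternating_def)
      qed
    qed
    have kK: "k \<in> KS" "w \<in> lists (C k)" using less.prems(1) ks by (auto simp: alternating_def)
    have ar: "alternating pre" "alternating rest" "alternating (pre @ rest) \<or> True" using less.prems(1) ks
      by (auto simp: alternating_def distinct_adj_append_iff distinct_adj_Cons)
    show ?thesis
    proof (cases w)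
      case Nil
      have "centered \<tau> [] = 0" by (simp add: centered_def word_def tau_Nil zero_list_def)
      then show ?thesis by (simp add: ks Nil)
    next
      case (Cons i p)
      have i: "i \<in> C k" "p \<in> lists (C k)" using kK Cons by auto
      have sR: "supp (centered_prod rest) \<subseteq> lists L" "supp (centered_prod pre) \<subseteq> lists L" by (rule supp_centered_prod, rule ar)+
      have pL: "p \<in> lists L" using i kK by auto
      have sp: "supp (word p) \<subseteq> lists L" using pL by (auto simp: word_def)
      have "cut \<tau> i X (centered_prod pre) Z = 0" for X Z
      proof (cases "pre = []")
        case False
        then obtain k0 w0 where k0: "pre = [(k0, w0)]" "k0 \<in> KS" "k0 \<noteq> k" "w0 \<in> lists (C k0)" using pre by auto
        then have "i \<notin> set w0" using disjoint[of k0 k] kK i by auto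
        then show ?thesis using k0(1) by (simp add: cut_centered cutw_notin)
      qed simp
      note cut_pre = this
      have "lin \<tau> (centered_prod pre * (word (i # p) * centered_prod rest)) = lin \<tau> (word [i] * (word p * (centered_prod rest * centered_prod pre)))"
        using word_append[of "[i]" p] lin_trace[of "centered_prod pre"] by (simp add: mult.assoc)
      also have "\<dots> = cut \<tau> i 1 (word p * (centered_prod rest * centered_prod pre)) 1"
        by (rule lin_letter[OF kK(1) ks(2) i(1)]) (intro supp_mult sR sp)
      also have "\<dots> = cut \<tau> i 1 (word p) (centered_prod rest * centered_prod pre) + cut \<tau> i (word p) (centered_prod rest) (centered_prod pre)"
        by (simp add: cut_mult cut_pre)
      \<comment> \<open>Each tail of \<open>p\<close> is its centered part plus its mean. The
        centered part gives an alternating product with fewer letters, which vanishes; the means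
        recombine by the equation for \<open>i # p\<close>.\<close>
      also have "cut \<tau> i 1 (word p) (centered_prod rest * centered_prod pre) = \<tau> (i # p) * lin \<tau> (centered_prod pre * centered_prod rest)"
      proof -
        have "lin \<tau> (word (drop (Suc q) p) * (centered_prod rest * centered_prod pre)) = \<tau> (drop (Suc q) p) * lin \<tau> (centered_prod pre * centered_prod rest)" for q
        proof -
          let ?u = "drop (Suc q) p"
          have "lin \<tau> (word ?u * (centered_prod rest * centered_prod pre)) = lin \<tau> (centered_prod pre * (word ?u * centered_prod rest))"
            using lin_trace[of "centered_prod pre"] by (simp add: mult.assoc)
          also have "\<dots> = lin \<tau> (centered_prod (pre @ (k, ?u) # rest)) + \<tau> ?u * lin \<tau> (centered_prod pre * centered_prod rest)"
            by (simp add: expand_word)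
          also have "lin \<tau> (centered_prod (pre @ (k, ?u) # rest)) = 0"
          proof (rule IH)
            have "?u \<in> lists (C k)" using i(2) by (auto dest: in_set_dropD)
            then show "alternating (pre @ (k, ?u) # rest)" using less.prems(1) ks by (auto simp: alternating_def)
          qed (use ks Cons in auto)
          finally show ?thesis by simp
        qed
        then have "cutw \<tau> i 1 (centered_prod rest * centered_prod pre) p = (\<Sum>q | q < length p \<and> p ! q = i. \<tau> (take q p) * (\<tau> (drop (Suc q) p) * lin \<tau> (centered_prod pre * centered_prod rest)))"
          unfolding cutw_def by simp
        also have "\<dots> = \<tau> (i # p) * lin \<tau> (centered_prod pre * centered_prod rest)"
          using SD[OF kK(1) ks(2) i(1) pL] by (simp add: sum_distrib_right mult.assoc)
        finally show ?thesis by (simp add: cut_def word_def)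
      qed
      finally have "lin \<tau> (centered_prod ks) = cut \<tau> i (word p) (centered_prod rest) (centered_prod pre)"
        by (simp add: ks Cons expand_centered)
      also have "\<dots> = 0"
      proof -
        \<comment> \<open>The blocks of \<open>rest\<close> are passed from left to right,
          \<open>a\<close> collecting those already passed.\<close>
        have "cut \<tau> i (word p * centered_prod a) (centered_prod b) (centered_prod pre) = 0" if "rest = a @ b" for a b
          using that
        proof (induction b arbitrary: a)
          case (Cons lv b)
          obtain l v where lv: "lv = (l, v)" by (cases lv)
          have "cut \<tau> i (word p * centered_prod a) (centered_prod (lv # b)) (centered_prod pre) =
            cutw \<tau> i (word p * centered_prod a) (centered_prod b * centered_prod pre) v + cut \<tau> i (word p * centered_prod (a @ [lv])) (centered_prod b) (centered_prod pre)"
            by (simp add: lv cut_mult cut_centered mult.assoc)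
          also have "cut \<tau> i (word p * centered_prod (a @ [lv])) (centered_prod b) (centered_prod pre) = 0"
            by (rule Cons.IH) (use Cons.prems in simp)
          also have "cutw \<tau> i (word p * centered_prod a) (centered_prod b * centered_prod pre) v = 0"
          proof (cases "i \<in> set v")
            case True
            have lK: "l \<in> KS" "v \<in> lists (C l)" using ar(2) Cons.prems lv by (auto simp: alternating_def)
            then have l: "l = k" using True disjoint[of l k] kK i by auto
            \<comment> \<open>Two blocks of class \<open>k\<close> are never adjacent, so some block
              separates \<open>p\<close> from \<open>v\<close>. This makes the enclosed product
              alternating.\<close>
            have a: "a \<noteq> []"
              using less.prems(1) ks Cons.prems lv l by (cases a) (auto simp: alternating_def distinct_adj_append_iff distinct_adj_Cons)
            have "lin \<tau> (word p * centered_prod a * word t) = 0" if t: "t \<in> lists (C k)" "length t \<le> length v" for t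
            proof -
              have al: "distinct_adj (map fst ((k, p) # a @ (k, t) # b))" "alternating a"
                using less.prems(1) ks Cons.prems lv l by (auto simp: alternating_def distinct_adj_append_iff distinct_adj_Cons)
              have len: "sum_list (map (length \<circ> snd) ks) > length p + sum_list (map (length \<circ> snd) a) + length t"
                using ks \<open>w = i # p\<close> Cons.prems lv t(2) by simp
              have da: "distinct_adj (map fst ((k, p) # a @ [(k, t)]))" "distinct_adj (map fst ((k, p) # a))" "distinct_adj (map fst (a @ [(k, t)]))"
                using al(1) a by (auto simp: distinct_adj_append_iff distinct_adj_Cons)
              have sa: "\<forall>(k, w)\<in>set a. k \<in> KS \<and> w \<in> lists (C k)" using al(2) by (simp add: alternating_def)
              \<comment> \<open>Replacing \<open>word p\<close> and \<open>word t\<close> by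
                centered part plus mean expands the enclosed product into four alternating ones, all
                with fewer letters.\<close>
              have z1: "lin \<tau> (centered_prod ((k, p) # a @ [(k, t)])) = 0"
                by (rule IH) (use da sa kK t i a len in \<open>auto simp: alternating_def\<close>)
              have z2: "lin \<tau> (centered_prod ((k, p) # a)) = 0"
                by (rule IH) (use da sa kK t i a len in \<open>auto simp: alternating_def\<close>)
              have z3: "lin \<tau> (centered_prod (a @ [(k, t)])) = 0"
                by (rule IH) (use da sa kK t i a len in \<open>auto simp: alternating_def\<close>)
              have z4: "lin \<tau> (centered_prod a) = 0" by (rule IH) (use al(2) a len in auto)
              show ?thesis
                using expand_word[of 1 p "centered_prod a * word t"] expand_word[of "centered \<tau> p * centered_prod a" t 1] expand_word[of "centered_prod a" t 1] z1 z2 z3 z4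
                by (simp add: mult.assoc)
            qed
            moreover have "take q v \<in> lists (C k)" for q using lK l by (auto dest: in_set_takeD)
            ultimately show ?thesis unfolding cutw_def by (intro sum.neutral) auto
          qed (rule cutw_notin)
          finally show ?case by simp
        qed simp
        from this[of "[]" rest] show ?thesis by simp
      qed
      finally show ?thesis .
    qed
  qed
qed

text \<open>The constants subtracted by centering add up to \<open>lin \<tau> p\<close>, which is
  0.\<close>

lemma centered_expansion:
  assumes "lin \<tau> p = 0"
  shows "p = (\<Sum>w\<in>supp p. mterm 0 (coef p w) * centered \<tau> w)"
proof -
  have "(\<Sum>w\<in>supp p. mterm 0 (coef p w) * centered \<tau> w) = (\<Sum>w\<in>supp p. mterm w (coef p w) - mterm 0 (coef p w * \<tau> w))"
    by (intro sum.cong refl) (simp add: centered_def algebra_simps mult_single word_def)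
  also have "\<dots> = p - mterm 0 (\<Sum>w\<in>supp p. coef p w * \<tau> w)"
  proof -
    have "(\<Sum>w\<in>S. mterm 0 (coef p w * \<tau> w)) = mterm 0 (\<Sum>w\<in>S. coef p w * \<tau> w)" for S
      by (induction S rule: infinite_finite_induct) (auto simp: single_add)
    then show ?thesis using poly_eq_sum[of p] by (simp add: sum_subtractf)
  qed
  finally show ?thesis using assms by (simp add: lin_eq)
qed

text \<open>The factors are expanded into centered words one after another from the left;
  \<open>ks\<close> is the part already expanded.\<close>

lemma alternating_polys:
  assumes "distinct_adj (map fst ks @ ls)" "\<forall>(k, w)\<in>set ks. k \<in> KS \<and> w \<in> lists (C k)"
    and "list_all2 (\<lambda>l p. l \<in> KS \<and> supp p \<subseteq> lists (C l) \<and> lin \<tau> p = 0) ls ps" "ks \<noteq> [] \<or> ls \<noteq> []"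
  shows "lin \<tau> (centered_prod ks * prod_list ps) = 0"
  using assms
proof (induction ls arbitrary: ks ps)
  case Nil
  then show ?case using alternating_words[of ks] by (simp add: alternating_def)
next
  case (Cons l ls)
  obtain p qs where ps: "ps = p # qs" using Cons.prems(3) by (cases ps) auto
  have p: "l \<in> KS" "supp p \<subseteq> lists (C l)" "lin \<tau> p = 0" using Cons.prems(3) ps by auto
  have "lin \<tau> (centered_prod ks * prod_list ps) = lin \<tau> (centered_prod ks * ((\<Sum>w\<in>supp p. mterm 0 (coef p w) * centered \<tau> w) * prod_list qs))"
    using centered_expansion[OF p(3)] ps by simp
  also have "\<dots> = (\<Sum>w\<in>supp p. coef p w * lin \<tau> (centered_prod (ks @ [(l, w)]) * prod_list qs))"
    by (simp add: sum_distrib_left sum_distrib_right lin_sum mult.assoc lin_mterm0)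
  also have "\<dots> = 0"
  proof (intro sum.neutral ballI)
    fix w assume "w \<in> supp p"
    then have "lin \<tau> (centered_prod (ks @ [(l, w)]) * prod_list qs) = 0"
      by (intro Cons.IH) (use Cons.prems ps p in auto)
    then show "coef p w * lin \<tau> (centered_prod (ks @ [(l, w)]) * prod_list qs) = 0" by simp
  qed
  finally show ?case .
qed

lemma free:
  assumes "list_all2 (\<lambda>l p. supp p \<subseteq> lists (C l) \<and> lin \<tau> p = 0) ls ps" "ls \<noteq> []" "distinct_adj ls" "set ls \<subseteq> KS"
  shows "lin \<tau> (prod_list ps) = 0"
proof -
  have "list_all2 (\<lambda>l p. l \<in> KS \<and> supp p \<subseteq> lists (C l) \<and> lin \<tau> p = 0) ls ps"
    using assms(1,4) by (auto simp: list_all2_conv_all_nth)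
  from alternating_polys[of "[]" ls ps] this assms show ?thesis by simp
qed

end

section \<open>Moments of the semicircle and the normal law\<close>

text \<open>The hypothesis is the ratio recursion of the Catalan numbers, the conclusion Segner's
  convolution. Exchanging \<open>a\<close> and \<open>m - a\<close> shows that the weight
  \<open>a\<close> multiplies the convolution sum by m/2 (\<open>T\<close>). Evaluating the sum with
  weight a + 1 in this way and by the ratio recursion gives the induction step.\<close>

lemma semicircle_convolution:
  fixes c :: "nat \<Rightarrow> real"
  assumes "c 0 = 1" "\<And>n. (real n + 2) * c (Suc n) = (4 * real n + 2) * c n"
  shows "(\<Sum>a\<le>n. c a * c (n - a)) = c (Suc n)"
proof (induction n)
  case 0
  show ?case using assms(2)[of 0] assms(1) by simp
next
  case (Suc n)
  define S where "S m = (\<Sum>a\<le>m. c a * c (m - a))" for m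
  have T: "(\<Sum>a\<le>m. real a * (c a * c (m - a))) = real m / 2 * S m" for m
  proof -
    have "(\<Sum>a\<le>m. real a * (c a * c (m - a))) = (\<Sum>a\<le>m. real (m - a) * (c a * c (m - a)))"
      by (rule sum.reindex_bij_witness[of _ "\<lambda>a. m - a" "\<lambda>a. m - a"]) (auto simp: mult_ac)
    also have "\<dots> = (\<Sum>a\<le>m. real m * (c a * c (m - a)) - real a * (c a * c (m - a)))"
      by (intro sum.cong refl) (auto simp: of_nat_diff algebra_simps)
    also have "\<dots> = real m * S m - (\<Sum>a\<le>m. real a * (c a * c (m - a)))"
      by (simp add: sum_subtractf S_def sum_distrib_left)
    finally show ?thesis by simp
  qed
  have "(\<Sum>a\<le>n. (real a + 2) * c (Suc a) * c (n - a)) = (\<Sum>a\<le>n. (4 * real a + 2) * c a * c (n - a))"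
    by (simp add: assms(2))
  also have "\<dots> = 4 * (\<Sum>a\<le>n. real a * (c a * c (n - a))) + 2 * S n"
  proof -
    have "(\<Sum>a\<le>n. (4 * real a + 2) * c a * c (n - a)) = (\<Sum>a\<le>n. 4 * (real a * (c a * c (n - a))) + 2 * (c a * c (n - a)))"
      by (intro sum.cong refl) (simp only: distrib_right mult.assoc)
    then show ?thesis by (simp only: sum.distrib sum_distrib_left[symmetric] S_def)
  qed
  also have "\<dots> = (2 * real n + 2) * S n" unfolding T by (simp add: algebra_simps)
  finally have 1: "(\<Sum>a\<le>n. (real a + 2) * c (Suc a) * c (n - a)) = (2 * real n + 2) * S n" .
  have "(\<Sum>a\<le>Suc n. (real a + 1) * (c a * c (Suc n - a))) = c (Suc n) + (\<Sum>a\<le>n. (real a + 2) * c (Suc a) * c (n - a))"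
    using assms(1) by (subst sum.atMost_Suc_shift) (simp add: algebra_simps)
  moreover have "(\<Sum>a\<le>Suc n. (real a + 1) * (c a * c (Suc n - a))) = real (Suc n) / 2 * S (Suc n) + S (Suc n)"
    using T[of "Suc n"] unfolding S_def by (simp only: distrib_right sum.distrib) simp
  ultimately have "(real n + 3) * S (Suc n) = 2 * (c (Suc n) + (2 * real n + 2) * S n)"
    using 1 by (simp add: algebra_simps)
  also have "S n = c (Suc n)" using Suc by (simp add: S_def)
  also have "2 * (c (Suc n) + (2 * real n + 2) * c (Suc n)) = (real n + 3) * c (Suc (Suc n))"
    using assms(2)[of "Suc n"] by (simp add: algebra_simps)
  finally show ?case by (simp add: S_def)
qed

text \<open>An integral over the interval, so that the fundamental theorem of calculus applies;
  \<open>semicircle_law_moment\<close> identifies it with the moment of the law.\<close>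

definition semicircle_moment :: "nat \<Rightarrow> real" where
  "semicircle_moment k = integral {-2..2} (\<lambda>x. x ^ k * sqrt (4 - x\<^sup>2)) / (2 * pi)"

lemma semicircle_domain: "x \<in> {-2<..<2} \<Longrightarrow> 4 - (x::real)\<^sup>2 > 0"
  using abs_square_less_1[of "x / 2"] by (simp add: power_divide abs_less_iff)

lemma deriv_semicircle:
  assumes "4 - (x::real)\<^sup>2 > 0"
  shows "((\<lambda>x. sqrt (4 - x\<^sup>2)) has_real_derivative - (x / sqrt (4 - x\<^sup>2))) (at x)"
    and "((\<lambda>x. (4 - x\<^sup>2) * sqrt (4 - x\<^sup>2)) has_real_derivative - (3 * x * sqrt (4 - x\<^sup>2))) (at x)"
proof -
  show 1: "((\<lambda>x. sqrt (4 - x\<^sup>2)) has_real_derivative - (x / sqrt (4 - x\<^sup>2))) (at x)"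
    using assms by (auto intro!: derivative_eq_intros simp: field_simps)
  have 2: "((\<lambda>x::real. 4 - x\<^sup>2) has_real_derivative - (2 * x)) (at x)"
    by (auto intro!: derivative_eq_intros)
  have s: "(4 - x\<^sup>2) / sqrt (4 - x\<^sup>2) = sqrt (4 - x\<^sup>2)" using assms by (simp add: real_div_sqrt)
  have "- (2 * x) * sqrt (4 - x\<^sup>2) + - (x / sqrt (4 - x\<^sup>2)) * (4 - x\<^sup>2) =
      - (2 * x) * sqrt (4 - x\<^sup>2) - x * ((4 - x\<^sup>2) / sqrt (4 - x\<^sup>2))" by simp
  also have "\<dots> = - (3 * x * sqrt (4 - x\<^sup>2))" unfolding s by simp
  finally have e: "- (2 * x) * sqrt (4 - x\<^sup>2) + - (x / sqrt (4 - x\<^sup>2)) * (4 - x\<^sup>2) = - (3 * x * sqrt (4 - x\<^sup>2))" .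
  show "((\<lambda>x. (4 - x\<^sup>2) * sqrt (4 - x\<^sup>2)) has_real_derivative - (3 * x * sqrt (4 - x\<^sup>2))) (at x)"
    by (rule DERIV_cong[OF DERIV_mult[OF 2 1] e])
qed

lemma semicircle_moment_0: "semicircle_moment 0 = 1"
proof -
  \<comment> \<open>The antiderivative of sqrt(4 - x^2); at the end points the root vanishes and the
    arcsine is pi/2 or -pi/2.\<close>
  let ?F = "\<lambda>x::real. x * sqrt (4 - x\<^sup>2) / 2 + 2 * arcsin (x / 2)"
  have "((\<lambda>x. sqrt (4 - x\<^sup>2)) has_integral (?F 2 - ?F (-2))) {-2..2}"
  proof (rule fundamental_theorem_of_calculus_interior)
    show "continuous_on {-2..2} ?F" by (intro continuous_intros) auto
    fix x :: real assume x: "x \<in> {-2<..<2}"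
    note p = semicircle_domain[OF x]
    define s where "s = sqrt (4 - x\<^sup>2)"
    have s: "s > 0" "s * s = 4 - x\<^sup>2" using p by (auto simp: s_def)
    have q: "sqrt (1 - (x / 2)\<^sup>2) = s / 2"
    proof -
      have e: "1 - (x / 2)\<^sup>2 = (4 - x\<^sup>2) / 4" by (simp add: power_divide field_simps)
      show ?thesis unfolding e s_def by (simp add: real_sqrt_divide)
    qed
    have "((\<lambda>x. x / 2 :: real) has_real_derivative 1 / 2) (at x)" by (auto intro!: derivative_eq_intros)
    then have "((\<lambda>x. arcsin (x / 2)) has_real_derivative inverse (sqrt (1 - (x / 2)\<^sup>2)) * (1 / 2)) (at x)"
      by (rule DERIV_chain2[OF DERIV_arcsin, rotated 2]) (use x in auto)
    then have a: "((\<lambda>x. arcsin (x / 2)) has_real_derivative 1 / s) (at x)" unfolding q by (simp add: field_simps)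
    have "(?F has_real_derivative (1 * sqrt (4 - x\<^sup>2) + - (x / sqrt (4 - x\<^sup>2)) * x) / 2 + 2 * (1 / s)) (at x)"
      by (intro DERIV_add DERIV_cdivide DERIV_mult DERIV_cmult DERIV_ident deriv_semicircle p a)
    moreover have "(1 * sqrt (4 - x\<^sup>2) + - (x / sqrt (4 - x\<^sup>2)) * x) / 2 + 2 * (1 / s) = s"
      unfolding s_def[symmetric] using s by (simp add: field_simps power2_eq_square)
    ultimately show "(?F has_vector_derivative sqrt (4 - x\<^sup>2)) (at x)"
      by (simp add: s_def has_real_derivative_iff_has_vector_derivative)
  qed simp
  moreover have "?F 2 - ?F (-2) = 2 * pi" by (simp add: arcsin_minus)
  ultimately show ?thesis by (simp add: semicircle_moment_def integral_unique)
qed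

text \<open>The integral of the derivative of x^(k+1) (4 - x^2)^(3/2), a function that vanishes at
  both end points.\<close>

lemma semicircle_moment_rec: "(real k + 4) * semicircle_moment (k + 2) = 4 * (real k + 1) * semicircle_moment k"
proof -
  let ?F = "\<lambda>x::real. x ^ (k + 1) * ((4 - x\<^sup>2) * sqrt (4 - x\<^sup>2))"
  let ?f = "\<lambda>x::real. 4 * (real k + 1) * (x ^ k * sqrt (4 - x\<^sup>2)) - (real k + 4) * (x ^ (k + 2) * sqrt (4 - x\<^sup>2))"
  have "(?f has_integral (?F 2 - ?F (-2))) {-2..2}"
  proof (rule fundamental_theorem_of_calculus_interior)
    show "continuous_on {-2..2} ?F" by (intro continuous_intros)
    fix x :: real assume x: "x \<in> {-2<..<2}"
    note p = semicircle_domain[OF x]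
    have "((\<lambda>x::real. x ^ (k + 1)) has_real_derivative real (k + 1) * x ^ k) (at x)"
      using DERIV_pow[of "k + 1" x] by simp
    from DERIV_mult[OF this deriv_semicircle(2)[OF p]]
    have "(?F has_real_derivative real (k + 1) * x ^ k * ((4 - x\<^sup>2) * sqrt (4 - x\<^sup>2)) + - (3 * x * sqrt (4 - x\<^sup>2)) * x ^ (k + 1)) (at x)" .
    moreover have "real (k + 1) * x ^ k * ((4 - x\<^sup>2) * sqrt (4 - x\<^sup>2)) + - (3 * x * sqrt (4 - x\<^sup>2)) * x ^ (k + 1) = ?f x"
      by (simp add: algebra_simps power2_eq_square)
    ultimately show "(?F has_vector_derivative ?f x) (at x)"
      by (simp add: has_real_derivative_iff_has_vector_derivative)
  qed simp
  then have "integral {-2..2} ?f = 0" by (simp add: integral_unique)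
  moreover have "integral {-2..2} ?f = 4 * (real k + 1) * integral {-2..2} (\<lambda>x. x ^ k * sqrt (4 - x\<^sup>2)) -
      (real k + 4) * integral {-2..2} (\<lambda>x. x ^ (k + 2) * sqrt (4 - x\<^sup>2))"
    by (subst Henstock_Kurzweil_Integration.integral_diff)
      (intro integrable_continuous_interval continuous_intros, intro integrable_continuous_interval continuous_intros,
        simp only: integral_mult_right)
  ultimately show ?thesis by (simp add: semicircle_moment_def field_simps)
qed

lemma semicircle_moment_odd: "semicircle_moment (2 * n + 1) = 0"
proof (induction n)
  case 0
  let ?F = "\<lambda>x::real. - ((4 - x\<^sup>2) * sqrt (4 - x\<^sup>2)) / 3"
  have "((\<lambda>x. x ^ 1 * sqrt (4 - x\<^sup>2)) has_integral (?F 2 - ?F (-2))) {-2..2}"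
  proof (rule fundamental_theorem_of_calculus_interior)
    show "continuous_on {-2..2} ?F" by (intro continuous_intros) auto
    fix x :: real assume x: "x \<in> {-2<..<2}"
    note p = semicircle_domain[OF x]
    from DERIV_cdivide[OF DERIV_minus[OF deriv_semicircle(2)[OF p]], of 3]
    show "(?F has_vector_derivative x ^ 1 * sqrt (4 - x\<^sup>2)) (at x)"
      by (simp add: has_real_derivative_iff_has_vector_derivative)
  qed simp
  then show ?case by (simp add: semicircle_moment_def integral_unique)
next
  case (Suc n)
  then show ?case using semicircle_moment_rec[of "2 * n + 1"] by simp
qed

lemma semicircle_moment_odd': "odd k \<Longrightarrow> semicircle_moment k = 0"
  using semicircle_moment_odd by (auto elim!: oddE)

text \<open>Odd moments vanish, so only even indices contribute, and by
  \<open>semicircle_moment_rec\<close> the even moments satisfy the ratio recursion of the Catalan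
  numbers.\<close>

lemma semicircle_moment_convolution: "(\<Sum>a\<le>k. semicircle_moment a * semicircle_moment (k - a)) = semicircle_moment (k + 2)"
proof (cases "even k")
  case True
  then obtain n where k: "k = 2 * n" by auto
  have "(\<Sum>a\<le>k. semicircle_moment a * semicircle_moment (k - a)) = (\<Sum>a\<in>(\<lambda>a. 2 * a) ` {..n}. semicircle_moment a * semicircle_moment (k - a))"
  proof (rule sum.mono_neutral_right)
    show "\<forall>a\<in>{..k} - (\<lambda>a. 2 * a) ` {..n}. semicircle_moment a * semicircle_moment (k - a) = 0"
    proof
      fix a assume a: "a \<in> {..k} - (\<lambda>a. 2 * a) ` {..n}"
      have "odd a"
      proof
        assume "even a"
        then obtain m where "a = 2 * m" by auto
        then show False using a k by auto
      qed
      then show "semicircle_moment a * semicircle_moment (k - a) = 0" using semicircle_moment_odd' by simp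
    qed
  qed (auto simp: k)
  also have "\<dots> = (\<Sum>a\<le>n. semicircle_moment (2 * a) * semicircle_moment (2 * (n - a)))"
    by (subst sum.reindex) (auto simp: inj_on_def k diff_mult_distrib2 intro!: sum.cong)
  also have "\<dots> = semicircle_moment (2 * Suc n)"
  proof (rule semicircle_convolution[of "\<lambda>n. semicircle_moment (2 * n)"])
    show "(real m + 2) * semicircle_moment (2 * Suc m) = (4 * real m + 2) * semicircle_moment (2 * m)" for m
      using semicircle_moment_rec[of "2 * m"] by (simp add: algebra_simps)
  qed (simp add: semicircle_moment_0)
  finally show ?thesis by (simp add: k)
next
  case False
  then obtain n where k: "k = 2 * n + 1" by (elim oddE)
  have "semicircle_moment a * semicircle_moment (k - a) = 0" if "a \<le> k" for a
  proof (cases "even a")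
    case True
    then have "odd (k - a)" using that False by simp
    then show ?thesis using semicircle_moment_odd' by simp
  next
    case False
    then show ?thesis using semicircle_moment_odd' by simp
  qed
  then have "(\<Sum>a\<le>k. semicircle_moment a * semicircle_moment (k - a)) = 0" by (intro sum.neutral) simp
  then show ?thesis using semicircle_moment_odd[of "n + 1"] by (simp add: k)
qed

lemma semicircle_law_moment:
  "integrable semicircle_law (\<lambda>x. x ^ k)" "(\<integral>x. x ^ k \<partial>semicircle_law) = semicircle_moment k"
proof -
  let ?f = "\<lambda>x::real. indicator {-2..2} x * sqrt (4 - x\<^sup>2) / (2 * pi)"
  have m: "?f \<in> borel_measurable lborel" by measurable
  have nn: "AE x in lborel. 0 \<le> ?f x"
  proof (rule AE_I2)
    fix x :: real
    show "0 \<le> ?f x"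
    proof (cases "x \<in> {-2..2}")
      case True
      then have "\<bar>x\<bar> \<le> 2" by auto
      then have "x\<^sup>2 \<le> 4" using abs_le_square_iff[of x 2] by simp
      then show ?thesis by simp
    qed simp
  qed
  have eq: "?f x *\<^sub>R x ^ k = indicator {-2..2} x *\<^sub>R (x ^ k * sqrt (4 - x\<^sup>2) / (2 * pi))" for x :: real
    by (simp add: mult_ac)
  have s: "set_integrable lborel {-2..2} (\<lambda>x::real. x ^ k * sqrt (4 - x\<^sup>2) / (2 * pi))"
    by (rule borel_integrable_atLeastAtMost') (intro continuous_intros, simp)
  have e: "(\<lambda>x. ennreal (indicator {-2..2} x * sqrt (4 - x\<^sup>2) / (2 * pi))) = (\<lambda>x. ennreal (?f x))" by simp
  show "integrable semicircle_law (\<lambda>x. x ^ k)"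
    unfolding semicircle_law_def
    by (subst integrable_density[OF _ m nn], simp, unfold eq) (rule s[unfolded set_integrable_def])
  have "(\<integral>x. x ^ k \<partial>semicircle_law) = (\<integral>x. ?f x *\<^sub>R x ^ k \<partial>lborel)"
    unfolding semicircle_law_def by (rule integral_density[OF _ m nn]) simp
  also have "\<dots> = (LINT x:{-2..2}|lborel. x ^ k * sqrt (4 - x\<^sup>2) / (2 * pi))"
    unfolding eq set_lebesgue_integral_def ..
  also have "\<dots> = integral {-2..2} (\<lambda>x. x ^ k * sqrt (4 - x\<^sup>2) / (2 * pi))"
    by (rule set_borel_integral_eq_integral(2)[OF s])
  also have "\<dots> = semicircle_moment k" by (simp add: semicircle_moment_def)
  finally show "(\<integral>x. x ^ k \<partial>semicircle_law) = semicircle_moment k" .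
qed

definition normal_moment :: "nat \<Rightarrow> real" where
  "normal_moment k = (\<integral>x. x ^ k \<partial>density lborel (\<lambda>x. ennreal (std_normal_density x)))"

lemma gaussian_moment:
  "integrable (density lborel (\<lambda>x. ennreal (std_normal_density x))) (\<lambda>x. x ^ k)"
  by (subst integrable_density) (auto intro!: integrable_std_normal_moment AE_I2)

lemma normal_moment_eq: "normal_moment k = (\<integral>x. std_normal_density x * x ^ k \<partial>lborel)"
  unfolding normal_moment_def by (subst integral_density) (auto intro!: AE_I2)

lemma normal_moment_0: "normal_moment 0 = 1"
  using std_normal_moment_even[of 0] by (simp add: normal_moment_eq has_bochner_integral_integral_eq)

lemma normal_moment_1: "normal_moment 1 = 0"
  using std_normal_moment_odd[of 0] by (simp add: normal_moment_eq has_bochner_integral_integral_eq)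

text \<open>Wick's recursion for one variable, read off from the closed form (2n)! / (2^n n!) of the
  even moments and the vanishing of the odd ones.\<close>

lemma normal_moment_rec: "normal_moment (k + 2) = (real k + 1) * normal_moment k"
proof (cases "even k")
  case True
  then obtain n where k: "k = 2 * n" by auto
  have e: "normal_moment (2 * m) = fact (2 * m) / (2 ^ m * fact m)" for m
    using std_normal_moment_even[of m] by (simp add: normal_moment_eq has_bochner_integral_integral_eq)
  have "normal_moment (k + 2) = fact (2 * Suc n) / (2 ^ Suc n * fact (Suc n))" using e[of "Suc n"] by (simp add: k)
  also have "\<dots> = (real k + 1) * (fact (2 * n) / (2 ^ n * fact n))"
  proof -
    have 1: "(fact (2 * Suc n) :: real) = (2 * (real n + 1)) * ((2 * real n + 1) * fact (2 * n))"
      by (simp add: algebra_simps)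
    have 2: "(2 ^ Suc n * fact (Suc n) :: real) = (2 * (real n + 1)) * (2 ^ n * fact n)"
      by (simp add: algebra_simps)
    have "2 * (real n + 1) > 0" by simp
    then have "2 * (real n + 1) \<noteq> 0" by (rule less_imp_neq[symmetric])
    then show ?thesis unfolding 1 2 by (subst mult_divide_mult_cancel_left) (auto simp: k)
  qed
  finally show ?thesis using e[of n] by (simp add: k)
next
  case False
  then obtain n where k: "k = 2 * n + 1" by (elim oddE)
  have "normal_moment (2 * m + 1) = 0" for m
    using std_normal_moment_odd[of m] by (simp add: normal_moment_eq has_bochner_integral_integral_eq)
  from this[of n] this[of "Suc n"] show ?thesis by (simp add: k)
qed

section \<open>Random band matrices\<close>

locale band_family = prob_space M
  for M :: "'w measure" +
  fixes X :: "'i \<Rightarrow> nat \<Rightarrow> nat \<Rightarrow> 'w \<Rightarrow> complex" and \<beta> :: "'i \<Rightarrow> real" and b :: "'i \<Rightarrow> nat \<Rightarrow> nat"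
    and I I1 I3 :: "'i set" and \<Theta> :: "nat \<Rightarrow> 'i \<Rightarrow> 'w \<Rightarrow> complex mat"
  assumes X: "\<And>i. i \<in> I \<Longrightarrow> finite_moment_wigner_array M (X i)"
    and param: "\<And>i. i \<in> I \<Longrightarrow> wigner_parameter M (X i) (complex_of_real (\<beta> i))"
    and indep: "\<And>n. independent_matrices M n (\<lambda>i. wigner_matrix (X i) n) I"
    and sub: "I1 \<subseteq> I" "I3 \<subseteq> I" "I1 \<inter> I3 = {}"
    and slow: "\<And>i. i \<in> I1 \<Longrightarrow> slow_growth (b i)"
    and full: "\<And>i. i \<in> I3 \<Longrightarrow> full_proportion (b i)"
    and \<Theta>1: "\<And>n i. i \<in> I1 \<Longrightarrow> \<Theta> n i = slow_band_matrix (X i) (b i) n"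
    and \<Theta>3: "\<And>n i. i \<in> I3 \<Longrightarrow> \<Theta> n i = full_band_matrix (X i) (b i) n"
begin

abbreviation "J \<equiv> I1 \<union> I3"

section \<open>The variance profile of a band matrix\<close>

definition scaling :: "nat \<Rightarrow> 'i \<Rightarrow> real" where
  "scaling n i = (if i \<in> I1 then 1 / sqrt (2 * real (b i n)) else 1 / sqrt (real n))"

definition band_coeff :: "nat \<Rightarrow> 'i \<Rightarrow> nat \<Rightarrow> nat \<Rightarrow> real" where
  "band_coeff n i j k = (if \<bar>int j - int k\<bar> \<le> int (b i n) then scaling n i else 0)"

definition K :: "nat \<Rightarrow> 'i \<Rightarrow> nat \<Rightarrow> nat \<Rightarrow> real" where
  "K n i j k = (band_coeff n i j k)\<^sup>2"

definition \<epsilon> :: "nat \<Rightarrow> 'i \<Rightarrow> real" where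
  "\<epsilon> n i = (scaling n i)\<^sup>2"

definition entry :: "nat \<Rightarrow> 'w \<Rightarrow> 'i \<times> nat \<times> nat \<Rightarrow> complex" where
  "entry n \<omega> = (\<lambda>(i, j, k). \<Theta> n i \<omega> $$ (j, k))"

definition entry_moment :: "nat \<Rightarrow> ('i \<times> nat \<times> nat) list \<Rightarrow> complex" where
  "entry_moment n es = (\<integral>\<omega>. prod_list (map (entry n \<omega>) es) \<partial>M)"

text \<open>The off-diagonal entries share one law and the diagonal ones another; the sum dominates
  the absolute moments of both.\<close>

definition C :: "'i \<Rightarrow> nat \<Rightarrow> real" where
  "C i m = (\<integral>\<omega>. norm (X i 0 1 \<omega>) ^ m \<partial>M) + (\<integral>\<omega>. norm (X i 0 0 \<omega>) ^ m \<partial>M)"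

lemma scaling_nonneg: "0 \<le> scaling n i"
  by (simp add: scaling_def)

lemma band_coeff_nonneg: "0 \<le> band_coeff n i j k"
  by (simp add: band_coeff_def scaling_nonneg)

lemma band_coeff_sym: "band_coeff n i j k = band_coeff n i k j"
  by (simp add: band_coeff_def abs_minus_commute)

lemma eps_I1: "i \<in> I1 \<Longrightarrow> \<epsilon> n i = 1 / (2 * real (b i n))"
  by (simp add: \<epsilon>_def scaling_def power_divide)

lemma eps_I3: "i \<in> I3 \<Longrightarrow> \<epsilon> n i = 1 / real n"
  using sub by (auto simp: \<epsilon>_def scaling_def power_divide)

lemma K_eq: "K n i j k = (if \<bar>int j - int k\<bar> \<le> int (b i n) then \<epsilon> n i else 0)"
  by (simp add: K_def band_coeff_def \<epsilon>_def)

lemma b_slow: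
  assumes "i \<in> I1"
  shows "filterlim (b i) at_top sequentially" "(\<lambda>n. real (b i n) / real n) \<longlonglongrightarrow> 0"
  using slow[OF assms] unfolding slow_growth_def by (auto dest: smalloD_tendsto)

lemma row_eq: "(\<Sum>k<n. K n i j k) = real (card {k. k < n \<and> \<bar>int j - int k\<bar> \<le> int (b i n)}) * \<epsilon> n i"
proof -
  have "(\<Sum>k<n. K n i j k) = (\<Sum>k\<in>{k. k < n \<and> \<bar>int j - int k\<bar> \<le> int (b i n)}. \<epsilon> n i)"
    unfolding K_eq by (subst sum.inter_filter[symmetric]) (auto intro!: sum.cong)
  then show ?thesis by simp
qed

lemma card_band_le: "card {k. k < n \<and> \<bar>int j - int k\<bar> \<le> int c} \<le> 2 * c + 1"
proof -
  have "{k. k < n \<and> \<bar>int j - int k\<bar> \<le> int c} \<subseteq> {j - c..j + c}" by auto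
  then have "card {k. k < n \<and> \<bar>int j - int k\<bar> \<le> int c} \<le> card {j - c..j + c}" by (intro card_mono) auto
  then show ?thesis by simp
qed

lemma card_band_le_n: "card {k. k < n \<and> \<bar>int j - int k\<bar> \<le> int c} \<le> n"
  using card_mono[of "{..<n}" "{k. k < n \<and> \<bar>int j - int k\<bar> \<le> int c}"] by auto

lemma row_bound: "i \<in> J \<Longrightarrow> (\<Sum>k<n. K n i j k) \<le> 2"
proof -
  assume "i \<in> J"
  then show ?thesis
  proof
    assume i: "i \<in> I1"
    have "real (card {k. k < n \<and> \<bar>int j - int k\<bar> \<le> int (b i n)}) \<le> 2 * real (b i n) + 1"
      using card_band_le[of n j "b i n"] by linarith
    \<comment> \<open>For band width 0 the scaling is 1 / 0 = 0; otherwise (2b + 1) / (2b) is at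
      most 3/2.\<close>
    then show ?thesis unfolding row_eq eps_I1[OF i]
      by (cases "b i n = 0") (auto simp: field_simps)
  next
    assume i: "i \<in> I3"
    have "real (card {k. k < n \<and> \<bar>int j - int k\<bar> \<le> int (b i n)}) \<le> real n"
      using card_band_le_n[of n j "b i n"] by linarith
    then show ?thesis unfolding row_eq eps_I3[OF i]
      by (cases "n = 0") (auto simp: field_simps)
  qed
qed

lemma row_nonneg: "0 \<le> (\<Sum>k<n. K n i j k)"
  by (intro sum_nonneg) (simp add: K_def)

text \<open>A row at distance at least b from both ends has exactly 2b + 1 positions in the band, so
  its sum deviates from 1 by 1/(2b). At most 2b rows are closer to an end, each with deviation at
  most 1. The average is at most 1/(2b) + 2b/n.\<close>

lemma row_avg_slow:
  assumes i: "i \<in> I1"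
  shows "(\<lambda>n. (\<Sum>j<n. \<bar>(\<Sum>k<n. K n i j k) - 1\<bar>) / real n) \<longlonglongrightarrow> 0"
proof (rule Lim_null_comparison)
  have "(\<lambda>n. 1 / (2 * real (b i n))) \<longlonglongrightarrow> 0"
    by (intro real_tendsto_divide_at_top[OF tendsto_const] filterlim_tendsto_pos_mult_at_top[OF tendsto_const]
        filterlim_compose[OF filterlim_real_sequentially b_slow(1)[OF i]]) auto
  from tendsto_add[OF this tendsto_mult[OF tendsto_const[of 2] b_slow(2)[OF i]]]
  show "(\<lambda>n. 1 / (2 * real (b i n)) + 2 * (real (b i n) / real n)) \<longlonglongrightarrow> 0" by simp
  have "eventually (\<lambda>n. b i n \<ge> 1) sequentially"
    using b_slow(1)[OF i] by (simp add: filterlim_at_top)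
  then show "eventually (\<lambda>n. norm ((\<Sum>j<n. \<bar>(\<Sum>k<n. K n i j k) - 1\<bar>) / real n) \<le>
      1 / (2 * real (b i n)) + 2 * (real (b i n) / real n)) sequentially"
    using eventually_gt_at_top[of 0]
  proof eventually_elim
    case (elim n)
    let ?c = "b i n"
    have "\<bar>(\<Sum>k<n. K n i j k) - 1\<bar> \<le> 1 / (2 * real ?c) + (if j < ?c \<or> n \<le> j + ?c then 1 else 0)" if j: "j < n" for j
    proof (cases "j < ?c \<or> n \<le> j + ?c")
      case True
      have "\<bar>(\<Sum>k<n. K n i j k) - 1\<bar> \<le> 1" using row_bound[of i n j] row_nonneg[of n i j] i by auto
      moreover have "0 \<le> 1 / (2 * real ?c)" by simp
      ultimately have "\<bar>(\<Sum>k<n. K n i j k) - 1\<bar> \<le> 1 / (2 * real ?c) + 1" by linarith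
      then show ?thesis using True by simp
    next
      case False
      have "{k. k < n \<and> \<bar>int j - int k\<bar> \<le> int ?c} = {j - ?c..j + ?c}" using False by auto
      then have "(\<Sum>k<n. K n i j k) = (2 * real ?c + 1) / (2 * real ?c)"
        using False unfolding row_eq eps_I1[OF i] by simp
      also have "\<dots> = 1 + 1 / (2 * real ?c)" using elim by (simp add: field_simps)
      finally show ?thesis by simp
    qed
    then have "(\<Sum>j<n. \<bar>(\<Sum>k<n. K n i j k) - 1\<bar>) \<le> (\<Sum>j<n. 1 / (2 * real ?c) + (if j < ?c \<or> n \<le> j + ?c then 1 else 0))"
      by (intro sum_mono) auto
    also have "\<dots> = real n * (1 / (2 * real ?c)) + real (card {j. j < n \<and> (j < ?c \<or> n \<le> j + ?c)})"
      by (simp add: sum.distrib sum.If_cases Int_def)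
    also have "card {j. j < n \<and> (j < ?c \<or> n \<le> j + ?c)} \<le> 2 * ?c"
    proof -
      have "card {j. j < n \<and> (j < ?c \<or> n \<le> j + ?c)} \<le> card ({..<?c} \<union> {n - ?c..<n})"
        by (intro card_mono) auto
      also have "\<dots> \<le> card {..<?c} + card {n - ?c..<n}" by (rule card_Un_le)
      also have "\<dots> \<le> 2 * ?c" by simp
      finally show ?thesis .
    qed
    finally have "(\<Sum>j<n. \<bar>(\<Sum>k<n. K n i j k) - 1\<bar>) \<le> real n * (1 / (2 * real ?c)) + 2 * real ?c" by simp
    then have "(\<Sum>j<n. \<bar>(\<Sum>k<n. K n i j k) - 1\<bar>) / real n \<le> (real n * (1 / (2 * real ?c)) + 2 * real ?c) / real n"
      by (intro divide_right_mono) auto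
    also have "\<dots> = 1 / (2 * real ?c) + 2 * (real ?c / real n)" using elim by (simp add: add_divide_distrib)
    finally show ?case by (simp add: sum_nonneg)
  qed
qed

text \<open>When b is at most n, a row misses at most n - b positions on either side of the
  diagonal, and otherwise none. The deviation is therefore at most 2|1 - b/n|, uniformly in the
  row.\<close>

lemma row_avg_full:
  assumes i: "i \<in> I3"
  shows "(\<lambda>n. (\<Sum>j<n. \<bar>(\<Sum>k<n. K n i j k) - 1\<bar>) / real n) \<longlonglongrightarrow> 0"
proof (rule Lim_null_comparison)
  have "(\<lambda>n. real (b i n) / real n) \<longlonglongrightarrow> 1" using full[OF i] by (simp add: full_proportion_def)
  from tendsto_mult[OF tendsto_const[of 2] tendsto_rabs[OF tendsto_diff[OF tendsto_const[of 1] this]]]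
  show "(\<lambda>n. 2 * \<bar>1 - real (b i n) / real n\<bar>) \<longlonglongrightarrow> 0" by simp
  show "eventually (\<lambda>n. norm ((\<Sum>j<n. \<bar>(\<Sum>k<n. K n i j k) - 1\<bar>) / real n) \<le> 2 * \<bar>1 - real (b i n) / real n\<bar>) sequentially"
    using eventually_gt_at_top[of 0]
  proof eventually_elim
    case (elim n)
    let ?c = "b i n"
    have "\<bar>(\<Sum>k<n. K n i j k) - 1\<bar> \<le> 2 * \<bar>1 - real ?c / real n\<bar>" if j: "j < n" for j
    proof -
      let ?B = "{k. k < n \<and> \<bar>int j - int k\<bar> \<le> int ?c}"
      have "{..<n} - ?B \<subseteq> {?c..<n} \<union> {..<n - ?c}" using j by auto
      then have "card ({..<n} - ?B) \<le> card ({?c..<n} \<union> {..<n - ?c})" by (intro card_mono) auto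
      also have "\<dots> \<le> card {?c..<n} + card {..<n - ?c}" by (rule card_Un_le)
      finally have 1: "card ({..<n} - ?B) \<le> 2 * (n - ?c)" by simp
      have 2: "card ({..<n} - ?B) = n - card ?B" by (subst card_Diff_subset) auto
      have "real n - real (card ?B) \<le> 2 * \<bar>real n - real ?c\<bar>"
      proof -
        have "real (n - card ?B) \<le> 2 * real (n - ?c)" using 1 2 by linarith
        moreover have "real (n - card ?B) = real n - real (card ?B)"
          using card_band_le_n[of n j ?c] by (rule of_nat_diff)
        moreover have "real (n - ?c) \<le> \<bar>real n - real ?c\<bar>" by (cases "?c \<le> n") auto
        ultimately show ?thesis by linarith
      qed
      then have "(real n - real (card ?B)) / real n \<le> 2 * \<bar>real n - real ?c\<bar> / real n"
        by (rule divide_right_mono) simp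
      moreover have "\<bar>real n - real ?c\<bar> / real n = \<bar>1 - real ?c / real n\<bar>"
        using elim by (simp add: abs_if field_simps)
      moreover have "\<bar>(\<Sum>k<n. K n i j k) - 1\<bar> = (real n - real (card ?B)) / real n"
      proof -
        have "(\<Sum>k<n. K n i j k) - 1 = - ((real n - real (card ?B)) / real n)"
          unfolding row_eq eps_I3[OF i] using elim by (simp add: field_simps)
        moreover have "real (card ?B) \<le> real n" using card_band_le_n[of n j ?c] by linarith
        ultimately show ?thesis by simp
      qed
      ultimately show ?thesis by simp
    qed
    then have "(\<Sum>j<n. \<bar>(\<Sum>k<n. K n i j k) - 1\<bar>) \<le> (\<Sum>j<n. 2 * \<bar>1 - real ?c / real n\<bar>)"
      by (intro sum_mono) auto
    then have "(\<Sum>j<n. \<bar>(\<Sum>k<n. K n i j k) - 1\<bar>) / real n \<le> 2 * \<bar>1 - real ?c / real n\<bar>"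
      using elim by (simp add: field_simps)
    then show ?case by (simp add: sum_nonneg)
  qed
qed

lemma eps_tendsto: "i \<in> J \<Longrightarrow> (\<lambda>n. \<epsilon> n i) \<longlonglongrightarrow> 0"
proof -
  assume "i \<in> J"
  then show ?thesis
  proof
    assume i: "i \<in> I1"
    show ?thesis unfolding eps_I1[OF i]
      by (intro real_tendsto_divide_at_top[OF tendsto_const] filterlim_tendsto_pos_mult_at_top[OF tendsto_const]
        filterlim_compose[OF filterlim_real_sequentially b_slow(1)[OF i]]) auto
  next
    assume i: "i \<in> I3"
    show ?thesis unfolding eps_I3[OF i] by (rule lim_1_over_n)
  qed
qed

lemma kernel_family_K: "kernel_family J K \<epsilon>"
proof
  fix n i j k
  show "0 \<le> K n i j k" by (simp add: K_def)
  show "K n i j k = K n i k j" by (simp add: K_def band_coeff_sym)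
  show "K n i j k \<le> \<epsilon> n i" by (simp add: K_eq \<epsilon>_def)
  show "\<epsilon> n i \<le> 1" if "i \<in> J"
    using that
  proof
    assume i: "i \<in> I1"
    show ?thesis unfolding eps_I1[OF i] by (cases "b i n = 0") (auto simp: field_simps)
  next
    assume i: "i \<in> I3"
    show ?thesis unfolding eps_I3[OF i] by (cases "n = 0") (auto simp: field_simps)
  qed
qed (use eps_tendsto row_bound row_avg_slow row_avg_full in auto)

lemma J_I: "i \<in> J \<Longrightarrow> i \<in> I"
  using sub by auto

lemma Theta_carrier: "i \<in> J \<Longrightarrow> \<Theta> n i \<in> carrier (random_matrix_space M n)"
  using band_in_space(1,2)[OF prob_space_axioms X[OF J_I]] by (auto simp: \<Theta>1 \<Theta>3)

lemma deg_carrier: "i \<in> J \<Longrightarrow> (\<lambda>\<omega>. deg (\<Theta> n i \<omega>)) \<in> carrier (random_matrix_space M n)"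
  using band_in_space(3,4)[OF prob_space_axioms X[OF J_I]] by (auto simp: \<Theta>1 \<Theta>3)

section \<open>Independence of the entries\<close>

definition upper_entry :: "'i \<times> nat \<times> nat \<Rightarrow> 'w \<Rightarrow> complex" where
  "upper_entry = (\<lambda>(i, j, k). X i j k)"

text \<open>Every entry is a deterministic function of one variable on or above the diagonal, which
  reduces the joint moments of entries to independence of the \<open>upper_entry\<close>
  variables.\<close>

definition entry_map :: "nat \<Rightarrow> 'i \<times> nat \<times> nat \<Rightarrow> complex \<Rightarrow> complex" where
  "entry_map n = (\<lambda>(i, j, k) z. of_real (band_coeff n i j k) * (if j \<le> k then z else cnj z))"

lemma entry_eq:
  assumes "e \<in> J \<times> {..<n} \<times> {..<n}"
  shows "entry n \<omega> e = entry_map n e (upper_entry (key e) \<omega>)"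
proof -
  obtain i j k where e: "e = (i, j, k)" by (cases e)
  have ijk: "i \<in> J" "j < n" "k < n" using assms e by auto
  have "\<Theta> n i \<omega> = of_real (scaling n i) \<cdot>\<^sub>m band_matrix (X i) (b i n) n \<omega>"
  proof (cases "i \<in> I1")
    case False
    then show ?thesis using ijk \<Theta>3[of i n] by (simp add: scaling_def full_band_matrix_def)
  qed (simp add: \<Theta>1 scaling_def slow_band_matrix_def)
  then show ?thesis
    using ijk by (auto simp: entry_def e entry_map_def upper_entry_def key_def band_coeff_def band_matrix_def wigner_matrix_def min_def max_def)
qed

lemma entry_moments: "e \<in> J \<times> {..<n} \<times> {..<n} \<Longrightarrow> all_moments M (\<lambda>\<omega>. entry n \<omega> e)"
  using Theta_carrier by (auto simp: entry_def random_matrix_space_def)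

lemma prod_list_moments:
  assumes "\<And>x. x \<in> set xs \<Longrightarrow> all_moments M (\<lambda>\<omega>. f \<omega> x)"
  shows "all_moments M (\<lambda>\<omega>. prod_list (map (f \<omega>) xs))"
  using assms
proof (induction xs)
  case (Cons x xs)
  have "all_moments M (\<lambda>\<omega>. f \<omega> x * prod_list (map (f \<omega>) xs))"
    by (rule all_moments_mult) (use Cons in auto)
  then show ?case by simp
qed (simp add: all_moments_const[OF prob_space_axioms])

lemma prod_moments:
  assumes "\<And>x. x \<in> S \<Longrightarrow> all_moments M (f x)"
  shows "all_moments M (\<lambda>\<omega>. \<Prod>x\<in>S. f x \<omega>)"
  using assms
  by (induction S rule: infinite_finite_induct)
    (auto intro!: all_moments_mult all_moments_const[OF prob_space_axioms])

text \<open>Independence is given on two levels, between the matrices of size \<open>n\<close> and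
  between the entries of each array. The product is grouped by matrix, and the expectation
  factorises first over the matrices and then inside each of them.\<close>

lemma indep_product:
  fixes f :: "'i \<times> nat \<times> nat \<Rightarrow> complex \<Rightarrow> complex"
  assumes S: "finite S" "S \<subseteq> {(i, j, k). i \<in> J \<and> j \<le> k \<and> k < n}"
    and f: "\<And>e. e \<in> S \<Longrightarrow> f e \<in> borel_measurable borel" "\<And>e. e \<in> S \<Longrightarrow> all_moments M (\<lambda>\<omega>. f e (upper_entry e \<omega>))"
  shows "(\<integral>\<omega>. (\<Prod>e\<in>S. f e (upper_entry e \<omega>)) \<partial>M) = (\<Prod>e\<in>S. \<integral>\<omega>. f e (upper_entry e \<omega>) \<partial>M)"
proof -
  define D where "D i = {jk. (i, jk) \<in> S}" for i
  define L where "L = fst ` S"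
  have SD: "S = Sigma L D" by (force simp: L_def D_def)
  have fin: "finite L" "\<And>i. finite (D i)"
  proof -
    show "finite L" using S by (simp add: L_def)
    show "finite (D i)" for i by (rule finite_subset[of _ "snd ` S"]) (use S in \<open>force simp: D_def\<close>)+
  qed
  have LI: "L \<subseteq> I" "L \<subseteq> J" using S(2) J_I by (auto simp: L_def)
  have Dn: "(j, k) \<in> D i \<Longrightarrow> i \<in> J \<and> j \<le> k \<and> k < n" for i j k using S(2) by (auto simp: D_def)
  define Z where "Z i \<omega> = (\<Prod>jk\<in>D i. f (i, jk) (upper_entry (i, jk) \<omega>))" for i \<omega>
  have prodS: "(\<Prod>e\<in>S. g e) = (\<Prod>i\<in>L. \<Prod>jk\<in>D i. g (i, jk))" for g :: "'i \<times> nat \<times> nat \<Rightarrow> complex"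
    unfolding SD using fin by (subst prod.Sigma) auto
  have Zm: "all_moments M (Z i)" for i
    unfolding Z_def by (rule prod_moments) (use f(2) in \<open>auto simp: D_def\<close>)
  have "indep_vars (\<lambda>_. Pi\<^sub>M ({..<n} \<times> {..<n}) (\<lambda>_. borel))
      (\<lambda>i \<omega>. \<lambda>jk\<in>{..<n} \<times> {..<n}. wigner_matrix (X i) n \<omega> $$ jk) L"
    using indep[of n] LI(1) unfolding independent_matrices_def by (rule indep_vars_subset)
  then have "indep_vars (\<lambda>_. borel) (\<lambda>i \<omega>. (\<lambda>y. \<Prod>jk\<in>D i. f (i, jk) (y jk))
      (\<lambda>jk\<in>{..<n} \<times> {..<n}. wigner_matrix (X i) n \<omega> $$ jk)) L"
  proof (rule indep_vars_compose2)
    fix i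
    show "(\<lambda>y. \<Prod>jk\<in>D i. f (i, jk) (y jk)) \<in> Pi\<^sub>M ({..<n} \<times> {..<n}) (\<lambda>_. borel) \<rightarrow>\<^sub>M borel"
    proof (rule borel_measurable_prod)
      fix jk assume jk: "jk \<in> D i"
      then have "jk \<in> {..<n} \<times> {..<n}" using Dn[of "fst jk" "snd jk" i] by (cases jk) auto
      then have "(\<lambda>y. y jk) \<in> Pi\<^sub>M ({..<n} \<times> {..<n}) (\<lambda>_. borel :: complex measure) \<rightarrow>\<^sub>M borel"
        by (rule measurable_component_singleton)
      then show "(\<lambda>y. f (i, jk) (y jk)) \<in> Pi\<^sub>M ({..<n} \<times> {..<n}) (\<lambda>_. borel) \<rightarrow>\<^sub>M borel"
        by (rule measurable_compose[OF _ f(1)]) (use jk in \<open>simp add: D_def\<close>)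
    qed
  qed
  also have "(\<lambda>i \<omega>. (\<lambda>y. \<Prod>jk\<in>D i. f (i, jk) (y jk)) (\<lambda>jk\<in>{..<n} \<times> {..<n}. wigner_matrix (X i) n \<omega> $$ jk)) = Z"
  proof (intro ext)
    fix i \<omega>
    show "(\<Prod>jk\<in>D i. f (i, jk) ((\<lambda>jk\<in>{..<n} \<times> {..<n}. wigner_matrix (X i) n \<omega> $$ jk) jk)) = Z i \<omega>"
      unfolding Z_def
    proof (intro prod.cong refl)
      fix jk assume "jk \<in> D i"
      then show "f (i, jk) ((\<lambda>jk\<in>{..<n} \<times> {..<n}. wigner_matrix (X i) n \<omega> $$ jk) jk) = f (i, jk) (upper_entry (i, jk) \<omega>)"
        using Dn[of "fst jk" "snd jk" i] by (cases jk) (auto simp: wigner_matrix_def upper_entry_def)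
    qed
  qed
  finally have iZ: "indep_vars (\<lambda>_. borel) Z L" .
  have 1: "(\<integral>\<omega>. (\<Prod>i\<in>L. Z i \<omega>) \<partial>M) = (\<Prod>i\<in>L. \<integral>\<omega>. Z i \<omega> \<partial>M)"
    by (rule indep_vars_lebesgue_integral[OF fin(1) iZ]) (rule all_moments_integrable[OF Zm])
  have 2: "(\<integral>\<omega>. Z i \<omega> \<partial>M) = (\<Prod>jk\<in>D i. \<integral>\<omega>. f (i, jk) (upper_entry (i, jk) \<omega>) \<partial>M)" if i: "i \<in> L" for i
  proof -
    have "indep_vars (\<lambda>_. borel) (\<lambda>(j, k). X i j k) {(j, k). j \<le> k}"
      using X[of i] LI i by (auto simp: finite_moment_wigner_array_def wigner_array_def)
    then have "indep_vars (\<lambda>_. borel) (\<lambda>(j, k). X i j k) (D i)"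
      by (rule indep_vars_subset) (use Dn in auto)
    then have "indep_vars (\<lambda>_. borel) (\<lambda>jk \<omega>. f (i, jk) ((case jk of (j, k) \<Rightarrow> X i j k) \<omega>)) (D i)"
      by (rule indep_vars_compose2) (use f(1) in \<open>auto simp: D_def\<close>)
    then have "indep_vars (\<lambda>_. borel) (\<lambda>jk \<omega>. f (i, jk) (upper_entry (i, jk) \<omega>)) (D i)"
      by (simp add: upper_entry_def case_prod_unfold)
    then show ?thesis unfolding Z_def
      by (rule indep_vars_lebesgue_integral[OF fin(2)]) (rule all_moments_integrable, rule f(2), simp add: D_def)
  qed
  show ?thesis unfolding prodS using 1 2 by (simp add: Z_def)
qed

lemma entry_map_measurable: "entry_map n e \<in> borel_measurable borel"
proof -
  obtain i j k where e: "e = (i, j, k)" by (cases e)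
  have "cnj \<in> borel_measurable borel" by (intro borel_measurable_continuous_onI continuous_on_cnj continuous_on_id)
  then show ?thesis unfolding entry_map_def e by (cases "j \<le> k") auto
qed

lemma key_range: "e \<in> J \<times> {..<n} \<times> {..<n} \<Longrightarrow> key e \<in> {(i, j, k). i \<in> J \<and> j \<le> k \<and> k < n}"
  by (auto simp: key_def)

text \<open>Entries with the same key are functions of one variable, so the product is one of
  functions of independent variables. A key in \<open>S\<close> that does not occur contributes the
  empty product.\<close>

lemma entry_moment_keys:
  assumes es: "set es \<subseteq> J \<times> {..<n} \<times> {..<n}" and S: "finite S" "key ` set es \<subseteq> S"
    "S \<subseteq> {(i, j, k). i \<in> J \<and> j \<le> k \<and> k < n}"
  shows "entry_moment n es = (\<Prod>\<kappa>\<in>S. entry_moment n (filter (\<lambda>e. key e = \<kappa>) es))"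
proof -
  define f where "f \<kappa> z = prod_list (map (\<lambda>e. entry_map n e z) (filter (\<lambda>e. key e = \<kappa>) es))" for \<kappa> z
  have fY: "f \<kappa> (upper_entry \<kappa> \<omega>) = prod_list (map (entry n \<omega>) (filter (\<lambda>e. key e = \<kappa>) es))" for \<kappa> \<omega>
    unfolding f_def by (intro arg_cong[where f = prod_list] map_cong refl) (use entry_eq es in auto)
  have "prod_list (map (entry n \<omega>) es) = (\<Prod>\<kappa>\<in>S. f \<kappa> (upper_entry \<kappa> \<omega>))" for \<omega>
    unfolding fY using S(2)
  proof (induction es)
    case (Cons e es)
    have "(\<Prod>\<kappa>\<in>S. prod_list (map (entry n \<omega>) (filter (\<lambda>e. key e = \<kappa>) (e # es)))) =
      (\<Prod>\<kappa>\<in>S. (if key e = \<kappa> then entry n \<omega> e else 1) * prod_list (map (entry n \<omega>) (filter (\<lambda>e. key e = \<kappa>) es)))"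
      by (intro prod.cong) auto
    also have "\<dots> = entry n \<omega> e * prod_list (map (entry n \<omega>) es)"
      using Cons S(1) by (simp add: prod.distrib)
    finally show ?case by simp
  qed simp
  then have "entry_moment n es = (\<integral>\<omega>. (\<Prod>\<kappa>\<in>S. f \<kappa> (upper_entry \<kappa> \<omega>)) \<partial>M)" by (simp add: entry_moment_def)
  also have "\<dots> = (\<Prod>\<kappa>\<in>S. \<integral>\<omega>. f \<kappa> (upper_entry \<kappa> \<omega>) \<partial>M)"
  proof (rule indep_product[OF S(1,3)])
    show "f \<kappa> \<in> borel_measurable borel" for \<kappa>
      unfolding f_def
    proof (induction es)
      case (Cons e es)
      have "(\<lambda>z. entry_map n e z) \<in> borel_measurable borel" using entry_map_measurable[of n e] by simp
      with Cons show ?case by (cases "key e = \<kappa>") auto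
    qed simp
    show "all_moments M (\<lambda>\<omega>. f \<kappa> (upper_entry \<kappa> \<omega>))" for \<kappa>
      unfolding fY by (rule prod_list_moments) (use entry_moments es in auto)
  qed
  finally show ?thesis by (simp add: fY entry_moment_def)
qed

lemma entry_moment_split':
  assumes "set (e # es) \<subseteq> J \<times> {..<n} \<times> {..<n}"
  shows "entry_moment n (e # es) = entry_moment n (e # filter (\<lambda>e'. key e' = key e) es) * entry_moment n (filter (\<lambda>e'. key e' \<noteq> key e) es)"
proof -
  let ?T = "filter (\<lambda>e'. key e' \<noteq> key e) es"
  let ?S = "key ` set ?T"
  have S: "key e \<notin> ?S" "finite ?S" by auto
  have r: "?S \<subseteq> {(i, j, k). i \<in> J \<and> j \<le> k \<and> k < n}" "key e \<in> {(i, j, k). i \<in> J \<and> j \<le> k \<and> k < n}"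
  proof -
    have "key e' \<in> {(i, j, k). i \<in> J \<and> j \<le> k \<and> k < n}" if "e' \<in> set (e # es)" for e'
      by (rule key_range) (use assms that in blast)
    note r = this
    show "?S \<subseteq> {(i, j, k). i \<in> J \<and> j \<le> k \<and> k < n}" by (intro image_subsetI r) simp
    show "key e \<in> {(i, j, k). i \<in> J \<and> j \<le> k \<and> k < n}" by (rule r) simp
  qed
  have "entry_moment n (e # es) = (\<Prod>\<kappa>\<in>insert (key e) ?S. entry_moment n (filter (\<lambda>e. key e = \<kappa>) (e # es)))"
    by (rule entry_moment_keys[OF assms]) (use r in auto)
  also have "\<dots> = entry_moment n (e # filter (\<lambda>e'. key e' = key e) es) * (\<Prod>\<kappa>\<in>?S. entry_moment n (filter (\<lambda>e. key e = \<kappa>) (e # es)))"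
    using S by (subst prod.insert) auto
  also have "(\<Prod>\<kappa>\<in>?S. entry_moment n (filter (\<lambda>e. key e = \<kappa>) (e # es))) = (\<Prod>\<kappa>\<in>?S. entry_moment n (filter (\<lambda>e. key e = \<kappa>) ?T))"
  proof (intro prod.cong refl arg_cong[where f = "entry_moment n"])
    fix \<kappa> assume "\<kappa> \<in> ?S"
    then have "\<kappa> \<noteq> key e" using S(1) by blast
    then show "filter (\<lambda>e. key e = \<kappa>) (e # es) = filter (\<lambda>e. key e = \<kappa>) ?T"
      by (auto simp: filter_filter intro!: filter_cong)
  qed
  also have "\<dots> = entry_moment n ?T" by (rule entry_moment_keys[symmetric]) (use assms r in auto)
  finally show ?thesis .
qed

lemma X_wigner: "i \<in> J \<Longrightarrow> wigner_array M (X i)"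
  using X[OF J_I] by (simp add: finite_moment_wigner_array_def)

text \<open>By equality of laws an off-diagonal moment is that of position (0, 1) and a diagonal one
  that of (0, 0); the other summand of \<open>C\<close> is nonnegative.\<close>

lemma X_moment_le:
  assumes i: "i \<in> J" and jk: "j \<le> k"
  shows "(\<integral>\<omega>. norm (X i j k \<omega>) ^ m \<partial>M) \<le> C i m"
proof -
  have am: "all_moments M (X i j k)" if "j \<le> k" for j k using X[OF J_I[OF i]] that by (auto simp: finite_moment_wigner_array_def)
  have d: "(\<integral>\<omega>. norm (X i j k \<omega>) ^ m \<partial>M) = (\<integral>z. norm z ^ m \<partial>distr M borel (X i j k))" if "j \<le> k" for j k
    using am[OF that] by (subst integral_distr) (auto simp: all_moments_def)
  have dd: "\<And>j k j' k'. j < k \<Longrightarrow> j' < k' \<Longrightarrow> distr M borel (X i j k) = distr M borel (X i j' k')"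
    "\<And>j j'. distr M borel (X i j j) = distr M borel (X i j' j')"
    using X_wigner[OF i] unfolding wigner_array_def by blast+
  have nn: "0 \<le> (\<integral>\<omega>. norm (X i j k \<omega>) ^ m \<partial>M)" for j k by (rule Bochner_Integration.integral_nonneg) simp
  show ?thesis
  proof (cases "j < k")
    case True
    then have eq: "distr M borel (X i j k) = distr M borel (X i 0 1)"
      by (intro dd(1)) simp_all
    have "(\<integral>\<omega>. norm (X i j k \<omega>) ^ m \<partial>M) = (\<integral>\<omega>. norm (X i 0 1 \<omega>) ^ m \<partial>M)"
    proof -
      have "(\<integral>\<omega>. norm (X i j k \<omega>) ^ m \<partial>M) = (\<integral>z. norm z ^ m \<partial>distr M borel (X i j k))" by (rule d[OF jk])
      also have "\<dots> = (\<integral>z. norm z ^ m \<partial>distr M borel (X i 0 1))" by (rule arg_cong[OF eq])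
      also have "\<dots> = (\<integral>\<omega>. norm (X i 0 1 \<omega>) ^ m \<partial>M)" by (rule d[symmetric]) simp
      finally show ?thesis .
    qed
    then show ?thesis using nn[of 0 0] unfolding C_def by linarith
  next
    case False
    then have jk': "k = j" using jk by simp
    have eq: "distr M borel (X i j j) = distr M borel (X i 0 0)"
      by (rule dd(2))
    have "(\<integral>\<omega>. norm (X i j k \<omega>) ^ m \<partial>M) = (\<integral>\<omega>. norm (X i 0 0 \<omega>) ^ m \<partial>M)"
    proof -
      have "(\<integral>\<omega>. norm (X i j k \<omega>) ^ m \<partial>M) = (\<integral>z. norm z ^ m \<partial>distr M borel (X i j j))" unfolding jk' by (rule d) simp
      also have "\<dots> = (\<integral>z. norm z ^ m \<partial>distr M borel (X i 0 0))" by (rule arg_cong[OF eq])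
      also have "\<dots> = (\<integral>\<omega>. norm (X i 0 0 \<omega>) ^ m \<partial>M)" by (rule d[symmetric]) simp
      finally show ?thesis .
    qed
    then show ?thesis using nn[of 0 1] unfolding C_def by linarith
  qed
qed

lemma entry_moment_bound':
  assumes i: "i \<in> J" "j < n" "k < n" and es: "\<forall>e\<in>set es. key e = key (i, j, k)"
  shows "norm (entry_moment n es) \<le> C i (length es) * sqrt (K n i j k) ^ length es"
proof -
  define a where "a = min j k"
  define c where "c = max j k"
  have ac: "a \<le> c" "a < n" "c < n" using i by (auto simp: a_def c_def)
  have sK: "sqrt (K n i j k) = band_coeff n i j k" by (simp add: K_def band_coeff_nonneg)
  have thn: "norm (entry n \<omega> e) = band_coeff n i j k * norm (X i a c \<omega>)" if e: "e \<in> set es" for \<omega> e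
  proof -
    obtain i' j' k' where e': "e = (i', j', k')" by (cases e)
    have k: "i' = i" "j' = j \<and> k' = k \<or> j' = k \<and> k' = j" using es e by (auto simp: e' key_eq_iff)
    then have "e \<in> J \<times> {..<n} \<times> {..<n}" using i e' by auto
    then have "entry n \<omega> e = entry_map n e (upper_entry (key e) \<omega>)" by (rule entry_eq)
    also have "key e = (i, a, c)" using es e by (auto simp: key_def a_def c_def)
    finally have "norm (entry n \<omega> e) = band_coeff n i j' k' * norm (X i a c \<omega>)"
      using k(1) by (auto simp: e' entry_map_def upper_entry_def norm_mult band_coeff_nonneg)
    also have "band_coeff n i j' k' = band_coeff n i j k" using k(2) band_coeff_sym by auto
    finally show ?thesis .
  qed
  have "norm (prod_list (map (entry n \<omega>) es)) = band_coeff n i j k ^ length es * norm (X i a c \<omega>) ^ length es" for \<omega>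
    using thn by (induction es) (auto simp: norm_mult)
  then have "norm (entry_moment n es) \<le> (\<integral>\<omega>. band_coeff n i j k ^ length es * norm (X i a c \<omega>) ^ length es \<partial>M)"
    unfolding entry_moment_def using integral_norm_bound[of M "\<lambda>\<omega>. prod_list (map (entry n \<omega>) es)"] by simp
  also have "\<dots> = band_coeff n i j k ^ length es * (\<integral>\<omega>. norm (X i a c \<omega>) ^ length es \<partial>M)" by simp
  also have "\<dots> \<le> band_coeff n i j k ^ length es * C i (length es)"
    by (intro mult_left_mono X_moment_le i ac zero_le_power band_coeff_nonneg)
  finally show ?thesis by (simp add: sK mult.commute)
qed

lemma wigner_moments_entry_moment: "wigner_moments J K \<epsilon> entry_moment \<beta> C"
proof (intro wigner_moments.intro kernel_family_K wigner_moments_axioms.intro)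
  show "entry_moment n [] = 1" for n by (simp add: entry_moment_def prob_space)
  fix n j k :: nat and i
  assume i: "i \<in> J" "j < n" "k < n" and jk: "j \<noteq> k"
  define a where "a = min j k"
  define c where "c = max j k"
  have ac: "a < c" using jk by (auto simp: a_def c_def min_def max_def)
  have in1: "(i, j, k) \<in> J \<times> {..<n} \<times> {..<n}" "(i, k, j) \<in> J \<times> {..<n} \<times> {..<n}" using i by auto
  have t1: "entry n \<omega> (i, j, k) = of_real (band_coeff n i j k) * (if j < k then X i a c \<omega> else cnj (X i a c \<omega>))" for \<omega>
    using entry_eq[OF in1(1)] jk by (auto simp: entry_map_def upper_entry_def key_def a_def c_def)
  have t2: "entry n \<omega> (i, k, j) = of_real (band_coeff n i j k) * (if j < k then cnj (X i a c \<omega>) else X i a c \<omega>)" for \<omega>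
    using entry_eq[OF in1(2)] jk by (auto simp: entry_map_def upper_entry_def key_def a_def c_def band_coeff_sym[of n i k j] min.commute max.commute)
  have w: "(\<integral>\<omega>. X i a c \<omega> \<partial>M) = 0" "(\<integral>\<omega>. (norm (X i a c \<omega>))\<^sup>2 \<partial>M) = 1"
    "(\<integral>\<omega>. (X i a c \<omega>)\<^sup>2 \<partial>M) = of_real (\<beta> i)"
    using X_wigner[OF i(1)] param[OF J_I[OF i(1)]] ac by (auto simp: wigner_array_def wigner_parameter_def)
  show "entry_moment n [(i, j, k)] = 0"
    using w(1) by (cases "j < k") (simp_all add: entry_moment_def t1)
  have "prod_list (map (entry n \<omega>) [(i, j, k), (i, k, j)]) = of_real ((band_coeff n i j k)\<^sup>2 * (norm (X i a c \<omega>))\<^sup>2)" for \<omega>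
  proof -
    have "prod_list (map (entry n \<omega>) [(i, j, k), (i, k, j)]) = of_real ((band_coeff n i j k)\<^sup>2) * (X i a c \<omega> * cnj (X i a c \<omega>))"
      by (cases "j < k") (simp_all add: t1 t2 power2_eq_square)
    then show ?thesis by (simp only: complex_norm_square[symmetric] of_real_mult)
  qed
  then have "entry_moment n [(i, j, k), (i, k, j)] = (\<integral>\<omega>. of_real ((band_coeff n i j k)\<^sup>2 * (norm (X i a c \<omega>))\<^sup>2) \<partial>M)"
    unfolding entry_moment_def by (simp only:)
  also have "\<dots> = of_real (K n i j k)" unfolding integral_complex_of_real by (simp add: w(2) K_def)
  finally show "entry_moment n [(i, j, k), (i, k, j)] = of_real (K n i j k)" .
  \<comment> \<open>Below the diagonal the variable is conjugated; as \<beta> is real, the second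
    moment is the same.\<close>
  have "entry_moment n [(i, j, k), (i, j, k)] = (\<integral>\<omega>. of_real (K n i j k) * (if j < k then (X i a c \<omega>)\<^sup>2 else cnj ((X i a c \<omega>)\<^sup>2)) \<partial>M)"
    unfolding entry_moment_def by (intro Bochner_Integration.integral_cong refl)
      (auto simp: t1 power2_eq_square K_def)
  also have "\<dots> = of_real (K n i j k) * of_real (\<beta> i)"
    using w(3) by (cases "j < k") (simp_all add: integral_cnj del: complex_cnj_power)
  finally show "entry_moment n [(i, j, k), (i, j, k)] = of_real (\<beta> i * K n i j k)" by (simp add: mult.commute)
qed (use entry_moment_split' entry_moment_bound' in blast)+

sublocale wigner_moments J K \<epsilon> entry_moment \<beta> C
  by (rule wigner_moments_entry_moment)

end

section \<open>Traces of matrix words as graph sums\<close>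

lemma mat_adjoint_mult:
  assumes "A \<in> carrier_mat n n" "B \<in> carrier_mat n n"
  shows "mat_adjoint (A * B) = mat_adjoint B * mat_adjoint (A :: complex mat)"
  using assms
  by (auto simp: mat_adjoint_dims mat_adjoint_index scalar_prod_def mult.commute intro!: eq_matI sum.cong)

lemma mat_adjoint_one: "mat_adjoint (1\<^sub>m n :: complex mat) = 1\<^sub>m n"
  by (rule eq_matI) (auto simp: mat_adjoint_dims mat_adjoint_index)

definition mprod :: "nat \<Rightarrow> ('v \<Rightarrow> complex mat) \<Rightarrow> 'v list \<Rightarrow> complex mat" where
  "mprod n A w = foldr (*) (map A w) (1\<^sub>m n)"

lemma mprod_simps [simp]: "mprod n A [] = 1\<^sub>m n" "mprod n A (v # w) = A v * mprod n A w"
  by (simp_all add: mprod_def)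

lemma mprod_carrier: "(\<And>v. v \<in> set w \<Longrightarrow> A v \<in> carrier_mat n n) \<Longrightarrow> mprod n A w \<in> carrier_mat n n"
  by (induction w) (auto intro!: mult_carrier_mat)

lemma mprod_append:
  assumes "\<And>v. v \<in> set (u @ w) \<Longrightarrow> A v \<in> carrier_mat n n"
  shows "mprod n A (u @ w) = mprod n A u * mprod n A w"
  using assms
proof (induction u)
  case Nil
  have "mprod n A w \<in> carrier_mat n n" by (rule mprod_carrier) (use Nil in auto)
  then show ?case by simp
next
  case (Cons v u)
  have c: "A v \<in> carrier_mat n n" "mprod n A u \<in> carrier_mat n n" "mprod n A w \<in> carrier_mat n n"
    using Cons.prems by (auto intro!: mprod_carrier)
  have "mprod n A (u @ w) = mprod n A u * mprod n A w" by (rule Cons.IH) (use Cons.prems in auto)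
  then show ?case by (simp add: assoc_mult_mat[OF c])
qed

lemma mprod_adjoint:
  assumes "\<And>v. v \<in> set u \<Longrightarrow> A v \<in> carrier_mat n n \<and> mat_adjoint (A v) = A v"
  shows "mat_adjoint (mprod n A u) = mprod n A (rev u)"
  using assms
proof (induction u)
  case (Cons v u)
  have c: "A v \<in> carrier_mat n n" "mprod n A u \<in> carrier_mat n n"
    using Cons.prems by (auto intro!: mprod_carrier)
  have "mprod n A (rev u @ [v]) = mprod n A (rev u) * mprod n A [v]"
    by (rule mprod_append) (use Cons.prems in auto)
  moreover have "mprod n A [v] = A v" using c(1) by simp
  ultimately show ?case using mat_adjoint_mult[OF c] Cons by simp
qed (simp add: mat_adjoint_one)

lemma lprod_random_matrix_space: "lprod (random_matrix_space M n) (map A w) = (\<lambda>\<omega>. mprod n (\<lambda>v. A v \<omega>) w)"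
  by (induction w) (auto simp: lprod_def random_matrix_space_def)

context band_family begin

definition letter :: "nat \<Rightarrow> 'i + 'i \<Rightarrow> 'w \<Rightarrow> complex mat" where
  "letter n = case_sum (\<Theta> n) (\<lambda>i \<omega>. deg (\<Theta> n i \<omega>))"

abbreviation "RM n \<equiv> random_matrix_space M n"

definition word_moment :: "nat \<Rightarrow> ('i + 'i) list \<Rightarrow> complex" where
  "word_moment n w = state (RM n) (lprod (RM n) (map (letter n) w))"

definition word_matrix :: "nat \<Rightarrow> 'w \<Rightarrow> ('i + 'i) list \<Rightarrow> complex mat" where
  "word_matrix n \<omega> w = mprod n (\<lambda>v. letter n v \<omega>) w"

lemma lprod_word_matrix: "lprod (RM n) (map (letter n) w) = (\<lambda>\<omega>. word_matrix n \<omega> w)"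
  unfolding word_matrix_def by (rule lprod_random_matrix_space)

lemma letter_carrier: "v \<in> J <+> J \<Longrightarrow> letter n v \<in> carrier (RM n)"
  using Theta_carrier deg_carrier by (auto simp: letter_def)

lemma letter_mat: "v \<in> J <+> J \<Longrightarrow> letter n v \<omega> \<in> carrier_mat n n"
  using letter_carrier[of v n] by (auto simp: random_matrix_space_def)

lemma word_matrix_mat: "w \<in> lists (J <+> J) \<Longrightarrow> word_matrix n \<omega> w \<in> carrier_mat n n"
  by (induction w) (auto simp: word_matrix_def mprod_def intro!: mult_carrier_mat letter_mat)

lemma word_matrix_Cons: "word_matrix n \<omega> (v # w) = letter n v \<omega> * word_matrix n \<omega> w"
  by (simp add: word_matrix_def mprod_def)

lemma word_matrix_append:
  assumes "u \<in> lists (J <+> J)" "v \<in> lists (J <+> J)"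
  shows "word_matrix n \<omega> (u @ v) = word_matrix n \<omega> u * word_matrix n \<omega> v"
  unfolding word_matrix_def by (rule mprod_append) (use assms letter_mat in auto)

lemma word_moment_eq: "word_moment n w = (\<integral>\<omega>. (\<Sum>j<n. word_matrix n \<omega> w $$ (j, j)) / of_nat n \<partial>M)"
  unfolding word_moment_def lprod_word_matrix by (simp add: random_matrix_space_def)

lemma deg_entry:
  assumes "i \<in> J" "j < n" "k < n"
  shows "deg (\<Theta> n i \<omega>) $$ (j, k) = (if j = k then \<Sum>l<n. entry n \<omega> (i, j, l) else 0)"
proof -
  have "\<Theta> n i \<omega> \<in> carrier_mat n n" using Theta_carrier[OF assms(1), of n] by (auto simp: random_matrix_space_def)
  then show ?thesis using assms by (auto simp: deg_def mat_diag_def entry_def)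
qed

definition edge_product :: "nat \<Rightarrow> 'w \<Rightarrow> ('v \<times> 'v \<times> 'i) list \<Rightarrow> ('v \<Rightarrow> nat) \<Rightarrow> complex" where
  "edge_product n \<omega> E \<phi> = prod_list (map (\<lambda>e. entry n \<omega> (edge_index \<phi> e)) E)"

lemma edge_product_cong: "graph_on V (kernel_edges E) \<Longrightarrow> (\<And>x. x \<in> V \<Longrightarrow> \<phi> x = \<psi> x) \<Longrightarrow> edge_product n \<omega> E \<phi> = edge_product n \<omega> E \<psi>"
  unfolding edge_product_def by (intro arg_cong[where f = prod_list] map_cong refl) (auto simp: edge_index_def graph_on_def set_kernel_edges)

lemma edge_product_fun_upd: "graph_on V (kernel_edges E) \<Longrightarrow> v \<notin> V \<Longrightarrow> edge_product n \<omega> E (\<phi>(v := k)) = edge_product n \<omega> E \<phi>"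
  by (rule edge_product_cong) auto

text \<open>Each intermediate index of the product becomes a spine vertex, each summation index of a
  row sum a pendant one. Indicators pin the two end vertices, so that putting a letter in front
  preserves the form.\<close>

lemma word_matrix_path:
  assumes "w \<in> lists (J <+> J)" "j < n" "k < n"
  shows "word_matrix n \<omega> w $$ (j, k) = (\<Sum>\<phi>\<in>Phi (path_vertices a w) n. of_bool (\<phi> (Inl a) = j) * of_bool (\<phi> (Inl (a + length w)) = k) *
     (of_real (wt n (path_constraints a w) \<phi>) * edge_product n \<omega> (path_edges a w) \<phi>))"
  using assms
proof (induction w arbitrary: a j rule: list.induct)
  case Nil
  show ?case using Nil sum_Phi_insert[of "{}" "Inl a :: nat + nat" "\<lambda>\<phi>. of_bool (\<phi> (Inl a) = j) * of_bool (\<phi> (Inl a) = k) :: complex" n]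
    by (simp add: word_matrix_def mprod_def edge_product_def PiE_empty_domain)
next
  case (Cons v w)
  have w: "w \<in> lists (J <+> J)" and v: "v \<in> J <+> J"
    using Cons.prems(1) by (simp_all only: Cons_in_lists_iff)
  let ?V = "path_vertices (Suc a) w" and ?f = "\<lambda>\<phi>. of_real (wt n (path_constraints (Suc a) w) \<phi>) * edge_product n \<omega> (path_edges (Suc a) w) \<phi>"
  let ?k = "\<lambda>\<phi>. of_bool (\<phi> (Inl (Suc a + length w)) = k) :: complex"
  have IH: "word_matrix n \<omega> w $$ (l, k) = (\<Sum>\<phi>\<in>Phi ?V n. of_bool (\<phi> (Inl (Suc a)) = l) * ?k \<phi> * ?f \<phi>)" if "l < n" for l
    using Cons.IH[OF w that Cons.prems(3), of "Suc a"] .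
  have ni: "Inl a \<notin> ?V" "Inr a \<notin> ?V" "Inl (Suc a) \<in> ?V" "Inl (Suc (a + length w)) \<in> ?V"
    by (auto simp: path_vertices_Inl dest: path_vertices_Inr)
  have g: "graph_on ?V (path_constraints (Suc a) w)" "graph_on ?V (kernel_edges (path_edges (Suc a) w))" by (rule graph_on_path_constraints, rule graph_on_path_edges[OF w])
  have fu: "?f (\<phi>(Inl a := q)) = ?f \<phi>" "?f (\<phi>(Inr a := q)) = ?f \<phi>" for \<phi> q
    by (simp_all only: wt_fun_upd[OF g(1) ni(1)] wt_fun_upd[OF g(1) ni(2)] edge_product_fun_upd[OF g(2) ni(1)] edge_product_fun_upd[OF g(2) ni(2)])
  have Wm: "letter n v \<omega> \<in> carrier_mat n n" "word_matrix n \<omega> w \<in> carrier_mat n n"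
    by (rule letter_mat[OF v], rule word_matrix_mat[OF w])
  have step: "word_matrix n \<omega> (v # w) $$ (j, k) = (\<Sum>l<n. letter n v \<omega> $$ (j, l) * word_matrix n \<omega> w $$ (l, k))"
    unfolding word_matrix_Cons by (rule matmul_index[OF Wm Cons.prems(2,3)])
  have dist: "(\<Sum>l<n. c l * (\<Sum>\<phi>\<in>Phi ?V n. of_bool (\<phi> (Inl (Suc a)) = l) * ?k \<phi> * ?f \<phi>)) =
     (\<Sum>\<phi>\<in>Phi ?V n. c (\<phi> (Inl (Suc a))) * ?k \<phi> * ?f \<phi>)" for c :: "nat \<Rightarrow> complex"
  proof -
    have "(\<Sum>l<n. c l * (\<Sum>\<phi>\<in>Phi ?V n. of_bool (\<phi> (Inl (Suc a)) = l) * ?k \<phi> * ?f \<phi>)) =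
      (\<Sum>\<phi>\<in>Phi ?V n. \<Sum>l<n. if l = \<phi> (Inl (Suc a)) then c l * ?k \<phi> * ?f \<phi> else 0)"
      unfolding sum_distrib_left by (subst sum.swap) (intro sum.cong refl, auto)
    also have "\<dots> = (\<Sum>\<phi>\<in>Phi ?V n. c (\<phi> (Inl (Suc a))) * ?k \<phi> * ?f \<phi>)"
      by (intro sum.cong refl) (use Phi_less[OF _ ni(3)] in simp)
    finally show ?thesis .
  qed
  show ?case
  proof (cases v)
    case (Inl i)
    have "word_matrix n \<omega> (v # w) $$ (j, k) = (\<Sum>l<n. entry n \<omega> (i, j, l) * (\<Sum>\<phi>\<in>Phi ?V n. of_bool (\<phi> (Inl (Suc a)) = l) * ?k \<phi> * ?f \<phi>))"
      unfolding step by (intro sum.cong refl) (simp add: IH Inl letter_def entry_def)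
    also have "\<dots> = (\<Sum>\<phi>\<in>Phi ?V n. entry n \<omega> (i, j, \<phi> (Inl (Suc a))) * ?k \<phi> * ?f \<phi>)" by (rule dist)
    also have "\<dots> = (\<Sum>\<phi>\<in>Phi ?V n. \<Sum>q<n. if q = j then entry n \<omega> (i, j, \<phi> (Inl (Suc a))) * ?k \<phi> * ?f \<phi> else 0)"
      using Cons.prems(2) by simp
    also have "\<dots> = (\<Sum>\<phi>\<in>Phi (path_vertices a (v # w)) n. of_bool (\<phi> (Inl a) = j) * of_bool (\<phi> (Inl (a + length (v # w))) = k) *
        (of_real (wt n (path_constraints a (v # w)) \<phi>) * edge_product n \<omega> (path_edges a (v # w)) \<phi>))"
    proof -
      have "edge_product n \<omega> (path_edges a (v # w)) \<phi> = entry n \<omega> (i, \<phi> (Inl a), \<phi> (Inl (Suc a))) * edge_product n \<omega> (path_edges (Suc a) w) \<phi>" for \<phi>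
        by (simp add: Inl edge_product_def edge_index_def)
      then show ?thesis
        using fu(1) by (simp add: Inl sum_Phi_insert[OF finite_path_vertices ni(1)]) (intro sum.cong refl, auto)
    qed
    finally show ?thesis .
  next
    case (Inr i)
    have iJ: "i \<in> J" using v Inr by auto
    have "word_matrix n \<omega> (v # w) $$ (j, k) = (\<Sum>l<n. (if j = l then \<Sum>q<n. entry n \<omega> (i, j, q) else 0) * (\<Sum>\<phi>\<in>Phi ?V n. of_bool (\<phi> (Inl (Suc a)) = l) * ?k \<phi> * ?f \<phi>))"
      unfolding step by (intro sum.cong refl) (simp add: IH Inr letter_def deg_entry[OF iJ Cons.prems(2)])
    also have "\<dots> = (\<Sum>\<phi>\<in>Phi ?V n. (if j = \<phi> (Inl (Suc a)) then \<Sum>q<n. entry n \<omega> (i, j, q) else 0) * ?k \<phi> * ?f \<phi>)" by (rule dist)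
    also have "\<dots> = (\<Sum>\<phi>\<in>Phi ?V n. \<Sum>q<n. \<Sum>p<n. if p = j then (if j = \<phi> (Inl (Suc a)) then entry n \<omega> (i, j, q) * ?k \<phi> * ?f \<phi> else 0) else 0)"
      using Cons.prems(2) by (intro sum.cong refl) (simp add: sum_distrib_right)
    also have "\<dots> = (\<Sum>\<phi>\<in>Phi (path_vertices a (v # w)) n. of_bool (\<phi> (Inl a) = j) * of_bool (\<phi> (Inl (a + length (v # w))) = k) *
        (of_real (wt n (path_constraints a (v # w)) \<phi>) * edge_product n \<omega> (path_edges a (v # w)) \<phi>))"
    proof -
      have "edge_product n \<omega> (path_edges a (v # w)) \<phi> = entry n \<omega> (i, \<phi> (Inl a), \<phi> (Inr a)) * edge_product n \<omega> (path_edges (Suc a) w) \<phi>" for \<phi>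
        by (simp add: Inr edge_product_def edge_index_def)
      moreover have "Inl a \<notin> insert (Inr a) ?V" using ni by simp
      ultimately show ?thesis
        using fu by (simp add: Inr sum_Phi_insert[OF finite.insertI[OF finite_path_vertices]] sum_Phi_insert[OF finite_path_vertices ni(2)])
          (intro sum.cong refl, auto)
    qed
    finally show ?thesis .
  qed
qed

lemma edge_product_moments: "graph_on V (kernel_edges E) \<Longrightarrow> \<phi> \<in> Phi V n \<Longrightarrow> all_moments M (\<lambda>\<omega>. edge_product n \<omega> E \<phi>)"
  unfolding edge_product_def
  by (rule prod_list_moments, rule entry_moments)
    (auto simp: edge_index_def graph_on_def set_kernel_edges Phi_less dest!: bspec)

lemma graph_sum_integral:
  assumes "graph_on V (kernel_edges E)"
  shows "(\<integral>\<omega>. (\<Sum>\<phi>\<in>Phi V n. of_real (wt n G \<phi>) * edge_product n \<omega> E \<phi>) / of_nat n \<partial>M) = graph_sum n V G E"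
proof -
  have i: "integrable M (\<lambda>\<omega>. edge_product n \<omega> E \<phi>)" if "\<phi> \<in> Phi V n" for \<phi>
    by (rule all_moments_integrable[OF edge_product_moments[OF assms that]])
  have "(\<integral>\<omega>. (\<Sum>\<phi>\<in>Phi V n. of_real (wt n G \<phi>) * edge_product n \<omega> E \<phi>) \<partial>M) = (\<Sum>\<phi>\<in>Phi V n. of_real (wt n G \<phi>) * edge_moment n E \<phi>)"
  proof -
    have "(\<integral>\<omega>. (\<Sum>\<phi>\<in>Phi V n. of_real (wt n G \<phi>) * edge_product n \<omega> E \<phi>) \<partial>M) =
        (\<Sum>\<phi>\<in>Phi V n. \<integral>\<omega>. of_real (wt n G \<phi>) * edge_product n \<omega> E \<phi> \<partial>M)"
      by (rule Bochner_Integration.integral_sum) (intro integrable_mult_right i)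
    also have "\<dots> = (\<Sum>\<phi>\<in>Phi V n. of_real (wt n G \<phi>) * edge_moment n E \<phi>)"
      by (simp add: edge_moment_def entry_moment_def edge_product_def comp_def)
    finally show ?thesis .
  qed
  then show ?thesis by (simp add: graph_sum_def)
qed

text \<open>Equating the two pinned end indices and summing over them produces the equality edge
  that closes the path.\<close>

lemma word_moment_path':
  assumes w: "w \<in> lists (J <+> J)"
  shows "word_moment n w = graph_sum n (path_vertices a w) ((Inl a, Inl (a + length w), None) # path_constraints a w) (path_edges a w)"
proof -
  have eq: "(\<Sum>j<n. word_matrix n \<omega> w $$ (j, j)) = (\<Sum>\<phi>\<in>Phi (path_vertices a w) n. of_real (wt n ((Inl a, Inl (a + length w), None) # path_constraints a w) \<phi>) * edge_product n \<omega> (path_edges a w) \<phi>)" for \<omega>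
  proof -
    have "(\<Sum>j<n. word_matrix n \<omega> w $$ (j, j)) = (\<Sum>\<phi>\<in>Phi (path_vertices a w) n. \<Sum>j<n. if j = \<phi> (Inl a) then of_bool (\<phi> (Inl (a + length w)) = j) * (of_real (wt n (path_constraints a w) \<phi>) * edge_product n \<omega> (path_edges a w) \<phi>) else 0)"
      by (subst sum.swap) (intro sum.cong refl, auto simp: word_matrix_path[OF w, where a = a] intro!: sum.cong)
    also have "\<dots> = (\<Sum>\<phi>\<in>Phi (path_vertices a w) n. of_real (wt n ((Inl a, Inl (a + length w), None) # path_constraints a w) \<phi>) * edge_product n \<omega> (path_edges a w) \<phi>)"
    proof (intro sum.cong refl)
      fix \<phi> assume "\<phi> \<in> Phi (path_vertices a w) n"
      then have "\<phi> (Inl a) < n" by (rule Phi_less) (simp add: path_vertices_Inl)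
      then show "(\<Sum>j<n. if j = \<phi> (Inl a) then of_bool (\<phi> (Inl (a + length w)) = j) * (of_real (wt n (path_constraints a w) \<phi>) * edge_product n \<omega> (path_edges a w) \<phi>) else 0) =
        of_real (wt n ((Inl a, Inl (a + length w), None) # path_constraints a w) \<phi>) * edge_product n \<omega> (path_edges a w) \<phi>"
        by (simp add: eq_commute[of "\<phi> (Inl a)"])
    qed
    finally show ?thesis .
  qed
  have "word_moment n w = (\<integral>\<omega>. (\<Sum>\<phi>\<in>Phi (path_vertices a w) n. of_real (wt n ((Inl a, Inl (a + length w), None) # path_constraints a w) \<phi>) * edge_product n \<omega> (path_edges a w) \<phi>) / of_nat n \<partial>M)"
    unfolding word_moment_eq by (intro arg_cong[where f = "lebesgue_integral M"] ext arg_cong2[where f = "(/)"] refl eq)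
  also have "\<dots> = graph_sum n (path_vertices a w) ((Inl a, Inl (a + length w), None) # path_constraints a w) (path_edges a w)"
    using graph_sum_integral[where n = n and G = "(Inl a, Inl (a + length w), None) # path_constraints a w", OF graph_on_path_edges[OF w, of a]] .
  finally show ?thesis .
qed

lemma word_matrix_degrees:
  assumes "snd ` set ls \<subseteq> J" "j < n" "k < n"
  shows "word_matrix n \<omega> (map (Inr \<circ> snd) ls) $$ (j, k) = (if j = k then prod_list (map (\<lambda>(l, i). \<Sum>q<n. entry n \<omega> (i, j, q)) ls) else 0)"
  using assms
proof (induction ls)
  case Nil
  then show ?case by (simp add: word_matrix_def mprod_def)
next
  case (Cons a ls)
  obtain l i where a: "a = (l, i)" by (cases a)
  have iJ: "i \<in> J" using Cons.prems a by auto
  have w: "map (Inr \<circ> snd) ls \<in> lists (J <+> J)" using Cons.prems(1) by force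
  have "word_matrix n \<omega> (map (Inr \<circ> snd) (a # ls)) $$ (j, k) = (\<Sum>q<n. deg (\<Theta> n i \<omega>) $$ (j, q) * word_matrix n \<omega> (map (Inr \<circ> snd) ls) $$ (q, k))"
    using matmul_index[OF letter_mat[OF InrI[OF iJ], of n \<omega>] word_matrix_mat[OF w, of n \<omega>] Cons.prems(2,3)]
    by (simp add: word_matrix_Cons a letter_def)
  also have "\<dots> = (\<Sum>q<n. if q = j then (\<Sum>q<n. entry n \<omega> (i, j, q)) * word_matrix n \<omega> (map (Inr \<circ> snd) ls) $$ (j, k) else 0)"
    by (intro sum.cong refl) (auto simp: deg_entry[OF iJ Cons.prems(2)])
  also have "\<dots> = (\<Sum>q<n. entry n \<omega> (i, j, q)) * word_matrix n \<omega> (map (Inr \<circ> snd) ls) $$ (j, k)"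
    using Cons.prems(2) by simp
  finally show ?case using Cons by (simp add: a comp_def)
qed

text \<open>A product of row sums of one row is multiplied out, with one leaf for each factor. The
  general \<open>f\<close> carries the induction: the row sum that is split off depends on the
  centre and is absorbed into it.\<close>

lemma star_sum:
  fixes f :: "nat \<Rightarrow> complex"
  assumes "distinct (map fst ls)"
  shows "(\<Sum>\<phi>\<in>Phi (insert (Inl 0) (Inr ` fst ` set ls)) n. f (\<phi> (Inl 0)) * edge_product n \<omega> (map (\<lambda>(l, i). (Inl 0 :: nat + nat, Inr l, i)) ls) \<phi>) =
    (\<Sum>j<n. f j * prod_list (map (\<lambda>(l, i). \<Sum>q<n. entry n \<omega> (i, j, q)) ls))"
  using assms
proof (induction ls arbitrary: f)
  case Nil
  show ?case using sum_Phi_insert[of "{}" "Inl 0 :: nat + nat" "\<lambda>\<phi>. f (\<phi> (Inl 0))" n]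
    by (simp add: edge_product_def PiE_empty_domain)
next
  case (Cons a ls)
  obtain l i where a: "a = (l, i)" by (cases a)
  let ?V = "insert (Inl 0) (Inr ` fst ` set ls) :: (nat + nat) set"
  let ?E = "\<lambda>ls. map (\<lambda>(l, i). (Inl 0 :: nat + nat, Inr l :: nat + nat, i)) ls"
  have V: "insert (Inl 0) (Inr ` fst ` set (a # ls)) = insert (Inr l) ?V" "Inr l \<notin> ?V" "finite ?V"
    using Cons.prems a by (auto simp: insert_commute)
  have c: "edge_product n \<omega> (?E ls) (\<phi>(Inr l := q)) = edge_product n \<omega> (?E ls) \<phi>" for \<phi> q
    unfolding edge_product_def by (intro arg_cong[where f = prod_list] map_cong refl) (use Cons.prems a in \<open>force simp: edge_index_def\<close>)
  have "(\<Sum>\<phi>\<in>Phi (insert (Inl 0) (Inr ` fst ` set (a # ls))) n. f (\<phi> (Inl 0)) * edge_product n \<omega> (?E (a # ls)) \<phi>) =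
    (\<Sum>\<phi>\<in>Phi ?V n. \<Sum>q<n. f (\<phi> (Inl 0)) * (entry n \<omega> (i, \<phi> (Inl 0), q) * edge_product n \<omega> (?E ls) \<phi>))"
    unfolding V(1) sum_Phi_insert[OF V(3,2)]
  proof (intro sum.cong refl)
    fix \<phi> q
    have "edge_product n \<omega> (?E (a # ls)) (\<phi>(Inr l := q)) = entry n \<omega> (i, \<phi> (Inl 0), q) * edge_product n \<omega> (?E ls) (\<phi>(Inr l := q))"
      by (simp add: edge_product_def a edge_index_def)
    then show "f ((\<phi>(Inr l := q)) (Inl 0)) * edge_product n \<omega> (?E (a # ls)) (\<phi>(Inr l := q)) =
      f (\<phi> (Inl 0)) * (entry n \<omega> (i, \<phi> (Inl 0), q) * edge_product n \<omega> (?E ls) \<phi>)" using c by simp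
  qed
  also have "\<dots> = (\<Sum>\<phi>\<in>Phi ?V n. (\<lambda>j. f j * (\<Sum>q<n. entry n \<omega> (i, j, q))) (\<phi> (Inl 0)) * edge_product n \<omega> (?E ls) \<phi>)"
    by (simp add: sum_distrib_left sum_distrib_right mult_ac)
  also have "\<dots> = (\<Sum>j<n. (f j * (\<Sum>q<n. entry n \<omega> (i, j, q))) * prod_list (map (\<lambda>(l, i). \<Sum>q<n. entry n \<omega> (i, j, q)) ls))"
    by (rule Cons.IH) (use Cons.prems in simp)
  finally show ?case by (simp add: a mult.assoc)
qed

lemma word_moment_star':
  assumes "distinct (map fst ls)" "snd ` set ls \<subseteq> J"
  shows "word_moment n (map (Inr \<circ> snd) ls) =
      graph_sum n (insert (Inl 0) (Inr ` fst ` set ls)) [] (map (\<lambda>(l, i). (Inl 0 :: nat + nat, Inr l, i)) ls)"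
proof -
  let ?V = "insert (Inl 0) (Inr ` fst ` set ls) :: (nat + nat) set"
  let ?E = "map (\<lambda>(l, i). (Inl 0 :: nat + nat, Inr l :: nat + nat, i)) ls"
  have g: "graph_on ?V (kernel_edges ?E)" using assms(2) by (force simp: graph_on_def set_kernel_edges)
  have "(\<Sum>j<n. word_matrix n \<omega> (map (Inr \<circ> snd) ls) $$ (j, j)) = (\<Sum>\<phi>\<in>Phi ?V n. of_real (wt n [] \<phi>) * edge_product n \<omega> ?E \<phi>)" for \<omega>
    using star_sum[OF assms(1), where f = "\<lambda>_. 1" and n = n and \<omega> = \<omega>] by (simp add: word_matrix_degrees[OF assms(2)])
  then show ?thesis unfolding word_moment_eq by (simp only: graph_sum_integral[OF g])
qed

lemma word_moment_trace':
  assumes "u \<in> lists (J <+> J)" "v \<in> lists (J <+> J)"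
  shows "word_moment n (u @ v) = word_moment n (v @ u)"
proof -
  have "(\<Sum>j<n. (A * B) $$ (j, j)) = (\<Sum>j<n. (B * A) $$ (j, j))"
    if "A \<in> carrier_mat n n" "B \<in> carrier_mat n n" for A B :: "complex mat"
  proof -
    have "(\<Sum>j<n. (A * B) $$ (j, j)) = (\<Sum>j<n. \<Sum>k<n. A $$ (j, k) * B $$ (k, j))"
      by (intro sum.cong refl matmul_index that) auto
    also have "\<dots> = (\<Sum>k<n. \<Sum>j<n. B $$ (k, j) * A $$ (j, k))" by (subst sum.swap) (simp add: mult.commute)
    also have "\<dots> = (\<Sum>k<n. (B * A) $$ (k, k))"
      by (intro sum.cong refl matmul_index[symmetric] that) auto
    finally show ?thesis .
  qed
  from this[OF word_matrix_mat[OF assms(1)] word_matrix_mat[OF assms(2)]] show ?thesis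
    unfolding word_moment_eq word_matrix_append[OF assms] word_matrix_append[OF assms(2,1)] by simp
qed

sublocale word_moments J K \<epsilon> entry_moment \<beta> C word_moment
proof (intro word_moments.intro wigner_moments_entry_moment word_moments_axioms.intro word_moment_path' word_moment_star' word_moment_trace')
  show "word_moment n [] = 1" if "n > 0" for n using that by (simp add: word_moment_eq word_matrix_def mprod_def prob_space)
qed

end

section \<open>Limits of self-adjoint families\<close>

lemma state_AE_cong:
  assumes "Y \<in> carrier (random_matrix_space M n)" "Z \<in> carrier (random_matrix_space M n)"
    and "AE \<omega> in M. Y \<omega> = Z \<omega>"
  shows "state (random_matrix_space M n) Y = state (random_matrix_space M n) Z"
proof -
  have m: "(\<lambda>\<omega>. (\<Sum>j<n. Y \<omega> $$ (j, j)) / of_nat n) \<in> borel_measurable M"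
    if "Y \<in> carrier (random_matrix_space M n)" for Y
    using that by (intro borel_measurable_divide borel_measurable_sum borel_measurable_const)
      (auto simp: random_matrix_space_def all_moments_def)
  have "(\<integral>\<omega>. (\<Sum>j<n. Y \<omega> $$ (j, j)) / of_nat n \<partial>M) = (\<integral>\<omega>. (\<Sum>j<n. Z \<omega> $$ (j, j)) / of_nat n \<partial>M)"
    by (rule integral_cong_AE[OF m[OF assms(1)] m[OF assms(2)]]) (use assms(3) in \<open>eventually_elim, simp\<close>)
  then show ?thesis by (simp add: random_matrix_space_def)
qed

lemma lin_pstar_mult:
  fixes f :: "'a \<Rightarrow> 'm :: monoid_add"
  shows "lin t (pstar r (\<Sum>a\<in>S. mterm (f a) (c a)) * (\<Sum>a\<in>S. mterm (f a) (c a))) =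
    (\<Sum>a\<in>S. \<Sum>b\<in>S. cnj (c a) * c b * t (r (f a) + f b))"
proof -
  have "pstar r (\<Sum>a\<in>S. mterm (f a) (c a)) = (\<Sum>a\<in>S. mterm (r (f a)) (cnj (c a)))"
    by (induction S rule: infinite_finite_induct) (auto simp: pstar_add)
  then show ?thesis by (simp add: sum_distrib_left sum_distrib_right lin_sum mult_single) (rule sum.swap)
qed

text \<open>Self-adjointness holds almost surely, because the entries of a degree matrix are known
  to be real only up to null sets. The value 0 on words with foreign letters makes \<open>t\<close>
  a functional on all words over the type.\<close>

locale self_adjoint_family = prob_space M
  for M :: "'w measure" +
  fixes a :: "nat \<Rightarrow> 'v \<Rightarrow> 'w \<Rightarrow> complex mat" and L :: "'v set" and t :: "'v list \<Rightarrow> complex"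
  assumes a_carrier: "v \<in> L \<Longrightarrow> a n v \<in> carrier (random_matrix_space M n)"
    and a_adjoint: "v \<in> L \<Longrightarrow> AE \<omega> in M. mat_adjoint (a n v \<omega>) = a n v \<omega>"
    and t_lim: "w \<in> lists L \<Longrightarrow> (\<lambda>n. state (random_matrix_space M n) (lprod (random_matrix_space M n) (map (a n) w))) \<longlonglongrightarrow> t w"
    and t_out: "w \<notin> lists L \<Longrightarrow> t w = 0"
begin

abbreviation "RM \<equiv> random_matrix_space M"

lemma space_RM: "n > 0 \<Longrightarrow> star_probability_space (RM n)"
  by (rule star_probability_space_random_matrix_space[OF prob_space_axioms])

lemma lprod_carrier: "n > 0 \<Longrightarrow> w \<in> lists L \<Longrightarrow> lprod (RM n) (map (a n) w) \<in> carrier (RM n)"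
  by (rule star_probability_space.lprod_closed[OF space_RM]) (auto intro: a_carrier)

lemma state_adj_lprod:
  assumes n: "n > 0" and u: "u \<in> lists L" and w: "w \<in> lists L"
  shows "state (RM n) (adj (RM n) (lprod (RM n) (map (a n) u)) \<otimes>\<^bsub>RM n\<^esub> lprod (RM n) (map (a n) w)) =
    state (RM n) (lprod (RM n) (map (a n) (rev u @ w)))"
proof (rule state_AE_cong)
  interpret S: star_probability_space "RM n" by (rule space_RM[OF n])
  show "adj (RM n) (lprod (RM n) (map (a n) u)) \<otimes>\<^bsub>RM n\<^esub> lprod (RM n) (map (a n) w) \<in> carrier (RM n)"
    by (intro S.m_closed S.adj_closed lprod_carrier n u w)
  show "lprod (RM n) (map (a n) (rev u @ w)) \<in> carrier (RM n)"
    by (rule lprod_carrier[OF n]) (use u w in auto)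
  have c: "a n v \<omega> \<in> carrier_mat n n" if "v \<in> L" for v \<omega>
    using a_carrier[OF that, of n] by (auto simp: random_matrix_space_def)
  have "AE \<omega> in M. \<forall>v\<in>set u. mat_adjoint (a n v \<omega>) = a n v \<omega>"
    using a_adjoint u by (subst AE_finite_all) auto
  then show "AE \<omega> in M. (adj (RM n) (lprod (RM n) (map (a n) u)) \<otimes>\<^bsub>RM n\<^esub> lprod (RM n) (map (a n) w)) \<omega> =
      lprod (RM n) (map (a n) (rev u @ w)) \<omega>"
  proof eventually_elim
    case (elim \<omega>)
    have "mprod n (\<lambda>v. a n v \<omega>) (rev u @ w) = mprod n (\<lambda>v. a n v \<omega>) (rev u) * mprod n (\<lambda>v. a n v \<omega>) w"
      by (rule mprod_append) (use u w c in auto)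
    moreover have "mat_adjoint (mprod n (\<lambda>v. a n v \<omega>) u) = mprod n (\<lambda>v. a n v \<omega>) (rev u)"
      by (rule mprod_adjoint) (use u c elim in auto)
    moreover have "adj (RM n) Y = (\<lambda>\<omega>. mat_adjoint (Y \<omega>))" "Y \<otimes>\<^bsub>RM n\<^esub> Z = (\<lambda>\<omega>. Y \<omega> * Z \<omega>)" for Y Z
      by (simp_all add: random_matrix_space_def)
    ultimately show ?case unfolding lprod_random_matrix_space by simp
  qed
qed

text \<open>Words with letters outside \<open>L\<close> contribute 0. On the others the sum is a
  limit of values of states at products of an element's adjoint with the element, and the
  nonnegative reals are closed.\<close>

lemma words_positive:
  assumes "finite S"
  shows "(\<Sum>x\<in>S. \<Sum>y\<in>S. cnj (c x) * c y * t (rev (f x) @ f y)) \<in> \<real>\<^sub>\<ge>\<^sub>0"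
proof -
  define p where "p = (\<Sum>x\<in>S. mterm (f x) (c x))"
  define T where "T = {w \<in> supp p. w \<in> lists L}"
  have T: "finite T" "T \<subseteq> lists L" by (auto simp: T_def)
  \<comment> \<open>Passing to the polynomial \<open>p\<close> collects the indices whose words
    coincide.\<close>
  have "(\<Sum>x\<in>S. \<Sum>y\<in>S. cnj (c x) * c y * t (rev (f x) @ f y)) = lin t (pstar rev p * p)"
    unfolding p_def lin_pstar_mult by (simp add: plus_list_def)
  also have "\<dots> = (\<Sum>u\<in>supp p. \<Sum>w\<in>supp p. cnj (coef p u) * coef p w * t (rev u @ w))"
    using lin_pstar_mult[of t rev "\<lambda>w. w" "coef p" "supp p"] by (simp add: plus_list_def flip: poly_eq_sum)
  also have "\<dots> = (\<Sum>u\<in>T. \<Sum>w\<in>supp p. cnj (coef p u) * coef p w * t (rev u @ w))"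
  proof (rule sum.mono_neutral_right)
    show "\<forall>u\<in>supp p - T. (\<Sum>w\<in>supp p. cnj (coef p u) * coef p w * t (rev u @ w)) = 0"
    proof
      fix u assume "u \<in> supp p - T"
      then have "u \<notin> lists L" by (simp add: T_def)
      then have "t (rev u @ w) = 0" for w by (intro t_out) (auto simp: in_lists_conv_set)
      then show "(\<Sum>w\<in>supp p. cnj (coef p u) * coef p w * t (rev u @ w)) = 0" by simp
    qed
  qed (auto simp: T_def)
  also have "\<dots> = (\<Sum>u\<in>T. \<Sum>w\<in>T. cnj (coef p u) * coef p w * t (rev u @ w))"
  proof (rule sum.cong[OF refl], rule sum.mono_neutral_right)
    show "\<forall>w\<in>supp p - T. cnj (coef p u) * coef p w * t (rev u @ w) = 0" for u
    proof
      fix w assume "w \<in> supp p - T"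
      then have "w \<notin> lists L" by (simp add: T_def)
      then have "t (rev u @ w) = 0" by (intro t_out) (auto simp: in_lists_conv_set)
      then show "cnj (coef p u) * coef p w * t (rev u @ w) = 0" by simp
    qed
  qed (auto simp: T_def)
  also have "\<dots> \<in> \<real>\<^sub>\<ge>\<^sub>0"
  proof (rule Lim_in_closed_set[OF closed_nonneg_Reals_complex _ sequentially_bot])
    show "(\<lambda>n. \<Sum>u\<in>T. \<Sum>w\<in>T. cnj (coef p u) * coef p w * state (RM n) (lprod (RM n) (map (a n) (rev u @ w))))
      \<longlonglongrightarrow> (\<Sum>u\<in>T. \<Sum>w\<in>T. cnj (coef p u) * coef p w * t (rev u @ w))"
      by (intro tendsto_sum tendsto_mult tendsto_const t_lim) (use T in auto)
    show "eventually (\<lambda>n. (\<Sum>u\<in>T. \<Sum>w\<in>T. cnj (coef p u) * coef p w * state (RM n) (lprod (RM n) (map (a n) (rev u @ w)))) \<in> \<real>\<^sub>\<ge>\<^sub>0) sequentially"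
      using eventually_gt_at_top[of 0]
    proof eventually_elim
      case (elim n)
      have "(\<Sum>u\<in>T. \<Sum>w\<in>T. cnj (coef p u) * coef p w * state (RM n) (lprod (RM n) (map (a n) (rev u @ w)))) =
        (\<Sum>u\<in>T. \<Sum>w\<in>T. cnj (coef p u) * coef p w * state (RM n) (adj (RM n) (lprod (RM n) (map (a n) u)) \<otimes>\<^bsub>RM n\<^esub> lprod (RM n) (map (a n) w)))"
        by (intro sum.cong refl arg_cong2[where f = "(*)"] state_adj_lprod[symmetric] elim) (use T in auto)
      also have "\<dots> \<in> \<real>\<^sub>\<ge>\<^sub>0"
        by (rule star_probability_space.state_words_positive[OF space_RM[OF elim] _ T]) (use a_carrier in auto)
      finally show ?case .
    qed
  qed
  finally show ?thesis .
qed

lemma t_Nil: "t [] = 1"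
proof -
  have "eventually (\<lambda>n. state (RM n) (lprod (RM n) (map (a n) [])) = 1) sequentially"
    using eventually_gt_at_top[of 0]
  proof eventually_elim
    case (elim n)
    then show ?case using star_probability_space.state_one[OF space_RM[OF elim]] by (simp add: lprod_def)
  qed
  then have "(\<lambda>n. state (RM n) (lprod (RM n) (map (a n) []))) \<longlonglongrightarrow> 1" by (rule tendsto_eventually)
  moreover have "(\<lambda>n. state (RM n) (lprod (RM n) (map (a n) []))) \<longlonglongrightarrow> t []" by (rule t_lim) simp
  ultimately show ?thesis by (rule LIMSEQ_unique[symmetric])
qed

lemma words_algebra: "monoid_algebra id rev t"
proof
  fix p :: "'v nc_poly"
  have "lin t (pstar rev p * p) = (\<Sum>u\<in>supp p. \<Sum>w\<in>supp p. cnj (coef p u) * coef p w * t (rev u @ w))"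
    using lin_pstar_mult[of t rev "\<lambda>w. w" "coef p" "supp p"] by (simp add: plus_list_def flip: poly_eq_sum)
  also have "\<dots> \<in> \<real>\<^sub>\<ge>\<^sub>0" by (rule words_positive) simp
  finally show "lin t (pstar rev p * p) \<in> \<real>\<^sub>\<ge>\<^sub>0" .
qed (auto simp: plus_list_def zero_list_def t_Nil)

text \<open>The letter \<open>v\<close> goes to the monoid element \<open>g v\<close>: a one-letter
  word in the word algebra, a one-element multiset in the commutative algebra of the Gaussian
  limit.\<close>

lemma converges_monoid_alg:
  assumes B: "monoid_algebra \<iota> r \<tau>" and eq: "\<And>w. w \<in> lists L \<Longrightarrow> \<tau> (sum_list (map g w)) = t w"
  shows "converges_in_distribution RM a (monoid_alg \<iota> r \<tau>) (\<lambda>v. \<iota> (mterm (g v) 1)) L"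
  unfolding converges_in_distribution_def
proof (intro conjI ballI)
  interpret B: monoid_algebra \<iota> r \<tau> by (rule B)
  show sB: "star_probability_space B.A" by (rule B.star_probability_space_A)
  show "(\<lambda>v. \<iota> (mterm (g v) 1)) \<in> L \<rightarrow> carrier B.A" by auto
  fix p :: "'v nc_poly" assume p: "p \<in> nc_polys L"
  have "state B.A (nc_eval B.A (\<lambda>v. \<iota> (mterm (g v) 1)) p) = (\<Sum>w\<in>supp p. coef p w * t w)"
  proof (subst star_probability_space.state_nc_eval[OF sB _ p])
    show "(\<Sum>w\<in>supp p. coef p w * state B.A (lprod B.A (map (\<lambda>v. \<iota> (mterm (g v) 1)) w))) = (\<Sum>w\<in>supp p. coef p w * t w)"
    proof (rule sum.cong[OF refl])
      fix w assume "w \<in> supp p"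
      then have "w \<in> lists L" using p unfolding nc_polys_def by blast
      then show "coef p w * state B.A (lprod B.A (map (\<lambda>v. \<iota> (mterm (g v) 1)) w)) = coef p w * t w"
        unfolding B.state_lprod_words by (simp only: eq)
    qed
  qed auto
  moreover have "(\<lambda>n. \<Sum>w\<in>supp p. coef p w * state (RM n) (lprod (RM n) (map (a n) w))) \<longlonglongrightarrow> (\<Sum>w\<in>supp p. coef p w * t w)"
    by (intro tendsto_sum tendsto_mult tendsto_const t_lim) (use p in \<open>auto simp: nc_polys_def\<close>)
  \<comment> \<open>For \<open>n = 0\<close> the normalised trace is 0 even at the unit, so the
    axioms of a state hold from 1 on.\<close>
  moreover have "eventually (\<lambda>n. (\<Sum>w\<in>supp p. coef p w * state (RM n) (lprod (RM n) (map (a n) w))) = state (RM n) (nc_eval (RM n) (a n) p)) sequentially"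
    using eventually_gt_at_top[of 0]
  proof eventually_elim
    case (elim n)
    show ?case
      by (rule star_probability_space.state_nc_eval[OF space_RM[OF elim] _ p, symmetric]) (use a_carrier in auto)
  qed
  ultimately show "(\<lambda>n. state (RM n) (nc_eval (RM n) (a n) p)) \<longlonglongrightarrow> state B.A (nc_eval B.A (\<lambda>v. \<iota> (mterm (g v) 1)) p)"
    by (auto elim: Lim_transform_eventually)
qed

end

context schwinger_dyson begin

lemma free_words:
  assumes alg: "monoid_algebra id rev \<tau>" and S: "\<And>k. k \<in> KS \<Longrightarrow> S k \<subseteq> {p. supp p \<subseteq> lists (C k)}"
  shows "free_subalgebras (monoid_alg id rev \<tau>) S KS"
  unfolding free_subalgebras_def
proof (intro allI impI)
  interpret B: monoid_algebra id rev \<tau> by (rule alg)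
  fix ks ps assume *: "ks \<noteq> [] \<and> set ks \<subseteq> KS \<and> distinct_adj ks \<and> list_all2 (\<lambda>k a. a \<in> S k \<and> state B.A a = 0) ks ps"
  have st: "state B.A p = lin \<tau> p" for p using B.A_simps(8)[of p] by simp
  have la: "list_all2 (\<lambda>k a. a \<in> S k \<and> lin \<tau> a = 0) ks ps" and ks: "set ks \<subseteq> KS" "distinct_adj ks" "ks \<noteq> []"
    using * unfolding st by blast+
  have "list_all2 (\<lambda>l p. supp p \<subseteq> lists (C l) \<and> lin \<tau> p = 0) ks ps"
    by (rule list.rel_mono_strong[OF la]) (use S ks(1) in blast)
  then have "lin \<tau> (prod_list ps) = 0" by (rule free) (use ks in simp_all)
  then show "state B.A (lprod B.A ps) = 0" using B.lprod_A[of ps] by (simp add: st list.map_id)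
qed

end

lemma sum_list_singletons [simp]: "sum_list (map (\<lambda>i. [g i]) w) = map g w"
  by (induction w) (auto simp: plus_list_def zero_list_def)

lemma gen_words_supported:
  assumes "monoid_algebra id rev \<tau>" "\<And>i. i \<in> J \<Longrightarrow> g i \<in> D"
  shows "gen_star_subalgebra (monoid_alg id rev \<tau>) ((\<lambda>i. mterm [g i] 1) ` J) \<subseteq> {p. supp p \<subseteq> lists D}"
proof -
  interpret B: monoid_algebra id rev \<tau> by (rule assms(1))
  have "gen_star_subalgebra B.A ((\<lambda>i. id (mterm [g i] 1)) ` J) \<subseteq> id ` {p. supp p \<subseteq> lists D}"
    by (rule B.gen_star_subalgebra_supported) (use assms(2) in \<open>auto simp: plus_list_def zero_list_def\<close>)
  then show ?thesis by simp
qed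

section \<open>The limit functional on words and the semicircular limit\<close>

context band_family begin

definition tau :: "('i + 'i) list \<Rightarrow> complex" where
  "tau w = (if w \<in> lists (J <+> J) then lim (\<lambda>n. word_moment n w) else 0)"

lemma word_moment_tau: "w \<in> lists (J <+> J) \<Longrightarrow> (\<lambda>n. word_moment n w) \<longlonglongrightarrow> tau w"
  using word_moment_convergent[of w] by (simp add: tau_def convergent_LIMSEQ_iff)

lemma tau_out: "w \<notin> lists (J <+> J) \<Longrightarrow> tau w = 0"
  by (simp add: tau_def)

lemma tau_trace: "tau (u @ v) = tau (v @ u)"
proof (cases "u \<in> lists (J <+> J) \<and> v \<in> lists (J <+> J)")
  case True
  then have "word_moment n (u @ v) = word_moment n (v @ u)" for n by (intro word_moment_trace) auto
  moreover have "u @ v \<in> lists (J <+> J)" "v @ u \<in> lists (J <+> J)" using True by (simp_all add: append_in_lists_conv)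
  ultimately show ?thesis by (simp add: tau_def)
next
  case False
  then have "u @ v \<notin> lists (J <+> J)" "v @ u \<notin> lists (J <+> J)" by (auto simp only: append_in_lists_conv)
  then show ?thesis by (simp add: tau_out)
qed

lemma tau_letter:
  assumes w: "w \<in> lists (J <+> J)" and i: "i \<in> J"
  shows "tau (Inl i # w) = (\<Sum>p | p < length w \<and> w ! p = Inl i. tau (take p w) * tau (drop (Suc p) w))"
proof -
  have td: "take p w \<in> lists (J <+> J)" "drop p w \<in> lists (J <+> J)" for p
    using w append_in_lists_conv[of "take p w" "drop p w"] by auto
  have "(\<lambda>n. \<Sum>p | p < length w \<and> w ! p = Inl i. word_moment n (take p w) * word_moment n (drop (Suc p) w)) \<longlonglongrightarrow>
      (\<Sum>p | p < length w \<and> w ! p = Inl i. tau (take p w) * tau (drop (Suc p) w))"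
    by (intro tendsto_sum tendsto_mult word_moment_tau td)
  from tendsto_add[OF word_moment_letter[OF w i] this]
  have "(\<lambda>n. word_moment n (Inl i # w)) \<longlonglongrightarrow> (\<Sum>p | p < length w \<and> w ! p = Inl i. tau (take p w) * tau (drop (Suc p) w))" by simp
  moreover have "(\<lambda>n. word_moment n (Inl i # w)) \<longlonglongrightarrow> tau (Inl i # w)" by (rule word_moment_tau) (use w i in auto)
  ultimately show ?thesis by (rule LIMSEQ_unique[symmetric])
qed

lemma tau_degree:
  assumes js: "js \<in> lists J" and i: "i \<in> J"
  shows "tau (map Inr (i # js)) = of_real (\<beta> i) * (\<Sum>p | p < length js \<and> js ! p = i. tau (map Inr (del p js)))"
proof -
  have dl: "map Inr (del p js) \<in> lists (J <+> J)" for p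
    using js set_del[of p js] by (auto simp only: in_lists_conv_set set_map)
  have "(\<lambda>n. of_real (\<beta> i) * (\<Sum>p | p < length js \<and> js ! p = i. word_moment n (map Inr (del p js)))) \<longlonglongrightarrow>
      of_real (\<beta> i) * (\<Sum>p | p < length js \<and> js ! p = i. tau (map Inr (del p js)))"
    by (intro tendsto_sum tendsto_mult tendsto_const word_moment_tau dl)
  from tendsto_add[OF word_moment_degree[OF js i] this]
  have "(\<lambda>n. word_moment n (map Inr (i # js))) \<longlonglongrightarrow> of_real (\<beta> i) * (\<Sum>p | p < length js \<and> js ! p = i. tau (map Inr (del p js)))" by simp
  moreover have "(\<lambda>n. word_moment n (map Inr (i # js))) \<longlonglongrightarrow> tau (map Inr (i # js))" by (rule word_moment_tau) (use js i in auto)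
  ultimately show ?thesis by (rule LIMSEQ_unique[symmetric])
qed

lemma entry_adjoint:
  assumes "i \<in> J" "j < n" "k < n" "\<omega> \<in> space M"
  shows "cnj (entry n \<omega> (i, k, j)) = entry n \<omega> (i, j, k)"
proof -
  have "X i j j \<omega> \<in> \<real>" using X_wigner[OF assms(1)] assms(4) by (auto simp: wigner_array_def)
  then show ?thesis
    using entry_eq[of "(i, j, k)" n \<omega>] entry_eq[of "(i, k, j)" n \<omega>] assms(1-3)
    by (cases j k rule: linorder_cases)
      (auto simp: entry_map_def upper_entry_def key_def band_coeff_sym[of n i k j] Reals_cnj_iff)
qed

lemma Theta_adjoint:
  assumes "i \<in> J" "\<omega> \<in> space M"
  shows "mat_adjoint (\<Theta> n i \<omega>) = \<Theta> n i \<omega>"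
proof -
  have c: "\<Theta> n i \<omega> \<in> carrier_mat n n" using Theta_carrier[OF assms(1), of n] by (auto simp: random_matrix_space_def)
  show ?thesis
    by (rule eq_matI) (use c entry_adjoint[OF assms(1) _ _ assms(2), of _ n] in \<open>auto simp: mat_adjoint_dims mat_adjoint_index entry_def\<close>)
qed

text \<open>For \<beta> = 1 both E|X|^2 and E X^2 equal 1, so the nonnegative variable |X|^2 - Re
  X^2 = 2 (Im X)^2 has expectation 0.\<close>

lemma X_real_AE:
  assumes i: "i \<in> J" and b: "\<beta> i = 1" and jk: "j \<le> k"
  shows "AE \<omega> in M. X i j k \<omega> \<in> \<real>"
proof (cases "j = k")
  case True
  then show ?thesis using X_wigner[OF i] by (intro AE_I2) (auto simp: wigner_array_def)
next
  case False
  let ?x = "X i j k"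
  have am: "all_moments M ?x" using X[OF J_I[OF i]] jk by (auto simp: finite_moment_wigner_array_def)
  have w: "(\<integral>\<omega>. (norm (?x \<omega>))\<^sup>2 \<partial>M) = 1" "(\<integral>\<omega>. (?x \<omega>)\<^sup>2 \<partial>M) = 1"
    using X_wigner[OF i] param[OF J_I[OF i]] False jk b by (auto simp: wigner_array_def wigner_parameter_def)
  have i1: "integrable M (\<lambda>\<omega>. (norm (?x \<omega>))\<^sup>2)" using am by (auto simp: all_moments_def)
  have i2: "integrable M (\<lambda>\<omega>. (?x \<omega>)\<^sup>2)"
    using all_moments_integrable[OF all_moments_mult[OF am am]] by (simp add: power2_eq_square)
  have i3: "integrable M (\<lambda>\<omega>. Re ((?x \<omega>)\<^sup>2))" using i2 by (rule integrable_Re)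
  have e: "(norm z)\<^sup>2 - Re (z\<^sup>2) = 2 * (Im z)\<^sup>2" for z :: complex
    by (simp add: cmod_power2 Re_power2)
  have "(\<integral>\<omega>. (norm (?x \<omega>))\<^sup>2 - Re ((?x \<omega>)\<^sup>2) \<partial>M) = 0"
    using w by (simp add: Bochner_Integration.integral_diff[OF i1 i3] integral_Re[OF i2])
  moreover have "AE \<omega> in M. 0 \<le> (norm (?x \<omega>))\<^sup>2 - Re ((?x \<omega>)\<^sup>2)" unfolding e by simp
  ultimately have "AE \<omega> in M. (norm (?x \<omega>))\<^sup>2 - Re ((?x \<omega>)\<^sup>2) = 0"
    using integral_nonneg_eq_0_iff_AE[OF Bochner_Integration.integrable_diff[OF i1 i3]] by blast
  then show ?thesis by eventually_elim (simp add: e complex_is_Real_iff)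
qed

text \<open>A degree matrix is diagonal, with sums of almost surely real entries; for each
  \<open>n\<close> only finitely many null sets are involved.\<close>

lemma deg_adjoint_AE:
  assumes i: "i \<in> J" and b: "\<beta> i = 1"
  shows "AE \<omega> in M. mat_adjoint (deg (\<Theta> n i \<omega>)) = deg (\<Theta> n i \<omega>)"
proof -
  have "AE \<omega> in M. \<forall>j\<in>{..<n}. \<forall>k\<in>{..<n}. j \<le> k \<longrightarrow> X i j k \<omega> \<in> \<real>"
    unfolding AE_finite_all[OF finite_lessThan]
  proof (intro ballI)
    fix j k show "AE \<omega> in M. j \<le> k \<longrightarrow> X i j k \<omega> \<in> \<real>"
      by (cases "j \<le> k") (simp_all add: X_real_AE[OF i b])
  qed
  then show ?thesis
  proof eventually_elim
    case (elim \<omega>)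
    have r: "cnj (entry n \<omega> (i, j, k)) = entry n \<omega> (i, j, k)" if "j < n" "k < n" for j k
    proof -
      have "X i (min j k) (max j k) \<omega> \<in> \<real>" using elim that by (auto simp: min_def max_def)
      then have "cnj (X i (min j k) (max j k) \<omega>) = X i (min j k) (max j k) \<omega>" by (simp add: Reals_cnj_iff)
      then show ?thesis using entry_eq[of "(i, j, k)" n \<omega>] i that
        by (cases "j \<le> k") (auto simp: entry_map_def upper_entry_def key_def min_def max_def)
    qed
    have c: "deg (\<Theta> n i \<omega>) \<in> carrier_mat n n" using deg_carrier[OF i, of n] by (auto simp: random_matrix_space_def)
    show ?case
    proof (rule eq_matI)
      fix j k assume "j < dim_row (deg (\<Theta> n i \<omega>))" "k < dim_col (deg (\<Theta> n i \<omega>))"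
      then have jk: "j < n" "k < n" using c by auto
      have "(\<Sum>l<n. cnj (entry n \<omega> (i, k, l))) = (\<Sum>l<n. entry n \<omega> (i, k, l))" using r jk by (intro sum.cong) auto
      then show "mat_adjoint (deg (\<Theta> n i \<omega>)) $$ (j, k) = deg (\<Theta> n i \<omega>) $$ (j, k)"
        using jk c by (simp add: mat_adjoint_index deg_entry[OF i] cnj_sum)
    qed (use c in \<open>simp_all add: mat_adjoint_dims\<close>)
  qed
qed

text \<open>Each letter forms a class of its own in \<open>SD\<close>, which gives freeness. For
  powers of one letter the Schwinger-Dyson equation is the convolution recursion of the semicircle
  moments, so the law follows by induction on the order.\<close>

lemma semicircular_limit:
  "\<exists>(S :: 'i nc_poly star_alg) s. semicircular_system S s J \<and> converges_in_distribution (random_matrix_space M) \<Theta> S s J"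
proof -
  define t where "t w = tau (map Inl w)" for w
  have inl: "map Inl w \<in> lists (J <+> J) \<longleftrightarrow> w \<in> lists J" for w :: "'i list" by (induction w) auto
  interpret F: self_adjoint_family M \<Theta> J t
  proof
    show "\<Theta> n v \<in> carrier (random_matrix_space M n)" if "v \<in> J" for n v by (rule Theta_carrier[OF that])
    show "AE \<omega> in M. mat_adjoint (\<Theta> n v \<omega>) = \<Theta> n v \<omega>" if "v \<in> J" for n v by (rule AE_I2) (rule Theta_adjoint[OF that])
    show "t w = 0" if "w \<notin> lists J" for w using that inl[of w] by (simp add: t_def tau_out)
    fix w assume w: "w \<in> lists J"
    have e: "map (letter n) (map Inl w) = map (\<Theta> n) w" for n by (simp add: letter_def)
    show "(\<lambda>n. state (random_matrix_space M n) (lprod (random_matrix_space M n) (map (\<Theta> n) w))) \<longlonglongrightarrow> t w"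
      using word_moment_tau[of "map Inl w", unfolded inl, OF w] unfolding word_moment_def e t_def .
  qed
  note alg = F.words_algebra
  interpret B: monoid_algebra id rev t by (rule alg)
  have sd: "t (i # w) = (\<Sum>p | p < length w \<and> w ! p = i. t (take p w) * t (drop (Suc p) w))" if "i \<in> J" "w \<in> lists J" for i w
  proof -
    have "{p. p < length w \<and> map Inl w ! p = (Inl i :: 'i + 'i)} = {p. p < length w \<and> w ! p = i}" by auto
    then show ?thesis using tau_letter[of "map Inl w" i] that inl[of w] by (simp add: t_def take_map drop_map)
  qed
  interpret D: schwinger_dyson t "\<lambda>i. {i}" J UNIV
  proof
    show "t [] = 1" by (rule F.t_Nil)
    show "t (u @ v) = t (v @ u)" for u v using tau_trace[of "map Inl u" "map Inl v"] by (simp add: t_def)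
  qed (use sd in auto)
  define s where "s = (\<lambda>i :: 'i. mterm [i] (1 :: complex))"
  have law: "has_law B.A (s i) semicircle_law" if i: "i \<in> J" for i
    unfolding has_law_def
  proof (intro conjI allI)
    show "s i \<in> carrier B.A" by simp
    show "adj B.A (s i) = s i" using B.A_simps(7)[of "s i"] by (simp add: s_def)
    show "integrable semicircle_law (\<lambda>x. x ^ k)" for k by (rule semicircle_law_moment)
    fix k
    have "t (replicate k i) = of_real (semicircle_moment k)"
    proof (induction k rule: less_induct)
      case (less k)
      show ?case
      proof (cases k)
        case 0
        then show ?thesis using F.t_Nil by (simp add: semicircle_moment_0)
      next
        case (Suc m)
        have "t (replicate k i) = (\<Sum>p | p < m \<and> replicate m i ! p = i. t (take p (replicate m i)) * t (drop (Suc p) (replicate m i)))"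
          unfolding Suc replicate_Suc by (subst sd) (use i in auto)
        also have "\<dots> = (\<Sum>p<m. of_real (semicircle_moment p * semicircle_moment (m - Suc p)))"
          by (rule sum.cong) (use less Suc in auto)
        also have "\<dots> = of_real (semicircle_moment k)"
        proof (cases m)
          case 0
          then show ?thesis using semicircle_moment_odd[of 0] Suc by simp
        next
          case (Suc l)
          \<comment> \<open>Here \<open>k\<close> is \<open>l + 2\<close>, matching the shift in
            \<open>semicircle_moment_convolution\<close>.\<close>
          then have "(\<Sum>p<m. semicircle_moment p * semicircle_moment (m - Suc p)) = (\<Sum>p\<le>l. semicircle_moment p * semicircle_moment (l - p))"
            by (simp add: lessThan_Suc_atMost)
          then show ?thesis using semicircle_moment_convolution[of l] Suc \<open>k = Suc m\<close> by (simp del: of_real_mult flip: of_real_sum)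
        qed
        finally show ?thesis .
      qed
    qed
    moreover have "state B.A (lprod B.A (replicate k (s i))) = t (replicate k i)"
      using B.state_lprod_words[of "\<lambda>i. [i]" "replicate k i"]
      unfolding sum_list_singletons id_apply list.map_ident
      unfolding map_replicate s_def .
    ultimately show "state B.A (lprod B.A (replicate k (s i))) = complex_of_real (\<integral>x. x ^ k \<partial>semicircle_law)"
      unfolding semicircle_law_moment(2) by (rule trans[rotated])
  qed
  have "free_subalgebras B.A (\<lambda>i. gen_star_subalgebra B.A {s i}) J"
  proof (rule D.free_words[OF alg])
    show "gen_star_subalgebra B.A {s i} \<subseteq> {p. supp p \<subseteq> lists {i}}" for i
      using gen_words_supported[OF alg, of "{i}" "\<lambda>i. i" "{i}"] by (simp only: s_def image_insert image_empty singletonI)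
  qed
  then have "semicircular_system B.A s J" unfolding semicircular_system_def using law by blast
  moreover have "converges_in_distribution (random_matrix_space M) \<Theta> B.A s J"
    using F.converges_monoid_alg[OF alg, of "\<lambda>i. [i]"] unfolding s_def id_apply sum_list_singletons list.map_ident by blast
  ultimately show ?thesis by blast
qed

end

section \<open>Gaussian systems\<close>

text \<open>The mixed moment of independent standard normal variables with the multiplicities given
  by \<open>m\<close>.\<close>

definition normal_mset_moment :: "'i multiset \<Rightarrow> real" where
  "normal_mset_moment m = (\<Prod>i\<in>set_mset m. normal_moment (count m i))"

lemma normal_mset_moment_superset: "finite S \<Longrightarrow> set_mset m \<subseteq> S \<Longrightarrow> normal_mset_moment m = (\<Prod>i\<in>S. normal_moment (count m i))"
  unfolding normal_mset_moment_def by (rule prod.mono_neutral_left) (auto simp: normal_moment_0 not_in_iff)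

lemma normal_mset_moment_empty [simp]: "normal_mset_moment {#} = 1"
  by (simp add: normal_mset_moment_def)

lemma normal_mset_moment_union: "set_mset m \<inter> set_mset m' = {} \<Longrightarrow> normal_mset_moment (m + m') = normal_mset_moment m * normal_mset_moment m'"
proof -
  assume d: "set_mset m \<inter> set_mset m' = {}"
  then have z: "count m' i = 0" if "i \<in># m" for i using that by (auto simp: count_eq_zero_iff)
  have z': "count m i = 0" if "i \<in># m'" for i using d that by (auto simp: count_eq_zero_iff)
  have "normal_mset_moment (m + m') = (\<Prod>i\<in>set_mset m. normal_moment (count (m + m') i)) * (\<Prod>i\<in>set_mset m'. normal_moment (count (m + m') i))"
    unfolding normal_mset_moment_def using d by (simp add: prod.union_disjoint)
  also have "(\<Prod>i\<in>set_mset m. normal_moment (count (m + m') i)) = normal_mset_moment m"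
    unfolding normal_mset_moment_def by (intro prod.cong) (simp_all add: z)
  also have "(\<Prod>i\<in>set_mset m'. normal_moment (count (m + m') i)) = normal_mset_moment m'"
    unfolding normal_mset_moment_def by (intro prod.cong) (simp_all add: z')
  finally show ?thesis .
qed

lemma normal_mset_moment_replicate [simp]: "normal_mset_moment (replicate_mset k i) = normal_moment k"
  by (subst normal_mset_moment_superset[of "{i}"]) (auto split: if_splits)

text \<open>Wick's formula: the new \<open>i\<close> is paired with each copy of \<open>i\<close> in
  \<open>m\<close>. Only one factor changes, and there it is the recursion of the normal
  moments.\<close>

lemma normal_mset_moment_add_mset: "normal_mset_moment (add_mset i m) = real (count m i) * normal_mset_moment (m - {#i#})"
proof -
  let ?S = "insert i (set_mset m)"
  let ?P = "\<Prod>j\<in>set_mset m - {i}. normal_moment (count m j)"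
  have "normal_mset_moment m' = normal_moment (count m' i) * ?P" if "set_mset m' \<subseteq> ?S" "\<And>j. j \<noteq> i \<Longrightarrow> count m' j = count m j" for m'
  proof -
    have "normal_mset_moment m' = normal_moment (count m' i) * (\<Prod>j\<in>?S - {i}. normal_moment (count m' j))"
      by (subst normal_mset_moment_superset[of ?S]) (use that(1) in \<open>auto simp: prod.remove[of _ i]\<close>)
    also have "(\<Prod>j\<in>?S - {i}. normal_moment (count m' j)) = ?P" by (rule prod.cong) (use that(2) in auto)
    finally show ?thesis .
  qed
  from this[of "add_mset i m"] this[of "m - {#i#}"]
  have "normal_mset_moment (add_mset i m) = normal_moment (Suc (count m i)) * ?P" "normal_mset_moment (m - {#i#}) = normal_moment (count m i - 1) * ?P"
    by (auto dest: in_diffD)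
  \<comment> \<open>For \<open>c = 0\<close> both sides are 0, the left one because the mean
    vanishes, so the truncated subtraction is harmless.\<close>
  moreover have "normal_moment (Suc c) = real c * normal_moment (c - 1)" for c
    using normal_moment_1 normal_moment_rec[of "c - 1"] by (cases c) auto
  ultimately show ?thesis by simp
qed

text \<open>The value 0 on foreign variables mirrors the convention for words, so that the two
  functionals agree on every word in degree letters.\<close>

definition gaussian_trace :: "'i set \<Rightarrow> 'i multiset \<Rightarrow> complex" where
  "gaussian_trace J m = (if set_mset m \<subseteq> J then of_real (normal_mset_moment m) else 0)"

text \<open>Multisets are encoded by representing words, so that the commutative algebra of polynomials is
  realised on the type of noncommutative ones.\<close>

definition mset_word :: "'i multiset \<Rightarrow> 'i list" where
  "mset_word m = (SOME w. mset w = m)"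

lemma mset_mset_word [simp]: "mset (mset_word m) = m"
  unfolding mset_word_def by (rule someI_ex) (rule ex_mset)

definition word_poly :: "('i multiset \<Rightarrow>\<^sub>0 complex) \<Rightarrow> 'i nc_poly" where
  "word_poly = linear_ext (\<lambda>m. mterm (mset_word m))"

lemma inj_word_poly: "inj word_poly"
proof (rule injI, rule poly_mapping_eqI)
  fix p q :: "'i multiset \<Rightarrow>\<^sub>0 complex" and m assume eq: "word_poly p = word_poly q"
  have "coef (word_poly p) (mset_word m) = coef p m" for p :: "'i multiset \<Rightarrow>\<^sub>0 complex"
  proof -
    have inj: "mset_word m' = mset_word m \<longleftrightarrow> m' = m" for m' by (metis mset_mset_word)
    have "coef (word_poly p) (mset_word m) = (\<Sum>m'\<in>supp p. if m' = m then coef p m' else 0)"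
      by (simp add: word_poly_def linear_ext_def lookup_sum lookup_single when_def inj)
    also have "\<dots> = coef p m" by (simp add: in_keys_iff)
    finally show ?thesis .
  qed
  with eq show "coef p m = coef q m" by metis
qed

text \<open>Positivity is left as an assumption because it comes for free from the traces of the
  degree matrices.\<close>

locale gaussian_functional =
  fixes J :: "'i set"
  assumes positive: "\<And>p. lin (gaussian_trace J) (pstar id p * p) \<in> \<real>\<^sub>\<ge>\<^sub>0"
begin

sublocale monoid_algebra word_poly id "gaussian_trace J"
  by unfold_locales (auto simp: inj_word_poly add.commute gaussian_trace_def intro: positive)

definition g :: "'i \<Rightarrow> 'i nc_poly" where
  "g i = word_poly (mterm {#i#} 1)"

text \<open>The powers of one variable form a submonoid, which confines the generated algebra to
  polynomials in that variable.\<close>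

lemma gen_g: "gen_star_subalgebra A {g i} \<subseteq> word_poly ` {p. supp p \<subseteq> range (\<lambda>k. replicate_mset k i)}"
proof -
  have "gen_star_subalgebra A ((\<lambda>j. word_poly (mterm {#j#} 1)) ` {i}) \<subseteq>
      word_poly ` {p. supp p \<subseteq> range (\<lambda>k. replicate_mset k i)}"
  proof (rule gen_star_subalgebra_supported)
    have "replicate_mset 0 i \<in> range (\<lambda>k. replicate_mset k i)" by (rule rangeI)
    then show "0 \<in> range (\<lambda>k. replicate_mset k i)" by simp
    have "replicate_mset 1 i \<in> range (\<lambda>k. replicate_mset k i)" by (rule rangeI)
    then show "{#j#} \<in> range (\<lambda>k. replicate_mset k i)" if "j \<in> {i}" for j using that by simp
    have "replicate_mset k i + replicate_mset l i = replicate_mset (k + l) i" for k l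
      by (rule multiset_eqI) simp
    then show "a + b \<in> range (\<lambda>k. replicate_mset k i)"
      if "a \<in> range (\<lambda>k. replicate_mset k i)" "b \<in> range (\<lambda>k. replicate_mset k i)" for a b
      using that by auto
  qed simp
  then show ?thesis by (simp add: g_def)
qed

text \<open>Multisets over disjoint sets of variables have multiplicative normal moments;
  bilinearity does the rest.\<close>

lemma lin_gaussian_trace_mult:
  assumes "i \<notin> S" "i \<in> J" "S \<subseteq> J"
    and p: "supp p \<subseteq> range (\<lambda>k. replicate_mset k i)" and q: "supp q \<subseteq> {m. set_mset m \<subseteq> S}"
  shows "lin (gaussian_trace J) (p * q) = lin (gaussian_trace J) p * lin (gaussian_trace J) q"
proof -
  have "p * q = (\<Sum>m\<in>supp p. \<Sum>m'\<in>supp q. mterm (m + m') (coef p m * coef q m'))"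
    by (subst poly_eq_sum[of p], subst poly_eq_sum[of q]) (simp add: sum_product mult_single)
  then have "lin (gaussian_trace J) (p * q) = (\<Sum>m\<in>supp p. \<Sum>m'\<in>supp q. coef p m * coef q m' * gaussian_trace J (m + m'))"
    by (simp add: lin_sum)
  also have "\<dots> = (\<Sum>m\<in>supp p. \<Sum>m'\<in>supp q. (coef p m * gaussian_trace J m) * (coef q m' * gaussian_trace J m'))"
  proof (intro sum.cong refl)
    fix m m' assume "m \<in> supp p" "m' \<in> supp q"
    then obtain k where k: "m = replicate_mset k i" and m': "set_mset m' \<subseteq> S" using p q by blast
    have "set_mset m \<inter> set_mset m' = {}" "set_mset m \<subseteq> J" using k m' assms(1,2) by (auto split: if_splits)
    then show "coef p m * coef q m' * gaussian_trace J (m + m') = (coef p m * gaussian_trace J m) * (coef q m' * gaussian_trace J m')"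
      using m' assms(3) by (simp add: gaussian_trace_def normal_mset_moment_union)
  qed
  also have "\<dots> = lin (gaussian_trace J) p * lin (gaussian_trace J) q" by (simp add: lin_eq sum_product)
  finally show ?thesis .
qed

text \<open>The support is carried through the induction, as the next factor must be a polynomial in
  a variable outside it.\<close>

lemma lin_gaussian_trace_prod:
  assumes "list_all2 (\<lambda>i p. supp p \<subseteq> range (\<lambda>k. replicate_mset k i)) l ps" "distinct l" "set l \<subseteq> J"
  shows "supp (prod_list ps) \<subseteq> {m. set_mset m \<subseteq> set l} \<and>
    lin (gaussian_trace J) (prod_list ps) = prod_list (map (lin (gaussian_trace J)) ps)"
  using assms
proof (induction rule: list_all2_induct)
  case Nil
  have "lin (gaussian_trace J) 1 = 1" using lin_single[of "gaussian_trace J" 0 1] by (simp add: gaussian_trace_def)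
  then show ?case by simp
next
  case (Cons i l p ps)
  have IH: "supp (prod_list ps) \<subseteq> {m. set_mset m \<subseteq> set l}"
      "lin (gaussian_trace J) (prod_list ps) = prod_list (map (lin (gaussian_trace J)) ps)"
    using Cons.IH Cons.prems by auto
  have "supp (p * prod_list ps) \<subseteq> {m. set_mset m \<subseteq> set (i # l)}"
  proof
    fix m assume "m \<in> supp (p * prod_list ps)"
    then obtain a c where ac: "m = a + c" "a \<in> supp p" "c \<in> supp (prod_list ps)" using keys_mult[of p "prod_list ps"] by blast
    then obtain k where "a = replicate_mset k i" using Cons.hyps(1) by blast
    then have "set_mset a \<subseteq> {i}" by auto
    moreover have "set_mset c \<subseteq> set l" using ac IH(1) by blast
    ultimately show "m \<in> {m. set_mset m \<subseteq> set (i # l)}" using ac(1) by auto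
  qed
  moreover have "lin (gaussian_trace J) (p * prod_list ps) = lin (gaussian_trace J) p * lin (gaussian_trace J) (prod_list ps)"
    by (rule lin_gaussian_trace_mult[of i "set l"]) (use Cons.prems Cons.hyps(1) IH(1) in auto)
  ultimately show ?case using IH(2) by simp
qed

lemma gaussian_system_g: "gaussian_system A g J"
  unfolding gaussian_system_def
proof (intro conjI ballI)
  fix i assume i: "i \<in> J"
  show "has_law A (g i) (density lborel (\<lambda>x. ennreal (std_normal_density x)))"
    unfolding has_law_def
  proof (intro conjI allI)
    show "g i \<in> carrier A" by (simp add: g_def)
    show "adj A (g i) = g i" by (simp add: g_def)
    fix k
    show "integrable (density lborel (\<lambda>x. ennreal (std_normal_density x))) (\<lambda>x. x ^ k)" by (rule gaussian_moment)
    have "sum_list (map (\<lambda>j. {#j#}) (replicate k i)) = replicate_mset k i" by (induction k) auto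
    moreover have "set_mset (replicate_mset k i) \<subseteq> J" using i by auto
    ultimately have "state A (lprod A (map g (replicate k i))) = of_real (normal_moment k)"
      using state_lprod_words[of "\<lambda>j. {#j#}" "replicate k i"]
      by (simp only: g_def[abs_def] gaussian_trace_def normal_mset_moment_replicate if_True)
    then show "state A (lprod A (replicate k (g i))) =
        complex_of_real (\<integral>x. x ^ k \<partial>density lborel (\<lambda>x. ennreal (std_normal_density x)))"
      by (simp only: map_replicate normal_moment_def)
  qed
next
  show "tensor_independent_subalgebras A (\<lambda>i. gen_star_subalgebra A {g i}) J"
    unfolding tensor_independent_subalgebras_def
  proof (intro conjI allI ballI impI)
    fix k l a c assume "a \<in> gen_star_subalgebra A {g k}" "c \<in> gen_star_subalgebra A {g l}"
    then obtain p q where "a = word_poly p" "c = word_poly q" using gen_g by blast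
    then show "a \<otimes>\<^bsub>A\<^esub> c = c \<otimes>\<^bsub>A\<^esub> a" by (simp add: mult.commute)
  next
    fix ks as assume *: "set ks \<subseteq> J \<and> distinct ks \<and> list_all2 (\<lambda>k a. a \<in> gen_star_subalgebra A {g k}) ks as"
    then have "list_all2 (\<lambda>k a. a \<in> gen_star_subalgebra A {g k}) ks as" by blast
    then have "\<exists>ps. as = map word_poly ps \<and> list_all2 (\<lambda>i p. supp p \<subseteq> range (\<lambda>k. replicate_mset k i)) ks ps"
    proof (induction rule: list_all2_induct)
      case (Cons i l a as)
      then obtain p where "a = word_poly p" "supp p \<subseteq> range (\<lambda>k. replicate_mset k i)" using gen_g by blast
      moreover obtain ps where "as = map word_poly ps" "list_all2 (\<lambda>i p. supp p \<subseteq> range (\<lambda>k. replicate_mset k i)) l ps"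
        using Cons.IH by blast
      ultimately show ?case by (intro exI[of _ "p # ps"]) simp
    qed simp
    then obtain ps where ps: "as = map word_poly ps" "list_all2 (\<lambda>i p. supp p \<subseteq> range (\<lambda>k. replicate_mset k i)) ks ps"
      by blast
    have "lin (gaussian_trace J) (prod_list ps) = prod_list (map (lin (gaussian_trace J)) ps)"
      using lin_gaussian_trace_prod[OF ps(2)] * by blast
    then show "state A (lprod A as) = prod_list (map (state A) as)"
      unfolding ps(1) lprod_A by (simp add: comp_def)
  qed
qed

end

section \<open>Limits involving the degree matrices\<close>

context band_family begin

text \<open>Both sides obey Wick's recursion: deleting \<open>i\<close> at any of its positions
  leaves the same multiset, and the number of positions is the multiplicity of
  \<open>i\<close>.\<close>

lemma tau_degrees:
  assumes b: "\<And>i. i \<in> J \<Longrightarrow> \<beta> i = 1" and js: "js \<in> lists J"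
  shows "tau (map Inr js) = of_real (normal_mset_moment (mset js))"
  using js
proof (induction "length js" arbitrary: js rule: less_induct)
  case less
  show ?case
  proof (cases js)
    case Nil
    have "tau [] = 1"
    proof (rule LIMSEQ_unique)
      show "(\<lambda>n. word_moment n []) \<longlonglongrightarrow> tau []" by (rule word_moment_tau) simp
      show "(\<lambda>n. word_moment n []) \<longlonglongrightarrow> 1"
        by (rule tendsto_eventually, rule eventually_mono[OF eventually_gt_at_top[of 0]]) (rule word_moment_Nil)
    qed
    then show ?thesis using Nil by simp
  next
    case (Cons i ks)
    have i: "i \<in> J" and ks: "ks \<in> lists J" using less.prems Cons by auto
    let ?P = "{p. p < length ks \<and> ks ! p = i}"
    have "tau (map Inr (del p ks)) = of_real (normal_mset_moment (mset ks - {#i#}))" if p: "p \<in> ?P" for p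
    proof -
      have "mset ks = mset (take p ks @ ks ! p # drop (Suc p) ks)" using p by (intro arg_cong[where f = mset] id_take_nth_drop) simp
      then have m: "mset (del p ks) = mset ks - {#i#}" using p by (simp add: del_def)
      have "length (del p ks) < length js" using p length_del[of p ks] by (simp add: Cons)
      moreover have "del p ks \<in> lists J" using ks set_del[of p ks] by (auto simp only: in_lists_conv_set)
      ultimately show ?thesis using less.hyps by (simp add: m)
    qed
    then have "tau (map Inr js) = of_real (real (card ?P) * normal_mset_moment (mset ks - {#i#}))"
      unfolding Cons tau_degree[OF ks i] by (simp add: b[OF i])
    moreover have "card ?P = count (mset ks) i"
      unfolding count_mset count_list_eq_length_filter length_filter_conv_card by (rule arg_cong[where f = card]) auto
    ultimately show ?thesis unfolding Cons mset.simps by (simp add: normal_mset_moment_add_mset)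
  qed
qed

context
  assumes \<beta>_one: "\<And>i. i \<in> J \<Longrightarrow> \<beta> i = 1"
begin

lemma letters_self_adjoint: "self_adjoint_family M letter (J <+> J) tau"
proof
  show "letter n v \<in> carrier (random_matrix_space M n)" if "v \<in> J <+> J" for n v by (rule letter_carrier[OF that])
  show "AE \<omega> in M. mat_adjoint (letter n v \<omega>) = letter n v \<omega>" if v: "v \<in> J <+> J" for n v
  proof (cases v)
    case (Inl i)
    then have "i \<in> J" using v by auto
    then show ?thesis unfolding Inl by (intro AE_I2) (simp add: letter_def Theta_adjoint)
  next
    case (Inr i)
    then have "i \<in> J" using v by auto
    then show ?thesis using deg_adjoint_AE[OF _ \<beta>_one] unfolding Inr by (simp add: letter_def)
  qed
  show "(\<lambda>n. state (random_matrix_space M n) (lprod (random_matrix_space M n) (map (letter n) w))) \<longlonglongrightarrow> tau w"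
    if "w \<in> lists (J <+> J)" for w using word_moment_tau[OF that] unfolding word_moment_def .
qed (rule tau_out)

lemma augmented_limit:
  "converges_in_distribution (random_matrix_space M) letter (monoid_alg id rev tau) (\<lambda>v. mterm [v] 1) (J <+> J)"
proof -
  interpret F: self_adjoint_family M letter "J <+> J" tau by (rule letters_self_adjoint)
  show ?thesis
    using F.converges_monoid_alg[OF F.words_algebra, of "\<lambda>v. [v]"]
    unfolding id_apply sum_list_singletons list.map_ident by blast
qed

text \<open>Two classes: the matrix letters lie in \<open>SD\<close>, and the degree letters form
  the one class outside it. The Schwinger-Dyson equation of a matrix letter holds in words that
  contain degree letters too, and freeness rests on this.\<close>

lemma Theta_deg_free:
  "asymptotically_free (random_matrix_space M) \<Theta> J (\<lambda>n i \<omega>. deg (\<Theta> n i \<omega>)) J"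
  unfolding asymptotically_free_def
proof (intro exI conjI)
  interpret F: self_adjoint_family M letter "J <+> J" tau by (rule letters_self_adjoint)
  note alg = F.words_algebra
  let ?C = "case_bool (Inl ` J) (Inr ` J) :: bool \<Rightarrow> ('i + 'i) set"
  let ?c = "\<lambda>i. mterm [Inl i :: 'i + 'i] (1 :: complex)" and ?d = "\<lambda>i. mterm [Inr i :: 'i + 'i] (1 :: complex)"
  have "case_sum ?c ?d = (\<lambda>v. mterm [v] 1)" by (rule ext) (simp split: sum.split)
  moreover have "(\<lambda>n. case_sum (\<Theta> n) (\<lambda>i \<omega>. deg (\<Theta> n i \<omega>))) = letter" by (rule ext) (simp add: letter_def)
  ultimately show "converges_in_distribution (random_matrix_space M) (\<lambda>n. case_sum (\<Theta> n) (\<lambda>i \<omega>. deg (\<Theta> n i \<omega>)))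
      (monoid_alg id rev tau) (case_sum ?c ?d) (J <+> J)"
    using augmented_limit by simp
  interpret D: schwinger_dyson tau ?C UNIV "{True}"
  proof
    have U: "\<Union> (range ?C) = J <+> J" by (simp add: UNIV_bool Plus_def Un_commute)
    show "tau (i # w) = (\<Sum>p | p < length w \<and> w ! p = i. tau (take p w) * tau (drop (Suc p) w))"
      if "k \<in> {True}" "i \<in> ?C k" "w \<in> lists (\<Union> (range ?C))" for k i w
      using that tau_letter[of w] unfolding U by auto
  qed (auto simp: F.t_Nil intro: tau_trace split: bool.splits)
  show "free_families (monoid_alg id rev tau) ?c J ?d J"
    unfolding free_families_def
  proof (rule D.free_words[OF alg])
    fix k :: bool
    have l: "gen_star_subalgebra (monoid_alg id rev tau) (?c ` J) \<subseteq> {p. supp p \<subseteq> lists (Inl ` J)}"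
      by (rule gen_words_supported[OF alg]) simp
    have r: "gen_star_subalgebra (monoid_alg id rev tau) (?d ` J) \<subseteq> {p. supp p \<subseteq> lists (Inr ` J)}"
      by (rule gen_words_supported[OF alg]) simp
    show "(case k of True \<Rightarrow> gen_star_subalgebra (monoid_alg id rev tau) (?c ` J)
        | False \<Rightarrow> gen_star_subalgebra (monoid_alg id rev tau) (?d ` J)) \<subseteq> {p. supp p \<subseteq> lists (?C k)}"
      using l r by (cases k) (simp_all only: bool.case)
  qed
qed

text \<open>On words in degree matrices the limit depends only on the multiset of letters, so it
  descends to the commutative algebra on multisets, where it is the functional of independent normal
  variables.\<close>

lemma gaussian_limit:
  "\<exists>(G :: 'i nc_poly star_alg) g. gaussian_system G g J \<and>
     converges_in_distribution (random_matrix_space M) (\<lambda>n i \<omega>. deg (\<Theta> n i \<omega>)) G g J"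
proof -
  define t where "t w = tau (map Inr w)" for w
  have inr: "map Inr w \<in> lists (J <+> J) \<longleftrightarrow> w \<in> lists J" for w :: "'i list" by (induction w) auto
  have t: "t w = gaussian_trace J (mset w)" for w
  proof (cases "w \<in> lists J")
    case True
    then show ?thesis using tau_degrees[OF \<beta>_one True] unfolding t_def gaussian_trace_def by (auto simp: in_lists_conv_set)
  next
    case False
    then have "map Inr w \<notin> lists (J <+> J)" unfolding inr .
    then have "t w = 0" unfolding t_def by (rule tau_out)
    then show ?thesis using False unfolding gaussian_trace_def by (auto simp: in_lists_conv_set)
  qed
  interpret F: self_adjoint_family M "\<lambda>n i \<omega>. deg (\<Theta> n i \<omega>)" J t
  proof
    show "(\<lambda>\<omega>. deg (\<Theta> n v \<omega>)) \<in> carrier (random_matrix_space M n)" if "v \<in> J" for n v by (rule deg_carrier[OF that])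
    show "AE \<omega> in M. mat_adjoint (deg (\<Theta> n v \<omega>)) = deg (\<Theta> n v \<omega>)" if "v \<in> J" for n v
      by (rule deg_adjoint_AE[OF that \<beta>_one[OF that]])
    show "t w = 0" if "w \<notin> lists J" for w
      unfolding t_def by (rule tau_out) (unfold inr, rule that)
    fix w assume w: "w \<in> lists J"
    have e: "map (letter n) (map Inr w) = map (\<lambda>i \<omega>. deg (\<Theta> n i \<omega>)) w" for n by (simp add: letter_def)
    show "(\<lambda>n. state (random_matrix_space M n) (lprod (random_matrix_space M n) (map (\<lambda>i \<omega>. deg (\<Theta> n i \<omega>)) w))) \<longlonglongrightarrow> t w"
      using word_moment_tau[of "map Inr w", unfolded inr, OF w] unfolding word_moment_def e t_def .
  qed
  interpret G: gaussian_functional J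
  proof
    fix p :: "'i multiset \<Rightarrow>\<^sub>0 complex"
    have "lin (gaussian_trace J) (pstar id p * p) = (\<Sum>m\<in>supp p. \<Sum>m'\<in>supp p. cnj (coef p m) * coef p m' * gaussian_trace J (m + m'))"
      using lin_pstar_mult[of "gaussian_trace J" id "\<lambda>m. m" "coef p" "supp p"] unfolding poly_eq_sum[symmetric] id_apply .
    \<comment> \<open>Representing words lift the form to words, where positivity is known; reversal
      does not change the multiset.\<close>
    also have "\<dots> = (\<Sum>m\<in>supp p. \<Sum>m'\<in>supp p. cnj (coef p m) * coef p m' * t (rev (mset_word m) @ mset_word m'))"
      by (simp add: t)
    also have "\<dots> \<in> \<real>\<^sub>\<ge>\<^sub>0" by (rule F.words_positive) simp
    finally show "lin (gaussian_trace J) (pstar id p * p) \<in> \<real>\<^sub>\<ge>\<^sub>0" .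
  qed
  have s: "sum_list (map (\<lambda>i. {#i#}) w) = mset w" for w :: "'i list" by (induction w) auto
  have "converges_in_distribution (random_matrix_space M) (\<lambda>n i \<omega>. deg (\<Theta> n i \<omega>)) G.A G.g J"
    unfolding G.g_def[abs_def]
    by (rule F.converges_monoid_alg[OF G.monoid_algebra_axioms, of "\<lambda>i. {#i#}"]) (simp only: s t)
  with G.gaussian_system_g show ?thesis by blast
qed

end

end

theorem corollary1p6:
  fixes M :: "'w measure"
    and X :: "'i \<Rightarrow> nat \<Rightarrow> nat \<Rightarrow> 'w \<Rightarrow> complex"
    and \<beta> :: "'i \<Rightarrow> real"
    and b :: "'i \<Rightarrow> nat \<Rightarrow> nat"
    and I I1 I3 :: "'i set"
    and \<Theta> :: "nat \<Rightarrow> 'i \<Rightarrow> 'w \<Rightarrow> complex mat"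
  assumes "prob_space M"
    and "\<And>i. i \<in> I \<Longrightarrow> finite_moment_wigner_array M (X i)"
    and "\<And>i. i \<in> I \<Longrightarrow> wigner_parameter M (X i) (complex_of_real (\<beta> i))"
    and "\<And>n. independent_matrices M n (\<lambda>i. wigner_matrix (X i) n) I"
    and "I1 \<subseteq> I" and "I3 \<subseteq> I" and "I1 \<inter> I3 = {}"
    and "\<And>i. i \<in> I1 \<Longrightarrow> slow_growth (b i)"
    and "\<And>i. i \<in> I3 \<Longrightarrow> full_proportion (b i)"
    and "\<And>n i. i \<in> I1 \<Longrightarrow> \<Theta> n i = slow_band_matrix (X i) (b i) n"
    and "\<And>n i. i \<in> I3 \<Longrightarrow> \<Theta> n i = full_band_matrix (X i) (b i) n"
  shows "(\<exists>(S :: 'i nc_poly star_alg) s.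
            semicircular_system S s (I1 \<union> I3) \<and>
            converges_in_distribution (random_matrix_space M) \<Theta> S s (I1 \<union> I3)) \<and>
         ((\<forall>i\<in>I. \<beta> i = 1) \<longrightarrow>
            (\<exists>(A :: ('i + 'i) nc_poly star_alg) a.
               converges_in_distribution (random_matrix_space M)
                 (\<lambda>n. case_sum (\<Theta> n) (\<lambda>i \<omega>. deg (\<Theta> n i \<omega>)))
                 A a ((I1 \<union> I3) <+> (I1 \<union> I3))) \<and>
            asymptotically_free (random_matrix_space M)
              \<Theta> (I1 \<union> I3) (\<lambda>n i \<omega>. deg (\<Theta> n i \<omega>)) (I1 \<union> I3) \<and>
            (\<exists>(G :: 'i nc_poly star_alg) g.
               gaussian_system G g (I1 \<union> I3) \<and>
               converges_in_distribution (random_matrix_space M)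
                 (\<lambda>n i \<omega>. deg (\<Theta> n i \<omega>)) G g (I1 \<union> I3)))"
proof (intro conjI impI)
  interpret B: band_family M X \<beta> b I I1 I3 \<Theta>
    by (intro band_family.intro band_family_axioms.intro) (fact assms)+
  show "\<exists>(S :: 'i nc_poly star_alg) s. semicircular_system S s (I1 \<union> I3) \<and>
      converges_in_distribution (random_matrix_space M) \<Theta> S s (I1 \<union> I3)"
    by (rule B.semicircular_limit)
  assume "\<forall>i\<in>I. \<beta> i = 1"
  then have \<beta>: "\<beta> i = 1" if "i \<in> I1 \<union> I3" for i using that assms(5,6) by blast
  have "(\<lambda>n. case_sum (\<Theta> n) (\<lambda>i \<omega>. deg (\<Theta> n i \<omega>))) = B.letter" by (rule ext) (simp add: B.letter_def)
  then show "\<exists>(A :: ('i + 'i) nc_poly star_alg) a. converges_in_distribution (random_matrix_space M)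
      (\<lambda>n. case_sum (\<Theta> n) (\<lambda>i \<omega>. deg (\<Theta> n i \<omega>))) A a ((I1 \<union> I3) <+> (I1 \<union> I3))"
    using B.augmented_limit[OF \<beta>] by metis
  show "asymptotically_free (random_matrix_space M) \<Theta> (I1 \<union> I3) (\<lambda>n i \<omega>. deg (\<Theta> n i \<omega>)) (I1 \<union> I3)"
    by (rule B.Theta_deg_free[OF \<beta>])
  show "\<exists>(G :: 'i nc_poly star_alg) g. gaussian_system G g (I1 \<union> I3) \<and>
      converges_in_distribution (random_matrix_space M) (\<lambda>n i \<omega>. deg (\<Theta> n i \<omega>)) G g (I1 \<union> I3)"
    by (rule B.gaussian_limit[OF \<beta>])
qed

end
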